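(* There exists a topological vector bundle on $X$ with fibre $\widehat{\mathcal L}_+=1\,\widehat\otimes\,\mathcal L_+$, trivialized over étale charts, such that the transition functions between any two étale charts are as follows. Let $U_1$, $U_2$ be étale charts with uniformizing parameters $x_1,\dots,x_N$ and $y_1,\dots,y_N$ respectively, and write on $U_1\cap U_2$ $$x_i=G_i(y_1,\dots,y_N),\qquad y_j=H_j(x_1,\dots,x_N),\qquad i,j=1,\dots,N .$$ Then for $m\in\mathbb Z_{\ge0}^N\setminus\{0\}$ and $p\in\{1,\dots,N\}$, $$X^m\frac{\partial}{\partial X_p}\;\mapsto\;\sum_{0\le k\le m}(-1)^{m-k}\binom mk G(y)^{m-k}\sum_{q=1}^N\Big(G(y+Y)^k\,\frac{\partial H_q}{\partial x_p}(G(y+Y))-G(y)^k\,\frac{\partial H_q}{\partial x_p}(G(y))\Big)\frac{\partial}{\partial Y_q},$$ extended to power series by continuity.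
   Context: $K$ is an algebraically closed field of characteristic $0$; $X$ is a smooth irreducible quasi-projective variety of dimension $N$ over $K$; $\mathcal A=\mathcal O$ is its sheaf of regular functions. Étale chart: an affine open $U\subset X$ for which there exist $x_1,\dots,x_N\in\mathcal A(U)$ (uniformizing parameters) that are algebraically independent over $K$, such that every $f\in\mathcal A(U)$ is algebraic over $K[x_1,\dots,x_N]$ and the derivations $\frac{\partial}{\partial x_i}$ of $K[x_1,\dots,x_N]$ extend (uniquely) to $\mathcal A(U)$. $X$ is covered by étale charts. The notations $G_i(y)$, $H_j(x)$ are symbolic: $G_i(y)$ is the regular function $x_i$ and $H_j(x)$ the regular function $y_j$ on $U_1\cap U_2$, and they can be differentiated using $\frac{\partial}{\partial y_j}$ and $\frac{\partial}{\partial x_i}$. For a regular function $f$ on $U_1\cap U_2$, $f(y+Y)$ denotes $\sum_{r\in\mathbb Z_{\ge0}^N}\frac1{r!}\frac{\partial^rf}{\partial y^r}Y^r\in\mathcal A(U_1\cap U_2)[[Y_1,\dots,Y_N]]$ and $f(y)$ denotes $f$ itself; $\frac{\partial H_q}{\partial x_p}(G(y))$ denotes the function $\frac{\partial y_q}{\partial x_p}$, and $\frac{\partial H_q}{\partial x_p}(G(y+Y))$ denotes its expansion $\sum_{r\in\mathbb Z_{\ge0}^N}\frac1{r!}\frac{\partial^r}{\partial y^r}\Big(\frac{\partial y_q}{\partial x_p}\Big)Y^r\in\mathcal A(U_1\cap U_2)[[Y_1,\dots,Y_N]]$. Multi-index conventions: $G^k=G_1^{k_1}\cdots G_N^{k_N}$,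 $\binom mk=\prod_i\binom{m_i}{k_i}$, $(-1)^{m-k}=(-1)^{|m|-|k|}$, and $k\le m$ is componentwise. $\mathcal L_+=\bigoplus_{i\ge0}\mathcal L_i\subset\mathrm{Der}\,K[X_1,\dots,X_N]$ is the Lie algebra of polynomial vector fields vanishing at the origin, graded by $\deg X^k\frac{\partial}{\partial X_i}=|k|-1$; $\mathcal L_{\ge k}=\bigoplus_{i\ge k}\mathcal L_i$; $A\,\widehat\otimes\,\mathcal L_+=\varprojlim_kA\otimes_K(\mathcal L_+/\mathcal L_{\ge k})$, and $\widehat{\mathcal L}_+=1\widehat\otimes\mathcal L_+\cong\varprojlim_k\mathcal L_+/\mathcal L_{\ge k}$. The image of $X^m\frac{\partial}{\partial X_p}$ under the transition function is an element of $\mathcal A(U_1\cap U_2)\,\widehat\otimes\,\mathcal L_+$, with $\mathcal L_+$ written in the variables $Y$ for the chart $U_2$. A sheaf $\mathcal F$ on $X$ is a topological vector bundle if it has a decreasing filtration of subsheaves $\mathcal F\supset\mathcal F_1\supset\mathcal F_2\supset\cdots$ with $\bigcap_m\mathcal F_m=0$, and there is an open cover of $X$ by affine subsets $U_i$ such that the quotients have compatible trivializations $\mathcal F/\mathcal F_m(U_i)\cong\mathcal O(U_i)\otimes V_{m,i}$, where the projections $\mathcal F/\mathcal F_{m+1}(U_i)\to\mathcal F/\mathcal F_m(U_i)$ are induced by maps $V_{m+1,i}\to V_{m,i}$. The fibre over $U_i$ is $\varprojlim_mV_{m,i}$. *)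

theory Defs
  imports
    "HOL-Library.Poly_Mapping"
    "HOL-Algebra.Finite_Extensions"
    "HOL-Algebra.Algebraic_Closure_Type"
    "HOL-Analysis.Abstract_Topology"
begin

no_notation var (\<open>X\<index>\<close>)

section \<open>Polynomials in finitely many variables\<close>

text \<open>The variables are indexed by \<^typ>\<open>nat\<close>; \<open>polys N\<close> is the polynomial ring in the variables
  with index \<open>< N\<close>.  The order that the library puts on \<^typ>\<open>nat \<Rightarrow>\<^sub>0 nat\<close> is not the
  componentwise one and is never used.\<close>

type_synonym mono = "nat \<Rightarrow>\<^sub>0 nat"
type_synonym 'k mpoly = "(nat \<Rightarrow>\<^sub>0 nat) \<Rightarrow>\<^sub>0 'k"

definition monomials :: "nat \<Rightarrow> mono set" where
  "monomials N = {m. Poly_Mapping.keys m \<subseteq> {..<N}}"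

definition mdeg :: "mono \<Rightarrow> nat" where
  "mdeg m = (\<Sum>i\<in>Poly_Mapping.keys m. Poly_Mapping.lookup m i)"

definition polys :: "nat \<Rightarrow> 'k::field mpoly set" where
  "polys N = {p. Poly_Mapping.keys p \<subseteq> monomials N}"

definition mono_eval :: "mono \<Rightarrow> (nat \<Rightarrow> 'k::field) \<Rightarrow> 'k" where
  "mono_eval m a = (\<Prod>i\<in>Poly_Mapping.keys m. a i ^ Poly_Mapping.lookup m i)"

definition peval :: "'k::field mpoly \<Rightarrow> (nat \<Rightarrow> 'k) \<Rightarrow> 'k" where
  "peval p a = (\<Sum>m\<in>Poly_Mapping.keys p. Poly_Mapping.lookup p m * mono_eval m a)"

text \<open>If \<open>X\<^sub>i\<close> does not occur in \<open>m\<close>, the truncated exponent in \<open>m - single i 1\<close> is harmless because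
  the coefficient is \<open>0\<close>.\<close>

definition ppartial :: "nat \<Rightarrow> 'k::field mpoly \<Rightarrow> 'k mpoly" where
  "ppartial i p = (\<Sum>m\<in>Poly_Mapping.keys p.
     Poly_Mapping.single (m - Poly_Mapping.single i 1)
       (of_nat (Poly_Mapping.lookup m i) * Poly_Mapping.lookup p m))"

definition homogeneous :: "nat \<Rightarrow> nat \<Rightarrow> 'k::field mpoly \<Rightarrow> bool" where
  "homogeneous n d f \<longleftrightarrow> f \<in> polys (Suc n) \<and> (\<forall>m\<in>Poly_Mapping.keys f. mdeg m = d)"

subsection \<open>Basic facts\<close>

lemma peval_superset:
  assumes "finite S" "Poly_Mapping.keys p \<subseteq> S"
  shows "peval p a = (\<Sum>m\<in>S. Poly_Mapping.lookup p m * mono_eval m a)"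
  unfolding peval_def using assms
  by (intro sum.mono_neutral_left) (auto simp: in_keys_iff)

lemma peval_add: "peval (p + q) a = peval p a + peval q a"
proof -
  let ?S = "Poly_Mapping.keys p \<union> Poly_Mapping.keys q"
  have "peval (p + q) a = (\<Sum>m\<in>?S. Poly_Mapping.lookup (p + q) m * mono_eval m a)"
    by (rule peval_superset) (simp_all add: Poly_Mapping.keys_add)
  also have "\<dots> = (\<Sum>m\<in>?S. Poly_Mapping.lookup p m * mono_eval m a)
      + (\<Sum>m\<in>?S. Poly_Mapping.lookup q m * mono_eval m a)"
    by (simp add: lookup_add distrib_right sum.distrib)
  also have "\<dots> = peval p a + peval q a"
    by (subst (1 2) peval_superset[of ?S]) auto
  finally show ?thesis .
qed

lemma peval_zero [simp]: "peval 0 a = 0"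
  by (simp add: peval_def)

lemma peval_sum: "peval (sum f S) a = (\<Sum>s\<in>S. peval (f s) a)"
  by (induction S rule: infinite_finite_induct) (auto simp: peval_add)

lemma peval_single [simp]: "peval (Poly_Mapping.single m c) a = c * mono_eval m a"
  by (cases "c = 0") (auto simp: peval_def)

lemma mono_eval_superset:
  assumes "finite S" "Poly_Mapping.keys m \<subseteq> S"
  shows "mono_eval m a = (\<Prod>i\<in>S. a i ^ Poly_Mapping.lookup m i)"
  unfolding mono_eval_def using assms
  by (intro prod.mono_neutral_left) (auto simp: in_keys_iff)

lemma mono_eval_add: "mono_eval (m + m') a = mono_eval m a * mono_eval m' a"
proof -
  let ?S = "Poly_Mapping.keys m \<union> Poly_Mapping.keys m'"
  have "mono_eval (m + m') a = (\<Prod>i\<in>?S. a i ^ Poly_Mapping.lookup (m + m') i)"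
    by (rule mono_eval_superset) (simp_all add: Poly_Mapping.keys_add)
  also have "\<dots> = mono_eval m a * mono_eval m' a"
    by (subst (1 2) mono_eval_superset[of ?S])
      (auto simp: lookup_add power_add prod.distrib)
  finally show ?thesis .
qed

lemma mdeg_superset:
  assumes "finite S" "Poly_Mapping.keys m \<subseteq> S"
  shows "mdeg m = (\<Sum>i\<in>S. Poly_Mapping.lookup m i)"
  unfolding mdeg_def using assms
  by (intro sum.mono_neutral_left) (auto simp: in_keys_iff)

lemma mdeg_add: "mdeg (m + m') = mdeg m + mdeg m'"
proof -
  let ?S = "Poly_Mapping.keys m \<union> Poly_Mapping.keys m'"
  have "mdeg (m + m') = (\<Sum>i\<in>?S. Poly_Mapping.lookup (m + m') i)"
    by (rule mdeg_superset) (simp_all add: Poly_Mapping.keys_add)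
  also have "\<dots> = mdeg m + mdeg m'"
    by (subst (1 2) mdeg_superset[of ?S]) (auto simp: lookup_add sum.distrib)
  finally show ?thesis .
qed

lemma mpoly_eq_sum_single:
  "p = (\<Sum>m\<in>Poly_Mapping.keys p. Poly_Mapping.single m (Poly_Mapping.lookup p m))"
proof (rule poly_mapping_eqI)
  fix k
  show "Poly_Mapping.lookup p k = Poly_Mapping.lookup
      (\<Sum>m\<in>Poly_Mapping.keys p. Poly_Mapping.single m (Poly_Mapping.lookup p m)) k"
    by (cases "k \<in> Poly_Mapping.keys p")
      (simp_all add: lookup_sum lookup_single when_def in_keys_iff)
qed

lemma peval_mult: "peval (p * q) a = peval p a * peval q a"
proof -
  let ?L = Poly_Mapping.lookup and ?K = Poly_Mapping.keys
  have p: "p = (\<Sum>m\<in>?K p. Poly_Mapping.single m (?L p m))"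
    and q: "q = (\<Sum>m\<in>?K q. Poly_Mapping.single m (?L q m))"
    by (rule mpoly_eq_sum_single)+
  have "p * q = (\<Sum>m\<in>?K p. \<Sum>m'\<in>?K q. Poly_Mapping.single (m + m') (?L p m * ?L q m'))"
    by (rule trans[OF arg_cong2[OF p q]]) (simp only: sum_product mult_single)
  then show ?thesis
    by (simp add: peval_sum mono_eval_add peval_def[of p] peval_def[of q] sum_product mult_ac)
qed

lemma polys_mult:
  assumes "f \<in> polys N" "g \<in> polys N"
  shows "f * g \<in> polys N"
proof -
  have "k + l \<in> monomials N" if "k \<in> monomials N" "l \<in> monomials N" for k l
    using that keys_add[of k l] by (auto simp: monomials_def)
  then show ?thesis
    using keys_mult[of f g] assms unfolding polys_def by blast
qed

lemma homogeneous_mult: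
  assumes "homogeneous n d f" "homogeneous n e g"
  shows "homogeneous n (d + e) (f * g)"
  unfolding homogeneous_def
proof (intro conjI ballI)
  show "f * g \<in> polys (Suc n)"
    using assms by (simp add: homogeneous_def polys_mult)
  fix m assume "m \<in> Poly_Mapping.keys (f * g)"
  then obtain k l where "m = k + l" "k \<in> Poly_Mapping.keys f" "l \<in> Poly_Mapping.keys g"
    using keys_mult[of f g] by blast
  then show "mdeg m = d + e"
    using assms by (simp add: homogeneous_def mdeg_add)
qed

lemma homogeneous_one: "homogeneous n 0 1"
  by (auto simp: homogeneous_def polys_def monomials_def mdeg_def)

lemma one_in_polys: "1 \<in> polys N"
  by (auto simp: polys_def monomials_def)

lemma peval_one [simp]: "peval 1 a = 1"
  by (simp add: peval_def mono_eval_def)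

lemma istopology_nonzero_loci:
  assumes one: "\<exists>f\<in>F. \<forall>P\<in>A. nz f P"
    and mult: "\<And>f g. f \<in> F \<Longrightarrow> g \<in> F \<Longrightarrow> \<exists>h\<in>F. \<forall>P\<in>A. nz h P \<longleftrightarrow> nz f P \<and> nz g P"
  shows "istopology (\<lambda>U. \<exists>S\<subseteq>F. U = {P\<in>A. \<exists>f\<in>S. nz f P})"
  unfolding istopology_def
proof (intro conjI allI impI)
  fix U V
  assume "\<exists>S\<subseteq>F. U = {P\<in>A. \<exists>f\<in>S. nz f P}" "\<exists>S\<subseteq>F. V = {P\<in>A. \<exists>f\<in>S. nz f P}"
  then obtain S S' where S: "S \<subseteq> F" "U = {P\<in>A. \<exists>f\<in>S. nz f P}"
      "S' \<subseteq> F" "V = {P\<in>A. \<exists>f\<in>S'. nz f P}"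
    by blast
  let ?S = "{h\<in>F. \<exists>f\<in>S. \<exists>g\<in>S'. \<forall>P\<in>A. nz h P \<longleftrightarrow> nz f P \<and> nz g P}"
  have "U \<inter> V = {P\<in>A. \<exists>h\<in>?S. nz h P}"
  proof (intro subset_antisym subsetI)
    fix P assume "P \<in> U \<inter> V"
    then obtain f g where fg: "P \<in> A" "f \<in> S" "g \<in> S'" "nz f P" "nz g P"
      using S by blast
    moreover obtain h where "h \<in> F" "\<forall>P\<in>A. nz h P \<longleftrightarrow> nz f P \<and> nz g P"
      using mult[of f g] fg S by blast
    ultimately show "P \<in> {P\<in>A. \<exists>h\<in>?S. nz h P}"
      by blast
  qed (use S in blast)
  then show "\<exists>S\<subseteq>F. U \<inter> V = {P\<in>A. \<exists>f\<in>S. nz f P}"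
    by (intro exI[of _ ?S]) blast
next
  fix \<K> assume *: "\<forall>K\<in>\<K>. \<exists>S\<subseteq>F. K = {P\<in>A. \<exists>f\<in>S. nz f P}"
  let ?S = "\<Union>{S. S \<subseteq> F \<and> {P\<in>A. \<exists>f\<in>S. nz f P} \<in> \<K>}"
  have "\<Union>\<K> = {P\<in>A. \<exists>f\<in>?S. nz f P}"
  proof (intro subset_antisym subsetI)
    fix P assume "P \<in> \<Union>\<K>"
    then obtain K where K: "K \<in> \<K>" "P \<in> K"
      by blast
    then obtain S where S: "S \<subseteq> F" "K = {P\<in>A. \<exists>f\<in>S. nz f P}"
      using * by blast
    then have "S \<subseteq> ?S"
      using K(1) by blast
    then show "P \<in> {P\<in>A. \<exists>f\<in>?S. nz f P}"
      using K(2) S(2) by blast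
  next
    fix P assume "P \<in> {P\<in>A. \<exists>f\<in>?S. nz f P}"
    then obtain S f where "P \<in> A" "{P\<in>A. \<exists>f\<in>S. nz f P} \<in> \<K>" "f \<in> S" "nz f P"
      by blast
    then show "P \<in> \<Union>\<K>"
      by (intro UnionI[of "{P\<in>A. \<exists>f\<in>S. nz f P}"]) auto
  qed
  then show "\<exists>S\<subseteq>F. \<Union>\<K> = {P\<in>A. \<exists>f\<in>S. nz f P}"
    by (intro exI[of _ ?S]) blast
qed

section \<open>Affine and projective space, regular functions\<close>

definition affine_space :: "nat \<Rightarrow> (nat \<Rightarrow> 'k::field) set" where
  "affine_space r = ({..<r} \<rightarrow>\<^sub>E UNIV)"

definition affine_zeros :: "nat \<Rightarrow> 'k::field mpoly set \<Rightarrow> (nat \<Rightarrow> 'k) set" where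
  "affine_zeros r S = {a \<in> affine_space r. \<forall>f\<in>S. peval f a = 0}"

definition affine_zariski :: "nat \<Rightarrow> (nat \<Rightarrow> 'k::field) topology" where
  "affine_zariski r = topology (\<lambda>U. \<exists>S\<subseteq>polys r. U = affine_space r - affine_zeros r S)"

text \<open>A point of \<open>\<P>\<^sup>n\<close> is the set of all its homogeneous coordinate vectors \<open>(v\<^sub>0, \<dots>, v\<^sub>n)\<close>.\<close>

type_synonym 'k ppoint = "(nat \<Rightarrow> 'k) set"

definition proj_space :: "nat \<Rightarrow> 'k::field ppoint set" where
  "proj_space n =
     (\<lambda>v. {\<lambda>i. c * v i | c. c \<noteq> 0}) ` {v. v \<noteq> (\<lambda>_. 0) \<and> (\<forall>i>n. v i = 0)}"

definition proj_zeros :: "nat \<Rightarrow> 'k::field mpoly set \<Rightarrow> 'k ppoint set" where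
  "proj_zeros n S = {P \<in> proj_space n. \<forall>f\<in>S. \<forall>v\<in>P. peval f v = 0}"

definition proj_zariski :: "nat \<Rightarrow> 'k::field ppoint topology" where
  "proj_zariski n = topology (\<lambda>U. \<exists>S\<subseteq>{f. \<exists>d. homogeneous n d f}. U = proj_space n - proj_zeros n S)"

lemma openin_affine_zariski:
  "openin (affine_zariski r) U \<longleftrightarrow>
     (\<exists>S\<subseteq>polys r. U = affine_space r - affine_zeros r (S :: 'k::field mpoly set))"
proof -
  let ?Z = "\<lambda>S. affine_space r - affine_zeros r (S :: 'k mpoly set)"
  have eq: "?Z S = {a \<in> affine_space r. \<exists>f\<in>S. peval f a \<noteq> 0}" for S
    by (auto simp: affine_zeros_def)
  have "istopology (\<lambda>U. \<exists>S\<subseteq>polys r. U = ?Z S)"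
    unfolding eq
  proof (rule istopology_nonzero_loci)
    show "\<exists>f\<in>polys r. \<forall>a\<in>affine_space r. peval f a \<noteq> (0::'k)"
      by (intro bexI[of _ 1]) (auto simp: one_in_polys)
    show "\<exists>h\<in>polys r. \<forall>a\<in>affine_space r. peval h a \<noteq> 0 \<longleftrightarrow> peval f a \<noteq> 0 \<and> peval g a \<noteq> 0"
      if "f \<in> polys r" "g \<in> polys r" for f g :: "'k mpoly"
      using that by (intro bexI[of _ "f * g"]) (auto simp: peval_mult polys_mult)
  qed
  then show ?thesis
    unfolding affine_zariski_def by (simp add: topology_inverse')
qed

lemma peval_scale:
  assumes "homogeneous n d f"
  shows "peval f (\<lambda>i. c * v i) = c ^ d * peval f v"
proof -
  have "mono_eval m (\<lambda>i. c * v i) = c ^ mdeg m * mono_eval m v" for m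
    by (simp add: mono_eval_def mdeg_def power_mult_distrib prod.distrib power_sum)
  then show ?thesis
    using assms by (simp add: peval_def homogeneous_def sum_distrib_left mult_ac)
qed

lemma peval_zero_on_ppoint:
  assumes "homogeneous n d f" "P \<in> proj_space n" "v \<in> P" "w \<in> P"
  shows "peval f v = 0 \<longleftrightarrow> peval f w = 0"
  using assms(2-4) peval_scale[OF assms(1)] unfolding proj_space_def by auto

lemma openin_proj_zariski:
  "openin (proj_zariski n) U \<longleftrightarrow> (\<exists>S\<subseteq>{f. \<exists>d. homogeneous n d f}.
     U = proj_space n - proj_zeros n (S :: 'k::field mpoly set))"
proof -
  let ?F = "{f :: 'k mpoly. \<exists>d. homogeneous n d f}"
  let ?Z = "\<lambda>S. proj_space n - proj_zeros n (S :: 'k mpoly set)"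
  have eq: "?Z S = {P \<in> proj_space n. \<exists>f\<in>S. \<exists>v\<in>P. peval f v \<noteq> 0}" for S
    by (auto simp: proj_zeros_def)
  have "istopology (\<lambda>U. \<exists>S\<subseteq>?F. U = ?Z S)"
    unfolding eq
  proof (rule istopology_nonzero_loci)
    have "P \<noteq> {}" if "P \<in> proj_space n" for P :: "'k ppoint"
    proof -
      obtain v where "P = {\<lambda>i. c * v i | c. c \<noteq> 0}"
        using \<open>P \<in> proj_space n\<close> by (auto simp: proj_space_def)
      then have "(\<lambda>i. 1 * v i) \<in> P"
        using one_neq_zero[where ?'a = 'k] by blast
      then show ?thesis by blast
    qed
    then show "\<exists>f\<in>?F. \<forall>P\<in>proj_space n. \<exists>v\<in>P. peval f v \<noteq> 0"
      using homogeneous_one by (intro bexI[of _ 1]) auto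
    show "\<exists>h\<in>?F. \<forall>P\<in>proj_space n. (\<exists>v\<in>P. peval h v \<noteq> 0) \<longleftrightarrow>
        (\<exists>v\<in>P. peval f v \<noteq> 0) \<and> (\<exists>v\<in>P. peval g v \<noteq> 0)"
      if F: "f \<in> ?F" "g \<in> ?F" for f g
    proof -
      obtain d e where fg: "homogeneous n d f" "homogeneous n e g"
        using F by blast
      have "(\<exists>v\<in>P. peval (f * g) v \<noteq> 0) \<longleftrightarrow> (\<exists>v\<in>P. peval f v \<noteq> 0) \<and> (\<exists>v\<in>P. peval g v \<noteq> 0)"
        if P: "P \<in> proj_space n" for P
        using peval_zero_on_ppoint[OF fg(1) P] peval_zero_on_ppoint[OF fg(2) P]
        unfolding peval_mult mult_eq_0_iff by meson
      then show ?thesis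
        using homogeneous_mult[OF fg] by (intro bexI[of _ "f * g"]) auto
    qed
  qed
  then show ?thesis
    unfolding proj_zariski_def by (simp add: topology_inverse')
qed

definition quasi_projective :: "nat \<Rightarrow> 'k::field ppoint set \<Rightarrow> bool" where
  "quasi_projective n X \<longleftrightarrow>
     (\<exists>A B. openin (proj_zariski n) A \<and> closedin (proj_zariski n) B \<and> X = A \<inter> B)"

abbreviation zariski :: "nat \<Rightarrow> 'k::field ppoint set \<Rightarrow> 'k ppoint topology" where
  "zariski n X \<equiv> subtopology (proj_zariski n) X"

definition irreducible_space :: "'p topology \<Rightarrow> bool" where
  "irreducible_space T \<longleftrightarrow> topspace T \<noteq> {} \<and>
     (\<forall>A B. closedin T A \<and> closedin T B \<and> topspace T = A \<union> B \<longrightarrow> A = topspace T \<or> B = topspace T)"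

definition fun_ring :: "'p set \<Rightarrow> ('p \<Rightarrow> 'k::field) set \<Rightarrow> ('p \<Rightarrow> 'k) ring" where
  "fun_ring U A =
     \<lparr>carrier = A, monoid.mult = (\<lambda>f g. \<lambda>P\<in>U. f P * g P), one = (\<lambda>P\<in>U. 1),
      ring.zero = (\<lambda>P\<in>U. 0), add = (\<lambda>f g. \<lambda>P\<in>U. f P + g P)\<rparr>"

definition regular_functions :: "nat \<Rightarrow> 'k::field ppoint set \<Rightarrow> 'k ppoint set \<Rightarrow> ('k ppoint \<Rightarrow> 'k) set" where
  "regular_functions n X U = {f \<in> extensional U. \<forall>P\<in>U. \<exists>V g h d.
     openin (zariski n X) V \<and> P \<in> V \<and> V \<subseteq> U \<and> homogeneous n d g \<and> homogeneous n d h \<and>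
     (\<forall>Q\<in>V. \<forall>v\<in>Q. peval h v \<noteq> 0 \<and> f Q = peval g v / peval h v)}"

definition structure_sheaf :: "nat \<Rightarrow> 'k::field ppoint set \<Rightarrow> 'k ppoint set \<Rightarrow> ('k ppoint \<Rightarrow> 'k) ring" where
  "structure_sheaf n X U = fun_ring U (regular_functions n X U)"

definition affine_regular_functions ::
    "nat \<Rightarrow> (nat \<Rightarrow> 'k::field) set \<Rightarrow> (nat \<Rightarrow> 'k) set \<Rightarrow> ((nat \<Rightarrow> 'k) \<Rightarrow> 'k) set" where
  "affine_regular_functions r Z U = {f \<in> extensional U. \<forall>a\<in>U. \<exists>V g h.
     openin (subtopology (affine_zariski r) Z) V \<and> a \<in> V \<and> V \<subseteq> U \<and> g \<in> polys r \<and> h \<in> polys r \<and>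
     (\<forall>b\<in>V. peval h b \<noteq> 0 \<and> f b = peval g b / peval h b)}"

section \<open>Dimension, smoothness, affine open sets and etale charts\<close>

text \<open>From here on, a space is given by a topology \<open>T\<close> and rings \<open>R U\<close> of functions on its open
  sets \<open>U\<close>; it will be \<open>zariski n X\<close> with \<open>structure_sheaf n X\<close>.\<close>

text \<open>An open subset that is isomorphic, as a space with functions, to a closed subset of some
  affine space.\<close>

definition affine_open :: "'p topology \<Rightarrow> ('p set \<Rightarrow> ('p \<Rightarrow> 'k::field) ring) \<Rightarrow> 'p set \<Rightarrow> bool" where
  "affine_open T R U \<longleftrightarrow> openin T U \<and>
     (\<exists>r Z \<psi>. closedin (affine_zariski r) Z \<and>
        homeomorphic_map (subtopology T U) (subtopology (affine_zariski r) Z) \<psi> \<and>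
        (\<forall>V. openin (subtopology (affine_zariski r) Z) V \<longrightarrow>
           (\<forall>f\<in>extensional V. f \<in> affine_regular_functions r Z V \<longleftrightarrow>
              (\<lambda>P \<in> {P\<in>U. \<psi> P \<in> V}. f (\<psi> P)) \<in> carrier (R {P\<in>U. \<psi> P \<in> V}))))"

definition alg_indep :: "nat \<Rightarrow> 'p set \<Rightarrow> (nat \<Rightarrow> 'p \<Rightarrow> 'k::field) \<Rightarrow> bool" where
  "alg_indep N U x \<longleftrightarrow> (\<forall>p\<in>polys N. (\<forall>P\<in>U. peval p (\<lambda>i. x i P) = 0) \<longrightarrow> p = 0)"

text \<open>Dimension of an irreducible variety: the transcendence degree of its function field, whose
  elements are represented by regular functions on nonempty open sets.\<close>

definition has_dimension :: "'p topology \<Rightarrow> ('p set \<Rightarrow> ('p \<Rightarrow> 'k::field) ring) \<Rightarrow> nat \<Rightarrow> bool" where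
  "has_dimension T R N \<longleftrightarrow>
     (\<exists>U x. openin T U \<and> U \<noteq> {} \<and> (\<forall>i<N. x i \<in> carrier (R U)) \<and> alg_indep N U x) \<and>
     \<not> (\<exists>U x. openin T U \<and> U \<noteq> {} \<and> (\<forall>i<Suc N. x i \<in> carrier (R U)) \<and> alg_indep (Suc N) U x)"

text \<open>The germ of \<open>f\<close> at \<open>P\<close> lies in the square of the maximal ideal of the local ring at \<open>P\<close>.\<close>

definition in_max_ideal_square ::
    "'p topology \<Rightarrow> ('p set \<Rightarrow> ('p \<Rightarrow> 'k::field) ring) \<Rightarrow> 'p \<Rightarrow> 'p set \<Rightarrow> ('p \<Rightarrow> 'k) \<Rightarrow> bool" where
  "in_max_ideal_square T R P V f \<longleftrightarrow>
     (\<exists>W (J::nat) g h. openin T W \<and> P \<in> W \<and> W \<subseteq> V \<and>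
        (\<forall>j<J. g j \<in> carrier (R W) \<and> h j \<in> carrier (R W) \<and> g j P = 0 \<and> h j P = 0) \<and>
        (\<forall>Q\<in>W. f Q = (\<Sum>j<J. g j Q * h j Q)))"

text \<open>\<open>\<mm>\<^sub>P / \<mm>\<^sub>P\<^sup>2\<close> has dimension \<open>N\<close> over the ground field: the classes of suitable \<open>t\<^sub>0, \<dots>, t\<^sub>N\<^sub>-\<^sub>1\<close>
  form a basis of it.\<close>

definition smooth_at :: "'p topology \<Rightarrow> ('p set \<Rightarrow> ('p \<Rightarrow> 'k::field) ring) \<Rightarrow> nat \<Rightarrow> 'p \<Rightarrow> bool" where
  "smooth_at T R N P \<longleftrightarrow>
     (\<exists>U t. openin T U \<and> P \<in> U \<and> (\<forall>i<N. t i \<in> carrier (R U) \<and> t i P = 0) \<and>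
        (\<forall>V f. openin T V \<and> P \<in> V \<and> V \<subseteq> U \<and> f \<in> carrier (R V) \<and> f P = 0 \<longrightarrow>
           (\<exists>!c. c \<in> {..<N} \<rightarrow>\<^sub>E UNIV \<and>
              in_max_ideal_square T R P V (\<lambda>Q. f Q - (\<Sum>i<N. c i * t i Q)))))"

definition derivation_on :: "('p set \<Rightarrow> ('p \<Rightarrow> 'k::field) ring) \<Rightarrow> 'p set \<Rightarrow> (('p \<Rightarrow> 'k) \<Rightarrow> 'p \<Rightarrow> 'k) \<Rightarrow> bool" where
  "derivation_on R U D \<longleftrightarrow>
     D \<in> carrier (R U) \<rightarrow>\<^sub>E carrier (R U) \<and>
     (\<forall>f\<in>carrier (R U). \<forall>g\<in>carrier (R U). D (f \<oplus>\<^bsub>R U\<^esub> g) = D f \<oplus>\<^bsub>R U\<^esub> D g) \<and>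
     (\<forall>c. \<forall>f\<in>carrier (R U). D (\<lambda>P\<in>U. c * f P) = (\<lambda>P\<in>U. c * D f P)) \<and>
     (\<forall>f\<in>carrier (R U). \<forall>g\<in>carrier (R U).
        D (f \<otimes>\<^bsub>R U\<^esub> g) = (f \<otimes>\<^bsub>R U\<^esub> D g) \<oplus>\<^bsub>R U\<^esub> (g \<otimes>\<^bsub>R U\<^esub> D f))"

text \<open>\<open>D\<close> is a derivation of \<open>R U\<close> extending \<open>\<partial>/\<partial>x\<^sub>i\<close> from \<open>K[x\<^sub>0, \<dots>, x\<^sub>N\<^sub>-\<^sub>1]\<close>.  Only the values of the
  \<open>x\<^sub>j\<close> on \<open>U\<close> matter, so functions defined on a larger set may be used.\<close>

definition extends_partial ::
    "('p set \<Rightarrow> ('p \<Rightarrow> 'k::field) ring) \<Rightarrow> nat \<Rightarrow> 'p set \<Rightarrow> (nat \<Rightarrow> 'p \<Rightarrow> 'k) \<Rightarrow> nat \<Rightarrow>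
       (('p \<Rightarrow> 'k) \<Rightarrow> 'p \<Rightarrow> 'k) \<Rightarrow> bool" where
  "extends_partial R N U x i D \<longleftrightarrow> derivation_on R U D \<and>
     (\<forall>p\<in>polys N. D (\<lambda>P\<in>U. peval p (\<lambda>j. x j P)) = (\<lambda>P\<in>U. peval (ppartial i p) (\<lambda>j. x j P)))"

definition chart_partial ::
    "('p set \<Rightarrow> ('p \<Rightarrow> 'k::field) ring) \<Rightarrow> nat \<Rightarrow> 'p set \<Rightarrow> (nat \<Rightarrow> 'p \<Rightarrow> 'k) \<Rightarrow> nat \<Rightarrow>
       ('p \<Rightarrow> 'k) \<Rightarrow> 'p \<Rightarrow> 'k" where
  "chart_partial R N U x i = (THE D. extends_partial R N U x i D)"

definition etale_chart ::
    "'p topology \<Rightarrow> ('p set \<Rightarrow> ('p \<Rightarrow> 'k::field) ring) \<Rightarrow> nat \<Rightarrow> 'p set \<Rightarrow> (nat \<Rightarrow> 'p \<Rightarrow> 'k) \<Rightarrow> bool" where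
  "etale_chart T R N U x \<longleftrightarrow>
     affine_open T R U \<and> x \<in> {..<N} \<rightarrow>\<^sub>E carrier (R U) \<and> alg_indep N U x \<and>
     (\<forall>f\<in>carrier (R U). \<not> ring.transcendental (R U) {\<lambda>P\<in>U. peval p (\<lambda>j. x j P) | p. p \<in> polys N} f) \<and>
     (\<forall>i<N. \<exists>!D. extends_partial R N U x i D)"

section \<open>Modules\<close>

definition quotient_module :: "('a, 'b) module \<Rightarrow> 'b set \<Rightarrow> ('a, 'b set) module" where
  "quotient_module M H =
     \<lparr>carrier = a_rcosets\<^bsub>M\<^esub> H, monoid.mult = undefined, one = undefined,
      ring.zero = H, add = set_add M, module.smult = (\<lambda>a C. \<Union>c\<in>C. H +>\<^bsub>M\<^esub> (a \<odot>\<^bsub>M\<^esub> c))\<rparr>"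

definition linear_map_on :: "'a ring \<Rightarrow> ('a, 'b) module \<Rightarrow> ('a, 'c) module \<Rightarrow> ('b \<Rightarrow> 'c) \<Rightarrow> bool" where
  "linear_map_on R M M' f \<longleftrightarrow> f \<in> carrier M \<rightarrow> carrier M' \<and>
     (\<forall>s\<in>carrier M. \<forall>t\<in>carrier M. f (s \<oplus>\<^bsub>M\<^esub> t) = f s \<oplus>\<^bsub>M'\<^esub> f t) \<and>
     (\<forall>a\<in>carrier R. \<forall>s\<in>carrier M. f (a \<odot>\<^bsub>M\<^esub> s) = a \<odot>\<^bsub>M'\<^esub> f s)"

text \<open>For a \<open>K\<close>-vector space \<open>V\<close> and a ring \<open>R W\<close> of \<open>K\<close>-valued functions on \<open>W\<close>, the map sending
  \<open>\<Sum>\<^sub>j f\<^sub>j \<otimes> v\<^sub>j\<close> to the function \<open>P \<mapsto> \<Sum>\<^sub>j f\<^sub>j(P) v\<^sub>j\<close> is injective on \<open>R W \<otimes>\<^sub>K V\<close>; the tensor product is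
  identified with its image.\<close>

definition tensor_module ::
    "('p set \<Rightarrow> ('p \<Rightarrow> 'k::field) ring) \<Rightarrow> 'p set \<Rightarrow> ('k, 'v) module \<Rightarrow> ('p \<Rightarrow> 'k, 'p \<Rightarrow> 'v) module" where
  "tensor_module R W V =
     \<lparr>carrier = {\<sigma> \<in> extensional W. \<exists>(J::nat) f v.
         (\<forall>j<J. f j \<in> carrier (R W) \<and> v j \<in> carrier V) \<and>
         (\<forall>P\<in>W. \<sigma> P = (\<Oplus>\<^bsub>V\<^esub>j\<in>{..<J}. f j P \<odot>\<^bsub>V\<^esub> v j))},
      monoid.mult = undefined, one = undefined, ring.zero = (\<lambda>P\<in>W. \<zero>\<^bsub>V\<^esub>),
      add = (\<lambda>\<sigma> \<tau>. \<lambda>P\<in>W. \<sigma> P \<oplus>\<^bsub>V\<^esub> \<tau> P), module.smult = (\<lambda>a \<sigma>. \<lambda>P\<in>W. a P \<odot>\<^bsub>V\<^esub> \<sigma> P)\<rparr>"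

section \<open>Sheaves of modules\<close>

record ('p, 'k, 's) mod_presheaf =
  sections :: "'p set \<Rightarrow> ('p \<Rightarrow> 'k, 's) module"
  res :: "'p set \<Rightarrow> 'p set \<Rightarrow> 's \<Rightarrow> 's"

definition presheaf_of_modules ::
    "'p topology \<Rightarrow> ('p set \<Rightarrow> ('p \<Rightarrow> 'k::field) ring) \<Rightarrow> ('p, 'k, 's) mod_presheaf \<Rightarrow> bool" where
  "presheaf_of_modules T R F \<longleftrightarrow>
     (\<forall>U. openin T U \<longrightarrow> module (R U) (sections F U)) \<and>
     (\<forall>U V. openin T U \<and> openin T V \<and> V \<subseteq> U \<longrightarrow>
        res F U V \<in> carrier (sections F U) \<rightarrow> carrier (sections F V) \<and>
        (\<forall>s\<in>carrier (sections F U). \<forall>t\<in>carrier (sections F U).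
           res F U V (s \<oplus>\<^bsub>sections F U\<^esub> t) = res F U V s \<oplus>\<^bsub>sections F V\<^esub> res F U V t) \<and>
        (\<forall>a\<in>carrier (R U). \<forall>s\<in>carrier (sections F U).
           res F U V (a \<odot>\<^bsub>sections F U\<^esub> s) = restrict a V \<odot>\<^bsub>sections F V\<^esub> res F U V s)) \<and>
     (\<forall>U. openin T U \<longrightarrow> (\<forall>s\<in>carrier (sections F U). res F U U s = s)) \<and>
     (\<forall>U V W. openin T U \<and> openin T V \<and> openin T W \<and> W \<subseteq> V \<and> V \<subseteq> U \<longrightarrow>
        (\<forall>s\<in>carrier (sections F U). res F V W (res F U V s) = res F U W s))"

definition sheaf_of_modules ::
    "'p topology \<Rightarrow> ('p set \<Rightarrow> ('p \<Rightarrow> 'k::field) ring) \<Rightarrow> ('p, 'k, 's) mod_presheaf \<Rightarrow> bool" where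
  "sheaf_of_modules T R F \<longleftrightarrow> presheaf_of_modules T R F \<and>
     (\<forall>\<U> s. (\<forall>U\<in>\<U>. openin T U \<and> s U \<in> carrier (sections F U)) \<and>
        (\<forall>U\<in>\<U>. \<forall>V\<in>\<U>. res F U (U \<inter> V) (s U) = res F V (U \<inter> V) (s V)) \<longrightarrow>
        (\<exists>!t. t \<in> carrier (sections F (\<Union>\<U>)) \<and> (\<forall>U\<in>\<U>. res F (\<Union>\<U>) U t = s U)))"

definition subsheaf ::
    "'p topology \<Rightarrow> ('p set \<Rightarrow> ('p \<Rightarrow> 'k::field) ring) \<Rightarrow> ('p, 'k, 's) mod_presheaf \<Rightarrow>
       ('p set \<Rightarrow> 's set) \<Rightarrow> bool" where
  "subsheaf T R F G \<longleftrightarrow>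
     (\<forall>U. openin T U \<longrightarrow> submodule (G U) (R U) (sections F U)) \<and>
     (\<forall>U V. openin T U \<and> openin T V \<and> V \<subseteq> U \<longrightarrow> res F U V ` G U \<subseteq> G V) \<and>
     (\<forall>\<U>. \<forall>s\<in>carrier (sections F (\<Union>\<U>)).
        (\<forall>U\<in>\<U>. openin T U \<and> res F (\<Union>\<U>) U s \<in> G U) \<longrightarrow> s \<in> G (\<Union>\<U>))"

subsection \<open>Sheafification and quotient sheaves\<close>

text \<open>A germ at \<open>P\<close> is the set of all pairs \<open>(V, t)\<close> representing it.\<close>

definition germ :: "'p topology \<Rightarrow> ('p, 'k, 's) mod_presheaf \<Rightarrow> 'p \<Rightarrow> 'p set \<times> 's \<Rightarrow> ('p set \<times> 's) set" where
  "germ T F P = (\<lambda>(U, s). {(V, t). openin T V \<and> P \<in> V \<and> t \<in> carrier (sections F V) \<and>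
     (\<exists>W. openin T W \<and> P \<in> W \<and> W \<subseteq> U \<inter> V \<and> res F U W s = res F V W t)})"

text \<open>A section of the sheafification assigns to each point of \<open>U\<close> a germ at that point, and is
  locally induced by sections of \<open>F\<close>.  In the operations, all members of each union over
  representatives of germs are equal.\<close>

definition sheafify ::
    "'p topology \<Rightarrow> ('p, 'k, 's) mod_presheaf \<Rightarrow> ('p, 'k, 'p \<Rightarrow> ('p set \<times> 's) set) mod_presheaf" where
  "sheafify T F =
     \<lparr>sections = (\<lambda>U.
        \<lparr>carrier = {\<sigma> \<in> extensional U. \<forall>P\<in>U. \<exists>V s. openin T V \<and> P \<in> V \<and> V \<subseteq> U \<and>
            s \<in> carrier (sections F V) \<and> (\<forall>Q\<in>V. \<sigma> Q = germ T F Q (V, s))},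
         monoid.mult = undefined, one = undefined,
         ring.zero = (\<lambda>P\<in>U. germ T F P (U, \<zero>\<^bsub>sections F U\<^esub>)),
         add = (\<lambda>\<sigma> \<tau>. \<lambda>P\<in>U. \<Union>(V, s)\<in>\<sigma> P. \<Union>(W, t)\<in>\<tau> P.
            germ T F P (V \<inter> W, res F V (V \<inter> W) s \<oplus>\<^bsub>sections F (V \<inter> W)\<^esub> res F W (V \<inter> W) t)),
         module.smult = (\<lambda>a \<sigma>. \<lambda>P\<in>U. \<Union>(V, s)\<in>\<sigma> P.
            germ T F P (V \<inter> U, restrict a (V \<inter> U) \<odot>\<^bsub>sections F (V \<inter> U)\<^esub> res F V (V \<inter> U) s))\<rparr>),
      res = (\<lambda>U V \<sigma>. restrict \<sigma> V)\<rparr>"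

definition quotient_presheaf ::
    "('p, 'k, 's) mod_presheaf \<Rightarrow> ('p set \<Rightarrow> 's set) \<Rightarrow> ('p, 'k, 's set) mod_presheaf" where
  "quotient_presheaf F G =
     \<lparr>sections = (\<lambda>U. quotient_module (sections F U) (G U)),
      res = (\<lambda>U V C. \<Union>s\<in>C. G V +>\<^bsub>sections F V\<^esub> res F U V s)\<rparr>"

definition quotient_sheaf ::
    "'p topology \<Rightarrow> ('p, 'k, 's) mod_presheaf \<Rightarrow> ('p set \<Rightarrow> 's set) \<Rightarrow>
       ('p, 'k, 'p \<Rightarrow> ('p set \<times> 's set) set) mod_presheaf" where
  "quotient_sheaf T F G = sheafify T (quotient_presheaf F G)"

text \<open>The projection from a quotient \<open>F/G'\<close> to \<open>F/G\<close> over \<open>W\<close>, where \<open>G'\<close> is contained in \<open>G\<close>.\<close>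

definition quotient_projection ::
    "'p topology \<Rightarrow> ('p, 'k, 's) mod_presheaf \<Rightarrow> ('p set \<Rightarrow> 's set) \<Rightarrow> 'p set \<Rightarrow>
       ('p \<Rightarrow> ('p set \<times> 's set) set) \<Rightarrow> 'p \<Rightarrow> ('p set \<times> 's set) set" where
  "quotient_projection T F G W \<sigma> = (\<lambda>P\<in>W. \<Union>(V, C)\<in>\<sigma> P.
     germ T (quotient_presheaf F G) P (V, \<Union>s\<in>C. G V +>\<^bsub>sections F V\<^esub> s))"

section \<open>Topological vector bundles\<close>

text \<open>The sheaf \<open>F\<close> with filtration \<open>F = Fil 0 \<supseteq> Fil 1 \<supseteq> \<dots>\<close> is a topological vector bundle, trivialized
  over the affine open cover \<open>(U i)\<close>, \<open>i \<in> I\<close>, by the isomorphisms of sheaves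
  \<open>\<phi> m i : F/Fil m \<cong> R \<otimes> V m i\<close> on \<open>U i\<close>.  Over \<open>U i\<close> its fibre is the inverse limit of
  \<open>\<dots> \<rightarrow> V 2 i \<rightarrow> V 1 i \<rightarrow> V 0 i\<close> along the maps \<open>\<pi> m i : V (m + 1) i \<rightarrow> V m i\<close>.\<close>

definition topological_vector_bundle ::
    "'p topology \<Rightarrow> ('p set \<Rightarrow> ('p \<Rightarrow> 'k::field) ring) \<Rightarrow>
     ('p, 'k, 's) mod_presheaf \<Rightarrow> (nat \<Rightarrow> 'p set \<Rightarrow> 's set) \<Rightarrow>
     'i set \<Rightarrow> ('i \<Rightarrow> 'p set) \<Rightarrow> (nat \<Rightarrow> 'i \<Rightarrow> ('k, 'v) module) \<Rightarrow> (nat \<Rightarrow> 'i \<Rightarrow> 'v \<Rightarrow> 'v) \<Rightarrow>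
     (nat \<Rightarrow> 'i \<Rightarrow> 'p set \<Rightarrow> ('p \<Rightarrow> ('p set \<times> 's set) set) \<Rightarrow> 'p \<Rightarrow> 'v) \<Rightarrow> bool" where
  "topological_vector_bundle T R F Fil I U V \<pi> \<phi> \<longleftrightarrow>
     \<comment> \<open>the filtration\<close>
     sheaf_of_modules T R F \<and>
     (\<forall>m. subsheaf T R F (Fil m)) \<and>
     (\<forall>W. openin T W \<longrightarrow>
        Fil 0 W = carrier (sections F W) \<and>
        (\<forall>m. Fil (Suc m) W \<subseteq> Fil m W) \<and>
        (\<Inter>m. Fil m W) = {\<zero>\<^bsub>sections F W\<^esub>}) \<and>
     \<comment> \<open>the cover and the fibres\<close>
     (\<forall>i\<in>I. affine_open T R (U i)) \<and> (\<Union>i\<in>I. U i) = topspace T \<and>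
     (\<forall>m. \<forall>i\<in>I. module ring_of_type_algebra (V m i) \<and>
        linear_map_on ring_of_type_algebra (V (Suc m) i) (V m i) (\<pi> m i)) \<and>
     \<comment> \<open>the trivializations\<close>
     (\<forall>m. \<forall>i\<in>I. \<forall>W. openin T W \<and> W \<subseteq> U i \<longrightarrow>
        linear_map_on (R W) (sections (quotient_sheaf T F (Fil m)) W) (tensor_module R W (V m i)) (\<phi> m i W) \<and>
        bij_betw (\<phi> m i W) (carrier (sections (quotient_sheaf T F (Fil m)) W))
          (carrier (tensor_module R W (V m i))) \<and>
        (\<forall>W'. openin T W' \<and> W' \<subseteq> W \<longrightarrow>
           (\<forall>\<sigma>\<in>carrier (sections (quotient_sheaf T F (Fil m)) W).
              \<phi> m i W' (res (quotient_sheaf T F (Fil m)) W W' \<sigma>) = restrict (\<phi> m i W \<sigma>) W')) \<and>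
        (\<forall>\<sigma>\<in>carrier (sections (quotient_sheaf T F (Fil (Suc m))) W).
           \<phi> m i W (quotient_projection T F (Fil m) W \<sigma>) = (\<lambda>P\<in>W. \<pi> m i (\<phi> (Suc m) i W \<sigma> P))))"

text \<open>An element of the inverse limit of the \<open>R W \<otimes> V m\<close> is written as the sequence of its components.
  The transition function from \<open>i\<close> to \<open>j\<close> over \<open>W\<close> is the inverse limit of the \<open>R W\<close>-linear maps
  \<open>\<phi> m j W \<circ> (\<phi> m i W)\<^sup>-\<^sup>1\<close>, hence \<open>R W\<close>-linear and continuous by construction.\<close>

definition transition ::
    "'p topology \<Rightarrow> ('p, 'k, 's) mod_presheaf \<Rightarrow> (nat \<Rightarrow> 'p set \<Rightarrow> 's set) \<Rightarrow>
     (nat \<Rightarrow> 'i \<Rightarrow> 'p set \<Rightarrow> ('p \<Rightarrow> ('p set \<times> 's set) set) \<Rightarrow> 'p \<Rightarrow> 'v) \<Rightarrow>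
     'i \<Rightarrow> 'i \<Rightarrow> 'p set \<Rightarrow> (nat \<Rightarrow> 'p \<Rightarrow> 'v) \<Rightarrow> nat \<Rightarrow> 'p \<Rightarrow> 'v" where
  "transition T F Fil \<phi> i j W \<sigma> = (\<lambda>m. \<phi> m j W
     (inv_into (carrier (sections (quotient_sheaf T F (Fil m)) W)) (\<phi> m i W) (\<sigma> m)))"

section \<open>Vector fields vanishing at the origin\<close>

text \<open>The vector field \<open>\<Sum>\<^sub>q w\<^sub>q \<partial>/\<partial>X\<^sub>q\<close> is represented by its coefficients \<open>w\<close>.\<close>

definition L_plus :: "nat \<Rightarrow> ('k::field, nat \<Rightarrow> 'k mpoly) module" where
  "L_plus N =
     \<lparr>carrier = {w. (\<forall>q<N. w q \<in> polys N \<and> Poly_Mapping.lookup (w q) 0 = 0) \<and> (\<forall>q\<ge>N. w q = 0)},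
      monoid.mult = undefined, one = undefined, ring.zero = (\<lambda>_. 0),
      add = (\<lambda>v w q. v q + w q), module.smult = (\<lambda>c w q. Poly_Mapping.map ((*) c) (w q))\<rparr>"

text \<open>\<open>X\<^sup>r \<partial>/\<partial>X\<^sub>q\<close> has degree \<open>|r| - 1\<close>.\<close>

definition L_ge :: "nat \<Rightarrow> nat \<Rightarrow> (nat \<Rightarrow> 'k::field mpoly) set" where
  "L_ge N k = {w \<in> carrier (L_plus N). \<forall>q. \<forall>r\<in>Poly_Mapping.keys (w q). k + 1 \<le> mdeg r}"

definition L_quot :: "nat \<Rightarrow> nat \<Rightarrow> ('k::field, (nat \<Rightarrow> 'k mpoly) set) module" where
  "L_quot N k = quotient_module (L_plus N) (L_ge N k)"

definition L_proj :: "nat \<Rightarrow> nat \<Rightarrow> (nat \<Rightarrow> 'k::field mpoly) set \<Rightarrow> (nat \<Rightarrow> 'k mpoly) set" where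
  "L_proj N k C = (\<Union>w\<in>C. L_ge N k +>\<^bsub>L_plus N\<^esub> w)"

text \<open>Let \<open>c P q r\<close> be the value at \<open>P\<close> of the coefficient of \<open>Y\<^sup>r \<partial>/\<partial>Y\<^sub>q\<close> in a formal vector field with
  coefficients in functions on \<open>W\<close>.  The sequence of its classes modulo \<open>L_ge N k\<close> is its image in
  the completed tensor product, the inverse limit of the \<open>R W \<otimes> L_quot N k\<close>.  The terms with \<open>r = 0\<close> are kept:
  if some \<open>c P q 0\<close> is not \<open>0\<close>, the result is not in that inverse limit.\<close>

definition truncated_field :: "nat \<Rightarrow> nat \<Rightarrow> (nat \<Rightarrow> mono \<Rightarrow> 'k::field) \<Rightarrow> nat \<Rightarrow> 'k mpoly" where
  "truncated_field N k c = (\<lambda>q. if q < N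
     then \<Sum>r\<in>{r \<in> monomials N. mdeg r \<le> k}. Poly_Mapping.single r (c q r) else 0)"

definition formal_field ::
    "nat \<Rightarrow> 'p set \<Rightarrow> ('p \<Rightarrow> nat \<Rightarrow> mono \<Rightarrow> 'k::field) \<Rightarrow> nat \<Rightarrow> 'p \<Rightarrow> (nat \<Rightarrow> 'k mpoly) set" where
  "formal_field N W c = (\<lambda>k. \<lambda>P\<in>W. L_ge N k +>\<^bsub>L_plus N\<^esub> truncated_field N k (c P))"

definition monomial_field :: "mono \<Rightarrow> nat \<Rightarrow> 'p \<Rightarrow> nat \<Rightarrow> mono \<Rightarrow> 'k::field" where
  "monomial_field m p = (\<lambda>P q r. if q = p \<and> r = m then 1 else 0)"

section \<open>The transition formula\<close>

text \<open>A power series over \<open>K\<close> is its coefficient function on \<^typ>\<open>mono\<close>.\<close>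

definition ps_one :: "mono \<Rightarrow> 'k::field" where
  "ps_one r = (if r = 0 then 1 else 0)"

definition ps_mult :: "(mono \<Rightarrow> 'k::field) \<Rightarrow> (mono \<Rightarrow> 'k) \<Rightarrow> mono \<Rightarrow> 'k" where
  "ps_mult f g r = (\<Sum>(a, b)\<in>{(a, b). a + b = r}. f a * g b)"

definition ps_power :: "nat \<Rightarrow> (nat \<Rightarrow> mono \<Rightarrow> 'k::field) \<Rightarrow> mono \<Rightarrow> mono \<Rightarrow> 'k" where
  "ps_power N G k = fold (\<lambda>i. (ps_mult (G i)) ^^ Poly_Mapping.lookup k i) [0..<N] ps_one"

definition multi_partial ::
    "('p set \<Rightarrow> ('p \<Rightarrow> 'k::field) ring) \<Rightarrow> nat \<Rightarrow> 'p set \<Rightarrow> (nat \<Rightarrow> 'p \<Rightarrow> 'k) \<Rightarrow> mono \<Rightarrow>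
       ('p \<Rightarrow> 'k) \<Rightarrow> 'p \<Rightarrow> 'k" where
  "multi_partial R N W y r = fold (\<lambda>i. chart_partial R N W y i ^^ Poly_Mapping.lookup r i) [0..<N]"

text \<open>\<open>f(y + Y)\<close>, with coefficients evaluated at \<open>P\<close>.\<close>

definition taylor ::
    "('p set \<Rightarrow> ('p \<Rightarrow> 'k::field_char_0) ring) \<Rightarrow> nat \<Rightarrow> 'p set \<Rightarrow> (nat \<Rightarrow> 'p \<Rightarrow> 'k) \<Rightarrow>
       ('p \<Rightarrow> 'k) \<Rightarrow> 'p \<Rightarrow> mono \<Rightarrow> 'k" where
  "taylor R N W y f P r =
     (if r \<in> monomials N then multi_partial R N W y r f P / (\<Prod>i<N. fact (Poly_Mapping.lookup r i)) else 0)"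

text \<open>The coefficient of \<open>Y\<^sup>r \<partial>/\<partial>Y\<^sub>q\<close> at \<open>P \<in> W\<close> in the image of \<open>X\<^sup>m \<partial>/\<partial>X\<^sub>p\<close>.  Here \<open>G\<^sub>i(y)\<close> is the function
  \<open>x\<^sub>i\<close>, and \<open>dH q\<close> is the function \<open>\<partial>y\<^sub>q/\<partial>x\<^sub>p\<close> on \<open>W\<close>.\<close>

definition transition_field ::
    "('p set \<Rightarrow> ('p \<Rightarrow> 'k::field_char_0) ring) \<Rightarrow> nat \<Rightarrow> 'p set \<Rightarrow> (nat \<Rightarrow> 'p \<Rightarrow> 'k) \<Rightarrow> (nat \<Rightarrow> 'p \<Rightarrow> 'k) \<Rightarrow>
       mono \<Rightarrow> nat \<Rightarrow> 'p \<Rightarrow> nat \<Rightarrow> mono \<Rightarrow> 'k" where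
  "transition_field R N W x y m p = (\<lambda>P q r.
     let G = (\<lambda>i. x i P);
         GY = (\<lambda>i. taylor R N W y (restrict (x i) W) P);
         dH = (\<lambda>q. chart_partial R N W x p (restrict (y q) W))
     in \<Sum>k\<in>{k. \<forall>i. Poly_Mapping.lookup k i \<le> Poly_Mapping.lookup m i}.
          (-1) ^ (mdeg m - mdeg k) *
          (\<Prod>i<N. of_nat (Poly_Mapping.lookup m i choose Poly_Mapping.lookup k i)) *
          mono_eval (m - k) G *
          (ps_mult (ps_power N GY k) (taylor R N W y (dH q) P) r
            - mono_eval k G * dH q P * ps_one r))"

end

theory Submission
  imports Defs "Jordan_Normal_Form.Determinant"
begin

text \<open>A jet of a vector field that vanishes at a point does not depend on coordinates; only its coefficients do.
  The bundle consists of the families of coefficients that come from such jets in all etale charts at once.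

  In a chart \<open>x\<close> the element \<open>X\<^sup>m \<partial>/\<partial>X\<^sub>p\<close> of the fibre at \<open>P\<close> stands for the vector field \<open>(x - x(P))\<^sup>m \<partial>/\<partial>x\<^sub>p\<close>.  In
  another chart \<open>y\<close> this field has the coefficients \<open>(x - x(P))\<^sup>m \<partial>y\<^sub>q/\<partial>x\<^sub>p\<close>.  Expanding \<open>(x - x(P))\<^sup>m\<close> by the binomial
  formula shows that the Taylor series of these coefficients in \<open>y\<close> at \<open>P\<close> are precisely the transition formula;
  the terms that the formula subtracts add up to \<open>0\<close> since \<open>m \<noteq> 0\<close> (\<open>transition_field_eq_taylor\<close>).  Hence the
  transition function computes the coefficients in \<open>y\<close> of any vector field from those in \<open>x\<close>
  (\<open>transfer_represents\<close>).  Truncation is harmless, because the order to which a function vanishes at \<open>P\<close> is the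
  same in all charts (\<open>vanishes_chart_independent\<close>).  The cocycle condition (\<open>transfer_cocycle\<close>) needs no
  computation with the formula: any finite set of coefficients at \<open>P\<close> is realized by a vector field, whose
  coefficients in a third chart can be computed directly or through the second chart.

  A section of the bundle therefore assigns to every chart regular coefficient functions, related by the
  transition functions, and the filtration is by the order of the coefficients that vanish.  Over a chart all
  other coefficients are determined by those in the chart and the latter are arbitrary; so the quotient
  by the \<open>k\<close>-th step is \<open>O \<otimes> L\<^sub>+/L\<^sub>\<ge>\<^sub>k\<close> (\<open>topological_vector_bundle_jet_bundle\<close>), and the
  transition maps are the prescribed ones by construction (\<open>transition_jet_bundle\<close>).

  It remains to cover \<open>X\<close> by etale charts (\<open>etale_chart_near_smooth_point\<close>).  Let \<open>t\<close> be local parameters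
  at a smooth point \<open>P\<close> and \<open>a\<^sub>0, \<dots>, a\<^sub>r\<^sub>-\<^sub>1\<close> affine coordinates.  By Nakayama's lemma, in the form that a matrix that is
  the identity at \<open>P\<close> is invertible near \<open>P\<close>, the \<open>da\<^sub>k\<close> are combinations of the \<open>dt\<^sub>i\<close> near \<open>P\<close>
  (\<open>differentials_of_coords\<close>).  In characteristic \<open>0\<close> a transcendence basis has dual vector fields on some nonempty open
  set (\<open>generic_dual_fields\<close>), and linear algebra turns them into fields dual to \<open>t\<close> there.  These fields
  send the \<open>a\<^sub>k\<close> to functions that are regular near \<open>P\<close>, and the equations that make such values
  a vector field extend by density (\<open>dual_fields_of_differentials\<close>, \<open>vfield_of_tangent\<close>).  Functions are algebraic
  over \<open>t\<close> for reasons of dimension.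

  All of this uses little of the geometry: regular functions are local, they can be inverted where they do not
  vanish, nonvanishing is an open condition, and the space is irreducible (\<open>function_space\<close>, \<open>variety\<close>), and there are
  arbitrarily small affine neighbourhoods.  The last part shows these properties for quasi-projective varieties
  (\<open>function_space_regular_functions\<close>, \<open>affine_open_neighbourhood\<close>).\<close>

section \<open>Polynomials and their partial derivatives\<close>

abbreviation lk :: "('a \<Rightarrow>\<^sub>0 'b::zero) \<Rightarrow> 'a \<Rightarrow> 'b" where
  "lk \<equiv> Poly_Mapping.lookup"

definition unit_mono :: "nat \<Rightarrow> mono" where
  "unit_mono i = Poly_Mapping.single i 1"

definition pconst :: "'k::field \<Rightarrow> 'k mpoly" where
  "pconst c = Poly_Mapping.single 0 c"

definition pvar :: "nat \<Rightarrow> 'k::field mpoly" where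
  "pvar i = Poly_Mapping.single (unit_mono i) 1"

lemma keys_unit_mono [simp]: "Poly_Mapping.keys (unit_mono i) = {i}"
  by (simp add: unit_mono_def)

lemma lookup_unit_mono [simp]: "lk (unit_mono i) j = (if j = i then 1 else 0)"
  by (auto simp: unit_mono_def lookup_single when_def)

lemma mdeg_zero [simp]: "mdeg 0 = 0"
  by (simp add: mdeg_def)

lemma mdeg_unit_mono [simp]: "mdeg (unit_mono i) = 1"
  by (simp add: mdeg_def lookup_unit_mono)

lemma mdeg_eq_0_iff: "mdeg m = 0 \<longleftrightarrow> m = 0"
proof
  assume "mdeg m = 0"
  then have "\<forall>i\<in>Poly_Mapping.keys m. lk m i = 0"
    by (simp add: mdeg_def)
  then show "m = 0"
    by (intro poly_mapping_eqI) (auto simp: in_keys_iff)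
qed simp

lemma monomials_zero [simp]: "0 \<in> monomials N"
  by (simp add: monomials_def)

lemma unit_mono_in_monomials [simp]: "unit_mono i \<in> monomials N \<longleftrightarrow> i < N"
  by (simp add: monomials_def)

lemma monomials_add_iff [simp]: "k + l \<in> monomials N \<longleftrightarrow> k \<in> monomials N \<and> l \<in> monomials N"
proof -
  have "Poly_Mapping.keys (k + l) = Poly_Mapping.keys k \<union> Poly_Mapping.keys l"
    by (auto simp: in_keys_iff lookup_add)
  then show ?thesis
    by (auto simp: monomials_def)
qed

lemma lookup_eq_0_of_monomials: "m \<in> monomials N \<Longrightarrow> N \<le> i \<Longrightarrow> lk m i = 0"
  by (force simp: monomials_def in_keys_iff)

lemma mono_remove_unit:
  assumes "lk m i \<noteq> 0"
  shows "m - unit_mono i + unit_mono i = m"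
  using assms by (intro poly_mapping_eqI) (auto simp: lookup_add lookup_minus lookup_unit_mono)

lemma mono_nonzero_split:
  assumes "m \<in> monomials N" "m \<noteq> 0"
  obtains i m' where "i < N" "m' \<in> monomials N" "m = m' + unit_mono i"
proof -
  obtain i where i: "lk m i \<noteq> 0"
    using assms(2) poly_mapping_eqI[of m 0] by auto
  then have "i < N"
    using assms(1) lookup_eq_0_of_monomials[of m N i] by (meson not_le)
  moreover have "m = (m - unit_mono i) + unit_mono i"
    using mono_remove_unit[OF i] by simp
  moreover have "m - unit_mono i \<in> monomials N"
    using assms(1) monomials_add_iff[of "m - unit_mono i" "unit_mono i" N]
    by (simp add: mono_remove_unit[OF i])
  ultimately show ?thesis using that[of i "m - unit_mono i"] by blast
qed

lemma finite_monomials_mdeg: "finite {m \<in> monomials N. mdeg m \<le> k}"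
proof -
  have "{m \<in> monomials N. mdeg m \<le> k} \<subseteq> {m. \<forall>i. lk m i \<in> {..k} \<and> (i \<notin> {..<N} \<longrightarrow> lk m i = 0)}"
  proof (intro subsetI CollectI allI conjI impI)
    fix m i assume m: "m \<in> {m \<in> monomials N. mdeg m \<le> k}"
    then have "lk m i \<le> mdeg m"
      by (cases "i \<in> Poly_Mapping.keys m") (auto simp: mdeg_def in_keys_iff intro: member_le_sum)
    then show "lk m i \<in> {..k}"
      using m by simp
    show "lk m i = 0" if "i \<notin> {..<N}"
      using that m lookup_eq_0_of_monomials[of m N i] by simp
  qed
  moreover have "finite {m :: mono. \<forall>i. lk m i \<in> {..k} \<and> (i \<notin> {..<N} \<longrightarrow> lk m i = 0)}"
  proof (rule finite_imageD)
    show "inj_on lk {m :: mono. \<forall>i. lk m i \<in> {..k} \<and> (i \<notin> {..<N} \<longrightarrow> lk m i = 0)}"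
      by (intro inj_onI poly_mapping_eqI) simp
    have "lk ` {m :: mono. \<forall>i. lk m i \<in> {..k} \<and> (i \<notin> {..<N} \<longrightarrow> lk m i = 0)}
        \<subseteq> {f. \<forall>i. (i \<in> {..<N} \<longrightarrow> f i \<in> {..k}) \<and> (i \<notin> {..<N} \<longrightarrow> f i = 0)}"
      by auto
    then show "finite (lk ` {m :: mono. \<forall>i. lk m i \<in> {..k} \<and> (i \<notin> {..<N} \<longrightarrow> lk m i = 0)})"
      by (rule finite_subset) (intro finite_set_of_finite_funs; simp)
  qed
  ultimately show ?thesis by (rule finite_subset)
qed

lemma lookup_ppartial:
  "lk (ppartial i p) k = of_nat (Suc (lk k i)) * lk p (k + unit_mono i)"
proof -
  have eq: "(m - unit_mono i = k \<and> lk m i \<noteq> 0) \<longleftrightarrow> m = k + unit_mono i" for m :: mono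
    using mono_remove_unit[of m i] by (auto simp: lookup_add)
  have "lk (ppartial i p) k = (\<Sum>m\<in>Poly_Mapping.keys p. if m = k + unit_mono i then of_nat (lk m i) * lk p m else 0)"
    unfolding ppartial_def lookup_sum lookup_single when_def
    unfolding unit_mono_def[symmetric]
  proof (intro sum.cong refl)
    fix m
    show "(if m - unit_mono i = k then of_nat (lk m i) * lk p m else 0)
        = (if m = k + unit_mono i then of_nat (lk m i) * lk p m else 0)"
      using eq[of m] by (cases "lk m i = 0") (simp_all only: of_nat_0 mult_zero_left if_cancel simp_thms)
  qed
  then show ?thesis
    by (simp add: sum.delta lookup_add lookup_unit_mono in_keys_iff)
qed

lemma ppartial_add: "ppartial i (p + q) = ppartial i p + ppartial i q"
  by (intro poly_mapping_eqI) (simp add: lookup_ppartial lookup_add algebra_simps)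

lemma ppartial_zero [simp]: "ppartial i 0 = 0"
  by (intro poly_mapping_eqI) (simp add: lookup_ppartial)

lemma ppartial_sum: "ppartial i (sum f S) = (\<Sum>s\<in>S. ppartial i (f s))"
  by (induction S rule: infinite_finite_induct) (auto simp: ppartial_add)

lemma ppartial_single:
  "ppartial i (Poly_Mapping.single m c) = Poly_Mapping.single (m - unit_mono i) (of_nat (lk m i) * c)"
  by (cases "c = 0") (auto simp: ppartial_def unit_mono_def)

lemma ppartial_mult: "ppartial i (p * q) = p * ppartial i q + q * ppartial i p"
proof -
  have single: "ppartial i (Poly_Mapping.single m c * Poly_Mapping.single m' c') =
      Poly_Mapping.single m c * ppartial i (Poly_Mapping.single m' c') +
      Poly_Mapping.single m' c' * ppartial i (Poly_Mapping.single m c)" for m m' :: mono and c c' :: 'a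
  proof -
    have e: "m + m' - unit_mono i = m + (m' - unit_mono i)" if "lk m' i \<noteq> 0" for m m' :: mono
      using that by (intro poly_mapping_eqI) (auto simp: lookup_add lookup_minus lookup_unit_mono)
    have "Poly_Mapping.single (m + m' - unit_mono i) (of_nat (lk m' i) * (c * c'))
        = Poly_Mapping.single (m + (m' - unit_mono i)) (c * (of_nat (lk m' i) * c'))"
      by (cases "lk m' i = 0") (simp_all add: e mult_ac)
    moreover have "Poly_Mapping.single (m + m' - unit_mono i) (of_nat (lk m i) * (c * c'))
        = Poly_Mapping.single (m' + (m - unit_mono i)) (c' * (of_nat (lk m i) * c))"
      by (cases "lk m i = 0") (simp_all add: e[of m m'] add.commute[of m m'] mult_ac)
    ultimately show ?thesis
      by (simp add: mult_single ppartial_single lookup_add distrib_right single_add)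
  qed
  let ?s = "\<lambda>p m. Poly_Mapping.single m (lk p m)" and ?K = Poly_Mapping.keys
  have p: "p = (\<Sum>m\<in>?K p. ?s p m)" and q: "q = (\<Sum>m\<in>?K q. ?s q m)"
    by (rule mpoly_eq_sum_single)+
  have "ppartial i (p * q) = ppartial i ((\<Sum>m\<in>?K p. ?s p m) * (\<Sum>m'\<in>?K q. ?s q m'))"
    using p q by simp
  also have "\<dots> = (\<Sum>m\<in>?K p. \<Sum>m'\<in>?K q. ?s p m * ppartial i (?s q m') + ?s q m' * ppartial i (?s p m))"
    by (simp only: sum_product ppartial_sum single)
  also have "\<dots> = (\<Sum>m\<in>?K p. ?s p m) * (\<Sum>m'\<in>?K q. ppartial i (?s q m'))
      + (\<Sum>m'\<in>?K q. ?s q m') * (\<Sum>m\<in>?K p. ppartial i (?s p m))"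
    unfolding sum_product sum.distrib by (subst (3) sum.swap) simp
  also have "\<dots> = p * ppartial i q + q * ppartial i p"
    unfolding ppartial_sum[symmetric] using p q by simp
  finally show ?thesis .
qed

lemma ppartial_const [simp]: "ppartial i (pconst c) = 0"
  by (simp add: pconst_def ppartial_single)

lemma ppartial_var: "ppartial i (pvar j) = (if i = j then 1 else 0)"
  by (auto simp: pvar_def ppartial_single lookup_single)

lemma ppartial_uminus: "ppartial i (- p) = - ppartial i p"
  by (intro poly_mapping_eqI) (simp add: lookup_ppartial)

lemma ppartial_diff: "ppartial i (p - q) = ppartial i p - ppartial i q"
  using ppartial_add[of i p "- q"] by (simp add: ppartial_uminus)

lemma pconst_in_polys [simp]: "pconst c \<in> polys N"
  by (auto simp: pconst_def polys_def split: if_splits)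

lemma pvar_in_polys: "i < N \<Longrightarrow> pvar i \<in> polys N"
  by (auto simp: pvar_def polys_def)

lemma polys_iff: "p \<in> polys N \<longleftrightarrow> (\<forall>m. lk p m \<noteq> 0 \<longrightarrow> m \<in> monomials N)"
  by (auto simp: polys_def in_keys_iff)

lemma polys_add: "p \<in> polys N \<Longrightarrow> q \<in> polys N \<Longrightarrow> p + q \<in> polys N"
  unfolding polys_iff lookup_add by (metis add.right_neutral)

lemma polys_uminus: "p \<in> polys N \<Longrightarrow> - p \<in> polys N"
  unfolding polys_iff by simp

lemma polys_diff: "p \<in> polys N \<Longrightarrow> q \<in> polys N \<Longrightarrow> p - q \<in> polys N"
  unfolding polys_iff lookup_minus by (metis diff_0_right)

lemma polys_zero [simp]: "0 \<in> polys N"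
  by (simp add: polys_iff)

lemma polys_sum: "(\<And>s. s \<in> S \<Longrightarrow> f s \<in> polys N) \<Longrightarrow> sum f S \<in> polys N"
  by (induction S rule: infinite_finite_induct) (auto simp: polys_add)

lemma polys_power: "p \<in> polys N \<Longrightarrow> p ^ e \<in> polys N"
  by (induction e) (auto simp: one_in_polys polys_mult)

lemma polys_mono: "p \<in> polys N \<Longrightarrow> N \<le> M \<Longrightarrow> p \<in> polys M"
  by (force simp: polys_def monomials_def)

lemma ppartial_in_polys: "p \<in> polys N \<Longrightarrow> ppartial i p \<in> polys N"
  by (auto simp: polys_iff lookup_ppartial)

lemma ppartial_eq_0: "p \<in> polys N \<Longrightarrow> N \<le> i \<Longrightarrow> ppartial i p = 0"
  by (intro poly_mapping_eqI) (use polys_iff[of p N] in \<open>auto simp: lookup_ppartial simp del: of_nat_Suc\<close>)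

lemma peval_const [simp]: "peval (pconst c) a = c"
  by (simp add: pconst_def mono_eval_def)

lemma peval_var [simp]: "peval (pvar i) a = a i"
  by (simp add: pvar_def mono_eval_def)

lemma peval_uminus: "peval (- p) a = - peval p a"
  using peval_add[of p "- p" a] by (simp add: add_eq_0_iff)

lemma peval_diff: "peval (p - q) a = peval p a - peval q a"
  using peval_add[of p "- q" a] by (simp add: peval_uminus)

lemma peval_power: "peval (p ^ e) a = peval p a ^ e"
  by (induction e) (auto simp: peval_mult)

lemma peval_cong:
  assumes "p \<in> polys N" "\<And>i. i < N \<Longrightarrow> a i = b i"
  shows "peval p a = peval p b"
  unfolding peval_def mono_eval_def
proof (intro sum.cong prod.cong refl arg_cong2[of _ _ _ _ "(*)"])
  fix m i assume "m \<in> Poly_Mapping.keys p" "i \<in> Poly_Mapping.keys m"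
  then have "i < N"
    using assms(1) by (auto simp: polys_def monomials_def)
  then show "a i ^ lk m i = b i ^ lk m i"
    using assms(2) by simp
qed

lemma pconst_add: "pconst (c + d) = pconst c + pconst d"
  by (simp add: pconst_def single_add)

lemma pconst_0 [simp]: "pconst 0 = 0"
  by (simp add: pconst_def)

lemma pconst_1 [simp]: "pconst 1 = 1"
  by (simp add: pconst_def)

lemma single_mono_in_closure:
  assumes "m \<in> monomials N"
    and const: "\<And>c. P (pconst c)"
    and var: "\<And>i. i < N \<Longrightarrow> P (pvar i)"
    and mult: "\<And>p q. p \<in> polys N \<Longrightarrow> q \<in> polys N \<Longrightarrow> P p \<Longrightarrow> P q \<Longrightarrow> P (p * q)"
  shows "P (Poly_Mapping.single m c)"
  using assms(1)
proof (induction "mdeg m" arbitrary: m)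
  case 0
  then show ?case using const[of c] by (simp add: mdeg_eq_0_iff pconst_def)
next
  case (Suc d)
  then have "m \<noteq> 0" by auto
  then obtain i m' where m: "i < N" "m' \<in> monomials N" "m = m' + unit_mono i"
    using Suc.prems mono_nonzero_split by blast
  then have "P (Poly_Mapping.single m' c)"
    using Suc.hyps by (simp add: mdeg_add)
  moreover have "Poly_Mapping.single m c = Poly_Mapping.single m' c * pvar i"
    by (simp add: m pvar_def mult_single)
  moreover have "Poly_Mapping.single m' c \<in> polys N"
    using m by (auto simp: polys_def)
  ultimately show ?case
    using mult var m pvar_in_polys by metis
qed

lemma polys_induct [consumes 1, case_names const var add mult]:
  assumes "p \<in> polys N"
    and const: "\<And>c. P (pconst c)"
    and var: "\<And>i. i < N \<Longrightarrow> P (pvar i)"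
    and add: "\<And>p q. p \<in> polys N \<Longrightarrow> q \<in> polys N \<Longrightarrow> P p \<Longrightarrow> P q \<Longrightarrow> P (p + q)"
    and mult: "\<And>p q. p \<in> polys N \<Longrightarrow> q \<in> polys N \<Longrightarrow> P p \<Longrightarrow> P q \<Longrightarrow> P (p * q)"
  shows "P p"
proof -
  let ?s = "\<lambda>m. Poly_Mapping.single m (lk p m)"
  have "P (sum ?s S)" if "finite S" "S \<subseteq> Poly_Mapping.keys p" for S
    using that
  proof (induction S)
    case empty
    then show ?case using const[of 0] by simp
  next
    case (insert m S)
    then have m: "m \<in> monomials N" and S: "S \<subseteq> monomials N"
      using assms(1) by (auto simp: polys_def)
    have "P (?s m)"
      using single_mono_in_closure[of m N P, OF m const var mult] by blast
    moreover have "sum ?s S \<in> polys N"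
      using S by (intro polys_sum) (auto simp: polys_def)
    moreover have "?s m \<in> polys N"
      using m by (auto simp: polys_def)
    ultimately show ?case using add insert by simp
  qed
  then show ?thesis using mpoly_eq_sum_single[of p] by (metis finite_keys order_refl)
qed

text \<open>\<open>\<Sum>\<^sub>j c\<^sub>j X\<^sub>N\<^sup>j\<close> with coefficients in the remaining variables.  Bounding \<open>j\<close> instead of speaking
  of the degree makes the arguments below, which split off the leading term, work for \<open>0\<close> as well.\<close>

definition below_degree :: "nat \<Rightarrow> nat \<Rightarrow> 'k::field mpoly set" where
  "below_degree N e = {p. \<exists>c. (\<forall>j. c j \<in> polys N) \<and> p = (\<Sum>j<e. c j * pvar N ^ j)}"

lemma below_degree_mono:
  assumes "p \<in> below_degree N e" "e \<le> e'"
  shows "p \<in> below_degree N e'"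
proof -
  obtain c where c: "\<forall>j. c j \<in> polys N" "p = (\<Sum>j<e. c j * pvar N ^ j)"
    using assms(1) by (auto simp: below_degree_def)
  let ?c = "\<lambda>j. if j < e then c j else 0"
  have "p = (\<Sum>j<e'. ?c j * pvar N ^ j)"
    unfolding c(2) using assms(2) by (intro sum.mono_neutral_cong_left) auto
  moreover have "\<forall>j. ?c j \<in> polys N"
    using c(1) by simp
  ultimately show ?thesis
    unfolding below_degree_def mem_Collect_eq by (intro exI[of _ ?c]) simp
qed

lemma below_degree_add:
  assumes "p \<in> below_degree N e" "q \<in> below_degree N e"
  shows "p + q \<in> below_degree N e"
proof -
  obtain c d where c: "\<forall>j. c j \<in> polys N" "p = (\<Sum>j<e. c j * pvar N ^ j)"
      and d: "\<forall>j. d j \<in> polys N" "q = (\<Sum>j<e. d j * pvar N ^ j)"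
    using assms by (auto simp: below_degree_def)
  have "p + q = (\<Sum>j<e. (c j + d j) * pvar N ^ j)"
    by (simp add: c d distrib_right sum.distrib)
  then show ?thesis
    using c d unfolding below_degree_def mem_Collect_eq
    by (intro exI[of _ "\<lambda>j. c j + d j"]) (simp add: polys_add)
qed

lemma below_degree_scale:
  assumes "p \<in> below_degree N e" "q \<in> polys N"
  shows "q * p \<in> below_degree N e"
proof -
  obtain c where c: "\<forall>j. c j \<in> polys N" "p = (\<Sum>j<e. c j * pvar N ^ j)"
    using assms by (auto simp: below_degree_def)
  have "q * p = (\<Sum>j<e. (q * c j) * pvar N ^ j)"
    by (simp add: c sum_distrib_left mult.assoc)
  then show ?thesis
    using c assms unfolding below_degree_def mem_Collect_eq
    by (intro exI[of _ "\<lambda>j. q * c j"]) (simp add: polys_mult)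
qed

lemma below_degree_shift:
  assumes "p \<in> below_degree N e"
  shows "p * pvar N ^ i \<in> below_degree N (e + i)"
proof -
  obtain c where c: "\<forall>j. c j \<in> polys N" "p = (\<Sum>j<e. c j * pvar N ^ j)"
    using assms by (auto simp: below_degree_def)
  let ?c = "\<lambda>j. if i \<le> j then c (j - i) else 0"
  have "p * pvar N ^ i = (\<Sum>j<e. c j * pvar N ^ (j + i))"
    by (simp add: c sum_distrib_right mult.assoc power_add)
  also have "\<dots> = (\<Sum>j\<in>{i..<e+i}. c (j - i) * pvar N ^ j)"
    by (rule sum.reindex_bij_witness[of _ "\<lambda>j. j - i" "\<lambda>j. j + i"]) auto
  also have "\<dots> = (\<Sum>j<e+i. ?c j * pvar N ^ j)"
    by (intro sum.mono_neutral_cong_left) auto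
  finally show ?thesis
    using c unfolding below_degree_def mem_Collect_eq by (intro exI[of _ ?c]) simp
qed

lemma below_degree_Suc:
  "p \<in> below_degree N (Suc e) \<longleftrightarrow> (\<exists>c q. c \<in> polys N \<and> q \<in> below_degree N e \<and> p = q + c * pvar N ^ e)"
proof
  assume "p \<in> below_degree N (Suc e)"
  then obtain c where "\<forall>j. c j \<in> polys N" "p = (\<Sum>j<Suc e. c j * pvar N ^ j)"
    by (auto simp: below_degree_def)
  then show "\<exists>c q. c \<in> polys N \<and> q \<in> below_degree N e \<and> p = q + c * pvar N ^ e"
    by (intro exI[of _ "c e"] exI[of _ "\<Sum>j<e. c j * pvar N ^ j"]) (auto simp: below_degree_def)
next
  assume "\<exists>c q. c \<in> polys N \<and> q \<in> below_degree N e \<and> p = q + c * pvar N ^ e"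
  then obtain c d where c: "c \<in> polys N" "\<forall>j. d j \<in> polys N"
      "p = (\<Sum>j<e. d j * pvar N ^ j) + c * pvar N ^ e"
    by (auto simp: below_degree_def)
  then show "p \<in> below_degree N (Suc e)"
    unfolding below_degree_def mem_Collect_eq
    by (intro exI[of _ "\<lambda>j. if j = e then c else d j"]) (auto intro!: sum.cong)
qed

lemma below_degree_0 [simp]: "p \<in> below_degree N 0 \<longleftrightarrow> p = 0"
  by (auto simp: below_degree_def intro: exI[of _ "\<lambda>_. 0"])

lemma below_degree_in_polys: "p \<in> below_degree N e \<Longrightarrow> p \<in> polys (Suc N)"
  by (auto simp: below_degree_def intro!: polys_sum polys_mult polys_power pvar_in_polys
      intro: polys_mono)

lemma polys_Suc_below_degree:
  assumes "p \<in> polys (Suc N)"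
  shows "\<exists>e. p \<in> below_degree N e"
  using assms
proof (induction rule: polys_induct)
  case (const c)
  have "pconst c \<in> below_degree N 1"
    by (auto simp: below_degree_def intro!: exI[of _ "\<lambda>_. pconst c"])
  then show ?case ..
next
  case (var i)
  show ?case
  proof (cases "i = N")
    case True
    have "1 * pvar N ^ 1 \<in> below_degree N (1 + 1)"
      by (rule below_degree_shift) (auto simp: below_degree_def one_in_polys intro!: exI[of _ "\<lambda>_. 1"])
    then show ?thesis using True by auto
  next
    case False
    then have "pvar i \<in> below_degree N 1"
      using var by (auto simp: below_degree_def pvar_in_polys intro!: exI[of _ "\<lambda>_. pvar i"])
    then show ?thesis ..
  qed
next
  case (add p q)
  then obtain e e' where "p \<in> below_degree N e" "q \<in> below_degree N e'"
    by blast
  then have "p + q \<in> below_degree N (max e e')"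
    by (intro below_degree_add) (auto elim: below_degree_mono)
  then show ?case ..
next
  case (mult p q)
  then obtain e e' where e: "p \<in> below_degree N e" "q \<in> below_degree N e'"
    by blast
  obtain c where c: "\<forall>j. c j \<in> polys N" "p = (\<Sum>j<e. c j * pvar N ^ j)"
    using e by (auto simp: below_degree_def)
  have sums: "(\<Sum>j\<in>S. f j) \<in> below_degree N d" if "finite S" "\<And>j. j \<in> S \<Longrightarrow> f j \<in> below_degree N d"
    for S and f :: "nat \<Rightarrow> 'a mpoly" and d
    using that
  proof (induction S)
    case empty
    then show ?case using below_degree_mono[of 0 N 0 d] by simp
  qed (auto intro: below_degree_add)
  have "p * q = (\<Sum>j<e. c j * (q * pvar N ^ j))"
    unfolding c(2) sum_distrib_right by (intro sum.cong refl) (simp add: mult_ac)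
  also have "\<dots> \<in> below_degree N (e' + e)"
    using c(1) by (intro sums below_degree_scale[OF below_degree_mono[OF below_degree_shift[OF e(2)]]]) auto
  finally show ?case ..
qed

lemma ppartial_power_var: "ppartial N (pvar N ^ Suc e :: 'k::field mpoly) = of_nat (Suc e) * pvar N ^ e"
proof (induction e)
  case (Suc e)
  have "ppartial N (pvar N ^ Suc (Suc e) :: 'k mpoly) = ppartial N (pvar N * pvar N ^ Suc e)"
    by simp
  then show ?case
    unfolding ppartial_mult Suc by (simp add: ppartial_var algebra_simps)
qed (simp add: ppartial_var)

lemma ppartial_below_degree:
  assumes "p \<in> below_degree N (Suc e)"
  shows "ppartial N p \<in> below_degree N e"
  using assms
proof (induction e arbitrary: p)
  case 0
  then show ?case
    by (auto simp: below_degree_Suc ppartial_add ppartial_mult ppartial_eq_0)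
next
  case (Suc e)
  obtain c q where c: "c \<in> polys N" "q \<in> below_degree N (Suc e)" "p = q + c * pvar N ^ Suc e"
    using Suc.prems below_degree_Suc[of p N "Suc e"] by blast
  have "ppartial N p = ppartial N q + (of_nat (Suc e) * c) * pvar N ^ e"
    using c by (simp only: c ppartial_add ppartial_mult ppartial_power_var ppartial_eq_0[OF c(1) order_refl])
      (simp add: algebra_simps)
  moreover have "ppartial N q \<in> below_degree N (Suc e)"
    using Suc.IH[OF c(2)] by (rule below_degree_mono) simp
  moreover have "of_nat (Suc e) * c \<in> polys N"
  proof -
    have "(of_nat k :: 'a mpoly) \<in> polys N" for k
      by (induction k) (auto simp: polys_add one_in_polys)
    then show ?thesis using c by (intro polys_mult)
  qed
  ultimately show ?case
    using Suc.IH[OF c(2)] unfolding below_degree_Suc by blast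
qed

lemma ppartial_leading_term:
  assumes "c \<in> polys N"
  shows "ppartial N (c * pvar N ^ Suc e) = of_nat (Suc e) * c * pvar N ^ e"
  unfolding ppartial_mult ppartial_eq_0[OF assms order_refl] ppartial_power_var by (simp add: mult_ac)

definition dir_deriv :: "nat \<Rightarrow> 'k::field mpoly \<Rightarrow> (nat \<Rightarrow> 'k) \<Rightarrow> (nat \<Rightarrow> 'k) \<Rightarrow> 'k" where
  "dir_deriv s p a v = (\<Sum>i<s. peval (ppartial i p) a * v i)"

lemma dir_deriv_add: "dir_deriv s (p + q) a v = dir_deriv s p a v + dir_deriv s q a v"
  by (simp add: dir_deriv_def ppartial_add peval_add distrib_right sum.distrib)

lemma dir_deriv_diff: "dir_deriv s (p - q) a v = dir_deriv s p a v - dir_deriv s q a v"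
  by (simp add: dir_deriv_def ppartial_diff peval_diff left_diff_distrib sum_subtractf)

lemma dir_deriv_mult: "dir_deriv s (p * q) a v = peval p a * dir_deriv s q a v + peval q a * dir_deriv s p a v"
  by (simp add: dir_deriv_def ppartial_mult peval_add peval_mult distrib_right sum.distrib
      sum_distrib_left mult.assoc)

lemma dir_deriv_const [simp]: "dir_deriv s (pconst c) a v = 0"
  by (simp add: dir_deriv_def)

lemma dir_deriv_zero [simp]: "dir_deriv s 0 a v = 0"
  by (simp add: dir_deriv_def)

lemma dir_deriv_var: "i < s \<Longrightarrow> dir_deriv s (pvar i) a v = v i"
proof -
  assume "i < s"
  have "dir_deriv s (pvar i) a v = (\<Sum>j<s. if j = i then v j else 0)"
    unfolding dir_deriv_def ppartial_var by (intro sum.cong) auto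
  then show ?thesis using \<open>i < s\<close> by simp
qed

lemma dir_deriv_scale: "dir_deriv s p a (\<lambda>i. c * v i) = c * dir_deriv s p a v"
  by (simp add: dir_deriv_def sum_distrib_left mult_ac)

lemma dir_deriv_cong:
  assumes "p \<in> polys s" "\<And>i. i < s \<Longrightarrow> a i = b i" "\<And>i. i < s \<Longrightarrow> v i = w i"
  shows "dir_deriv s p a v = dir_deriv s p b w"
  unfolding dir_deriv_def using assms peval_cong[OF ppartial_in_polys[OF assms(1)], of a b]
  by (intro sum.cong) auto

lemma dir_deriv_larger:
  assumes "p \<in> polys s" "s \<le> t"
  shows "dir_deriv t p a v = dir_deriv s p a v"
  unfolding dir_deriv_def using assms by (intro sum.mono_neutral_right) (auto simp: ppartial_eq_0)

definition degree_le :: "nat \<Rightarrow> 'k::field mpoly \<Rightarrow> bool" where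
  "degree_le d p \<longleftrightarrow> (\<forall>m\<in>Poly_Mapping.keys p. mdeg m \<le> d)"

lemma degree_le_ppartial:
  assumes "degree_le (Suc d) p"
  shows "degree_le d (ppartial i p)"
  unfolding degree_le_def
proof
  fix m assume "m \<in> Poly_Mapping.keys (ppartial i p)"
  then have "m + unit_mono i \<in> Poly_Mapping.keys p"
    by (auto simp: in_keys_iff lookup_ppartial)
  then show "mdeg m \<le> d"
    using assms by (auto simp: degree_le_def mdeg_add dest!: bspec)
qed

lemma degree_le_exists: "\<exists>d. degree_le d p"
proof (cases "Poly_Mapping.keys p = {}")
  case False
  then show ?thesis
    unfolding degree_le_def by (intro exI[of _ "Max (mdeg ` Poly_Mapping.keys p)"]) simp
qed (simp add: degree_le_def)

lemma ppartial_eq_0_imp_const: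
  fixes p :: "'k::field_char_0 mpoly"
  assumes "p \<in> polys N" "\<And>i. i < N \<Longrightarrow> ppartial i p = 0"
  shows "p = pconst (lk p 0)"
proof (rule poly_mapping_eqI)
  fix m
  show "lk p m = lk (pconst (lk p 0)) m"
  proof (cases "m = 0")
    case False
    have "lk p m = 0"
    proof (rule ccontr)
      assume nz: "lk p m \<noteq> 0"
      then have "m \<in> monomials N"
        using assms(1) by (simp add: polys_iff)
      then obtain i m' where "i < N" "m = m' + unit_mono i"
        using False by (rule mono_nonzero_split)
      then show False
        using assms(2)[of i] nz lookup_ppartial[of i p m'] by (auto simp del: of_nat_Suc)
    qed
    then show ?thesis using False by (simp add: pconst_def lookup_single)
  qed (simp add: pconst_def)
qed

section \<open>Irreducible spaces with functions, derivations and vector fields\<close>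

text \<open>The local theory uses only the following properties of the regular functions on an
  irreducible variety.\<close>

locale function_space =
  fixes T :: "'p topology" and A :: "'p set \<Rightarrow> ('p \<Rightarrow> 'k::field_char_0) set"
  assumes functions_extensional: "openin T U \<Longrightarrow> f \<in> A U \<Longrightarrow> f \<in> extensional U"
    and functions_const: "openin T U \<Longrightarrow> restrict (\<lambda>_. c) U \<in> A U"
    and functions_add: "openin T U \<Longrightarrow> f \<in> A U \<Longrightarrow> g \<in> A U \<Longrightarrow> restrict (\<lambda>P. f P + g P) U \<in> A U"
    and functions_mult: "openin T U \<Longrightarrow> f \<in> A U \<Longrightarrow> g \<in> A U \<Longrightarrow> restrict (\<lambda>P. f P * g P) U \<in> A U"
    and functions_inverse: "openin T U \<Longrightarrow> f \<in> A U \<Longrightarrow> \<forall>P\<in>U. f P \<noteq> 0 \<Longrightarrow>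
      restrict (\<lambda>P. inverse (f P)) U \<in> A U"
    and functions_restrict: "openin T U \<Longrightarrow> openin T V \<Longrightarrow> V \<subseteq> U \<Longrightarrow> f \<in> A U \<Longrightarrow> restrict f V \<in> A V"
    and functions_local: "openin T U \<Longrightarrow> f \<in> extensional U \<Longrightarrow>
      \<forall>P\<in>U. \<exists>V. openin T V \<and> P \<in> V \<and> V \<subseteq> U \<and> restrict f V \<in> A V \<Longrightarrow> f \<in> A U"
    and functions_nonzero_open: "openin T U \<Longrightarrow> f \<in> A U \<Longrightarrow> openin T {P \<in> U. f P \<noteq> 0}"
    and opens_meet: "openin T U \<Longrightarrow> openin T V \<Longrightarrow> U \<noteq> {} \<Longrightarrow> V \<noteq> {} \<Longrightarrow> U \<inter> V \<noteq> {}"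
begin

abbreviation R :: "'p set \<Rightarrow> ('p \<Rightarrow> 'k) ring" where
  "R \<equiv> \<lambda>U. fun_ring U (A U)"

text \<open>Regularity on \<open>U\<close> as a property of total functions lets the operations be pointwise.\<close>

definition reg :: "'p set \<Rightarrow> ('p \<Rightarrow> 'k) \<Rightarrow> bool" where
  "reg U f \<longleftrightarrow> openin T U \<and> restrict f U \<in> A U"

lemma reg_open: "reg U f \<Longrightarrow> openin T U"
  by (simp add: reg_def)

lemma reg_iff_functions: "f \<in> extensional U \<Longrightarrow> reg U f \<longleftrightarrow> openin T U \<and> f \<in> A U"
  by (simp add: reg_def extensional_restrict)

lemma reg_of_functions: "openin T U \<Longrightarrow> f \<in> A U \<Longrightarrow> reg U f"
  using functions_extensional reg_iff_functions by blast

lemma reg_cong: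
  assumes "\<And>P. P \<in> U \<Longrightarrow> f P = g P"
  shows "reg U f \<longleftrightarrow> reg U g"
proof -
  have "restrict f U = restrict g U" using assms by (auto simp: restrict_def)
  then show ?thesis by (simp add: reg_def)
qed

lemma reg_const: "openin T U \<Longrightarrow> reg U (\<lambda>_. c)"
  by (simp add: reg_def functions_const)

lemma reg_add: "reg U f \<Longrightarrow> reg U g \<Longrightarrow> reg U (\<lambda>P. f P + g P)"
proof -
  assume fg: "reg U f" "reg U g"
  have "restrict (\<lambda>P. restrict f U P + restrict g U P) U = restrict (\<lambda>P. f P + g P) U"
    by (auto simp: restrict_def)
  then show ?thesis
    using functions_add[of U "restrict f U" "restrict g U"] fg by (simp add: reg_def)
qed

lemma reg_mult: "reg U f \<Longrightarrow> reg U g \<Longrightarrow> reg U (\<lambda>P. f P * g P)"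
proof -
  assume fg: "reg U f" "reg U g"
  have "restrict (\<lambda>P. restrict f U P * restrict g U P) U = restrict (\<lambda>P. f P * g P) U"
    by (auto simp: restrict_def)
  then show ?thesis
    using functions_mult[of U "restrict f U" "restrict g U"] fg by (simp add: reg_def)
qed

lemma reg_inverse: "reg U f \<Longrightarrow> (\<And>P. P \<in> U \<Longrightarrow> f P \<noteq> 0) \<Longrightarrow> reg U (\<lambda>P. inverse (f P))"
proof -
  assume f: "reg U f" "\<And>P. P \<in> U \<Longrightarrow> f P \<noteq> 0"
  have "restrict (\<lambda>P. inverse (restrict f U P)) U = restrict (\<lambda>P. inverse (f P)) U"
    by (auto simp: restrict_def)
  then show ?thesis
    using functions_inverse[of U "restrict f U"] f by (simp add: reg_def)
qed

lemma reg_uminus: "reg U f \<Longrightarrow> reg U (\<lambda>P. - f P)"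
  using reg_mult[OF reg_const[of U "-1"], of f] reg_open[of U f] by simp

lemma reg_diff: "reg U f \<Longrightarrow> reg U g \<Longrightarrow> reg U (\<lambda>P. f P - g P)"
  using reg_add[of U f "\<lambda>P. - g P"] reg_uminus[of U g] by simp

lemma reg_divide: "reg U f \<Longrightarrow> reg U g \<Longrightarrow> (\<And>P. P \<in> U \<Longrightarrow> g P \<noteq> 0) \<Longrightarrow> reg U (\<lambda>P. f P / g P)"
  using reg_mult[of U f "\<lambda>P. inverse (g P)"] reg_inverse[of U g] by (simp add: divide_inverse)

lemma reg_sum: "openin T U \<Longrightarrow> (\<And>i. i \<in> I \<Longrightarrow> reg U (f i)) \<Longrightarrow> reg U (\<lambda>P. \<Sum>i\<in>I. f i P)"
  by (induction I rule: infinite_finite_induct) (auto simp: reg_const reg_add)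

lemma reg_prod: "openin T U \<Longrightarrow> (\<And>i. i \<in> I \<Longrightarrow> reg U (f i)) \<Longrightarrow> reg U (\<lambda>P. \<Prod>i\<in>I. f i P)"
  by (induction I rule: infinite_finite_induct) (auto simp: reg_const reg_mult)

lemma reg_power: "reg U f \<Longrightarrow> reg U (\<lambda>P. f P ^ e)"
  by (induction e) (auto simp: reg_const reg_open reg_mult)

lemma reg_subset: "reg U f \<Longrightarrow> openin T V \<Longrightarrow> V \<subseteq> U \<Longrightarrow> reg V f"
  using functions_restrict[of U V "restrict f U"] by (simp add: reg_def restrict_restrict inf.absorb2)

lemma reg_local:
  assumes "openin T U" "\<And>P. P \<in> U \<Longrightarrow> \<exists>V. P \<in> V \<and> V \<subseteq> U \<and> reg V f"
  shows "reg U f"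
proof -
  have "\<exists>V. openin T V \<and> P \<in> V \<and> V \<subseteq> U \<and> restrict (restrict f U) V \<in> A V" if "P \<in> U" for P
  proof -
    obtain V where "P \<in> V" "V \<subseteq> U" "reg V f" using assms(2)[of P] \<open>P \<in> U\<close> by blast
    then show ?thesis
      by (intro exI[of _ V]) (simp add: reg_def restrict_restrict inf.absorb2)
  qed
  then show ?thesis
    using assms(1) functions_local[of U "restrict f U"] by (simp add: reg_def)
qed

lemma reg_peval:
  assumes "openin T U" "p \<in> polys s" "\<And>i. i < s \<Longrightarrow> reg U (b i)"
  shows "reg U (\<lambda>P. peval p (\<lambda>i. b i P))"
  using assms(2)
  by (induction rule: polys_induct) (auto simp: peval_add peval_mult assms reg_const reg_add reg_mult)

lemma reg_dir_deriv:
  assumes "openin T U" "p \<in> polys s" "\<And>i. i < s \<Longrightarrow> reg U (b i)" "\<And>i. i < s \<Longrightarrow> reg U (v i)"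
  shows "reg U (\<lambda>P. dir_deriv s p (\<lambda>i. b i P) (\<lambda>i. v i P))"
  unfolding dir_deriv_def
  by (intro reg_sum reg_mult reg_peval[OF _ ppartial_in_polys]) (use assms in auto)

lemma reg_nonzero_open: "reg U f \<Longrightarrow> openin T {P \<in> U. f P \<noteq> 0}"
  using functions_nonzero_open[of U "restrict f U"] by (auto simp: reg_def cong: conj_cong)

lemma reg_eq_0_dense:
  assumes "reg U f" "openin T V" "V \<noteq> {}" "V \<subseteq> U" "\<And>P. P \<in> V \<Longrightarrow> f P = 0" "P \<in> U"
  shows "f P = 0"
  using opens_meet[OF reg_nonzero_open[OF assms(1)] assms(2)] assms(3-) by fast

lemma reg_eq_dense:
  assumes "reg U f" "reg U g" "openin T V" "V \<noteq> {}" "V \<subseteq> U" "\<And>P. P \<in> V \<Longrightarrow> f P = g P" "P \<in> U"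
  shows "f P = g P"
  using reg_eq_0_dense[OF reg_diff[OF assms(1,2)] assms(3-5)] assms(6,7) by simp

text \<open>If \<open>g\<close> had a nonzero value too, the nonvanishing loci of \<open>f\<close> and \<open>g\<close> would be disjoint nonempty open sets
  of an irreducible space.\<close>

lemma reg_cancel:
  assumes "reg U f" "reg U g" "Q \<in> U" "f Q \<noteq> 0" "\<And>P. P \<in> U \<Longrightarrow> f P * g P = 0" "P \<in> U"
  shows "g P = 0"
  by (rule reg_eq_0_dense[OF assms(2) reg_nonzero_open[OF assms(1)]]) (use assms in auto)

subsection \<open>Derivations\<close>

definition derives :: "'p set \<Rightarrow> (('p \<Rightarrow> 'k) \<Rightarrow> 'p \<Rightarrow> 'k) \<Rightarrow> bool" where
  "derives W D \<longleftrightarrow> openin T W \<and> (\<forall>f. reg W f \<longrightarrow> reg W (D f)) \<and>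
     (\<forall>f g. reg W f \<and> reg W g \<longrightarrow> (\<forall>P\<in>W. D (\<lambda>Q. f Q + g Q) P = D f P + D g P)) \<and>
     (\<forall>f g. reg W f \<and> reg W g \<longrightarrow> (\<forall>P\<in>W. D (\<lambda>Q. f Q * g Q) P = f P * D g P + g P * D f P)) \<and>
     (\<forall>c. \<forall>P\<in>W. D (\<lambda>_. c) P = 0) \<and>
     (\<forall>f g. reg W f \<and> reg W g \<and> (\<forall>P\<in>W. f P = g P) \<longrightarrow> (\<forall>P\<in>W. D f P = D g P))"

text \<open>A derivation of the sheaf of regular functions on \<open>W\<close>.\<close>

definition vfield :: "'p set \<Rightarrow> (('p \<Rightarrow> 'k) \<Rightarrow> 'p \<Rightarrow> 'k) \<Rightarrow> bool" where
  "vfield W D \<longleftrightarrow> openin T W \<and> (\<forall>V. openin T V \<and> V \<subseteq> W \<longrightarrow> derives V D)"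

lemma vfield_open: "vfield W D \<Longrightarrow> openin T W"
  by (simp add: vfield_def)

lemma vfield_derives: "vfield W D \<Longrightarrow> openin T V \<Longrightarrow> V \<subseteq> W \<Longrightarrow> derives V D"
  by (simp add: vfield_def)

lemma vfield_subset: "vfield W D \<Longrightarrow> openin T V \<Longrightarrow> V \<subseteq> W \<Longrightarrow> vfield V D"
  by (auto simp: vfield_def)

lemma derives_open: "derives W D \<Longrightarrow> openin T W"
  by (simp add: derives_def)

lemma derives_reg: "derives W D \<Longrightarrow> reg W f \<Longrightarrow> reg W (D f)"
  by (simp add: derives_def)

lemma derives_add:
  "derives W D \<Longrightarrow> reg W f \<Longrightarrow> reg W g \<Longrightarrow> P \<in> W \<Longrightarrow> D (\<lambda>Q. f Q + g Q) P = D f P + D g P"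
  unfolding derives_def by blast

lemma derives_mult:
  "derives W D \<Longrightarrow> reg W f \<Longrightarrow> reg W g \<Longrightarrow> P \<in> W \<Longrightarrow>
     D (\<lambda>Q. f Q * g Q) P = f P * D g P + g P * D f P"
  unfolding derives_def by blast

lemma derives_const: "derives W D \<Longrightarrow> P \<in> W \<Longrightarrow> D (\<lambda>_. c) P = 0"
  unfolding derives_def by blast

lemma derives_cong:
  "derives W D \<Longrightarrow> reg W f \<Longrightarrow> (\<And>P. P \<in> W \<Longrightarrow> f P = g P) \<Longrightarrow> P \<in> W \<Longrightarrow> D f P = D g P"
proof -
  assume a: "derives W D" "reg W f" "\<And>P. P \<in> W \<Longrightarrow> f P = g P" "P \<in> W"
  then have "reg W g" using reg_cong[of W f g] by simp
  moreover have "\<forall>f g. reg W f \<and> reg W g \<and> (\<forall>P\<in>W. f P = g P) \<longrightarrow> (\<forall>P\<in>W. D f P = D g P)"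
    using a(1) by (simp add: derives_def)
  ultimately show ?thesis using a(2-4) by simp
qed

lemma derives_scale:
  "derives W D \<Longrightarrow> reg W f \<Longrightarrow> P \<in> W \<Longrightarrow> D (\<lambda>Q. c * f Q) P = c * D f P"
  using derives_mult[of W D "\<lambda>_. c" f P] by (simp add: derives_const reg_const derives_open)

lemma derives_uminus:
  "derives W D \<Longrightarrow> reg W f \<Longrightarrow> P \<in> W \<Longrightarrow> D (\<lambda>Q. - f Q) P = - D f P"
  using derives_scale[of W D f P "-1"] by simp

lemma derives_diff:
  "derives W D \<Longrightarrow> reg W f \<Longrightarrow> reg W g \<Longrightarrow> P \<in> W \<Longrightarrow> D (\<lambda>Q. f Q - g Q) P = D f P - D g P"
  using derives_add[of W D f "\<lambda>Q. - g Q" P] by (simp add: derives_uminus reg_uminus)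

lemma derives_sum:
  assumes "derives W D" "\<And>i. i \<in> I \<Longrightarrow> reg W (f i)" "P \<in> W"
  shows "D (\<lambda>Q. \<Sum>i\<in>I. f i Q) P = (\<Sum>i\<in>I. D (f i) P)"
  using assms(2)
proof (induction I rule: infinite_finite_induct)
  case (insert i I)
  have "D (\<lambda>Q. f i Q + (\<Sum>i\<in>I. f i Q)) P = D (f i) P + D (\<lambda>Q. \<Sum>i\<in>I. f i Q) P"
    using insert by (intro derives_add[OF assms(1) _ reg_sum[OF derives_open[OF assms(1)]] assms(3)]) auto
  then show ?case using insert by simp
qed (auto simp: derives_const[OF assms(1,3)])

lemma derives_peval:
  assumes "derives W D" "p \<in> polys s" "\<And>i. i < s \<Longrightarrow> reg W (a i)" "P \<in> W"
  shows "D (\<lambda>Q. peval p (\<lambda>i. a i Q)) P = dir_deriv s p (\<lambda>i. a i P) (\<lambda>i. D (a i) P)"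
  using assms(2)
proof (induction rule: polys_induct)
  case (const c)
  then show ?case using assms by (simp add: derives_const)
next
  case (var i)
  then show ?case by (simp add: dir_deriv_var)
next
  case (add p q)
  then show ?case
    using derives_add[OF assms(1) reg_peval reg_peval assms(4), of p s a q s a] assms
    by (simp add: peval_add dir_deriv_add derives_open)
next
  case (mult p q)
  then show ?case
    using derives_mult[OF assms(1) reg_peval reg_peval assms(4), of p s a q s a] assms
    by (simp add: peval_mult dir_deriv_mult derives_open)
qed

lemma derives_of_derivation_on:
  assumes "derivation_on R W D" "openin T W"
  shows "derives W (\<lambda>f. D (restrict f W))"
proof -
  have D: "\<And>f. f \<in> A W \<Longrightarrow> D f \<in> A W"
    and add: "\<And>f g. f \<in> A W \<Longrightarrow> g \<in> A W \<Longrightarrow> D (\<lambda>P\<in>W. f P + g P) = (\<lambda>P\<in>W. D f P + D g P)"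
    and scale: "\<And>c f. f \<in> A W \<Longrightarrow> D (\<lambda>P\<in>W. c * f P) = (\<lambda>P\<in>W. c * D f P)"
    and mult: "\<And>f g. f \<in> A W \<Longrightarrow> g \<in> A W \<Longrightarrow>
        D (\<lambda>P\<in>W. f P * g P) = (\<lambda>P\<in>W. (\<lambda>P\<in>W. f P * D g P) P + (\<lambda>P\<in>W. g P * D f P) P)"
    using assms(1) by (auto simp: derivation_on_def fun_ring_def)
  have r: "restrict f W \<in> A W" if "reg W f" for f
    using that by (simp add: reg_def)
  have eq: "restrict (\<lambda>Q. F (f Q) (g Q)) W = restrict (\<lambda>Q. F (restrict f W Q) (restrict g W Q)) W"
    for f g :: "'p \<Rightarrow> 'k" and F :: "'k \<Rightarrow> 'k \<Rightarrow> 'k"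
    by (auto simp: restrict_def)
  have one: "D (restrict (\<lambda>_. 1) W) P = 0" if "P \<in> W" for P
  proof -
    have "D (\<lambda>P\<in>W. restrict (\<lambda>_. 1) W P * restrict (\<lambda>_. 1) W P) P
        = D (restrict (\<lambda>_. 1) W) P + D (restrict (\<lambda>_. 1) W) P"
      by (subst mult) (use r reg_const assms(2) that in auto)
    moreover have "(\<lambda>P\<in>W. restrict (\<lambda>_. 1) W P * restrict (\<lambda>_. 1) W P) = restrict (\<lambda>_. 1 :: 'k) W"
      by (auto simp: restrict_def)
    ultimately show ?thesis by simp
  qed
  have const: "D (restrict (\<lambda>_. c) W) P = 0" if "P \<in> W" for P c
  proof -
    have "(\<lambda>P\<in>W. c * restrict (\<lambda>_. 1) W P) = restrict (\<lambda>_. c) W"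
      by (auto simp: restrict_def)
    then show ?thesis
      using scale[OF r[OF reg_const[OF assms(2)]], of c 1] one that by simp
  qed
  have cong: "restrict f W = restrict g W" if "\<forall>P\<in>W. f P = g P" for f g :: "'p \<Rightarrow> 'k"
    using that by (auto simp: restrict_def)
  show ?thesis
    unfolding derives_def
  proof (intro conjI allI impI ballI assms(2))
    show "reg W (D (restrict f W))" if "reg W f" for f
      by (intro reg_of_functions assms(2) D r that)
    fix f g P assume "reg W f \<and> reg W g" "P \<in> W"
    then show "D (restrict (\<lambda>Q. f Q + g Q) W) P = D (restrict f W) P + D (restrict g W) P"
      unfolding eq[of "(+)" f g] by (subst add) (auto simp: r)
    show "D (restrict (\<lambda>Q. f Q * g Q) W) P = f P * D (restrict g W) P + g P * D (restrict f W) P"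
      using \<open>reg W f \<and> reg W g\<close> \<open>P \<in> W\<close>
      unfolding eq[of "(*)" f g] by (subst mult) (auto simp: r)
  next
    fix f g P assume fg: "reg W f \<and> reg W g \<and> (\<forall>P\<in>W. f P = g P)" "P \<in> W"
    then have "restrict f W = restrict g W" by (intro cong) blast
    then show "D (restrict f W) P = D (restrict g W) P" by (rule arg_cong)
  qed (use const in auto)
qed

lemma derivation_on_of_derives:
  assumes "derives W D"
  shows "derivation_on R W (\<lambda>f\<in>A W. restrict (D f) W)"
proof -
  note W = derives_open[OF assms]
  have r: "reg W f" if "f \<in> A W" for f
    using that W by (rule reg_of_functions[rotated])
  have rA: "restrict f W \<in> A W" if "reg W f" for f
    using that by (simp add: reg_def)
  have res: "D (restrict f W) P = D f P" if "reg W f" "P \<in> W" for f P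
    using derives_cong[OF assms that(1), of "restrict f W"] that(2) by simp
  have rD: "restrict (D f) W \<in> A W" if "f \<in> A W" for f
    using rA[OF derives_reg[OF assms r[OF that]]] .
  show ?thesis
    unfolding derivation_on_def fun_ring_def ring.simps partial_object.simps monoid.simps
  proof (intro conjI ballI allI)
    show "(\<lambda>f\<in>A W. restrict (D f) W) \<in> A W \<rightarrow>\<^sub>E A W"
      using rD by auto
    fix f assume f: "f \<in> A W"
    show "(\<lambda>f\<in>A W. restrict (D f) W) (\<lambda>P\<in>W. c * f P) = (\<lambda>P\<in>W. c * (\<lambda>f\<in>A W. restrict (D f) W) f P)" for c
    proof -
      have "reg W (\<lambda>P. c * f P)" using reg_mult[OF reg_const[OF W] r[OF f]] .
      then show ?thesis
        using f rA by (auto intro!: restrict_ext simp: res derives_scale[OF assms r[OF f]])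
    qed
    fix g assume g: "g \<in> A W"
    have "reg W (\<lambda>P. f P + g P)" "reg W (\<lambda>P. f P * g P)"
      using reg_add reg_mult r f g by blast+
    then show "(\<lambda>f\<in>A W. restrict (D f) W) (\<lambda>P\<in>W. f P + g P)
          = (\<lambda>P\<in>W. (\<lambda>f\<in>A W. restrict (D f) W) f P + (\<lambda>f\<in>A W. restrict (D f) W) g P)"
      and "(\<lambda>f\<in>A W. restrict (D f) W) (\<lambda>P\<in>W. f P * g P)
          = (\<lambda>P\<in>W. (\<lambda>P\<in>W. f P * (\<lambda>f\<in>A W. restrict (D f) W) g P) P
               + (\<lambda>P\<in>W. g P * (\<lambda>f\<in>A W. restrict (D f) W) f P) P)"
      using f g rA by (auto intro!: restrict_ext simp: res derives_add[OF assms r[OF f] r[OF g]]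
          derives_mult[OF assms r[OF f] r[OF g]])
  qed
qed

lemma vfield_combination:
  assumes W: "openin T W" and D: "\<And>i. i \<in> I \<Longrightarrow> vfield W (D i)" and c: "\<And>i. i \<in> I \<Longrightarrow> reg W (c i)"
  shows "vfield W (\<lambda>f P. \<Sum>i\<in>I. c i P * D i f P)"
  unfolding vfield_def
proof (intro conjI allI impI W)
  fix V assume V: "openin T V \<and> V \<subseteq> W"
  have d: "derives V (D i)" if "i \<in> I" for i
    using D that V vfield_derives by blast
  show "derives V (\<lambda>f P. \<Sum>i\<in>I. c i P * D i f P)"
    unfolding derives_def
  proof (intro conjI allI impI ballI)
    show "reg V (\<lambda>P. \<Sum>i\<in>I. c i P * D i f P)" if "reg V f" for f
      using V by (intro reg_sum reg_mult[OF reg_subset[OF c] derives_reg[OF d that]]) auto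
    fix f g P assume fg: "reg V f \<and> reg V g" "P \<in> V"
    have "D i (\<lambda>Q. f Q + g Q) P = D i f P + D i g P" if "i \<in> I" for i
      by (rule derives_add[OF d[OF that]]) (use fg in auto)
    then show "(\<Sum>i\<in>I. c i P * D i (\<lambda>Q. f Q + g Q) P) = (\<Sum>i\<in>I. c i P * D i f P) + (\<Sum>i\<in>I. c i P * D i g P)"
      by (simp add: distrib_left sum.distrib)
    have "D i (\<lambda>Q. f Q * g Q) P = f P * D i g P + g P * D i f P" if "i \<in> I" for i
      by (rule derives_mult[OF d[OF that]]) (use fg in auto)
    then show "(\<Sum>i\<in>I. c i P * D i (\<lambda>Q. f Q * g Q) P)
        = f P * (\<Sum>i\<in>I. c i P * D i g P) + g P * (\<Sum>i\<in>I. c i P * D i f P)"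
      by (simp add: distrib_left sum.distrib sum_distrib_left mult_ac)
  next
    fix f g P assume fg: "reg V f \<and> reg V g \<and> (\<forall>P\<in>V. f P = g P)" "P \<in> V"
    show "(\<Sum>i\<in>I. c i P * D i f P) = (\<Sum>i\<in>I. c i P * D i g P)"
    proof (intro sum.cong refl arg_cong2[of _ _ _ _ "(*)"])
      fix i assume "i \<in> I"
      show "D i f P = D i g P"
        by (rule derives_cong[OF d[OF \<open>i \<in> I\<close>]]) (use fg in auto)
    qed
  qed (use V in \<open>auto simp: derives_const[OF d] intro!: sum.neutral\<close>)
qed

text \<open>The commutator serves to show that the partial derivatives of a chart commute: it is a derivation that
  kills the coordinates.\<close>

lemma vfield_commutator:
  assumes D: "vfield W D" and E: "vfield W E"
  shows "vfield W (\<lambda>f P. D (E f) P - E (D f) P)"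
  unfolding vfield_def
proof (intro conjI allI impI vfield_open[OF D])
  fix V assume V: "openin T V \<and> V \<subseteq> W"
  have d: "derives V D" "derives V E"
    using D E V vfield_derives by blast+
  have add: "D (E (\<lambda>Q. f Q + g Q)) P = D (E f) P + D (E g) P"
    if D: "derives V D" and E: "derives V E" and f: "reg V f" and g: "reg V g" and P: "P \<in> V" for D E f g P
  proof -
    have "D (E (\<lambda>Q. f Q + g Q)) P = D (\<lambda>Q. E f Q + E g Q) P"
      by (rule derives_cong[OF D derives_reg[OF E reg_add[OF f g]] derives_add[OF E f g] P])
    then show ?thesis
      using derives_add[OF D derives_reg[OF E f] derives_reg[OF E g] P] by simp
  qed
  have mult: "D (E (\<lambda>Q. f Q * g Q)) P = (f P * D (E g) P + E g P * D f P) + (g P * D (E f) P + E f P * D g P)"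
    if D: "derives V D" and E: "derives V E" and f: "reg V f" and g: "reg V g" and P: "P \<in> V" for D E f g P
  proof -
    have "D (E (\<lambda>Q. f Q * g Q)) P = D (\<lambda>Q. f Q * E g Q + g Q * E f Q) P"
      by (rule derives_cong[OF D derives_reg[OF E reg_mult[OF f g]] derives_mult[OF E f g] P])
    also have "\<dots> = D (\<lambda>Q. f Q * E g Q) P + D (\<lambda>Q. g Q * E f Q) P"
      by (rule derives_add[OF D reg_mult[OF f derives_reg[OF E g]] reg_mult[OF g derives_reg[OF E f]] P])
    finally show ?thesis
      using derives_mult[OF D f derives_reg[OF E g] P] derives_mult[OF D g derives_reg[OF E f] P] by simp
  qed
  show "derives V (\<lambda>f P. D (E f) P - E (D f) P)"
    unfolding derives_def
  proof (intro conjI allI impI ballI)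
    show "reg V (\<lambda>P. D (E f) P - E (D f) P)" if "reg V f" for f
      by (rule reg_diff[OF derives_reg[OF d(1) derives_reg[OF d(2) that]] derives_reg[OF d(2) derives_reg[OF d(1) that]]])
    fix f g P assume fg: "reg V f \<and> reg V g" "P \<in> V"
    show "D (E (\<lambda>Q. f Q + g Q)) P - E (D (\<lambda>Q. f Q + g Q)) P = D (E f) P - E (D f) P + (D (E g) P - E (D g) P)"
      using fg d by (simp add: add)
    show "D (E (\<lambda>Q. f Q * g Q)) P - E (D (\<lambda>Q. f Q * g Q)) P
        = f P * (D (E g) P - E (D g) P) + g P * (D (E f) P - E (D f) P)"
      using fg d by (simp add: mult algebra_simps)
  next
    have c0: "D (E (\<lambda>_. c)) P = 0" if D: "derives V D" and E: "derives V E" and P: "P \<in> V" for D E c P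
      using derives_cong[OF D derives_reg[OF E reg_const[OF derives_open[OF E]]] derives_const[OF E] P]
        derives_const[OF D P] by simp
    show "D (E (\<lambda>_. c)) P - E (D (\<lambda>_. c)) P = 0" if "P \<in> V" for c P
      using c0[OF d that] c0[OF d(2,1) that] by simp
    fix f g P assume fg: "reg V f \<and> reg V g \<and> (\<forall>P\<in>V. f P = g P)" "P \<in> V"
    have c1: "D (E f) P = D (E g) P" if D: "derives V D" and E: "derives V E" for D E
    proof (rule derives_cong[OF D derives_reg[OF E]])
      show "E f Q = E g Q" if "Q \<in> V" for Q
        by (rule derives_cong[OF E]) (use fg that in auto)
    qed (use fg in auto)
    show "D (E f) P - E (D f) P = D (E g) P - E (D g) P"
      using c1[OF d] c1[OF d(2,1)] by simp
  qed (use V in auto)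
qed

subsection \<open>Coordinates and tangent vectors\<close>

text \<open>The functions \<open>a\<^sub>0, \<dots>, a\<^sub>r\<^sub>-\<^sub>1\<close> embed \<open>W\<close> into affine space: every regular function is locally a
  fraction of polynomials in them.\<close>

definition coords :: "'p set \<Rightarrow> nat \<Rightarrow> (nat \<Rightarrow> 'p \<Rightarrow> 'k) \<Rightarrow> bool" where
  "coords W r a \<longleftrightarrow> openin T W \<and> (\<forall>k<r. reg W (a k)) \<and>
     (\<forall>V f P. V \<subseteq> W \<and> reg V f \<and> P \<in> V \<longrightarrow> (\<exists>V' g h. openin T V' \<and> P \<in> V' \<and> V' \<subseteq> V \<and>
        g \<in> polys r \<and> h \<in> polys r \<and>
        (\<forall>Q\<in>V'. peval h (\<lambda>k. a k Q) \<noteq> 0 \<and> f Q = peval g (\<lambda>k. a k Q) / peval h (\<lambda>k. a k Q))))"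

lemma coords_subset:
  assumes "coords W r a" "openin T W'" "W' \<subseteq> W"
  shows "coords W' r a"
  unfolding coords_def
proof (intro conjI allI impI assms(2))
  show "reg W' (a k)" if "k < r" for k
    using assms that reg_subset by (auto simp: coords_def)
  fix V f P assume "V \<subseteq> W' \<and> reg V f \<and> P \<in> V"
  then have "V \<subseteq> W \<and> reg V f \<and> P \<in> V"
    using assms(3) by blast
  with assms(1) show "\<exists>V' g h. openin T V' \<and> P \<in> V' \<and> V' \<subseteq> V \<and> g \<in> polys r \<and> h \<in> polys r \<and>
        (\<forall>Q\<in>V'. peval h (\<lambda>k. a k Q) \<noteq> 0 \<and> f Q = peval g (\<lambda>k. a k Q) / peval h (\<lambda>k. a k Q))"
    unfolding coords_def by blast
qed

lemma coords_reg: "coords W r a \<Longrightarrow> k < r \<Longrightarrow> reg W (a k)"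
  by (simp add: coords_def)

lemma coords_fraction:
  assumes "coords W r a" "V \<subseteq> W" "reg V f" "P \<in> V"
  obtains V' g h where "openin T V'" "P \<in> V'" "V' \<subseteq> V" "g \<in> polys r" "h \<in> polys r"
    "\<And>Q. Q \<in> V' \<Longrightarrow> peval h (\<lambda>k. a k Q) \<noteq> 0"
    "\<And>Q. Q \<in> V' \<Longrightarrow> f Q = peval g (\<lambda>k. a k Q) / peval h (\<lambda>k. a k Q)"
proof -
  have "\<exists>V' g h. openin T V' \<and> P \<in> V' \<and> V' \<subseteq> V \<and> g \<in> polys r \<and> h \<in> polys r \<and>
        (\<forall>Q\<in>V'. peval h (\<lambda>k. a k Q) \<noteq> 0 \<and> f Q = peval g (\<lambda>k. a k Q) / peval h (\<lambda>k. a k Q))"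
    using assms unfolding coords_def by blast
  then show ?thesis using that by blast
qed

text \<open>At each point of \<open>W\<close> the vector \<open>v\<close> is tangent to the closure of the image of \<open>W\<close> under \<open>b\<close>, because the
  relations between the \<open>b\<^sub>i\<close> are the equations of that closure.\<close>

definition tangent :: "'p set \<Rightarrow> nat \<Rightarrow> (nat \<Rightarrow> 'p \<Rightarrow> 'k) \<Rightarrow> (nat \<Rightarrow> 'p \<Rightarrow> 'k) \<Rightarrow> bool" where
  "tangent W s b v \<longleftrightarrow> openin T W \<and> (\<forall>i<s. reg W (b i) \<and> reg W (v i)) \<and>
     (\<forall>p\<in>polys s. (\<forall>P\<in>W. peval p (\<lambda>i. b i P) = 0) \<longrightarrow>
        (\<forall>P\<in>W. dir_deriv s p (\<lambda>i. b i P) (\<lambda>i. v i P) = 0))"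

text \<open>If \<open>f = g(a)/h(a)\<close> near \<open>P\<close>, then a derivation with values \<open>E\<close> on the coordinates must send \<open>f\<close>
  to \<open>(dg - f dh)/h\<close>; tangency says precisely that this does not depend on the fraction.\<close>

theorem vfield_of_tangent:
  assumes C: "coords W r a" and E: "tangent W r a E"
  shows "\<exists>D. vfield W D \<and> (\<forall>k<r. \<forall>P\<in>W. D (a k) P = E k P)"
proof -
  note Wo = C[unfolded coords_def, THEN conjunct1]
  note ra = coords_reg[OF C]
  have rE: "reg W (E k)" if "k < r" for k using E that by (simp add: tangent_def)
  let ?d = "\<lambda>g P. dir_deriv r g (\<lambda>k. a k P) (\<lambda>k. E k P)" and ?e = "\<lambda>g P. peval g (\<lambda>k. a k P)"
  define rep where "rep = (\<lambda>f P V g h. openin T V \<and> P \<in> V \<and> V \<subseteq> W \<and> g \<in> polys r \<and> h \<in> polys r \<and>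
      (\<forall>Q\<in>V. ?e h Q \<noteq> 0 \<and> f Q = ?e g Q / ?e h Q))"
  define val where "val = (\<lambda>f g h P. (?d g P - f P * ?d h P) / ?e h P)"
  define D where "D = (\<lambda>f P. SOME v. \<exists>V g h. rep f P V g h \<and> v = val f g h P)"
  have unique: "val f g h P = val f g' h' P" if "rep f P V g h" "rep f P V' g' h'" for f P V g h V' g' h'
  proof -
    let ?p = "g * h' - g' * h"
    have pp: "?p \<in> polys r"
      using that by (auto simp: rep_def intro!: polys_diff polys_mult)
    have nz: "?e h Q \<noteq> 0" "?e h' Q \<noteq> 0" "?e g Q = f Q * ?e h Q" "?e g' Q = f Q * ?e h' Q" if "Q \<in> V \<inter> V'" for Q
    proof -
      have "?e h Q \<noteq> 0 \<and> f Q = ?e g Q / ?e h Q" "?e h' Q \<noteq> 0 \<and> f Q = ?e g' Q / ?e h' Q"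
        using \<open>rep f P V g h\<close> \<open>rep f P V' g' h'\<close> that unfolding rep_def by blast+
      then show "?e h Q \<noteq> 0" "?e h' Q \<noteq> 0" "?e g Q = f Q * ?e h Q" "?e g' Q = f Q * ?e h' Q"
        by (metis nonzero_eq_divide_eq)+
    qed
    have "?e ?p Q = 0" if "Q \<in> W" for Q
    proof (rule reg_eq_0_dense[OF reg_peval[OF Wo pp ra] _ _ _ _ that])
      show "openin T (V \<inter> V')" "V \<inter> V' \<noteq> {}" "V \<inter> V' \<subseteq> W"
        using \<open>rep f P V g h\<close> \<open>rep f P V' g' h'\<close> by (auto simp: rep_def)
      show "?e ?p Q = 0" if "Q \<in> V \<inter> V'" for Q
        using nz[OF that] by (simp add: peval_diff peval_mult)
    qed simp
    then have "?d ?p P = 0"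
      using E pp that by (auto simp: tangent_def rep_def)
    moreover have P: "P \<in> V \<inter> V'"
      using that by (simp add: rep_def)
    ultimately have "?e h' P * (?d g P - f P * ?d h P) = ?e h P * (?d g' P - f P * ?d h' P)"
      using nz(3,4)[OF P] by (simp add: dir_deriv_diff dir_deriv_mult algebra_simps)
    then show ?thesis
      using nz(1,2)[OF P] by (simp add: val_def field_simps)
  qed
  have Deq: "D f P = val f g h P" if "rep f P V g h" for f P V g h
  proof -
    have "\<exists>v V g h. rep f P V g h \<and> v = val f g h P" using that by blast
    then have "\<exists>V g h. rep f P V g h \<and> D f P = val f g h P"
      unfolding D_def by (rule someI_ex)
    then show ?thesis using unique that by metis
  qed
  have rep_ex: "\<exists>V' g h. V' \<subseteq> V \<and> rep f P V' g h" if V: "V \<subseteq> W" "reg V f" "P \<in> V" for V f P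
  proof -
    obtain V' g h where "openin T V'" "P \<in> V'" "V' \<subseteq> V" "g \<in> polys r" "h \<in> polys r"
      "\<And>Q. Q \<in> V' \<Longrightarrow> ?e h Q \<noteq> 0" "\<And>Q. Q \<in> V' \<Longrightarrow> f Q = ?e g Q / ?e h Q"
      using coords_fraction[OF C V] by blast
    then show ?thesis using V(1) by (intro exI[of _ V'] exI[of _ g] exI[of _ h]) (auto simp: rep_def)
  qed
  have rep_move: "rep f Q V g h" if "rep f P V g h" "Q \<in> V" for f P Q V g h
    using that by (simp add: rep_def)
  have two: "\<exists>V' g h g' h'. V' \<subseteq> V \<and> rep f P V' g h \<and> rep f' P V' g' h'"
    if V: "V \<subseteq> W" "reg V f" "reg V f'" "P \<in> V" for V f f' P
  proof -
    obtain V1 g h where 1: "V1 \<subseteq> V" "rep f P V1 g h" using rep_ex[OF V(1,2,4)] by blast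
    obtain V2 g' h' where 2: "V2 \<subseteq> V" "rep f' P V2 g' h'" using rep_ex[OF V(1,3,4)] by blast
    show ?thesis
      by (rule exI[of _ "V1 \<inter> V2"], rule exI[of _ g], rule exI[of _ h], rule exI[of _ g'], rule exI[of _ h'])
        (use 1 2 in \<open>auto simp: rep_def\<close>)
  qed
  have "vfield W D"
    unfolding vfield_def
  proof (intro conjI allI impI Wo)
    fix V assume V: "openin T V \<and> V \<subseteq> W"
    then have VW: "V \<subseteq> W" by simp
    show "derives V D"
      unfolding derives_def
    proof (intro conjI allI impI ballI)
      show "openin T V" using V by simp
      show "reg V (D f)" if f: "reg V f" for f
      proof (rule reg_local)
        show "openin T V" using V by simp
        fix P assume "P \<in> V"
        then obtain V' g h where V': "V' \<subseteq> V" "rep f P V' g h"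
          using rep_ex[OF VW f] by blast
        then have o: "openin T V'" "P \<in> V'" and gh: "g \<in> polys r" "h \<in> polys r" "\<And>Q. Q \<in> V' \<Longrightarrow> ?e h Q \<noteq> 0"
          by (auto simp: rep_def)
        have sub: "reg V' (a k)" "reg V' (E k)" if "k < r" for k
          using ra[OF that] rE[OF that] V' o reg_subset VW by blast+
        have "reg V' (val f g h)"
          unfolding val_def using o gh sub V' f
          by (intro reg_divide reg_diff reg_mult reg_dir_deriv reg_peval) (auto intro: reg_subset)
        then have "reg V' (D f)"
          using Deq[OF rep_move[OF V'(2)]] by (subst reg_cong) auto
        then show "\<exists>V'. P \<in> V' \<and> V' \<subseteq> V \<and> reg V' (D f)"
          using o V' by blast
      qed
      fix f f' P assume f: "reg V f \<and> reg V f'" and P: "P \<in> V"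
      obtain V' g h g' h' where r: "V' \<subseteq> V" "rep f P V' g h" "rep f' P V' g' h'"
        using two[OF VW, of f f' P] f P by blast
      have nz: "?e h P \<noteq> 0" "?e h' P \<noteq> 0" "f P = ?e g P / ?e h P" "f' P = ?e g' P / ?e h' P"
        using r by (auto simp: rep_def)
      have a: "rep (\<lambda>Q. f Q + f' Q) P V' (g * h' + g' * h) (h * h')"
        using r(2,3) unfolding rep_def
        by (auto simp: peval_add peval_mult add_divide_eq_iff divide_add_eq_iff add_frac_eq intro!: polys_add polys_mult)
      show "D (\<lambda>Q. f Q + f' Q) P = D f P + D f' P"
        using nz(1,2) unfolding Deq[OF a] Deq[OF r(2)] Deq[OF r(3)] val_def
        by (simp add: nz(3,4) dir_deriv_add dir_deriv_mult peval_mult field_simps)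
      have m: "rep (\<lambda>Q. f Q * f' Q) P V' (g * g') (h * h')"
        using r(2,3) unfolding rep_def by (auto simp: peval_mult intro!: polys_mult)
      show "D (\<lambda>Q. f Q * f' Q) P = f P * D f' P + f' P * D f P"
        using nz(1,2) unfolding Deq[OF m] Deq[OF r(2)] Deq[OF r(3)] val_def
        by (simp add: nz(3,4) dir_deriv_add dir_deriv_mult peval_mult field_simps)
    next
      fix c P assume "P \<in> V"
      then have c: "rep (\<lambda>_. c) P V (pconst c) 1"
        using V by (auto simp: rep_def one_in_polys)
      have "?d 1 P = 0" using dir_deriv_const[of r 1] by simp
      then show "D (\<lambda>_. c) P = 0"
        unfolding Deq[OF c] val_def by simp
    next
      fix f f' P assume f: "reg V f \<and> reg V f' \<and> (\<forall>P\<in>V. f P = f' P)" and P: "P \<in> V"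
      obtain V' g h where r: "V' \<subseteq> V" "rep f P V' g h"
        using rep_ex[OF VW conjunct1[OF f] P] by blast
      moreover have "\<forall>Q\<in>V'. f' Q = f Q" using f r(1) by auto
      ultimately have r': "rep f' P V' g h"
        by (simp add: rep_def)
      have "f P = f' P" using f P by blast
      then show "D f P = D f' P"
        unfolding Deq[OF r(2)] Deq[OF r'] val_def by simp
    qed
  qed
  moreover have "D (a k) P = E k P" if "k < r" "P \<in> W" for k P
  proof -
    have c: "rep (a k) P W (pvar k) 1"
      using that Wo by (auto simp: rep_def one_in_polys pvar_in_polys)
    have "?d 1 P = 0" using dir_deriv_const[of r 1] by simp
    then show ?thesis
      unfolding Deq[OF c] val_def using that by (simp add: dir_deriv_var)
  qed
  ultimately show ?thesis by blast
qed

lemma derives_fraction: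
  assumes C: "coords W r a" and D: "derives W D" and D': "derives W D'"
    and eq: "\<And>k P. k < r \<Longrightarrow> P \<in> W \<Longrightarrow> D (a k) P = D' (a k) P"
    and f: "reg W f" and P: "P \<in> W"
  shows "D f P = D' f P"
proof -
  note Wo = derives_open[OF D]
  note ra = coords_reg[OF C]
  let ?e = "\<lambda>g P. peval g (\<lambda>k. a k P)"
  obtain V' g h where V': "openin T V'" "P \<in> V'" "V' \<subseteq> W" "g \<in> polys r" "h \<in> polys r"
      "\<And>Q. Q \<in> V' \<Longrightarrow> ?e h Q \<noteq> 0" "\<And>Q. Q \<in> V' \<Longrightarrow> f Q = ?e g Q / ?e h Q"
    using coords_fraction[OF C order_refl f P] by blast
  have rg: "reg W (?e g)" "reg W (?e h)"
    using V' ra Wo by (auto intro: reg_peval)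
  have e: "?e g Q = ?e h Q * f Q" if "Q \<in> W" for Q
    by (rule reg_eq_dense[OF rg(1) reg_mult[OF rg(2) f] V'(1)]) (use V' that in auto)
  have *: "dir_deriv r g (\<lambda>k. a k P) (\<lambda>k. D (a k) P)
      = ?e h P * D f P + f P * dir_deriv r h (\<lambda>k. a k P) (\<lambda>k. D (a k) P)" if D: "derives W D" for D
  proof -
    have "D (?e g) P = D (\<lambda>Q. ?e h Q * f Q) P"
      using derives_cong[OF D rg(1) e P] .
    then show ?thesis
      using derives_peval[OF D V'(4) ra P] derives_peval[OF D V'(5) ra P] derives_mult[OF D rg(2) f P]
      by simp
  qed
  have "dir_deriv r p (\<lambda>k. a k P) (\<lambda>k. D (a k) P) = dir_deriv r p (\<lambda>k. a k P) (\<lambda>k. D' (a k) P)" for p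
    unfolding dir_deriv_def by (intro sum.cong refl) (simp add: eq P)
  then have "?e h P * D f P = ?e h P * D' f P"
    using *[OF D] *[OF D'] by (metis add_right_cancel)
  then show ?thesis using V'(6)[OF V'(2)] by simp
qed

lemma tangent_of_derives:
  assumes "derives W D" "\<And>i. i < s \<Longrightarrow> reg W (b i)"
  shows "tangent W s b (\<lambda>i. D (b i))"
  unfolding tangent_def
proof (intro conjI allI impI ballI)
  fix p P assume p: "p \<in> polys s" "\<forall>P\<in>W. peval p (\<lambda>i. b i P) = 0" and P: "P \<in> W"
  have "D (\<lambda>Q. peval p (\<lambda>i. b i Q)) P = D (\<lambda>_. 0) P"
    using p P by (intro derives_cong[OF assms(1) reg_peval[OF derives_open[OF assms(1)] p(1) assms(2)]]) auto
  then show "dir_deriv s p (\<lambda>i. b i P) (\<lambda>i. D (b i) P) = 0"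
    using derives_peval[OF assms(1) p(1) assms(2) P] derives_const[OF assms(1) P] by simp
qed (use assms in \<open>auto simp: derives_open derives_reg\<close>)

text \<open>The values on coordinates form a tangent vector, hence come from a vector field, which agrees with \<open>D\<close> by
  the quotient rule.\<close>

lemma vfield_of_derives:
  assumes C: "coords W r a" and D: "derives W D"
  shows "\<exists>D'. vfield W D' \<and> (\<forall>f. reg W f \<longrightarrow> (\<forall>P\<in>W. D' f P = D f P))"
proof -
  obtain D' where D': "vfield W D'" "\<And>k P. k < r \<Longrightarrow> P \<in> W \<Longrightarrow> D' (a k) P = D (a k) P"
    using vfield_of_tangent[OF C tangent_of_derives[OF D]] coords_reg[OF C] by blast
  have "D' f P = D f P" if "reg W f" "P \<in> W" for f P
    using derives_fraction[OF C vfield_derives[OF D'(1)] D D'(2)] that derives_open[OF D] by blast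
  then show ?thesis using D'(1) by blast
qed

end

section \<open>Algebraic dependence and generic vector fields\<close>

lemma alg_indep_cong:
  assumes "\<And>i P. i < N \<Longrightarrow> P \<in> U \<Longrightarrow> x i P = y i P"
  shows "alg_indep N U x \<longleftrightarrow> alg_indep N U y"
proof -
  have "peval p (\<lambda>i. x i P) = peval p (\<lambda>i. y i P)" if "p \<in> polys N" "P \<in> U" for p P
    using that assms by (intro peval_cong) auto
  then show ?thesis by (simp add: alg_indep_def)
qed

context function_space
begin

lemma alg_indep_dense:
  assumes "alg_indep N U x" "\<And>i. i < N \<Longrightarrow> reg U (x i)" "openin T U" "openin T V" "V \<noteq> {}" "V \<subseteq> U"
  shows "alg_indep N V x"
  unfolding alg_indep_def
proof (intro ballI impI)
  fix p assume p: "p \<in> polys N" "\<forall>P\<in>V. peval p (\<lambda>i. x i P) = 0"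
  have "\<forall>P\<in>U. peval p (\<lambda>i. x i P) = 0"
    using reg_eq_0_dense[OF reg_peval[OF assms(3) p(1), of x, OF assms(2)] assms(4-6)] p(2) by blast
  then show "p = 0"
    using assms(1) p(1) by (auto simp: alg_indep_def)
qed

lemma finite_nonzero:
  assumes "finite I" "openin T V" "V \<noteq> {}" "\<And>i. i \<in> I \<Longrightarrow> reg V (h i)" "\<And>i. i \<in> I \<Longrightarrow> \<exists>P\<in>V. h i P \<noteq> 0"
  shows "\<exists>V'. openin T V' \<and> V' \<noteq> {} \<and> V' \<subseteq> V \<and> (\<forall>i\<in>I. \<forall>P\<in>V'. h i P \<noteq> 0)"
  using assms(1,4,5)
proof (induction I)
  case empty
  then show ?case using assms by blast
next
  case (insert i I)
  then obtain V' where V': "openin T V'" "V' \<noteq> {}" "V' \<subseteq> V" "\<forall>i\<in>I. \<forall>P\<in>V'. h i P \<noteq> 0"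
    by auto
  have o: "openin T {P \<in> V. h i P \<noteq> 0}" and n: "{P \<in> V. h i P \<noteq> 0} \<noteq> {}"
    using insert.prems reg_nonzero_open[of V "h i"] by auto
  have "V' \<inter> {P \<in> V. h i P \<noteq> 0} \<noteq> {}"
    by (rule opens_meet) (use o n V' in auto)
  then show ?case
    using V' o by (intro exI[of _ "V' \<inter> {P \<in> V. h i P \<noteq> 0}"]) auto
qed

lemma finite_neighbourhood:
  assumes "finite I" "openin T W0" "P \<in> W0"
    and ex: "\<And>i. i \<in> I \<Longrightarrow> \<exists>W. openin T W \<and> P \<in> W \<and> \<Phi> i W"
    and mono: "\<And>i W W'. i \<in> I \<Longrightarrow> \<Phi> i W \<Longrightarrow> openin T W' \<Longrightarrow> P \<in> W' \<Longrightarrow> W' \<subseteq> W \<Longrightarrow> \<Phi> i W'"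
  shows "\<exists>W. openin T W \<and> P \<in> W \<and> W \<subseteq> W0 \<and> (\<forall>i\<in>I. \<Phi> i W)"
  using assms(1) ex mono
proof (induction I)
  case empty
  then show ?case using assms(2,3) by blast
next
  case (insert i I)
  have "\<exists>W. openin T W \<and> P \<in> W \<and> W \<subseteq> W0 \<and> (\<forall>i\<in>I. \<Phi> i W)"
  proof (rule insert.IH)
    show "\<exists>W. openin T W \<and> P \<in> W \<and> \<Phi> i W" if "i \<in> I" for i
      using insert.prems(1)[OF insertI2[OF that]] .
    show "\<Phi> i W'" if "i \<in> I" "\<Phi> i W" "openin T W'" "P \<in> W'" "W' \<subseteq> W" for i W W'
      using insert.prems(2)[OF insertI2[OF that(1)] that(2-)] .
  qed
  then obtain W where W: "openin T W" "P \<in> W" "W \<subseteq> W0" "\<forall>i\<in>I. \<Phi> i W"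
    by (elim exE conjE) (rule that)
  obtain W' where W': "openin T W'" "P \<in> W'" "\<Phi> i W'"
    using insert.prems(1)[OF insertI1] by (elim exE conjE) (rule that)
  have "\<Phi> j (W \<inter> W')" if "j \<in> insert i I" for j
    using that insert.prems(2)[of j W "W \<inter> W'"] insert.prems(2)[of j W' "W \<inter> W'"] W W' by auto
  then show ?case
    using W W' by (intro exI[of _ "W \<inter> W'"]) auto
qed

text \<open>\<open>f\<close> satisfies an equation over the polynomials in \<open>b\<close> whose leading coefficient is not
  identically \<open>0\<close>.  Here and below \<open>f\<close> takes the place of the variable with index \<open>s\<close>.\<close>

definition alg_over :: "'p set \<Rightarrow> nat \<Rightarrow> (nat \<Rightarrow> 'p \<Rightarrow> 'k) \<Rightarrow> ('p \<Rightarrow> 'k) \<Rightarrow> bool" where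
  "alg_over V s b f \<longleftrightarrow> (\<exists>c d. (\<forall>j. c j \<in> polys s) \<and> (\<exists>P\<in>V. peval (c d) (\<lambda>i. b i P) \<noteq> 0) \<and>
     (\<forall>P\<in>V. (\<Sum>j\<le>d. peval (c j) (\<lambda>i. b i P) * f P ^ j) = 0))"

lemma alg_over_mono:
  assumes "alg_over V s b f" "s \<le> s'" "\<And>i P. i < s \<Longrightarrow> P \<in> V \<Longrightarrow> b' i P = b i P"
  shows "alg_over V s' b' f"
proof -
  obtain c d where c: "\<forall>j. c j \<in> polys s" "\<exists>P\<in>V. peval (c d) (\<lambda>i. b i P) \<noteq> 0"
      "\<forall>P\<in>V. (\<Sum>j\<le>d. peval (c j) (\<lambda>i. b i P) * f P ^ j) = 0"
    using assms(1) by (auto simp: alg_over_def)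
  have "peval (c j) (\<lambda>i. b' i P) = peval (c j) (\<lambda>i. b i P)" if "P \<in> V" for j P
    using c(1) assms(3) that by (intro peval_cong[of _ s]) auto
  then show ?thesis
    unfolding alg_over_def using c
    by (intro exI[of _ c] exI[of _ d] conjI allI polys_mono[OF _ assms(2)]) auto
qed

lemma peval_upd: "p \<in> polys s \<Longrightarrow> peval p (\<lambda>i. (b(s := f)) i P) = peval p (\<lambda>i. b i P)"
  by (rule peval_cong) auto

definition relation :: "'p set \<Rightarrow> nat \<Rightarrow> (nat \<Rightarrow> 'p \<Rightarrow> 'k) \<Rightarrow> ('p \<Rightarrow> 'k) \<Rightarrow> nat \<Rightarrow> 'k mpoly \<Rightarrow> 'k mpoly \<Rightarrow> bool" where
  "relation V s b f d q l \<longleftrightarrow> q \<in> below_degree s d \<and> l \<in> polys s \<and> (\<exists>P\<in>V. peval l (\<lambda>i. b i P) \<noteq> 0) \<and>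
     (\<forall>P\<in>V. peval (q + l * pvar s ^ d) (\<lambda>i. (b(s := f)) i P) = 0)"

text \<open>Characteristic \<open>0\<close> enters here: the derivative of a relation of minimal degree has the nonzero
  leading coefficient \<open>d l\<close>, so by minimality it is not a relation.\<close>

lemma minimal_relation:
  assumes "alg_over V s b f"
  shows "\<exists>d q l. relation V s b f d q l \<and> (\<forall>e<d. \<forall>q' l'. \<not> relation V s b f e q' l') \<and>
    (\<exists>P\<in>V. peval (ppartial s (q + l * pvar s ^ d)) (\<lambda>i. (b(s := f)) i P) \<noteq> 0)"
proof -
  obtain c d where c: "\<forall>j. c j \<in> polys s" "\<exists>P\<in>V. peval (c d) (\<lambda>i. b i P) \<noteq> 0"
      "\<forall>P\<in>V. (\<Sum>j\<le>d. peval (c j) (\<lambda>i. b i P) * f P ^ j) = 0"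
    using assms by (auto simp: alg_over_def)
  have "relation V s b f d (\<Sum>j<d. c j * pvar s ^ j) (c d)"
    using c by (auto simp: relation_def below_degree_def peval_add peval_sum peval_mult peval_power
        peval_upd lessThan_Suc_atMost[symmetric] simp del: fun_upd_apply) (simp add: peval_upd[simplified])
  then have "\<exists>d q l. relation V s b f d q l" by blast
  then have "\<exists>q l. relation V s b f (LEAST d. \<exists>q l. relation V s b f d q l) q l"
    by (rule LeastI_ex)
  then obtain d q l where r: "relation V s b f d q l" and "d = (LEAST d. \<exists>q l. relation V s b f d q l)"
    by blast
  then have min: "\<not> relation V s b f e q' l'" if "e < d" for e q' l'
    using not_less_Least that by blast
  have "\<exists>P\<in>V. peval (ppartial s (q + l * pvar s ^ d)) (\<lambda>i. (b(s := f)) i P) \<noteq> 0"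
  proof (cases d)
    case 0
    then have "\<forall>P\<in>V. peval l (\<lambda>i. b i P) = 0"
      using r by (auto simp: relation_def peval_upd[simplified])
    then show ?thesis using r by (auto simp: relation_def)
  next
    case (Suc e)
    have q: "ppartial s q \<in> below_degree s e" "l \<in> polys s"
      using r Suc by (auto simp: relation_def intro: ppartial_below_degree)
    have eq: "ppartial s (q + l * pvar s ^ d) = ppartial s q + pconst (of_nat (Suc e)) * l * pvar s ^ e"
    proof -
      have "(of_nat k :: 'k mpoly) = pconst (of_nat k)" for k
        by (induction k) (auto simp: pconst_add)
      then show ?thesis
        using q Suc by (simp only: ppartial_add ppartial_leading_term)
    qed
    show ?thesis
    proof (rule ccontr)
      assume "\<not> ?thesis"
      then have "relation V s b f e (ppartial s q) (pconst (of_nat (Suc e)) * l)"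
        using q r unfolding eq relation_def
        by (auto simp: peval_mult polys_mult simp del: of_nat_Suc)
      then show False using min Suc by blast
    qed
  qed
  with r min show ?thesis by blast
qed

lemma derives_eq_0_of_algebraic:
  assumes D: "derives V D" and x: "\<And>i. i < s \<Longrightarrow> reg V (x i)" "\<And>i P. i < s \<Longrightarrow> P \<in> V \<Longrightarrow> D (x i) P = 0"
    and f: "reg V f" and alg: "alg_over V s x f" and P: "P \<in> V"
  shows "D f P = 0"
proof -
  obtain d q l where r: "relation V s x f d q l"
      and nz: "\<exists>P\<in>V. peval (ppartial s (q + l * pvar s ^ d)) (\<lambda>i. (x(s := f)) i P) \<noteq> 0"
    using minimal_relation[OF alg] by (elim exE conjE) (rule that)
  let ?Q = "q + l * pvar s ^ d" and ?x = "x(s := f)"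
  have V: "openin T V" by (rule derives_open[OF D])
  have Q: "?Q \<in> polys (Suc s)"
    using r by (auto simp: relation_def intro!: polys_add polys_mult polys_power pvar_in_polys
        intro: below_degree_in_polys polys_mono)
  have rx: "reg V (?x i)" if "i < Suc s" for i
    using that x f by (auto simp: less_Suc_eq)
  have rd: "reg V (\<lambda>P. peval (ppartial s ?Q) (\<lambda>i. ?x i P))"
    using ppartial_in_polys[OF Q] rx by (rule reg_peval[OF V])
  obtain P0 where P0: "P0 \<in> V" "peval (ppartial s ?Q) (\<lambda>i. ?x i P0) \<noteq> 0"
    using nz by blast
  show ?thesis
  proof (rule reg_cancel[OF rd derives_reg[OF D f] P0 _ P])
    fix P assume P: "P \<in> V"
    have "D (\<lambda>P. peval ?Q (\<lambda>i. ?x i P)) P = D (\<lambda>_. 0) P"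
      using r by (intro derives_cong[OF D reg_peval[OF V Q rx] _ P]) (auto simp: relation_def)
    then have "dir_deriv (Suc s) ?Q (\<lambda>i. ?x i P) (\<lambda>i. D (?x i) P) = 0"
      using derives_peval[OF D Q rx P] derives_const[OF D P] by simp
    moreover have "(\<Sum>i<s. peval (ppartial i ?Q) (\<lambda>i. ?x i P) * D (?x i) P) = 0"
      using x(2) P by (intro sum.neutral) auto
    ultimately show "peval (ppartial s ?Q) (\<lambda>i. ?x i P) * D f P = 0"
      by (simp add: dir_deriv_def)
  qed
qed

text \<open>A tangent vector extends along an algebraic function \<open>f\<close> with minimal relation \<open>Q\<close>: the value
  on \<open>f\<close> is forced by \<open>dQ = 0\<close>, up to the denominator \<open>\<partial>Q/\<partial>X\<^sub>s\<close> that is multiplied away.  Any other relation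
  reduces to \<open>Q\<close> by pseudo-division, that is, by removing leading terms one at a time.\<close>

lemma tangent_extend:
  assumes t: "tangent V s b v" and f: "reg V f" and alg: "alg_over V s b f"
  shows "\<exists>h u. reg V h \<and> (\<exists>P\<in>V. h P \<noteq> 0) \<and> tangent V (Suc s) (b(s := f)) ((\<lambda>i P. h P * v i P)(s := u))"
proof -
  obtain d q l where r: "relation V s b f d q l"
      and min: "\<forall>e<d. \<forall>q' l'. \<not> relation V s b f e q' l'"
      and nz: "\<exists>P\<in>V. peval (ppartial s (q + l * pvar s ^ d)) (\<lambda>i. (b(s := f)) i P) \<noteq> 0"
    using minimal_relation[OF alg] by (elim exE conjE) (rule that)
  define Q where "Q = q + l * pvar s ^ d"
  define b' where "b' = b(s := f)"
  have V: "openin T V" and rb: "\<And>i. i < s \<Longrightarrow> reg V (b i)" and rv: "\<And>i. i < s \<Longrightarrow> reg V (v i)"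
    using t by (auto simp: tangent_def)
  have q: "q \<in> below_degree s d" and l: "l \<in> polys s" and lnz: "\<exists>P\<in>V. peval l (\<lambda>i. b i P) \<noteq> 0"
    and Q0: "\<And>P. P \<in> V \<Longrightarrow> peval Q (\<lambda>i. b' i P) = 0"
    using r by (auto simp: relation_def Q_def b'_def)
  have Q: "Q \<in> polys (Suc s)"
    using q l unfolding Q_def by (auto intro!: polys_add polys_mult polys_power pvar_in_polys
        intro: below_degree_in_polys polys_mono)
  have rb': "reg V (b' i)" if "i < Suc s" for i
    using that rb f by (auto simp: b'_def less_Suc_eq)
  have b's: "b' s = f" and pb: "peval p (\<lambda>i. b' i P) = peval p (\<lambda>i. b i P)" if "p \<in> polys s" for p P
    using peval_upd[OF that] by (auto simp: b'_def)
  define h where "h = (\<lambda>P. peval (ppartial s Q) (\<lambda>i. b' i P))"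
  define u where "u = (\<lambda>P. - dir_deriv s Q (\<lambda>i. b' i P) (\<lambda>i. v i P))"
  define v' where "v' = (\<lambda>i P. h P * v i P)(s := u)"
  let ?\<delta> = "\<lambda>p P. dir_deriv (Suc s) p (\<lambda>i. b' i P) (\<lambda>i. v' i P)"
  let ?e = "\<lambda>p P. peval p (\<lambda>i. b' i P)"
  have rh: "reg V h"
    unfolding h_def by (rule reg_peval[OF V ppartial_in_polys[OF Q] rb'])
  have ru: "reg V u"
    unfolding u_def dir_deriv_def using rv rb'
    by (intro reg_uminus reg_sum[OF V] reg_mult reg_peval[OF V ppartial_in_polys[OF Q]]) auto
  have rv': "reg V (v' i)" if "i < Suc s" for i
    using that rh ru rv reg_mult by (auto simp: v'_def less_Suc_eq)
  have \<delta>Q: "?\<delta> Q P = 0" for P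
    by (simp add: dir_deriv_def v'_def u_def h_def sum_distrib_left mult_ac)
  have \<delta>c: "?\<delta> p P = h P * dir_deriv s p (\<lambda>i. b i P) (\<lambda>i. v i P)" if p: "p \<in> polys s" for p P
  proof -
    have "?\<delta> p P = dir_deriv s p (\<lambda>i. b' i P) (\<lambda>i. v' i P)"
      using p by (rule dir_deriv_larger) simp
    also have "\<dots> = dir_deriv s p (\<lambda>i. b i P) (\<lambda>i. h P * v i P)"
      using p by (rule dir_deriv_cong) (auto simp: b'_def v'_def)
    finally show ?thesis by (simp add: dir_deriv_scale)
  qed
  have main: "\<forall>P\<in>V. ?\<delta> p P = 0" if "p \<in> below_degree s e" "\<forall>P\<in>V. ?e p P = 0" for p e
    using that
  proof (induction e arbitrary: p)
    case 0
    then show ?case by simp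
  next
    case (Suc e)
    obtain c p0 where c: "c \<in> polys s" "p0 \<in> below_degree s e" "p = p0 + c * pvar s ^ e"
      using Suc.prems(1) unfolding below_degree_Suc by blast
    show ?case
    proof (cases "\<forall>P\<in>V. ?e c P = 0")
      case True
      then have "\<forall>P\<in>V. peval c (\<lambda>i. b i P) = 0"
        using pb[OF c(1)] by simp
      then have dc: "\<forall>P\<in>V. dir_deriv s c (\<lambda>i. b i P) (\<lambda>i. v i P) = 0"
        using t c(1) unfolding tangent_def by blast
      have "\<forall>P\<in>V. ?e p0 P = 0"
        using Suc.prems(2) True by (simp add: c(3) peval_add peval_mult)
      then have "\<forall>P\<in>V. ?\<delta> p0 P = 0"
        using Suc.IH[OF c(2)] by blast
      then show ?thesis
        using True dc by (simp add: c(3) dir_deriv_add dir_deriv_mult \<delta>c[OF c(1)])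
    next
      case False
      then have "relation V s b f e p0 c"
        using c Suc.prems(2) pb[OF c(1)] by (auto simp: relation_def b'_def)
      then have de: "d \<le> e" using min not_less by blast
      let ?p = "l * p - c * pvar s ^ (e - d) * Q"
      have X: "pvar s ^ (e - d) * pvar s ^ d = (pvar s ^ e :: 'k mpoly)"
        using de by (simp add: power_add[symmetric])
      have "?p = l * p0 + (- c) * (q * pvar s ^ (e - d))"
        unfolding c(3) Q_def X[symmetric] by (simp add: algebra_simps)
      moreover have "q * pvar s ^ (e - d) \<in> below_degree s e"
        using below_degree_shift[OF q, of "e - d"] de by simp
      ultimately have "?p \<in> below_degree s e"
        using c(1,2) l by (simp only: below_degree_add below_degree_scale polys_uminus)
      moreover have "\<forall>P\<in>V. ?e ?p P = 0"
        using Suc.prems(2) Q0 by (simp add: peval_diff peval_mult)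
      ultimately have "\<forall>P\<in>V. ?\<delta> ?p P = 0"
        by (rule Suc.IH)
      then have 0: "?e l P * ?\<delta> p P = 0" if "P \<in> V" for P
        using that Suc.prems(2) Q0[OF that] by (simp add: dir_deriv_diff dir_deriv_mult \<delta>Q)
      have p: "p \<in> polys (Suc s)" using Suc.prems(1) by (rule below_degree_in_polys)
      obtain P0 where P0: "P0 \<in> V" "?e l P0 \<noteq> 0" using lnz pb[OF l] by auto
      have rl: "reg V (?e l)" using polys_mono[OF l] rb' by (intro reg_peval[OF V]) auto
      show ?thesis
        using reg_cancel[OF rl reg_dir_deriv[OF V p rb' rv'] P0 0] by blast
    qed
  qed
  have "tangent V (Suc s) b' v'"
    unfolding tangent_def using V rb' rv' main polys_Suc_below_degree by blast
  then show ?thesis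
    unfolding b'_def v'_def using rh nz[folded Q_def b'_def] by (auto simp: h_def b'_def)
qed

text \<open>The tangent vector is extended along one function at a time; each step multiplies it by a denominator, and
  \<open>h\<close> is their product.\<close>

lemma tangent_extend_many:
  assumes V: "openin T V" and t: "tangent V N z v"
    and a: "\<And>k. k < r \<Longrightarrow> reg V (a k)" "\<And>k. k < r \<Longrightarrow> alg_over V N z (a k)" and ne: "V \<noteq> {}"
  shows "\<exists>h v'. reg V h \<and> (\<exists>P\<in>V. h P \<noteq> 0) \<and>
     tangent V (N + r) (\<lambda>i. if i < N then z i else a (i - N)) v' \<and> (\<forall>i<N. \<forall>P\<in>V. v' i P = h P * v i P)"
  using a
proof (induction r)
  case 0
  have "tangent V N (\<lambda>i. if i < N then z i else a (i - N)) v"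
  proof -
    have "peval p (\<lambda>i. (if i < N then z i else a (i - N)) P) = peval p (\<lambda>i. z i P)"
      "dir_deriv N p (\<lambda>i. (if i < N then z i else a (i - N)) P) w = dir_deriv N p (\<lambda>i. z i P) w"
      if "p \<in> polys N" for p P w
      using that by (auto intro: peval_cong dir_deriv_cong)
    then show ?thesis using t by (auto simp: tangent_def)
  qed
  then show ?case
    using V ne by (intro exI[of _ "\<lambda>_. 1"] exI[of _ v]) (auto simp: reg_const)
next
  case (Suc r)
  let ?b = "\<lambda>i. if i < N then z i else a (i - N)"
  obtain h v' where h: "reg V h" "\<exists>P\<in>V. h P \<noteq> 0" "tangent V (N + r) ?b v'"
      "\<forall>i<N. \<forall>P\<in>V. v' i P = h P * v i P"
    using Suc by auto
  have "alg_over V (N + r) ?b (a r)"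
    by (rule alg_over_mono[OF Suc.prems(2)]) auto
  then obtain g u where g: "reg V g" "\<exists>P\<in>V. g P \<noteq> 0"
      "tangent V (Suc (N + r)) (?b(N + r := a r)) ((\<lambda>i P. g P * v' i P)(N + r := u))"
    using tangent_extend[OF h(3)] Suc.prems(1) by blast
  have eq: "?b(N + r := a r) = ?b"
    by auto
  have gh: "\<exists>P\<in>V. g P * h P \<noteq> 0"
  proof (rule ccontr)
    assume "\<not> ?thesis"
    then have "h P = 0" if "P \<in> V" for P
      using reg_cancel[OF g(1) h(1)] g(2) that by blast
    then show False using h(2) by blast
  qed
  show ?case
  proof (intro exI conjI allI impI ballI)
    show "reg V (\<lambda>P. g P * h P)" using g(1) h(1) by (rule reg_mult)
    show "\<exists>P\<in>V. g P * h P \<noteq> 0" by (rule gh)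
    show "tangent V (N + Suc r) ?b ((\<lambda>i P. g P * v' i P)(N + r := u))"
      using g(3) unfolding eq by simp
    show "((\<lambda>i P. g P * v' i P)(N + r := u)) i P = g P * h P * v i P" if "i < N" "P \<in> V" for i P
      using h(4) that by simp
  qed
qed

end

lemma polys_shift_variables:
  assumes "p \<in> polys r"
  shows "\<exists>p'\<in>polys (N + r). \<forall>b. peval p' b = peval p (\<lambda>k. b (N + k))"
  using assms
proof (induction rule: polys_induct)
  case (const c)
  show ?case by (intro bexI[of _ "pconst c"]) auto
next
  case (var i)
  then show ?case by (intro bexI[of _ "pvar (N + i)"]) (auto simp: pvar_in_polys)
next
  case (add p q)
  then obtain p' q' where "p' \<in> polys (N + r)" "q' \<in> polys (N + r)"
    "\<forall>b. peval p' b = peval p (\<lambda>k. b (N + k))" "\<forall>b. peval q' b = peval q (\<lambda>k. b (N + k))" by blast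
  then show ?case by (intro bexI[of _ "p' + q'"]) (auto simp: peval_add polys_add)
next
  case (mult p q)
  then obtain p' q' where "p' \<in> polys (N + r)" "q' \<in> polys (N + r)"
    "\<forall>b. peval p' b = peval p (\<lambda>k. b (N + k))" "\<forall>b. peval q' b = peval q (\<lambda>k. b (N + k))" by blast
  then show ?case by (intro bexI[of _ "p' * q'"]) (auto simp: peval_mult polys_mult)
qed

locale variety = function_space +
  fixes N :: nat
  assumes dimension: "has_dimension T (\<lambda>U. fun_ring U (A U)) N"
begin

text \<open>This is where the dimension enters: otherwise \<open>x\<close> and \<open>f\<close> would be \<open>N + 1\<close> algebraically independent
  functions.\<close>

lemma alg_over_parameters:
  assumes V: "openin T V" "V \<noteq> {}" and x: "\<And>i. i < N \<Longrightarrow> reg V (x i)" "alg_indep N V x" and f: "reg V f"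
  shows "alg_over V N x f"
proof -
  let ?x = "x(N := f)"
  have rx: "reg V (?x i)" if "i < Suc N" for i
    using that x f by (auto simp: less_Suc_eq)
  have "\<not> alg_indep (Suc N) V (\<lambda>i. restrict (?x i) V)"
  proof
    assume "alg_indep (Suc N) V (\<lambda>i. restrict (?x i) V)"
    moreover have "\<forall>i<Suc N. restrict (?x i) V \<in> A V" using rx by (simp add: reg_def)
    ultimately have "\<exists>U x. openin T U \<and> U \<noteq> {} \<and> (\<forall>i<Suc N. x i \<in> A U) \<and> alg_indep (Suc N) U x"
      using V by (intro exI[of _ V] exI[of _ "\<lambda>i. restrict (?x i) V"]) simp
    moreover have "\<not> (\<exists>U x. openin T U \<and> U \<noteq> {} \<and> (\<forall>i<Suc N. x i \<in> A U) \<and> alg_indep (Suc N) U x)"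
      using dimension by (simp add: has_dimension_def fun_ring_def)
    ultimately show False by blast
  qed
  then obtain p where p: "p \<in> polys (Suc N)" "\<forall>P\<in>V. peval p (\<lambda>i. ?x i P) = 0" "p \<noteq> 0"
    using alg_indep_cong[of "Suc N" V "\<lambda>i. restrict (?x i) V" ?x] by (auto simp: alg_indep_def)
  obtain e c where c: "\<forall>j. c j \<in> polys N" "p = (\<Sum>j<e. c j * pvar N ^ j)"
    using polys_Suc_below_degree[OF p(1)] by (auto simp: below_degree_def)
  let ?S = "{j. j < e \<and> c j \<noteq> 0}"
  have "?S \<noteq> {}"
  proof
    assume "?S = {}"
    then have "p = 0" unfolding c(2) by (intro sum.neutral) auto
    then show False using p(3) by blast
  qed
  define d where "d = Max ?S"
  have "finite ?S" by simp
  then have d: "d < e" "c d \<noteq> 0"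
    using Max_in[of ?S] \<open>?S \<noteq> {}\<close> unfolding d_def by blast+
  have z: "c j = 0" if "d < j" "j < e" for j
  proof (rule ccontr)
    assume "c j \<noteq> 0"
    then have "j \<le> d" unfolding d_def using that by (intro Max_ge) auto
    then show False using that by simp
  qed
  have "p = (\<Sum>j\<le>d. c j * pvar N ^ j)"
    unfolding c(2) using d z by (intro sum.mono_neutral_right) (auto simp: not_le)
  then have "\<forall>P\<in>V. (\<Sum>j\<le>d. peval (c j) (\<lambda>i. x i P) * f P ^ j) = 0"
    using p(2) c(1) by (simp add: peval_sum peval_mult peval_power peval_upd[simplified])
  moreover have "\<exists>P\<in>V. peval (c d) (\<lambda>i. x i P) \<noteq> 0"
    using x(2) d(2) c(1) by (auto simp: alg_indep_def)
  ultimately show ?thesis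
    unfolding alg_over_def using c(1) by blast
qed

lemma derives_eq_0:
  assumes D: "derives V D" and x: "\<And>i. i < N \<Longrightarrow> reg V (x i)" "alg_indep N V x"
    and 0: "\<And>i P. i < N \<Longrightarrow> P \<in> V \<Longrightarrow> D (x i) P = 0" and f: "reg V f" and P: "P \<in> V"
  shows "D f P = 0"
  by (rule derives_eq_0_of_algebraic[OF D x(1) 0 f alg_over_parameters[OF _ _ x f] P])
    (use P derives_open[OF D] in auto)

text \<open>There are no relations between the \<open>z\<^sub>i\<close>, so the unit vectors are tangent for \<open>z\<close> alone; they extend along
  the coordinates, which are algebraic over \<open>z\<close>.  The denominators that arise are inverted on \<open>V'\<close>.\<close>

lemma generic_dual_fields:
  assumes C: "coords V r a" and ne: "V \<noteq> {}" and z: "\<And>i. i < N \<Longrightarrow> reg V (z i)" "alg_indep N V z"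
  shows "\<exists>V' D. openin T V' \<and> V' \<noteq> {} \<and> V' \<subseteq> V \<and>
     (\<forall>i<N. vfield V' (D i) \<and> (\<forall>j<N. \<forall>P\<in>V'. D i (z j) P = (if i = j then 1 else 0)))"
proof -
  have V: "openin T V" using C by (simp add: coords_def)
  let ?b = "\<lambda>i. if i < N then z i else a (i - N)"
  have C': "coords V (N + r) ?b"
    unfolding coords_def
  proof (intro conjI allI impI V)
    show "reg V (?b k)" if "k < N + r" for k
      using that z(1) coords_reg[OF C] by auto
    fix V1 f P assume 1: "V1 \<subseteq> V \<and> reg V1 f \<and> P \<in> V1"
    obtain V' g h where V': "openin T V'" "P \<in> V'" "V' \<subseteq> V1" "g \<in> polys r" "h \<in> polys r"
        "\<And>Q. Q \<in> V' \<Longrightarrow> peval h (\<lambda>k. a k Q) \<noteq> 0"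
        "\<And>Q. Q \<in> V' \<Longrightarrow> f Q = peval g (\<lambda>k. a k Q) / peval h (\<lambda>k. a k Q)"
      by (rule coords_fraction[OF C, of V1 f P]) (use 1 in auto)
    obtain g' h' where "g' \<in> polys (N + r)" "h' \<in> polys (N + r)"
        "\<forall>b. peval g' b = peval g (\<lambda>k. b (N + k))" "\<forall>b. peval h' b = peval h (\<lambda>k. b (N + k))"
      using polys_shift_variables[OF V'(4)] polys_shift_variables[OF V'(5)] by metis
    then show "\<exists>V' g h. openin T V' \<and> P \<in> V' \<and> V' \<subseteq> V1 \<and> g \<in> polys (N + r) \<and> h \<in> polys (N + r) \<and>
        (\<forall>Q\<in>V'. peval h (\<lambda>k. ?b k Q) \<noteq> 0 \<and> f Q = peval g (\<lambda>k. ?b k Q) / peval h (\<lambda>k. ?b k Q))"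
      using V' by (intro exI[of _ V'] exI[of _ g'] exI[of _ h']) simp
  qed
  define dual where "dual = (\<lambda>i h E. reg V h \<and> (\<exists>P\<in>V. h P \<noteq> 0) \<and> vfield V E \<and>
      (\<forall>j<N. \<forall>P\<in>V. E (z j) P = (if i = j then h P else 0)))"
  have "\<exists>h E. dual i h E" if "i < N" for i
  proof -
    have "tangent V N z (\<lambda>j _. if i = j then 1 else 0)"
      unfolding tangent_def
    proof (intro conjI allI impI ballI V)
      fix p P assume "p \<in> polys N" "\<forall>P\<in>V. peval p (\<lambda>i. z i P) = 0"
      then have "p = 0" using z(2) by (auto simp: alg_indep_def)
      then show "dir_deriv N p (\<lambda>i. z i P) (\<lambda>j. if i = j then 1 else 0) = 0" by simp
    qed (auto simp: z reg_const V)
    then obtain h v where h: "reg V h" "\<exists>P\<in>V. h P \<noteq> 0" "tangent V (N + r) ?b v"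
        "\<forall>j<N. \<forall>P\<in>V. v j P = h P * (if i = j then 1 else 0)"
      using tangent_extend_many[OF V, of N z _ r a] coords_reg[OF C]
        alg_over_parameters[OF V ne z coords_reg[OF C]] ne by blast
    obtain E where E: "vfield V E" "\<forall>k<N + r. \<forall>P\<in>V. E (?b k) P = v k P"
      using vfield_of_tangent[OF C' h(3)] by blast
    have "E (z j) P = (if i = j then h P else 0)" if "j < N" "P \<in> V" for j P
      using E(2)[rule_format, of j P] h(4) that by simp
    then show ?thesis
      using h(1,2) E(1) unfolding dual_def by (intro exI[of _ h] exI[of _ E]) simp
  qed
  then obtain h E where "\<And>i. i < N \<Longrightarrow> dual i (h i) (E i)"
    by metis
  then have h: "\<And>i. i < N \<Longrightarrow> reg V (h i)" "\<And>i. i < N \<Longrightarrow> \<exists>P\<in>V. h i P \<noteq> 0"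
      "\<And>i. i < N \<Longrightarrow> vfield V (E i)"
      "\<And>i j P. i < N \<Longrightarrow> j < N \<Longrightarrow> P \<in> V \<Longrightarrow> E i (z j) P = (if i = j then h i P else 0)"
    by (simp_all add: dual_def)
  obtain V' where V': "openin T V'" "V' \<noteq> {}" "V' \<subseteq> V" "\<forall>i\<in>{..<N}. \<forall>P\<in>V'. h i P \<noteq> 0"
    using finite_nonzero[of "{..<N}" V h] V ne h(1,2) by auto
  let ?D = "\<lambda>i f P. \<Sum>_\<in>{()}. inverse (h i P) * E i f P"
  have "vfield V' (?D i)" if "i < N" for i
    using V'(4) that by (intro vfield_combination V'(1) reg_inverse vfield_subset[OF h(3)[OF that] V'(1,3)]
        reg_subset[OF h(1)[OF that] V'(1,3)]) auto
  moreover have "?D i (z j) P = (if i = j then 1 else 0)" if "i < N" "j < N" "P \<in> V'" for i j P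
    using h(4) V' that by auto
  ultimately show ?thesis
    using V'(1-3) by (intro exI[of _ V'] exI[of _ ?D]) simp
qed

lemma transcendence_basis: "\<exists>U z. openin T U \<and> U \<noteq> {} \<and> (\<forall>i<N. reg U (z i)) \<and> alg_indep N U z"
proof -
  have "\<exists>U z. openin T U \<and> U \<noteq> {} \<and> (\<forall>i<N. z i \<in> A U) \<and> alg_indep N U z"
    using dimension by (simp add: has_dimension_def fun_ring_def)
  then show ?thesis using reg_of_functions by meson
qed

end

section \<open>Etale charts near smooth points\<close>

context function_space
begin

subsection \<open>Differentials\<close>

text \<open>\<open>dg = \<Sum>\<^sub>l \<gamma>\<^sub>l da\<^sub>l\<close> on \<open>W\<close>, tested against all derivations of all smaller open sets.\<close>

definition differential :: "'p set \<Rightarrow> nat \<Rightarrow> (nat \<Rightarrow> 'p \<Rightarrow> 'k) \<Rightarrow> ('p \<Rightarrow> 'k) \<Rightarrow> (nat \<Rightarrow> 'p \<Rightarrow> 'k) \<Rightarrow> bool" where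
  "differential W r a g \<gamma> \<longleftrightarrow> (\<forall>l<r. reg W (\<gamma> l)) \<and>
     (\<forall>V D. V \<subseteq> W \<and> derives V D \<longrightarrow> (\<forall>Q\<in>V. D g Q = (\<Sum>l<r. \<gamma> l Q * D (a l) Q)))"

lemma differentialD:
  "differential W r a g \<gamma> \<Longrightarrow> derives V D \<Longrightarrow> V \<subseteq> W \<Longrightarrow> Q \<in> V \<Longrightarrow> D g Q = (\<Sum>l<r. \<gamma> l Q * D (a l) Q)"
  by (simp add: differential_def)

lemma differential_subset:
  assumes "differential W r a g \<gamma>" "openin T W'" "W' \<subseteq> W"
  shows "differential W' r a g \<gamma>"
  using assms reg_subset unfolding differential_def by (meson order_trans)

lemma differential_in_coords:
  assumes C: "coords W r a" and g: "reg W g" and P: "P \<in> W"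
  shows "\<exists>W' \<gamma>. openin T W' \<and> P \<in> W' \<and> W' \<subseteq> W \<and> differential W' r a g \<gamma>"
proof -
  note ra = coords_reg[OF C]
  let ?e = "\<lambda>p Q. peval p (\<lambda>k. a k Q)"
  obtain W' G H where W': "openin T W'" "P \<in> W'" "W' \<subseteq> W" "G \<in> polys r" "H \<in> polys r"
      and nz: "\<And>Q. Q \<in> W' \<Longrightarrow> ?e H Q \<noteq> 0" and eq: "\<And>Q. Q \<in> W' \<Longrightarrow> g Q = ?e G Q / ?e H Q"
    by (rule coords_fraction[OF C order_refl g P]) blast
  define \<gamma> where "\<gamma> = (\<lambda>l Q. (?e (ppartial l G) Q - g Q * ?e (ppartial l H) Q) / ?e H Q)"
  have ra': "reg W' (a k)" if "k < r" for k
    using ra[OF that] W' reg_subset by blast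
  have rp: "reg W' (?e p)" if "p \<in> polys r" for p
    using that ra' by (rule reg_peval[OF W'(1)])
  have "differential W' r a g \<gamma>"
    unfolding differential_def
  proof (intro conjI allI impI ballI)
    show "reg W' (\<gamma> l)" if "l < r" for l
      unfolding \<gamma>_def using W' nz
      by (intro reg_divide reg_diff reg_mult rp ppartial_in_polys reg_subset[OF g]) auto
    fix V D Q assume V: "V \<subseteq> W' \<and> derives V D" and Q: "Q \<in> V"
    then have D: "derives V D" and o: "openin T V" by (auto intro: derives_open)
    have raV: "reg V (a k)" if "k < r" for k
      using ra'[OF that] V o reg_subset by blast
    have rV: "reg V (?e G)" "reg V (?e H)" "reg V g"
      using rp W' V o reg_subset g by blast+
    have nzQ: "?e H Q \<noteq> 0"
      using nz[of Q] V Q by blast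
    have "D (?e G) Q = D (\<lambda>Q. ?e H Q * g Q) Q"
      by (rule derives_cong[OF D rV(1) _ Q]) (use V nz eq in auto)
    then have "?e H Q * D g Q = dir_deriv r G (\<lambda>k. a k Q) (\<lambda>k. D (a k) Q)
        - g Q * dir_deriv r H (\<lambda>k. a k Q) (\<lambda>k. D (a k) Q)"
      using derives_peval[OF D W'(4) raV Q] derives_peval[OF D W'(5) raV Q] derives_mult[OF D rV(2,3) Q]
      by (simp add: algebra_simps)
    also have "\<dots> = ?e H Q * (\<Sum>l<r. \<gamma> l Q * D (a l) Q)"
      using nzQ by (simp add: \<gamma>_def dir_deriv_def sum_distrib_left sum_subtractf[symmetric]
          left_diff_distrib mult.assoc)
    finally show "D g Q = (\<Sum>l<r. \<gamma> l Q * D (a l) Q)"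
      using nzQ by simp
  qed
  then show ?thesis using W' by blast
qed

lemma differential_sum_products:
  fixes J :: nat
  assumes W: "openin T W" and g: "\<And>j. j < J \<Longrightarrow> reg W (g j)" "\<And>j. j < J \<Longrightarrow> differential W r a (g j) (\<gamma> j)"
    and h: "\<And>j. j < J \<Longrightarrow> reg W (h j)" "\<And>j. j < J \<Longrightarrow> differential W r a (h j) (\<eta> j)"
    and f: "\<And>Q. Q \<in> W \<Longrightarrow> f Q = (\<Sum>j<J. g j Q * h j Q)"
  shows "differential W r a f (\<lambda>l Q. \<Sum>j<J. g j Q * \<eta> j l Q + h j Q * \<gamma> j l Q)"
  unfolding differential_def
proof (intro conjI allI impI ballI)
  show "reg W (\<lambda>Q. \<Sum>j<J. g j Q * \<eta> j l Q + h j Q * \<gamma> j l Q)" if "l < r" for l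
    using g h that by (intro reg_sum[OF W] reg_add reg_mult) (auto simp: differential_def)
  fix V D Q assume V: "V \<subseteq> W \<and> derives V D" and Q: "Q \<in> V"
  then have D: "derives V D" and VW: "V \<subseteq> W" and o: "openin T V" by (auto intro: derives_open)
  have rV: "reg V (g j)" "reg V (h j)" if "j < J" for j
    using g(1) h(1) that VW o reg_subset by blast+
  have rgh: "reg V (\<lambda>Q. \<Sum>j<J. g j Q * h j Q)"
    using rV by (intro reg_sum[OF o] reg_mult) auto
  have "D f Q = D (\<lambda>Q. \<Sum>j<J. g j Q * h j Q) Q"
    by (rule derives_cong[OF D rgh _ Q, symmetric]) (use f VW in auto)
  also have "\<dots> = (\<Sum>j<J. D (\<lambda>Q. g j Q * h j Q) Q)"
    by (rule derives_sum[OF D _ Q]) (use rV reg_mult in auto)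
  also have "\<dots> = (\<Sum>j<J. g j Q * (\<Sum>l<r. \<eta> j l Q * D (a l) Q) + h j Q * (\<Sum>l<r. \<gamma> j l Q * D (a l) Q))"
  proof (intro sum.cong refl)
    fix j assume "j \<in> {..<J}"
    then have j: "j < J" by simp
    show "D (\<lambda>Q. g j Q * h j Q) Q
        = g j Q * (\<Sum>l<r. \<eta> j l Q * D (a l) Q) + h j Q * (\<Sum>l<r. \<gamma> j l Q * D (a l) Q)"
      unfolding derives_mult[OF D rV[OF j] Q] differentialD[OF g(2)[OF j] D VW Q]
        differentialD[OF h(2)[OF j] D VW Q] ..
  qed
  also have "\<dots> = (\<Sum>l<r. (\<Sum>j<J. g j Q * \<eta> j l Q + h j Q * \<gamma> j l Q) * D (a l) Q)"
    unfolding sum_distrib_left sum_distrib_right sum.distrib[symmetric]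
    by (subst sum.swap) (simp add: algebra_simps)
  finally show "D f Q = (\<Sum>l<r. (\<Sum>j<J. g j Q * \<eta> j l Q + h j Q * \<gamma> j l Q) * D (a l) Q)" .
qed

lemma in_max_ideal_square_cong:
  assumes "in_max_ideal_square T R P V f" "\<And>Q. Q \<in> V \<Longrightarrow> f Q = g Q"
  shows "in_max_ideal_square T R P V g"
proof -
  obtain W J G h where *: "openin T W" "P \<in> W" "W \<subseteq> V"
      "\<forall>j<(J::nat). G j \<in> carrier (R W) \<and> h j \<in> carrier (R W) \<and> G j P = 0 \<and> h j P = 0"
      "\<forall>Q\<in>W. f Q = (\<Sum>j<J. G j Q * h j Q)"
    using assms(1) unfolding in_max_ideal_square_def by (elim exE conjE) (rule that)
  have "\<forall>Q\<in>W. g Q = (\<Sum>j<J. G j Q * h j Q)"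
    using *(3,5) assms(2) by (metis subsetD)
  then show ?thesis
    unfolding in_max_ideal_square_def using *(1-4) by (intro exI conjI)
qed

lemma max_square_differential:
  assumes C: "coords W0 r a" and P: "P \<in> W0" and f: "in_max_ideal_square T R P W0 f"
  shows "\<exists>W B. openin T W \<and> P \<in> W \<and> W \<subseteq> W0 \<and> differential W r a f B \<and> (\<forall>l<r. B l P = 0)"
proof -
  obtain W1 J g h where W1: "openin T W1" "P \<in> W1" "W1 \<subseteq> W0"
      and gh: "\<forall>j<(J::nat). g j \<in> carrier (R W1) \<and> h j \<in> carrier (R W1) \<and> g j P = 0 \<and> h j P = 0"
      and eq: "\<forall>Q\<in>W1. f Q = (\<Sum>j<J. g j Q * h j Q)"
    using f unfolding in_max_ideal_square_def by (elim exE conjE) (rule that)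
  have C1: "coords W1 r a" by (rule coords_subset[OF C W1(1,3)])
  have r: "reg W1 (g j)" "reg W1 (h j)" if "j < J" for j
    using gh that W1(1) reg_of_functions by (auto simp: fun_ring_def)
  have "\<exists>W. openin T W \<and> P \<in> W \<and> W \<subseteq> W1 \<and>
      (\<forall>j\<in>{..<J}. (\<exists>\<gamma>. differential W r a (g j) \<gamma>) \<and> (\<exists>\<eta>. differential W r a (h j) \<eta>))"
  proof (rule finite_neighbourhood[of _ W1 P "\<lambda>j W. (\<exists>\<gamma>. differential W r a (g j) \<gamma>) \<and> (\<exists>\<eta>. differential W r a (h j) \<eta>)"])
    fix j assume "j \<in> {..<J}"
    then have j: "j < J" by simp
    obtain Wg \<gamma> where "openin T Wg" "P \<in> Wg" "differential Wg r a (g j) \<gamma>"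
      using differential_in_coords[OF C1 r(1)[OF j] W1(2)] by blast
    moreover obtain Wh \<eta> where "openin T Wh" "P \<in> Wh" "differential Wh r a (h j) \<eta>"
      using differential_in_coords[OF C1 r(2)[OF j] W1(2)] by blast
    ultimately have "openin T (Wg \<inter> Wh)" "P \<in> Wg \<inter> Wh" "differential (Wg \<inter> Wh) r a (g j) \<gamma>"
        "differential (Wg \<inter> Wh) r a (h j) \<eta>"
      using differential_subset[of Wg r a "g j" \<gamma> "Wg \<inter> Wh"] differential_subset[of Wh r a "h j" \<eta> "Wg \<inter> Wh"]
      by auto
    then show "\<exists>W. openin T W \<and> P \<in> W \<and> (\<exists>\<gamma>. differential W r a (g j) \<gamma>) \<and> (\<exists>\<eta>. differential W r a (h j) \<eta>)"
      by blast
  qed (use W1 differential_subset in blast)+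
  then obtain W where W: "openin T W" "P \<in> W" "W \<subseteq> W1"
      "\<forall>j\<in>{..<J}. (\<exists>\<gamma>. differential W r a (g j) \<gamma>) \<and> (\<exists>\<eta>. differential W r a (h j) \<eta>)"
    by blast
  then obtain \<gamma> \<eta> where d: "\<And>j. j < J \<Longrightarrow> differential W r a (g j) (\<gamma> j)" "\<And>j. j < J \<Longrightarrow> differential W r a (h j) (\<eta> j)"
    by (metis lessThan_iff)
  have "differential W r a f (\<lambda>l Q. \<Sum>j<J. g j Q * \<eta> j l Q + h j Q * \<gamma> j l Q)"
    by (rule differential_sum_products[OF W(1) _ d(1) _ d(2)])
      (use r W eq in \<open>auto intro: reg_subset\<close>)
  then show ?thesis
    using W W1 gh by (intro exI[of _ W] exI[of _ "\<lambda>l Q. \<Sum>j<J. g j Q * \<eta> j l Q + h j Q * \<gamma> j l Q"]) auto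
qed

lemma reg_det:
  assumes U: "openin T U" and F: "\<And>i j. i < n \<Longrightarrow> j < n \<Longrightarrow> reg U (F i j)"
  shows "reg U (\<lambda>Q. det (mat n n (\<lambda>(i, j). F i j Q)))"
proof -
  have "det (mat n n (\<lambda>(i, j). F i j Q))
      = (\<Sum>p\<in>{p. p permutes {0..<n}}. signof p * (\<Prod>i\<in>{0..<n}. F i (p i) Q))" for Q
    by (subst det_def'[where n = n]) (auto intro!: sum.cong prod.cong arg_cong2[of _ _ _ _ "(*)"] simp: permutes_in_image)
  moreover have "reg U (\<lambda>Q. \<Sum>p\<in>{p. p permutes {0..<n}}. signof p * (\<Prod>i\<in>{0..<n}. F i (p i) Q))"
    using F by (intro reg_sum[OF U] reg_mult[OF reg_const[OF U]] reg_prod[OF U]) (auto simp: permutes_in_image)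
  ultimately show ?thesis by simp
qed

lemma reg_adj_mat:
  assumes U: "openin T U" and F: "\<And>i j. i < n \<Longrightarrow> j < n \<Longrightarrow> reg U (F i j)" and kl: "k < n" "l < n"
  shows "reg U (\<lambda>Q. adj_mat (mat n n (\<lambda>(i, j). F i j Q)) $$ (k, l))"
proof -
  let ?s = "\<lambda>k i. if i < k then i else Suc i"
  have "adj_mat (mat n n (\<lambda>(i, j). F i j Q)) $$ (k, l)
      = (-1) ^ (l + k) * det (mat (n - 1) (n - 1) (\<lambda>(i, j). F (?s l i) (?s k j) Q))" for Q
  proof -
    have "mat_delete (mat n n (\<lambda>(i, j). F i j Q)) l k = mat (n - 1) (n - 1) (\<lambda>(i, j). F (?s l i) (?s k j) Q)"
      using kl by (intro eq_matI) (auto simp: mat_delete_def)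
    then show ?thesis
      using kl by (simp add: adj_mat_def cofactor_def)
  qed
  moreover have "reg U (\<lambda>Q. (-1) ^ (l + k) * det (mat (n - 1) (n - 1) (\<lambda>(i, j). F (?s l i) (?s k j) Q)))"
    using kl by (intro reg_mult[OF reg_const[OF U]] reg_det[OF U] F) auto
  ultimately show ?thesis by simp
qed

text \<open>Nakayama's lemma for the cotangent space: modulo the square of the maximal ideal each coordinate
  is a linear combination \<open>c t\<close> of the parameters, so \<open>(1 - B) da = c dt\<close> with \<open>B(P) = 0\<close>, and \<open>1 - B\<close>
  is invertible near \<open>P\<close>.\<close>

lemma differentials_of_coords:
  assumes C: "coords W0 r a" and P: "P \<in> W0" and t: "\<And>i. i < N \<Longrightarrow> reg W0 (t i)"
    and sq: "\<And>k. k < r \<Longrightarrow> \<exists>c. in_max_ideal_square T R P W0 (\<lambda>Q. (a k Q - a k P) - (\<Sum>i<N. c i * t i Q))"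
  shows "\<exists>W E. openin T W \<and> P \<in> W \<and> W \<subseteq> W0 \<and> (\<forall>k<r. differential W N t (a k) (E k))"
proof -
  have "\<forall>k. \<exists>c. k < r \<longrightarrow> in_max_ideal_square T R P W0 (\<lambda>Q. (a k Q - a k P) - (\<Sum>i<N. c i * t i Q))"
    using sq by blast
  then obtain c where "\<forall>k. k < r \<longrightarrow> in_max_ideal_square T R P W0 (\<lambda>Q. (a k Q - a k P) - (\<Sum>i<N. c k i * t i Q))"
    by (elim choice[THEN exE]) (rule that)
  then have c: "\<And>k. k < r \<Longrightarrow> in_max_ideal_square T R P W0 (\<lambda>Q. (a k Q - a k P) - (\<Sum>i<N. c k i * t i Q))"
    by blast
  define f where "f = (\<lambda>k Q. (a k Q - a k P) - (\<Sum>i<N. c k i * t i Q))"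
  have W0: "openin T W0" using C by (simp add: coords_def)
  have "\<exists>W. openin T W \<and> P \<in> W \<and> W \<subseteq> W0 \<and> (\<forall>k\<in>{..<r}. \<exists>B. differential W r a (f k) B \<and> (\<forall>l<r. B l P = 0))"
  proof (rule finite_neighbourhood[of _ W0 P "\<lambda>k W. \<exists>B. differential W r a (f k) B \<and> (\<forall>l<r. B l P = 0)"])
    fix k assume "k \<in> {..<r}"
    then have "in_max_ideal_square T R P W0 (f k)"
      unfolding f_def using c by simp
    from max_square_differential[OF C P this]
    show "\<exists>W. openin T W \<and> P \<in> W \<and> (\<exists>B. differential W r a (f k) B \<and> (\<forall>l<r. B l P = 0))"
      by blast
  qed (use W0 P differential_subset in blast)+
  then obtain W B where W: "openin T W" "P \<in> W" "W \<subseteq> W0"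
      and B: "\<And>k. k < r \<Longrightarrow> differential W r a (f k) (B k)" "\<And>k l. k < r \<Longrightarrow> l < r \<Longrightarrow> B k l P = 0"
    by (metis lessThan_iff)
  define F where "F = (\<lambda>k l Q. (if k = l then 1 else 0) - B k l Q)"
  define M where "M = (\<lambda>Q. mat r r (\<lambda>(k, l). F k l Q))"
  have rF: "reg W (F k l)" if "k < r" "l < r" for k l
    using B(1)[OF that(1)] that unfolding F_def by (intro reg_diff reg_const W) (auto simp: differential_def)
  have rdet: "reg W (\<lambda>Q. det (M Q))"
    unfolding M_def by (rule reg_det[OF W(1) rF])
  have "M P = 1\<^sub>m r"
    unfolding M_def F_def using B(2) by (intro eq_matI) auto
  then have detP: "det (M P) \<noteq> 0" by simp
  define W' where "W' = {Q \<in> W. det (M Q) \<noteq> 0}"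
  have W': "openin T W'" "P \<in> W'" "W' \<subseteq> W" "\<And>Q. Q \<in> W' \<Longrightarrow> det (M Q) \<noteq> 0"
    using reg_nonzero_open[OF rdet] detP W by (auto simp: W'_def)
  define E where "E = (\<lambda>k i Q. (\<Sum>l<r. adj_mat (M Q) $$ (k, l) * c l i) / det (M Q))"
  have "differential W' N t (a k) (E k)" if k: "k < r" for k
    unfolding differential_def
  proof (intro conjI allI impI ballI)
    have "reg W (\<lambda>Q. \<Sum>l<r. adj_mat (M Q) $$ (k, l) * c l i)" for i
      unfolding M_def by (intro reg_sum[OF W(1)] reg_mult reg_adj_mat[OF W(1) rF] reg_const W(1)) (use k in auto)
    then show "reg W' (E k i)" for i
      unfolding E_def using rdet W' reg_subset by (intro reg_divide) blast+
    fix V D Q assume V: "V \<subseteq> W' \<and> derives V D" and Q: "Q \<in> V"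
    then have D: "derives V D" and o: "openin T V" and VW: "V \<subseteq> W" "V \<subseteq> W'" "V \<subseteq> W0"
      using W W' by (auto intro: derives_open)
    have rV: "reg V (a l)" if "l < r" for l
      using coords_reg[OF C that] VW o reg_subset by blast
    have tV: "reg V (t i)" if "i < N" for i
      using t[OF that] VW o reg_subset by blast
    have Df: "(\<Sum>m<r. F l m Q * D (a m) Q) = (\<Sum>i<N. c l i * D (t i) Q)" if l: "l < r" for l
    proof -
      have rs: "reg V (\<lambda>Q. \<Sum>i<N. c l i * t i Q)" "reg V (\<lambda>Q. a l Q - a l P)"
        using tV rV[OF l] by (auto intro!: reg_sum[OF o] reg_mult reg_diff reg_const o)
      have "D (f l) Q = D (\<lambda>Q. a l Q - a l P) Q - D (\<lambda>Q. \<Sum>i<N. c l i * t i Q) Q"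
        unfolding f_def by (rule derives_diff[OF D rs(2,1) Q])
      also have "D (\<lambda>Q. a l Q - a l P) Q = D (a l) Q"
        using derives_diff[OF D rV[OF l] reg_const[OF o] Q] derives_const[OF D Q] by simp
      also have "D (\<lambda>Q. \<Sum>i<N. c l i * t i Q) Q = (\<Sum>i<N. c l i * D (t i) Q)"
        using tV derives_sum[OF D _ Q, of "{..<N}" "\<lambda>i Q. c l i * t i Q"] derives_scale[OF D _ Q]
        by (simp add: reg_mult reg_const[OF o])
      finally have "D (a l) Q - (\<Sum>m<r. B l m Q * D (a m) Q) = (\<Sum>i<N. c l i * D (t i) Q)"
        using differentialD[OF B(1)[OF l] D VW(1) Q] by (simp add: algebra_simps)
      moreover have "(\<Sum>m<r. F l m Q * D (a m) Q) = D (a l) Q - (\<Sum>m<r. B l m Q * D (a m) Q)"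
      proof -
        have "(\<Sum>m<r. F l m Q * D (a m) Q) = (\<Sum>m<r. (if m = l then D (a m) Q else 0) - B l m Q * D (a m) Q)"
          unfolding F_def by (intro sum.cong refl) (auto simp: left_diff_distrib)
        then show ?thesis using l by (simp add: sum_subtractf)
      qed
      ultimately show ?thesis by simp
    qed
    have Mc: "M Q \<in> carrier_mat r r" by (simp add: M_def)
    have adj: "(\<Sum>l<r. adj_mat (M Q) $$ (k, l) * F l m Q) = (if k = m then det (M Q) else 0)" if m: "m < r" for m
    proof -
      have "(adj_mat (M Q) * M Q) $$ (k, m) = (\<Sum>l<r. adj_mat (M Q) $$ (k, l) * F l m Q)"
        using k m adj_mat(1)[OF Mc] by (simp add: M_def scalar_prod_def lessThan_atLeast0)
      then show ?thesis
        using k m by (simp add: adj_mat(3)[OF Mc] split: if_splits)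
    qed
    have "(\<Sum>l<r. adj_mat (M Q) $$ (k, l) * (\<Sum>m<r. F l m Q * D (a m) Q))
        = (\<Sum>m<r. (\<Sum>l<r. adj_mat (M Q) $$ (k, l) * F l m Q) * D (a m) Q)"
      unfolding sum_distrib_left sum_distrib_right by (subst sum.swap) (simp add: mult.assoc)
    also have "\<dots> = (\<Sum>m<r. if k = m then det (M Q) * D (a m) Q else 0)"
      by (intro sum.cong refl) (simp add: adj)
    also have "\<dots> = det (M Q) * D (a k) Q"
      using k by simp
    finally have "det (M Q) * D (a k) Q = (\<Sum>l<r. adj_mat (M Q) $$ (k, l) * (\<Sum>i<N. c l i * D (t i) Q))"
      using Df by simp
    also have "\<dots> = (\<Sum>i<N. (\<Sum>l<r. adj_mat (M Q) $$ (k, l) * c l i) * D (t i) Q)"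
      unfolding sum_distrib_left sum_distrib_right by (subst sum.swap) (simp add: mult.assoc)
    also have "\<dots> = det (M Q) * (\<Sum>i<N. E k i Q * D (t i) Q)"
      using W'(4)[of Q] VW Q unfolding E_def sum_distrib_left by (intro sum.cong refl) auto
    finally show "D (a k) Q = (\<Sum>i<N. E k i Q * D (t i) Q)"
      using W'(4)[of Q] VW Q by auto
  qed
  then show ?thesis
    using W W' by (intro exI[of _ W'] exI[of _ E]) auto
qed

lemma coords_of_affine_open:
  assumes "affine_open T R U"
  shows "\<exists>r a. coords U r a"
proof -
  obtain r Z \<psi> where U: "openin T U" and Z: "closedin (affine_zariski r) Z"
      and \<psi>: "homeomorphic_map (subtopology T U) (subtopology (affine_zariski r) Z) \<psi>"
      and fn: "\<And>V f. openin (subtopology (affine_zariski r) Z) V \<Longrightarrow> f \<in> extensional V \<Longrightarrow>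
         f \<in> affine_regular_functions r Z V \<longleftrightarrow> (\<lambda>P \<in> {P\<in>U. \<psi> P \<in> V}. f (\<psi> P)) \<in> A {P\<in>U. \<psi> P \<in> V}"
    using assms by (auto simp: affine_open_def fun_ring_def)
  let ?Y = "subtopology (affine_zariski r) Z"
  have topU: "topspace (subtopology T U) = U"
    using openin_subset[OF U] by auto
  have topZ: "topspace ?Y = Z"
    using closedin_subset[OF Z] by auto
  have img: "\<psi> ` U = Z" and inj: "inj_on \<psi> U"
    using homeomorphic_imp_surjective_map[OF \<psi>] homeomorphic_imp_injective_map[OF \<psi>] topU topZ by auto
  have openi: "openin ?Y (\<psi> ` V)" if "openin T V" "V \<subseteq> U" for V
    using homeomorphic_map_openness_eq[OF \<psi>, of V] that U by (simp add: openin_open_subtopology)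
  have pre: "openin T {P \<in> U. \<psi> P \<in> V}" if "openin ?Y V" for V
  proof -
    have "openin (subtopology T U) {P \<in> topspace (subtopology T U). \<psi> P \<in> V}"
      by (rule openin_continuous_map_preimage[OF homeomorphic_imp_continuous_map[OF \<psi>] that])
    then show ?thesis
      unfolding topU using U by (simp only: openin_open_subtopology)
  qed
  define a where "a = (\<lambda>(k::nat) P. \<psi> P k)"
  have "reg U (a k)" if k: "k < r" for k
  proof -
    have Y: "openin ?Y Z" using topZ openin_topspace[of ?Y] by simp
    have "\<exists>V g h. openin ?Y V \<and> b \<in> V \<and> V \<subseteq> Z \<and> g \<in> polys r \<and> h \<in> polys r \<and>
        (\<forall>c\<in>V. peval h c \<noteq> 0 \<and> restrict (\<lambda>b. b k) Z c = peval g c / peval h c)" if "b \<in> Z" for b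
      using Y that k by (intro exI[of _ Z] exI[of _ "pvar k"] exI[of _ 1]) (auto simp: pvar_in_polys one_in_polys)
    then have "restrict (\<lambda>b. b k) Z \<in> affine_regular_functions r Z Z"
      unfolding affine_regular_functions_def by blast
    then have "(\<lambda>P \<in> {P\<in>U. \<psi> P \<in> Z}. restrict (\<lambda>b. b k) Z (\<psi> P)) \<in> A {P\<in>U. \<psi> P \<in> Z}"
      using fn[OF Y] by blast
    moreover have "{P\<in>U. \<psi> P \<in> Z} = U" using img by auto
    moreover have "(\<lambda>P\<in>U. restrict (\<lambda>b. b k) Z (\<psi> P)) = restrict (a k) U"
      using img by (auto simp: a_def restrict_def)
    ultimately show ?thesis using U by (simp add: reg_def)
  qed
  moreover have "\<exists>V' g h. openin T V' \<and> P \<in> V' \<and> V' \<subseteq> V \<and> g \<in> polys r \<and> h \<in> polys r \<and>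
      (\<forall>Q\<in>V'. peval h (\<lambda>k. a k Q) \<noteq> 0 \<and> f Q = peval g (\<lambda>k. a k Q) / peval h (\<lambda>k. a k Q))"
    if V: "V \<subseteq> U" "reg V f" "P \<in> V" for V f P
  proof -
    have o: "openin ?Y (\<psi> ` V)" using openi reg_open[OF V(2)] V(1) .
    let ?f = "\<lambda>b\<in>\<psi> ` V. f (inv_into U \<psi> b)"
    have VV: "{P\<in>U. \<psi> P \<in> \<psi> ` V} = V" using inj V(1) by (auto dest: inj_onD)
    have inv: "inv_into U \<psi> (\<psi> Q) = Q" if "Q \<in> V" for Q
      using that V(1) inj by (simp add: inv_into_f_f subsetD)
    have "(\<lambda>P\<in>V. ?f (\<psi> P)) = restrict f V"
      using inv by (intro restrict_ext) auto
    then have "?f \<in> affine_regular_functions r Z (\<psi> ` V)"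
      using fn[OF o, of ?f] V(2) unfolding VV by (simp add: reg_def)
    then obtain Y g h where Y: "openin ?Y Y" "\<psi> P \<in> Y" "Y \<subseteq> \<psi> ` V" "g \<in> polys r" "h \<in> polys r"
        "\<forall>b\<in>Y. peval h b \<noteq> 0 \<and> ?f b = peval g b / peval h b"
      using V(3) unfolding affine_regular_functions_def by blast
    have sub: "{P \<in> U. \<psi> P \<in> Y} \<subseteq> V" using Y(3) VV by blast
    show ?thesis
    proof (intro exI conjI ballI)
      show "openin T {P \<in> U. \<psi> P \<in> Y}" using pre[OF Y(1)] .
      show "P \<in> {P \<in> U. \<psi> P \<in> Y}" using Y V by auto
      show "{P \<in> U. \<psi> P \<in> Y} \<subseteq> V" by (rule sub)
      show "g \<in> polys r" "h \<in> polys r" by fact+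
      fix Q assume Q: "Q \<in> {P \<in> U. \<psi> P \<in> Y}"
      then have "Q \<in> V" using sub by blast
      have "?f (\<psi> Q) = f Q"
        using \<open>Q \<in> V\<close> inv by simp
      moreover have "(\<lambda>k. a k Q) = \<psi> Q" by (simp add: a_def)
      moreover have "peval h (\<psi> Q) \<noteq> 0 \<and> ?f (\<psi> Q) = peval g (\<psi> Q) / peval h (\<psi> Q)"
        using Y(6) Q by blast
      ultimately show "peval h (\<lambda>k. a k Q) \<noteq> 0" "f Q = peval g (\<lambda>k. a k Q) / peval h (\<lambda>k. a k Q)"
        by simp_all
    qed
  qed
  ultimately have "coords U r a"
    unfolding coords_def using U by blast
  then show ?thesis by blast
qed

lemma cring_functions:
  assumes "openin T U"
  shows "cring (R U)"
proof -
  note U = assms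
  have r: "reg U f" if "f \<in> A U" for f
    using that U reg_of_functions by blast
  have rA: "restrict f U \<in> A U" if "reg U f" for f
    using that by (simp add: reg_def)
  have ext: "f \<in> extensional U" if "f \<in> A U" for f
    using functions_extensional[OF U that] .
  have eqI: "f = g" if "f \<in> extensional U" "g \<in> extensional U" "\<And>P. P \<in> U \<Longrightarrow> f P = g P" for f g :: "'p \<Rightarrow> 'k"
    using that by (rule extensionalityI)
  show ?thesis
  proof (rule cringI)
    show "abelian_group (R U)"
    proof (rule abelian_groupI; unfold fun_ring_def ring.simps partial_object.simps monoid.simps)
      fix f g h assume f: "f \<in> A U" and g: "g \<in> A U" and h: "h \<in> A U"
      show "(\<lambda>P\<in>U. f P + g P) \<in> A U" using reg_add[OF r[OF f] r[OF g]] by (rule rA)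
      show "(\<lambda>P\<in>U. (\<lambda>P\<in>U. f P + g P) P + h P) = (\<lambda>P\<in>U. f P + (\<lambda>P\<in>U. g P + h P) P)"
        "(\<lambda>P\<in>U. f P + g P) = (\<lambda>P\<in>U. g P + f P)"
        by (auto intro!: restrict_ext simp: algebra_simps)
      show "(\<lambda>P\<in>U. (\<lambda>P\<in>U. 0) P + f P) = f"
        using ext[OF f] by (intro eqI) auto
      show "\<exists>y\<in>A U. (\<lambda>P\<in>U. y P + f P) = (\<lambda>P\<in>U. 0)"
        using rA[OF reg_uminus[OF r[OF f]]] by (intro bexI[of _ "\<lambda>P\<in>U. - f P"]) (auto intro!: restrict_ext)
    qed (use rA[OF reg_const[OF U]] in auto)
    show "comm_monoid (R U)"
    proof (rule comm_monoidI; unfold fun_ring_def ring.simps partial_object.simps monoid.simps)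
      fix f g h assume f: "f \<in> A U" and g: "g \<in> A U" and h: "h \<in> A U"
      show "(\<lambda>P\<in>U. f P * g P) \<in> A U" using reg_mult[OF r[OF f] r[OF g]] by (rule rA)
      show "(\<lambda>P\<in>U. (\<lambda>P\<in>U. f P * g P) P * h P) = (\<lambda>P\<in>U. f P * (\<lambda>P\<in>U. g P * h P) P)"
        "(\<lambda>P\<in>U. f P * g P) = (\<lambda>P\<in>U. g P * f P)"
        by (auto intro!: restrict_ext simp: algebra_simps)
      show "(\<lambda>P\<in>U. (\<lambda>P\<in>U. 1) P * f P) = f"
        using ext[OF f] by (intro eqI) auto
    qed (use rA[OF reg_const[OF U]] in auto)
  qed (auto simp: fun_ring_def intro!: restrict_ext simp: algebra_simps)
qed

text \<open>Over \<open>R W\<close> an equation with nonvanishing leading coefficient is a nonzero polynomial.\<close>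

lemma not_transcendental_if_alg_over:
  assumes W: "openin T W" and t: "\<And>i. i < N \<Longrightarrow> reg W (t i)" and f: "f \<in> A W" and alg: "alg_over W N t f"
  shows "\<not> ring.transcendental (R W) {\<lambda>P\<in>W. peval p (\<lambda>j. t j P) | p. p \<in> polys N} f"
proof
  interpret cring "R W" by (rule cring_functions[OF W])
  let ?K = "{\<lambda>P\<in>W. peval p (\<lambda>j. t j P) | p. p \<in> polys N}"
  assume tr: "transcendental ?K f"
  obtain c d where c: "\<forall>j. c j \<in> polys N" "\<exists>P\<in>W. peval (c d) (\<lambda>i. t i P) \<noteq> 0"
     "\<forall>P\<in>W. (\<Sum>j\<le>d. peval (c j) (\<lambda>i. t i P) * f P ^ j) = 0"
    using alg unfolding alg_over_def by blast
  define e where "e = (\<lambda>j. \<lambda>P\<in>W. peval (c j) (\<lambda>i. t i P))"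
  have pow: "f [^]\<^bsub>R W\<^esub> (j::nat) = (\<lambda>P\<in>W. f P ^ j)" for j
    by (induction j) (auto simp: fun_ring_def nat_pow_def intro!: restrict_ext)
  have ev: "eval (map e (rev [0..<j])) f = (\<lambda>P\<in>W. \<Sum>i<j. peval (c i) (\<lambda>i. t i P) * f P ^ i)" for j
  proof (induction j)
    case (Suc j)
    have "eval (map e (rev [0..<Suc j])) f = e j \<otimes>\<^bsub>R W\<^esub> (f [^]\<^bsub>R W\<^esub> j) \<oplus>\<^bsub>R W\<^esub> eval (map e (rev [0..<j])) f"
      by simp
    also have "\<dots> = (\<lambda>P\<in>W. \<Sum>i<Suc j. peval (c i) (\<lambda>i. t i P) * f P ^ i)"
      unfolding Suc pow by (auto simp: e_def fun_ring_def fun_eq_iff restrict_def add.commute)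
    finally show ?case .
  next
    case 0
    have "\<zero>\<^bsub>R W\<^esub> = (\<lambda>P\<in>W. 0)" by (simp add: fun_ring_def)
    then show ?case by simp
  qed
  let ?q = "map e (rev [0..<Suc d])"
  have "eval ?q f = \<zero>\<^bsub>R W\<^esub>"
    unfolding ev using c(3) by (auto simp: fun_ring_def lessThan_Suc_atMost intro!: restrict_ext)
  moreover have "e d \<noteq> \<zero>\<^bsub>R W\<^esub>"
  proof -
    obtain P where P: "P \<in> W" "peval (c d) (\<lambda>i. t i P) \<noteq> 0" using c(2) by blast
    then have "e d P \<noteq> \<zero>\<^bsub>R W\<^esub> P" by (simp add: e_def fun_ring_def)
    then show ?thesis by metis
  qed
  then have "?q \<in> carrier (?K[X]\<^bsub>R W\<^esub>)"
    unfolding univ_poly_carrier[symmetric] polynomial_def using c(1) by (auto simp: e_def)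
  moreover have "[] \<in> carrier (?K[X]\<^bsub>R W\<^esub>)"
    unfolding univ_poly_carrier[symmetric] polynomial_def by simp
  ultimately have "?q = []"
    using tr inj_onD[of "\<lambda>p. eval p f" "carrier (?K[X]\<^bsub>R W\<^esub>)" ?q "[]"]
    unfolding transcendental_def by simp
  then show False by simp
qed

lemma derives_difference:
  assumes D: "derives V D" and E: "derives V E"
  shows "derives V (\<lambda>f P. D f P - E f P)"
  unfolding derives_def
proof (intro conjI allI impI ballI)
  show "openin T V" by (rule derives_open[OF D])
  show "reg V (\<lambda>P. D f P - E f P)" if "reg V f" for f
    by (rule reg_diff[OF derives_reg[OF D that] derives_reg[OF E that]])
  fix f g P assume fg: "reg V f \<and> reg V g" "P \<in> V"
  then have f: "reg V f" and g: "reg V g" by auto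
  show "D (\<lambda>Q. f Q + g Q) P - E (\<lambda>Q. f Q + g Q) P = D f P - E f P + (D g P - E g P)"
    unfolding derives_add[OF D f g fg(2)] derives_add[OF E f g fg(2)] by simp
  show "D (\<lambda>Q. f Q * g Q) P - E (\<lambda>Q. f Q * g Q) P = f P * (D g P - E g P) + g P * (D f P - E f P)"
    unfolding derives_mult[OF D f g fg(2)] derives_mult[OF E f g fg(2)] by (simp add: algebra_simps)
next
  fix f g P assume fg: "reg V f \<and> reg V g \<and> (\<forall>P\<in>V. f P = g P)" "P \<in> V"
  have "D f P = D g P" by (rule derives_cong[OF D]) (use fg in auto)
  moreover have "E f P = E g P" by (rule derives_cong[OF E]) (use fg in auto)
  ultimately show "D f P - E f P = D g P - E g P" by simp
qed (simp add: derives_const[OF D] derives_const[OF E])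

end

context variety
begin

lemma derives_unique:
  assumes D: "derives V D" and E: "derives V E" and x: "\<And>i. i < N \<Longrightarrow> reg V (x i)" "alg_indep N V x"
    and eq: "\<And>i P. i < N \<Longrightarrow> P \<in> V \<Longrightarrow> D (x i) P = E (x i) P" and f: "reg V f" and P: "P \<in> V"
  shows "D f P = E f P"
  using derives_eq_0[OF derives_difference[OF D E] x _ f P] eq by simp

text \<open>The fields dual to the parameters are found generically, as combinations of the fields dual to a
  transcendence basis \<open>z\<close>: with \<open>dz = Z dt\<close> and \<open>V\<close> the values of the latter on \<open>t\<close> one has \<open>Z V = 1\<close>, hence
  \<open>V Z = 1\<close>.  They send \<open>a\<^sub>k\<close> to the regular functions \<open>E\<^sub>k\<^sub>j\<close>, so by density these form a tangent vector
  on all of \<open>W\<close>.\<close>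

lemma dual_fields_of_differentials:
  assumes C: "coords W r a" and ne: "W \<noteq> {}" and t: "\<And>i. i < N \<Longrightarrow> reg W (t i)"
    and E: "\<And>k. k < r \<Longrightarrow> differential W N t (a k) (E k)"
  shows "\<exists>D. \<forall>j<N. vfield W (D j) \<and> (\<forall>i<N. \<forall>Q\<in>W. D j (t i) Q = (if i = j then 1 else 0))"
proof -
  have W: "openin T W" using C by (simp add: coords_def)
  obtain U z where U: "openin T U" "U \<noteq> {}" and z1: "\<forall>i<N. reg U (z i)" and z2: "alg_indep N U z"
    using transcendence_basis by (elim exE conjE) (rule that)
  have z: "\<And>i. i < N \<Longrightarrow> reg U (z i)" "alg_indep N U z"
    using z1 z2 by auto
  define V0 where "V0 = W \<inter> U"
  have V0: "openin T V0" "V0 \<noteq> {}" "V0 \<subseteq> W" "V0 \<subseteq> U"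
    using opens_meet[OF W U(1) ne U(2)] W U by (auto simp: V0_def)
  have C0: "coords V0 r a" by (rule coords_subset[OF C V0(1,3)])
  have z0: "reg V0 (z i)" if "i < N" for i
    using z(1)[OF that] V0 reg_subset by blast
  have indep: "alg_indep N V0 z" by (rule alg_indep_dense[OF z(2) z(1) U(1) V0(1,2,4)])
  obtain V1 G where V1: "openin T V1" "V1 \<noteq> {}" "V1 \<subseteq> V0"
      and G: "\<And>i. i < N \<Longrightarrow> vfield V1 (G i)"
        "\<And>i j P. i < N \<Longrightarrow> j < N \<Longrightarrow> P \<in> V1 \<Longrightarrow> G i (z j) P = (if i = j then 1 else 0)"
    using generic_dual_fields[OF C0 V0(2) z0 indep] by blast
  obtain P0 where P0: "P0 \<in> V1" using V1(2) by blast
  have C1: "coords V1 r a" by (rule coords_subset[OF C0 V1(1,3)])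
  have "\<exists>V2. openin T V2 \<and> P0 \<in> V2 \<and> V2 \<subseteq> V1 \<and> (\<forall>j\<in>{..<N}. \<exists>\<gamma>. differential V2 r a (z j) \<gamma>)"
  proof (rule finite_neighbourhood[of _ V1 P0 "\<lambda>j V2. \<exists>\<gamma>. differential V2 r a (z j) \<gamma>"])
    fix j assume "j \<in> {..<N}"
    then have "reg V1 (z j)" using reg_subset[OF z0 V1(1,3)] by simp
    then show "\<exists>V2. openin T V2 \<and> P0 \<in> V2 \<and> (\<exists>\<gamma>. differential V2 r a (z j) \<gamma>)"
      using differential_in_coords[OF C1 _ P0] by blast
  qed (use V1 P0 differential_subset in blast)+
  then obtain V2 \<gamma> where V2: "openin T V2" "P0 \<in> V2" "V2 \<subseteq> V1"
      and \<gamma>: "\<And>j. j < N \<Longrightarrow> differential V2 r a (z j) (\<gamma> j)"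
    by (metis lessThan_iff)
  have V2W: "V2 \<subseteq> W" "V2 \<noteq> {}" using V2 V1 V0 by auto
  have G2: "vfield V2 (G i)" if "i < N" for i
    using G(1)[OF that] V2(1,3) by (rule vfield_subset)
  have dG: "derives V2 (G i)" if "i < N" for i
    using vfield_derives[OF G2[OF that] V2(1) order_refl] .
  define Z where "Z = (\<lambda>j m Q. \<Sum>l<r. \<gamma> j l Q * E l m Q)"
  have rE: "reg W (E l m)" if "l < r" "m < N" for l m
    using E[OF that(1)] that(2) by (simp add: differential_def)
  have rZ: "reg V2 (Z j m)" if "j < N" "m < N" for j m
    unfolding Z_def using \<gamma>[OF that(1)] rE[OF _ that(2)] V2(1) V2W
    by (intro reg_sum[OF V2(1)] reg_mult reg_subset[OF rE[OF _ that(2)] V2(1) V2W(1)]) (auto simp: differential_def)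
  have ZV: "(\<Sum>m<N. Z j m Q * G i (t m) Q) = (if i = j then 1 else 0)" if ij: "i < N" "j < N" and Q: "Q \<in> V2" for i j Q
  proof -
    have "G i (z j) Q = (\<Sum>l<r. \<gamma> j l Q * G i (a l) Q)"
      by (rule differentialD[OF \<gamma>[OF ij(2)] dG[OF ij(1)] order_refl Q])
    also have "\<dots> = (\<Sum>l<r. \<gamma> j l Q * (\<Sum>m<N. E l m Q * G i (t m) Q))"
      using differentialD[OF E dG[OF ij(1)] V2W(1) Q] by (intro sum.cong refl) simp
    also have "\<dots> = (\<Sum>m<N. Z j m Q * G i (t m) Q)"
      unfolding Z_def sum_distrib_left sum_distrib_right by (subst sum.swap) (simp add: mult.assoc)
    finally show ?thesis using G(2)[OF ij, of Q] Q V2 by auto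
  qed
  have VZ: "(\<Sum>i<N. G i (t l) Q * Z i j Q) = (if l = j then 1 else 0)" if lj: "l < N" "j < N" and Q: "Q \<in> V2" for l j Q
  proof -
    let ?Z = "mat N N (\<lambda>(j, m). Z j m Q)" and ?V = "mat N N (\<lambda>(m, i). G i (t m) Q)"
    have ZV1: "?Z * ?V = 1\<^sub>m N"
    proof (rule eq_matI)
      fix j i assume "j < dim_row (1\<^sub>m N :: 'b mat)" "i < dim_col (1\<^sub>m N :: 'b mat)"
      then show "(?Z * ?V) $$ (j, i) = 1\<^sub>m N $$ (j, i)"
        using ZV[of i j Q] Q by (simp add: scalar_prod_def lessThan_atLeast0)
    qed auto
    have "?V * ?Z = 1\<^sub>m N"
      by (rule mat_mult_left_right_inverse[OF _ _ ZV1]) simp_all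
    then have "(?V * ?Z) $$ (l, j) = 1\<^sub>m N $$ (l, j)" by simp
    then show ?thesis
      using lj by (simp add: scalar_prod_def lessThan_atLeast0)
  qed
  define w where "w = (\<lambda>j f P. \<Sum>i<N. Z i j P * G i f P)"
  have w: "vfield V2 (w j)" if "j < N" for j
    unfolding w_def using V2(1) G2 rZ that by (intro vfield_combination) auto
  have dw: "derives V2 (w j)" if "j < N" for j
    using vfield_derives[OF w[OF that] V2(1) order_refl] .
  have wt: "w j (t l) Q = (if l = j then 1 else 0)" if "j < N" "l < N" "Q \<in> V2" for j l Q
    using VZ[of l j Q] that by (simp add: w_def mult.commute)
  have wa: "w j (a k) Q = E k j Q" if "j < N" "k < r" "Q \<in> V2" for j k Q
  proof -
    have "w j (a k) Q = (\<Sum>m<N. E k m Q * w j (t m) Q)"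
      by (rule differentialD[OF E[OF that(2)] dw[OF that(1)] V2W(1) that(3)])
    also have "\<dots> = (\<Sum>m<N. if m = j then E k m Q else 0)"
      using wt that by (intro sum.cong refl) auto
    finally show ?thesis using that by simp
  qed
  have "\<exists>D. vfield W D \<and> (\<forall>i<N. \<forall>Q\<in>W. D (t i) Q = (if i = j then 1 else 0))" if j: "j < N" for j
  proof -
    have ra: "reg W (a k)" if "k < r" for k by (rule coords_reg[OF C that])
    have ra2: "reg V2 (a k)" if "k < r" for k using ra[OF that] V2(1) V2W(1) by (rule reg_subset)
    have "tangent W r a (\<lambda>k. E k j)"
      unfolding tangent_def
    proof (intro conjI allI impI ballI W)
      show "reg W (a k)" "reg W (E k j)" if "k < r" for k using ra rE that j by auto
      fix p P assume p: "p \<in> polys r" "\<forall>P\<in>W. peval p (\<lambda>i. a i P) = 0" and P: "P \<in> W"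
      show "dir_deriv r p (\<lambda>i. a i P) (\<lambda>i. E i j P) = 0"
      proof (rule reg_eq_0_dense[OF reg_dir_deriv[OF W p(1) ra] V2(1) V2W(2,1) _ P])
        show "reg W (E i j)" if "i < r" for i using rE that j by blast
        fix Q assume Q: "Q \<in> V2"
        have "dir_deriv r p (\<lambda>i. a i Q) (\<lambda>i. w j (a i) Q) = 0"
          using tangent_of_derives[OF dw[OF j] ra2] p Q V2W(1) by (simp add: tangent_def subset_iff)
        then show "dir_deriv r p (\<lambda>i. a i Q) (\<lambda>i. E i j Q) = 0"
          using dir_deriv_cong[OF p(1), of "\<lambda>i. a i Q" "\<lambda>i. a i Q" "\<lambda>i. w j (a i) Q" "\<lambda>i. E i j Q"] wa[OF j _ Q]
          by simp
      qed
    qed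
    then obtain D where D: "vfield W D" "\<forall>k<r. \<forall>P\<in>W. D (a k) P = E k j P"
      using vfield_of_tangent[OF C] by blast
    have D2: "derives V2 D" using D(1) V2(1) V2W(1) by (rule vfield_derives)
    have DW: "derives W D" using D(1) W order_refl by (rule vfield_derives)
    have "D (t i) Q = (if i = j then 1 else 0)" if i: "i < N" and Q: "Q \<in> W" for i Q
    proof (rule reg_eq_dense[OF derives_reg[OF DW t[OF i]] reg_const[OF W] V2(1) V2W(2,1) _ Q])
      fix Q assume Q: "Q \<in> V2"
      have "D (t i) Q = w j (t i) Q"
        by (rule derives_fraction[OF coords_subset[OF C V2(1) V2W(1)] D2 dw[OF j] _ reg_subset[OF t[OF i] V2(1) V2W(1)] Q])
          (use D(2) wa[OF j] V2W(1) in auto)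
      then show "D (t i) Q = (if i = j then 1 else 0)" using wt[OF j i Q] by simp
    qed
    then show ?thesis using D(1) by blast
  qed
  then show ?thesis by metis
qed

text \<open>By the chain rule the derivatives of a relation are relations of smaller degree, hence \<open>0\<close> by induction;
  in characteristic \<open>0\<close> the relation is then constant.\<close>

lemma alg_indep_of_dual_fields:
  assumes W: "openin T W" "W \<noteq> {}" and t: "\<And>i. i < N \<Longrightarrow> reg W (t i)"
    and D: "\<And>j. j < N \<Longrightarrow> derives W (D j)" "\<And>i j Q. j < N \<Longrightarrow> i < N \<Longrightarrow> Q \<in> W \<Longrightarrow> D j (t i) Q = (if i = j then 1 else 0)"
  shows "alg_indep N W t"
    and "\<And>p j Q. p \<in> polys N \<Longrightarrow> j < N \<Longrightarrow> Q \<in> W \<Longrightarrow>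
      D j (\<lambda>P. peval p (\<lambda>i. t i P)) Q = peval (ppartial j p) (\<lambda>i. t i Q)"
proof -
  show Dp: "D j (\<lambda>P. peval p (\<lambda>i. t i P)) Q = peval (ppartial j p) (\<lambda>i. t i Q)"
    if p: "p \<in> polys N" and j: "j < N" and Q: "Q \<in> W" for p j Q
  proof -
    have "D j (\<lambda>P. peval p (\<lambda>i. t i P)) Q = (\<Sum>i<N. if i = j then peval (ppartial i p) (\<lambda>i. t i Q) else 0)"
    proof -
      have "D j (\<lambda>P. peval p (\<lambda>i. t i P)) Q = dir_deriv N p (\<lambda>i. t i Q) (\<lambda>i. D j (t i) Q)"
        by (rule derives_peval[OF D(1)[OF j] p t Q])
      then show ?thesis
        unfolding dir_deriv_def by (rule trans) (intro sum.cong refl, simp add: D(2)[OF j _ Q])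
    qed
    then show ?thesis using j by simp
  qed
  have "p = 0" if "p \<in> polys N" "degree_le d p" "\<forall>P\<in>W. peval p (\<lambda>i. t i P) = 0" for d p
    using that
  proof (induction d arbitrary: p)
    case 0
    have "ppartial i p = 0" for i
    proof (rule poly_mapping_eqI)
      fix m
      have "lk p (m + unit_mono i) = 0"
      proof (rule ccontr)
        assume "lk p (m + unit_mono i) \<noteq> 0"
        then have "mdeg (m + unit_mono i) \<le> 0" using 0(2) by (simp add: degree_le_def in_keys_iff)
        then show False by (simp add: mdeg_add)
      qed
      then show "lk (ppartial i p) m = lk 0 m"
        by (simp add: lookup_ppartial)
    qed
    then have p: "p = pconst (lk p 0)" using 0(1) by (intro ppartial_eq_0_imp_const)
    obtain P where "P \<in> W" using W(2) by blast
    then have "lk p 0 = 0" using 0(3) p by (metis peval_const)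
    then show ?case using p by simp
  next
    case (Suc d)
    have "ppartial j p = 0" if j: "j < N" for j
    proof (rule Suc.IH)
      show "\<forall>Q\<in>W. peval (ppartial j p) (\<lambda>i. t i Q) = 0"
      proof
        fix Q assume Q: "Q \<in> W"
        have "D j (\<lambda>P. peval p (\<lambda>i. t i P)) Q = D j (\<lambda>_. 0) Q"
          using Suc.prems(3) by (intro derives_cong[OF D(1)[OF j] reg_peval[OF W(1) Suc.prems(1) t] _ Q]) auto
        then show "peval (ppartial j p) (\<lambda>i. t i Q) = 0"
          using Dp[OF Suc.prems(1) j Q] derives_const[OF D(1)[OF j] Q] by simp
      qed
    qed (use Suc.prems in \<open>auto intro: ppartial_in_polys degree_le_ppartial\<close>)
    then have p: "p = pconst (lk p 0)" using Suc.prems(1) by (intro ppartial_eq_0_imp_const)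
    obtain P where "P \<in> W" using W(2) by blast
    then have "lk p 0 = 0" using Suc.prems(3) p by (metis peval_const)
    then show ?case using p by simp
  qed
  then show "alg_indep N W t"
    unfolding alg_indep_def using degree_le_exists by blast
qed

text \<open>Uniqueness makes the definite description behind \<open>chart_partial\<close> denote the restriction of a given field.\<close>

lemma extends_partial_iff:
  assumes W: "openin T W" "W \<noteq> {}" and t: "\<And>i. i < N \<Longrightarrow> reg W (t i)"
    and D: "\<And>j. j < N \<Longrightarrow> derives W (D j)" "\<And>i j Q. j < N \<Longrightarrow> i < N \<Longrightarrow> Q \<in> W \<Longrightarrow> D j (t i) Q = (if i = j then 1 else 0)"
    and i: "i < N"
  shows "extends_partial R N W t i D' \<longleftrightarrow> D' = (\<lambda>f\<in>A W. restrict (D i f) W)"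
proof
  have indep: "alg_indep N W t" "\<And>p j Q. p \<in> polys N \<Longrightarrow> j < N \<Longrightarrow> Q \<in> W \<Longrightarrow>
      D j (\<lambda>P. peval p (\<lambda>i. t i P)) Q = peval (ppartial j p) (\<lambda>i. t i Q)"
    by (rule alg_indep_of_dual_fields[OF W t D]; assumption)+
  have "(\<lambda>f\<in>A W. restrict (D i f) W) (\<lambda>P\<in>W. peval p (\<lambda>j. t j P)) = (\<lambda>P\<in>W. peval (ppartial i p) (\<lambda>j. t j P))"
    if p: "p \<in> polys N" for p
  proof -
    have rp: "reg W (\<lambda>P. peval p (\<lambda>j. t j P))" by (rule reg_peval[OF W(1) p t])
    have "D i (\<lambda>P\<in>W. peval p (\<lambda>j. t j P)) Q = peval (ppartial i p) (\<lambda>j. t j Q)" if Q: "Q \<in> W" for Q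
    proof -
      have "D i (\<lambda>P. peval p (\<lambda>j. t j P)) Q = D i (\<lambda>P\<in>W. peval p (\<lambda>j. t j P)) Q"
        by (rule derives_cong[OF D(1)[OF i] rp _ Q]) auto
      then show ?thesis using indep(2)[OF p i Q] by simp
    qed
    then show ?thesis using rp by (auto simp: reg_def intro!: restrict_ext)
  qed
  then show "extends_partial R N W t i D'" if "D' = (\<lambda>f\<in>A W. restrict (D i f) W)"
    unfolding extends_partial_def that using derivation_on_of_derives[OF D(1)[OF i]] by blast
  assume D': "extends_partial R N W t i D'"
  then have dD': "derivation_on R W D'" by (simp add: extends_partial_def)
  note d' = derives_of_derivation_on[OF dD' W(1)]
  have "D' (restrict (t j) W) P = D i (t j) P" if j: "j < N" and P: "P \<in> W" for j P
  proof -
    have "D' (\<lambda>P\<in>W. peval (pvar j) (\<lambda>j. t j P)) = (\<lambda>P\<in>W. peval (ppartial i (pvar j)) (\<lambda>j. t j P))"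
      using D' pvar_in_polys[OF j] unfolding extends_partial_def by blast
    then show ?thesis using D(2)[OF i j P] P by (auto simp: ppartial_var)
  qed
  then have eq: "D' (restrict f W) P = D i f P" if "reg W f" "P \<in> W" for f P
    using derives_unique[OF d' D(1)[OF i], of t, OF t indep(1)] that by blast
  show "D' = (\<lambda>f\<in>A W. restrict (D i f) W)"
  proof
    fix f
    have D'E: "D' \<in> A W \<rightarrow>\<^sub>E A W" using dD' by (simp add: derivation_on_def fun_ring_def)
    show "D' f = (\<lambda>f\<in>A W. restrict (D i f) W) f"
    proof (cases "f \<in> A W")
      case True
      then have "D' f \<in> extensional W" using D'E functions_extensional[OF W(1)] by blast
      moreover have "D' f P = D i f P" if "P \<in> W" for P
        using eq[OF reg_of_functions[OF W(1) True] that] functions_extensional[OF W(1) True]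
        by (simp add: extensional_restrict)
      ultimately show ?thesis using True by (auto simp: extensional_def)
    next
      case False
      then show ?thesis using D'E by (auto simp: PiE_def extensional_def)
    qed
  qed
qed

lemma etale_chart_of_dual_fields:
  assumes aff: "affine_open T R W" and ne: "W \<noteq> {}" and t: "\<And>i. i < N \<Longrightarrow> reg W (t i)"
    and D: "\<And>j. j < N \<Longrightarrow> derives W (D j)" "\<And>i j Q. j < N \<Longrightarrow> i < N \<Longrightarrow> Q \<in> W \<Longrightarrow> D j (t i) Q = (if i = j then 1 else 0)"
  shows "etale_chart T R N W (\<lambda>i\<in>{..<N}. restrict (t i) W)"
proof -
  define x where "x = (\<lambda>i\<in>{..<N}. restrict (t i) W)"
  have W: "openin T W" using aff by (simp add: affine_open_def)
  have xt: "x i P = t i P" if "i < N" "P \<in> W" for i P using that by (simp add: x_def)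
  have rx: "reg W (x i)" if "i < N" for i
    using t[OF that] xt[OF that] reg_cong[of W "x i" "t i"] by blast
  have Dx: "D j (x i) Q = (if i = j then 1 else 0)" if "j < N" "i < N" "Q \<in> W" for i j Q
    using derives_cong[OF D(1)[OF that(1)] rx[OF that(2)] xt[OF that(2)] that(3)] D(2)[OF that] by simp
  have ix: "alg_indep N W x"
    by (rule alg_indep_of_dual_fields(1)[OF W ne rx D(1) Dx])
  show ?thesis
    unfolding etale_chart_def x_def[symmetric]
  proof (intro conjI ballI allI impI aff ix)
    show "x \<in> {..<N} \<rightarrow>\<^sub>E carrier (R W)"
      using t by (auto simp: x_def fun_ring_def reg_def)
    fix f assume "f \<in> carrier (R W)"
    then have f: "f \<in> A W" by (simp add: fun_ring_def)
    show "\<not> ring.transcendental (R W) {\<lambda>P\<in>W. peval p (\<lambda>j. x j P) |p. p \<in> polys N} f"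
      by (rule not_transcendental_if_alg_over[OF W rx f alg_over_parameters[OF W ne rx ix reg_of_functions[OF W f]]])
  next
    fix i assume i: "i < N"
    show "\<exists>!D. extends_partial R N W x i D"
      using extends_partial_iff[OF W ne, of x D i, OF rx D(1) Dx i] by auto
  qed
qed

text \<open>Smoothness provides local parameters \<open>t\<close> at \<open>P\<close>.  Near \<open>P\<close> the differentials of affine coordinates are
  combinations of the \<open>dt\<^sub>i\<close>, and this suffices for fields dual to \<open>t\<close>; an affine neighbourhood on which they exist
  is an etale chart.\<close>

theorem etale_chart_near_smooth_point:
  assumes smooth: "smooth_at T R N P"
    and affine: "\<And>W. openin T W \<Longrightarrow> P \<in> W \<Longrightarrow> \<exists>V. affine_open T R V \<and> P \<in> V \<and> V \<subseteq> W"
  shows "\<exists>U x. etale_chart T R N U x \<and> P \<in> U"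
proof -
  obtain U t where U: "openin T U" "P \<in> U" and tU: "\<forall>i<N. t i \<in> carrier (R U) \<and> t i P = 0"
      and sqU: "\<forall>V f. openin T V \<and> P \<in> V \<and> V \<subseteq> U \<and> f \<in> carrier (R V) \<and> f P = 0 \<longrightarrow>
        (\<exists>!c. c \<in> {..<N} \<rightarrow>\<^sub>E UNIV \<and> in_max_ideal_square T R P V (\<lambda>Q. f Q - (\<Sum>i<N. c i * t i Q)))"
    using smooth unfolding smooth_at_def by (elim exE conjE) (rule that)
  have t: "t i \<in> A U" if "i < N" for i
    using tU that by (simp add: fun_ring_def)
  have sq: "\<exists>c. in_max_ideal_square T R P V (\<lambda>Q. f Q - (\<Sum>i<N. c i * t i Q))"
    if "openin T V" "P \<in> V" "V \<subseteq> U" "f \<in> A V" "f P = 0" for V f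
    using sqU[rule_format, of V f] that by (auto simp: fun_ring_def)
  obtain W0 where W0: "affine_open T R W0" "P \<in> W0" "W0 \<subseteq> U"
    using affine[OF U] by blast
  have o: "openin T W0" using W0 by (simp add: affine_open_def)
  obtain r a where C: "coords W0 r a" using coords_of_affine_open[OF W0(1)] by blast
  have t0: "reg W0 (t i)" if "i < N" for i
    using reg_subset[OF reg_of_functions[OF U(1) t[OF that]] o W0(3)] .
  have "\<exists>c. in_max_ideal_square T R P W0 (\<lambda>Q. (a k Q - a k P) - (\<Sum>i<N. c i * t i Q))" if k: "k < r" for k
  proof -
    have "restrict (\<lambda>Q. a k Q - a k P) W0 \<in> A W0"
      using reg_diff[OF coords_reg[OF C k] reg_const[OF o]] by (simp add: reg_def)
    then obtain c where "in_max_ideal_square T R P W0 (\<lambda>Q. restrict (\<lambda>Q. a k Q - a k P) W0 Q - (\<Sum>i<N. c i * t i Q))"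
      using sq[OF o W0(2,3), of "restrict (\<lambda>Q. a k Q - a k P) W0"] W0(2) by auto
    then have "in_max_ideal_square T R P W0 (\<lambda>Q. (a k Q - a k P) - (\<Sum>i<N. c i * t i Q))"
      by (rule in_max_ideal_square_cong) simp
    then show ?thesis by blast
  qed
  then obtain W E where W': "openin T W" "P \<in> W" "W \<subseteq> W0" "\<forall>k<r. differential W N t (a k) (E k)"
    using differentials_of_coords[OF C W0(2), of N t, OF t0] by blast
  then have W: "openin T W" "P \<in> W" "W \<subseteq> W0" "\<And>k. k < r \<Longrightarrow> differential W N t (a k) (E k)"
    by auto
  obtain V where V: "affine_open T R V" "P \<in> V" "V \<subseteq> W" using affine[OF W(1,2)] by blast
  have oV: "openin T V" using V by (simp add: affine_open_def)
  have CW: "coords W r a" by (rule coords_subset[OF C W(1,3)])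
  have tW: "reg W (t i)" if "i < N" for i using reg_subset[OF t0[OF that] W(1,3)] .
  obtain D where D: "\<forall>j<N. vfield W (D j) \<and> (\<forall>i<N. \<forall>Q\<in>W. D j (t i) Q = (if i = j then 1 else 0))"
    using dual_fields_of_differentials[OF CW _ tW W(4)] W(2) by blast
  have "etale_chart T R N V (\<lambda>i\<in>{..<N}. restrict (t i) V)"
  proof (rule etale_chart_of_dual_fields[OF V(1)])
    show "derives V (D j)" if "j < N" for j
      using D that vfield_derives[OF _ oV V(3)] by blast
    show "D j (t i) Q = (if i = j then 1 else 0)" if "j < N" "i < N" "Q \<in> V" for i j Q
      using D that V(3) by auto
  qed (use V(2) reg_subset[OF tW oV V(3)] in auto)
  then show ?thesis using V(2) by blast
qed

end

section \<open>Taylor expansion in a chart\<close>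

lemma monomials_induct [consumes 1, case_names zero step]:
  assumes "r \<in> monomials N" "Q 0"
    and "\<And>r i. r \<in> monomials N \<Longrightarrow> i < N \<Longrightarrow> Q r \<Longrightarrow> Q (r + unit_mono i)"
  shows "Q r"
  using assms(1)
proof (induction "mdeg r" arbitrary: r)
  case 0
  then show ?case using assms(2) by (simp add: mdeg_eq_0_iff)
next
  case (Suc d)
  then have "r \<noteq> 0" by auto
  with Suc.prems obtain i r' where r: "i < N" "r' \<in> monomials N" "r = r' + unit_mono i"
    by (rule mono_nonzero_split)
  then have "Q r'" using Suc.hyps by (simp add: mdeg_add)
  then show ?case using assms(3) r by simp
qed

text \<open>Repeated partial derivatives are taken in the order of the variables.  Since they commute, one more of
  them may be applied first, which yields the recursion for Taylor coefficients.\<close>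

lemma fold_commuting_powers:
  fixes E :: "nat \<Rightarrow> 'a \<Rightarrow> 'a"
  assumes cl: "\<And>i f. i < N \<Longrightarrow> f \<in> S \<Longrightarrow> E i f \<in> S"
    and comm: "\<And>i j f. i < N \<Longrightarrow> j < N \<Longrightarrow> f \<in> S \<Longrightarrow> E i (E j f) = E j (E i f)"
    and "n \<le> N" "f \<in> S"
  shows "fold (\<lambda>j. E j ^^ k j) [0..<n] f \<in> S \<and>
    (\<forall>i<N. E i (fold (\<lambda>j. E j ^^ k j) [0..<n] f) = fold (\<lambda>j. E j ^^ k j) [0..<n] (E i f)) \<and>
    (\<forall>i<n. fold (\<lambda>j. E j ^^ (k(i := Suc (k i))) j) [0..<n] f = fold (\<lambda>j. E j ^^ k j) [0..<n] (E i f))"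
  using assms(3,4)
proof (induction n)
  case 0
  then show ?case by simp
next
  case (Suc n)
  have pw: "(E n ^^ e) g \<in> S \<and> (\<forall>i<N. E i ((E n ^^ e) g) = (E n ^^ e) (E i g))" if "g \<in> S" for e g
  proof (induction e)
    case (Suc e)
    have nN: "n < N" using \<open>Suc n \<le> N\<close> by simp
    have eq: "(E n ^^ Suc e) h = E n ((E n ^^ e) h)" for h by simp
    show ?case
      unfolding eq using Suc.IH cl[OF nN] comm[OF _ nN] by simp
  qed (use that in simp)
  let ?F = "\<lambda>k. fold (\<lambda>j. E j ^^ k j) [0..<n]"
  have IH: "?F k f \<in> S" "\<And>i. i < N \<Longrightarrow> E i (?F k f) = ?F k (E i f)"
      "\<And>i. i < n \<Longrightarrow> ?F (k(i := Suc (k i))) f = ?F k (E i f)"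
    using Suc by auto
  have F: "fold (\<lambda>j. E j ^^ k j) [0..<Suc n] g = (E n ^^ k n) (?F k g)" for k g by simp
  have upd: "?F (k(n := Suc (k n))) f = ?F k f"
    by (rule fold_cong) auto
  show ?case
  proof (intro conjI allI impI)
    show "fold (\<lambda>j. E j ^^ k j) [0..<Suc n] f \<in> S"
      unfolding F using pw IH(1) by blast
    show "E i (fold (\<lambda>j. E j ^^ k j) [0..<Suc n] f) = fold (\<lambda>j. E j ^^ k j) [0..<Suc n] (E i f)" if "i < N" for i
      unfolding F using pw[OF IH(1)] IH(2)[OF that] that by simp
    fix i assume i: "i < Suc n"
    show "fold (\<lambda>j. E j ^^ (k(i := Suc (k i))) j) [0..<Suc n] f = fold (\<lambda>j. E j ^^ k j) [0..<Suc n] (E i f)"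
    proof (cases "i = n")
      case True
      then show ?thesis
        unfolding F using upd IH(2)[of n] Suc.prems(1) by (simp add: funpow_swap1)
    next
      case False
      then show ?thesis
        unfolding F using IH(3)[of i] i by simp
    qed
  qed
qed

lemma finite_mono_pairs: "finite {(a, b). a + b = (r :: mono)}"
proof -
  let ?B = "{k. \<forall>i. lk k i \<le> lk r i}"
  have "inj_on lk ?B"
    by (intro inj_onI poly_mapping_eqI) simp
  moreover have "lk ` ?B \<subseteq> {f. \<forall>i. (i \<in> Poly_Mapping.keys r \<longrightarrow> f i \<in> {..mdeg r}) \<and> (i \<notin> Poly_Mapping.keys r \<longrightarrow> f i = 0)}"
  proof (intro image_subsetI CollectI allI conjI impI)
    fix k i assume k: "k \<in> ?B"
    then have ki: "lk k i \<le> lk r i" by simp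
    show "lk k i \<in> {..mdeg r}" if "i \<in> Poly_Mapping.keys r"
    proof -
      have "lk r i \<le> mdeg r" unfolding mdeg_def using that by (intro member_le_sum) auto
      then show ?thesis using ki by simp
    qed
    show "lk k i = 0" if "i \<notin> Poly_Mapping.keys r"
      using ki that by (simp add: in_keys_iff)
  qed
  then have "finite (lk ` ?B)"
    by (rule finite_subset) (intro finite_set_of_finite_funs; simp)
  ultimately have "finite ?B" by (rule finite_imageD[rotated])
  then have "finite (?B \<times> ?B)" by simp
  moreover have "{(a, b). a + b = r} \<subseteq> ?B \<times> ?B"
    by (auto simp: lookup_add)
  ultimately show ?thesis by (rule finite_subset[rotated])
qed

lemma ps_mult_zero_exponent: "ps_mult f g 0 = f 0 * g 0"
proof -
  have "{(a, b). a + b = (0 :: mono)} = {(0, 0)}"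
  proof (intro subset_antisym subsetI)
    fix ab assume "ab \<in> {(a, b). a + b = (0 :: mono)}"
    then obtain a b where ab: "ab = (a, b)" "a + b = (0 :: mono)" by blast
    then have "mdeg a = 0" "mdeg b = 0" using mdeg_add[of a b] by auto
    then show "ab \<in> {(0, 0)}" using ab by (simp add: mdeg_eq_0_iff)
  qed simp
  then show ?thesis by (simp add: ps_mult_def)
qed

text \<open>The Leibniz rule for the formal derivative \<open>r \<mapsto> (r\<^sub>i + 1) f(r + e\<^sub>i)\<close>, in which \<open>r\<^sub>i + 1\<close> is split
  along \<open>a + b = r + e\<^sub>i\<close>.\<close>

lemma ps_mult_derivative:
  fixes f g :: "mono \<Rightarrow> 'k::field"
  shows "of_nat (Suc (lk r i)) * ps_mult f g (r + unit_mono i)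
    = ps_mult (\<lambda>a. of_nat (Suc (lk a i)) * f (a + unit_mono i)) g r
      + ps_mult f (\<lambda>b. of_nat (Suc (lk b i)) * g (b + unit_mono i)) r"
proof -
  let ?e = "unit_mono i"
  let ?S = "{(a, b). a + b = r + ?e}"
  have "of_nat (Suc (lk r i)) * ps_mult f g (r + ?e)
      = (\<Sum>(a, b)\<in>?S. of_nat (lk a i) * f a * g b + f a * (of_nat (lk b i) * g b))"
    unfolding ps_mult_def sum_distrib_left
  proof (intro sum.cong refl, clarify)
    fix a b assume "a + b = r + ?e"
    then have "lk a i + lk b i = Suc (lk r i)"
      by (metis lookup_add lookup_unit_mono add.commute plus_1_eq_Suc)
    then have "(of_nat (Suc (lk r i)) :: 'k) = of_nat (lk a i) + of_nat (lk b i)"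
      by (metis of_nat_add)
    then show "of_nat (Suc (lk r i)) * (f a * g b) = of_nat (lk a i) * f a * g b + f a * (of_nat (lk b i) * g b)"
      by (simp add: algebra_simps)
  qed
  also have "\<dots> = (\<Sum>(a, b)\<in>?S. of_nat (lk a i) * f a * g b) + (\<Sum>(a, b)\<in>?S. f a * (of_nat (lk b i) * g b))"
    by (simp add: sum.distrib case_prod_beta)
  also have "(\<Sum>(a, b)\<in>?S. of_nat (lk a i) * f a * g b)
      = (\<Sum>(a, b)\<in>{(a, b)\<in>?S. lk a i \<noteq> 0}. of_nat (lk a i) * f a * g b)"
    using finite_mono_pairs[of "r + ?e"] by (intro sum.mono_neutral_right) (auto intro!: gr0I)
  also have "\<dots> = ps_mult (\<lambda>a. of_nat (Suc (lk a i)) * f (a + ?e)) g r"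
    unfolding ps_mult_def
  proof (rule sum.reindex_bij_witness[of _ "\<lambda>(a, b). (a + ?e, b)" "\<lambda>(a, b). (a - ?e, b)"], safe)
    fix a b assume ab: "a + b = r + ?e" "0 < lk a i"
    have a: "a - ?e + ?e = a" by (rule mono_remove_unit) (use ab in simp)
    then have "(a - ?e + b) + ?e = r + ?e" using ab(1) by (simp add: add.commute add.left_commute)
    then show "a - ?e + b = r" by simp
    show "a - ?e + ?e = a" by (rule a)
    have "lk (a - ?e) i = lk a i - 1" by (simp add: lookup_minus)
    then show "of_nat (Suc (lk (a - ?e) i)) * f (a - ?e + ?e) * g b = of_nat (lk a i) * f a * g b"
      using ab(2) a by simp
  qed (auto simp: lookup_add add_ac)
  also have "(\<Sum>(a, b)\<in>?S. f a * (of_nat (lk b i) * g b))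
      = (\<Sum>(a, b)\<in>{(a, b)\<in>?S. lk b i \<noteq> 0}. f a * (of_nat (lk b i) * g b))"
    using finite_mono_pairs[of "r + ?e"] by (intro sum.mono_neutral_right) (auto intro!: gr0I)
  also have "\<dots> = ps_mult f (\<lambda>b. of_nat (Suc (lk b i)) * g (b + ?e)) r"
    unfolding ps_mult_def
  proof (rule sum.reindex_bij_witness[of _ "\<lambda>(a, b). (a, b + ?e)" "\<lambda>(a, b). (a, b - ?e)"], safe)
    fix a b assume ab: "a + b = r + ?e" "0 < lk b i"
    have b: "b - ?e + ?e = b" by (rule mono_remove_unit) (use ab in simp)
    then have "(a + (b - ?e)) + ?e = r + ?e" using ab(1) by (simp add: add.assoc)
    then show "a + (b - ?e) = r" by simp
    show "b - ?e + ?e = b" by (rule b)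
    have "lk (b - ?e) i = lk b i - 1" by (simp add: lookup_minus)
    then show "f a * (of_nat (Suc (lk (b - ?e) i)) * g (b - ?e + ?e)) = f a * (of_nat (lk b i) * g b)"
      using ab(2) b by simp
  qed (auto simp: lookup_add add_ac)
  finally show ?thesis .
qed

text \<open>The product over \<open>i\<close> of the binomial formulas for \<open>(a\<^sub>i - G\<^sub>i)\<close> to the power \<open>m\<^sub>i\<close>.\<close>

lemma multi_binomial:
  fixes a G :: "nat \<Rightarrow> 'k::field"
  assumes m: "m \<in> monomials N"
  shows "(\<Sum>k\<in>{k. \<forall>i. lk k i \<le> lk m i}. (-1) ^ (mdeg m - mdeg k) *
      (\<Prod>i<N. of_nat (lk m i choose lk k i)) * mono_eval (m - k) G * mono_eval k a)
    = mono_eval m (\<lambda>i. a i - G i)"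
proof -
  let ?K = "{k. \<forall>i. lk k i \<le> lk m i}"
  let ?t = "\<lambda>i j. of_nat (lk m i choose j) * a i ^ j * (- G i) ^ (lk m i - j)"
  have ev: "mono_eval k b = (\<Prod>i<N. b i ^ lk k i)" if "k \<in> monomials N" for k and b :: "nat \<Rightarrow> 'k"
    using that by (intro mono_eval_superset) (auto simp: monomials_def)
  have K: "k \<in> monomials N" if "k \<in> ?K" for k
  proof -
    have "Poly_Mapping.keys k \<subseteq> Poly_Mapping.keys m"
    proof
      fix i assume "i \<in> Poly_Mapping.keys k"
      moreover have "lk k i \<le> lk m i" using that by simp
      ultimately show "i \<in> Poly_Mapping.keys m" by (simp add: in_keys_iff)
    qed
    then show ?thesis using m by (auto simp: monomials_def)
  qed
  have "mono_eval m (\<lambda>i. a i - G i) = (\<Prod>i<N. (a i + - G i) ^ lk m i)"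
    by (simp add: ev[OF m])
  also have "\<dots> = (\<Prod>i<N. \<Sum>j\<in>{..lk m i}. ?t i j)"
    by (simp only: binomial_ring)
  also have "\<dots> = (\<Sum>g\<in>PiE {..<N} (\<lambda>i. {..lk m i}). \<Prod>i<N. ?t i (g i))"
    by (rule prod_sum_PiE) auto
  also have "\<dots> = (\<Sum>k\<in>?K. \<Prod>i<N. ?t i (lk k i))"
  proof (rule sum.reindex_bij_witness[of _ "\<lambda>k. restrict (lk k) {..<N}" "\<lambda>g. Abs_poly_mapping (\<lambda>i. if i < N then g i else 0)"])
    fix g assume g: "g \<in> PiE {..<N} (\<lambda>i. {..lk m i})"
    have "finite {i. (if i < N then g i else 0) \<noteq> 0}"
      by (rule finite_subset[of _ "{..<N}"]) (auto split: if_splits)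
    then have l: "lk (Abs_poly_mapping (\<lambda>i. if i < N then g i else 0)) = (\<lambda>i. if i < N then g i else 0)"
      by (rule lookup_Abs_poly_mapping)
    show "restrict (lk (Abs_poly_mapping (\<lambda>i. if i < N then g i else 0))) {..<N} = g"
      unfolding l using g by (auto simp: PiE_def extensional_def)
    show "Abs_poly_mapping (\<lambda>i. if i < N then g i else 0) \<in> ?K"
      unfolding mem_Collect_eq l using g by auto
    show "(\<Prod>i<N. ?t i (lk (Abs_poly_mapping (\<lambda>i. if i < N then g i else 0)) i)) = (\<Prod>i<N. ?t i (g i))"
      unfolding l by (intro prod.cong) auto
  next
    fix k assume k: "k \<in> ?K"
    have "(\<lambda>i. if i < N then restrict (lk k) {..<N} i else 0) = lk k"
      using lookup_eq_0_of_monomials[OF K[OF k]] by auto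
    then show "Abs_poly_mapping (\<lambda>i. if i < N then restrict (lk k) {..<N} i else 0) = k"
      by simp
    show "restrict (lk k) {..<N} \<in> PiE {..<N} (\<lambda>i. {..lk m i})"
      using k by auto
  qed
  also have "\<dots> = (\<Sum>k\<in>?K. (-1) ^ (mdeg m - mdeg k) *
      (\<Prod>i<N. of_nat (lk m i choose lk k i)) * mono_eval (m - k) G * mono_eval k a)"
  proof (intro sum.cong refl)
    fix k assume k: "k \<in> ?K"
    have km: "k + (m - k) = m"
      using k by (intro poly_mapping_eqI) (auto simp: lookup_add lookup_minus)
    have mk: "m - k \<in> monomials N" using m km monomials_add_iff by metis
    have "mdeg m - mdeg k = mdeg (m - k)"
      using mdeg_add[of k "m - k"] km by simp
    also have "\<dots> = (\<Sum>i<N. lk m i - lk k i)"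
      using mk by (subst mdeg_superset[of "{..<N}"]) (auto simp: monomials_def lookup_minus)
    finally have sgn: "(-1 :: 'k) ^ (mdeg m - mdeg k) = (\<Prod>i<N. (-1) ^ (lk m i - lk k i))"
      by (simp add: power_sum)
    show "(\<Prod>i<N. ?t i (lk k i)) = (-1) ^ (mdeg m - mdeg k) *
      (\<Prod>i<N. of_nat (lk m i choose lk k i)) * mono_eval (m - k) G * mono_eval k a"
      unfolding sgn ev[OF mk] ev[OF K[OF k]] prod.distrib[symmetric] lookup_minus
      by (intro prod.cong refl) (simp add: power_minus[of "G _"] mult_ac)
  qed
  finally show ?thesis by simp
qed

lemma mono_eval_zero_point: "m \<noteq> 0 \<Longrightarrow> mono_eval m (\<lambda>i. 0) = 0"
proof -
  assume "m \<noteq> 0"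
  then obtain i where "lk m i \<noteq> 0" using poly_mapping_eqI[of m 0] by auto
  then show ?thesis
    unfolding mono_eval_def by (intro prod_zero bexI[of _ i]) (auto simp: in_keys_iff)
qed

context variety
begin

subsection \<open>Frames\<close>

text \<open>The partial derivatives of a chart as vector fields, hence available on all smaller open sets.\<close>

definition frame :: "'a set \<Rightarrow> (nat \<Rightarrow> 'a \<Rightarrow> 'b) \<Rightarrow> (nat \<Rightarrow> ('a \<Rightarrow> 'b) \<Rightarrow> 'a \<Rightarrow> 'b) \<Rightarrow> bool" where
  "frame W x D \<longleftrightarrow> openin T W \<and> (\<forall>i<N. reg W (x i) \<and> vfield W (D i)) \<and>
     (\<forall>i<N. \<forall>j<N. \<forall>Q\<in>W. D j (x i) Q = (if i = j then 1 else 0))"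

lemma frame_open: "frame W x D \<Longrightarrow> openin T W"
  by (simp add: frame_def)

lemma frame_reg: "frame W x D \<Longrightarrow> i < N \<Longrightarrow> reg W (x i)"
  by (simp add: frame_def)

lemma frame_dual: "frame W x D \<Longrightarrow> j < N \<Longrightarrow> i < N \<Longrightarrow> Q \<in> W \<Longrightarrow> D j (x i) Q = (if i = j then 1 else 0)"
  by (simp add: frame_def)

lemma frame_derives: "frame W x D \<Longrightarrow> i < N \<Longrightarrow> derives W (D i)"
  unfolding frame_def using vfield_derives by blast

lemma frame_subset:
  assumes F: "frame W x D" and V: "openin T V" "V \<subseteq> W"
  shows "frame V x D"
  unfolding frame_def
proof (intro conjI allI impI ballI V(1))
  fix i assume i: "i < N"
  show "reg V (x i)" by (rule reg_subset[OF frame_reg[OF F i] V])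
  have "vfield W (D i)" using F i unfolding frame_def by simp
  then show "vfield V (D i)" using V by (rule vfield_subset)
next
  show "D j (x i) Q = (if i = j then 1 else 0)" if "i < N" "j < N" "Q \<in> V" for i j Q
    by (rule frame_dual[OF F that(2,1) subsetD[OF V(2) that(3)]])
qed

lemma frame_alg_indep: "frame W x D \<Longrightarrow> W \<noteq> {} \<Longrightarrow> alg_indep N W x"
  by (rule alg_indep_of_dual_fields(1)[of W x D]) (auto simp: frame_open frame_reg frame_derives frame_dual)

lemma frame_of_etale_chart:
  assumes "etale_chart T R N U x"
  shows "U \<noteq> {} \<and> (\<exists>D. frame U x D)"
proof -
  have aff: "affine_open T R U" and x: "x \<in> {..<N} \<rightarrow>\<^sub>E carrier (R U)" and ind: "alg_indep N U x"
    and ex: "\<And>i. i < N \<Longrightarrow> \<exists>D. extends_partial R N U x i D"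
    using assms by (auto simp: etale_chart_def)
  have U: "openin T U" using aff by (simp add: affine_open_def)
  have rx: "reg U (x i)" if "i < N" for i
    using x that U by (intro reg_of_functions) (auto simp: fun_ring_def)
  obtain r a where C: "coords U r a" using coords_of_affine_open[OF aff] by blast
  have "\<exists>D. vfield U D \<and> (\<forall>j<N. \<forall>Q\<in>U. D (x j) Q = (if j = i then 1 else 0))" if i: "i < N" for i
  proof -
    obtain D0 where D0: "extends_partial R N U x i D0" using ex[OF i] by blast
    then have "derives U (\<lambda>f. D0 (restrict f U))"
      using derives_of_derivation_on[OF _ U] by (simp add: extends_partial_def)
    then obtain D where D: "vfield U D" "\<forall>f. reg U f \<longrightarrow> (\<forall>P\<in>U. D f P = D0 (restrict f U) P)"
      using vfield_of_derives[OF C] by blast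
    have "D (x j) Q = (if j = i then 1 else 0)" if j: "j < N" and Q: "Q \<in> U" for j Q
    proof -
      have "D0 (\<lambda>P\<in>U. peval (pvar j) (\<lambda>j. x j P)) = (\<lambda>P\<in>U. peval (ppartial i (pvar j)) (\<lambda>j. x j P))"
        using D0 pvar_in_polys[OF j] unfolding extends_partial_def by blast
      then have "D0 (restrict (x j) U) Q = (if j = i then 1 else 0)"
        using Q by (auto simp: ppartial_var)
      then show ?thesis using D(2) rx[OF j] Q by simp
    qed
    then show ?thesis using D(1) by blast
  qed
  then have "\<forall>i. \<exists>D. i < N \<longrightarrow> vfield U D \<and> (\<forall>j<N. \<forall>Q\<in>U. D (x j) Q = (if j = i then 1 else 0))"
    by blast
  then obtain D where "\<forall>i. i < N \<longrightarrow> vfield U (D i) \<and> (\<forall>j<N. \<forall>Q\<in>U. D i (x j) Q = (if j = i then 1 else 0))"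
    by (elim choice[THEN exE]) (rule that)
  then have "frame U x D" unfolding frame_def using U rx by blast
  moreover have "U \<noteq> {}"
  proof
    assume "U = {}"
    moreover have "(1 :: 'b mpoly) \<in> polys N" by (rule one_in_polys)
    ultimately have "(1 :: 'b mpoly) = 0" using ind unfolding alg_indep_def by blast
    then show False by simp
  qed
  ultimately show ?thesis by blast
qed

lemma chart_partial_frame:
  assumes F: "frame W x D" and "W \<noteq> {}" "i < N"
  shows "chart_partial R N W x i = (\<lambda>f\<in>A W. restrict (D i f) W)"
proof -
  have "extends_partial R N W x i D' \<longleftrightarrow> D' = (\<lambda>f\<in>A W. restrict (D i f) W)" for D'
    using extends_partial_iff[of W x D i] F assms(2,3)
    by (simp add: frame_open frame_reg frame_derives frame_dual)
  then show ?thesis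
    unfolding chart_partial_def by (intro the_equality) simp_all
qed

lemma frame_unique:
  assumes F: "frame W x D" and E: "derives W E" "derives W E'"
    and eq: "\<And>i Q. i < N \<Longrightarrow> Q \<in> W \<Longrightarrow> E (x i) Q = E' (x i) Q" and f: "reg W f" and Q: "Q \<in> W"
  shows "E f Q = E' f Q"
proof -
  have "W \<noteq> {}" using Q by blast
  show ?thesis
    by (rule derives_unique[OF E frame_reg[OF F] frame_alg_indep[OF F \<open>W \<noteq> {}\<close>] eq f Q])
qed

lemma frame_expand:
  assumes F: "frame W x D" and E: "derives W E" and f: "reg W f" and Q: "Q \<in> W"
  shows "E f Q = (\<Sum>i<N. E (x i) Q * D i f Q)"
proof (rule frame_unique[OF F E _ _ f Q])
  have W: "openin T W" by (rule frame_open[OF F])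
  have "vfield W (\<lambda>f P. \<Sum>i<N. E (x i) P * D i f P)"
    using F derives_reg[OF E frame_reg[OF F]] by (intro vfield_combination[OF W]) (auto simp: frame_def)
  then show "derives W (\<lambda>f P. \<Sum>i<N. E (x i) P * D i f P)"
    using vfield_derives[OF _ W order_refl] by blast
  fix j Q assume j: "j < N" and Q: "Q \<in> W"
  have "(\<Sum>i<N. E (x i) Q * D i (x j) Q) = (\<Sum>i<N. if i = j then E (x j) Q else 0)"
    by (intro sum.cong refl) (simp add: frame_dual[OF F _ j Q])
  then show "E (x j) Q = (\<Sum>i<N. E (x i) Q * D i (x j) Q)" using j by simp
qed

lemma frame_commute:
  assumes F: "frame W x D" and ij: "i < N" "j < N" and f: "reg W f" and Q: "Q \<in> W"
  shows "D i (D j f) Q = D j (D i f) Q"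
proof -
  have W: "openin T W" by (rule frame_open[OF F])
  have vf: "vfield W (D i)" "vfield W (D j)" using F ij by (auto simp: frame_def)
  have d: "derives W (\<lambda>f P. D i (D j f) P - D j (D i f) P)"
    using vfield_derives[OF vfield_commutator[OF vf] W order_refl] .
  have 0: "D i (D j (x k)) P = 0" if "i < N" "j < N" "k < N" "P \<in> W" for i j k P
  proof -
    have "D i (D j (x k)) P = D i (\<lambda>_. if k = j then 1 else 0) P"
      by (rule derives_cong[OF frame_derives[OF F that(1)] derives_reg[OF frame_derives[OF F that(2)] frame_reg[OF F that(3)]]
          frame_dual[OF F that(2,3)] that(4)])
    then show ?thesis using derives_const[OF frame_derives[OF F that(1)] that(4)] by simp
  qed
  have "W \<noteq> {}" using Q by blast
  have "D i (D j f) Q - D j (D i f) Q = 0"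
    by (rule derives_eq_0[OF d frame_reg[OF F] frame_alg_indep[OF F \<open>W \<noteq> {}\<close>] _ f Q]) (simp_all add: 0 ij)
  then show ?thesis by simp
qed

subsection \<open>The Taylor coefficients\<close>

definition tay :: "'a set \<Rightarrow> (nat \<Rightarrow> 'a \<Rightarrow> 'b) \<Rightarrow> ('a \<Rightarrow> 'b) \<Rightarrow> 'a \<Rightarrow> mono \<Rightarrow> 'b" where
  "tay W x f = taylor R N W x (restrict f W)"

lemma tay_outside: "r \<notin> monomials N \<Longrightarrow> tay W x f P r = 0"
  by (simp add: tay_def taylor_def)

lemma tay_zero: "P \<in> W \<Longrightarrow> tay W x f P 0 = f P"
proof -
  have "fold (\<lambda>i. id) [0..<n] g = g" for n and g :: "'a \<Rightarrow> 'b" by (induction n) auto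
  moreover have "(\<lambda>i. chart_partial R N W x i ^^ 0) = (\<lambda>i. id)" by (auto simp: fun_eq_iff)
  ultimately show "P \<in> W \<Longrightarrow> ?thesis"
    by (simp add: tay_def taylor_def multi_partial_def id_def)
qed

lemma tay_cong: "(\<And>Q. Q \<in> W \<Longrightarrow> f Q = g Q) \<Longrightarrow> tay W x f P r = tay W x g P r"
  unfolding tay_def by (metis restrict_ext)

text \<open>All further properties of the expansion follow by induction from this recursion.\<close>

lemma tay_step:
  assumes F: "frame W x D" and i: "i < N" and r: "r \<in> monomials N" and f: "reg W f" and P: "P \<in> W"
  shows "of_nat (Suc (lk r i)) * tay W x f P (r + unit_mono i) = tay W x (D i f) P r"
proof -
  let ?E = "\<lambda>i. chart_partial R N W x i"
  have W: "openin T W" "W \<noteq> {}" using frame_open[OF F] P by auto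
  have E: "?E i = (\<lambda>f\<in>A W. restrict (D i f) W)" if "i < N" for i
    by (rule chart_partial_frame[OF F W(2) that])
  have r1: "reg W g" if "g \<in> A W" for g using reg_of_functions[OF W(1) that] .
  have cl: "?E i g \<in> A W" if "i < N" "g \<in> A W" for i g
    using derives_reg[OF frame_derives[OF F that(1)] r1[OF that(2)]] that by (simp add: E reg_def)
  have res: "D i (restrict g W) Q = D i g Q" if "i < N" "reg W g" "Q \<in> W" for i g Q
    by (rule derives_cong[OF frame_derives[OF F that(1)] that(2) _ that(3), symmetric]) simp
  have comm: "?E i (?E j g) = ?E j (?E i g)" if "i < N" "j < N" "g \<in> A W" for i j g
  proof -
    have "D i (restrict (D j g) W) Q = D j (restrict (D i g) W) Q" if Q: "Q \<in> W" for Q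
      using res[OF \<open>i < N\<close> derives_reg[OF frame_derives[OF F \<open>j < N\<close>] r1[OF \<open>g \<in> A W\<close>]] Q]
        res[OF \<open>j < N\<close> derives_reg[OF frame_derives[OF F \<open>i < N\<close>] r1[OF \<open>g \<in> A W\<close>]] Q]
        frame_commute[OF F \<open>i < N\<close> \<open>j < N\<close> r1[OF \<open>g \<in> A W\<close>] Q] by simp
    then show ?thesis
      using cl[OF that(1,3)] cl[OF that(2,3)] that by (auto simp: E intro!: restrict_ext)
  qed
  have fA: "restrict f W \<in> A W" using f by (simp add: reg_def)
  have "multi_partial R N W x (r + unit_mono i) (restrict f W) = multi_partial R N W x r (?E i (restrict f W))"
  proof -
    have l: "lk (r + unit_mono i) = (lk r)(i := Suc (lk r i))"
      by (auto simp: lookup_add fun_eq_iff)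
    show ?thesis
      unfolding multi_partial_def l
      using fold_commuting_powers[of N "A W" ?E N "restrict f W" "lk r", OF cl comm order_refl fA] i by blast
  qed
  moreover have "?E i (restrict f W) = restrict (D i f) W"
    using fA res[OF i f] by (auto simp: E[OF i] intro!: restrict_ext)
  moreover have "(\<Prod>j<N. fact (lk (r + unit_mono i) j) :: 'b) = of_nat (Suc (lk r i)) * (\<Prod>j<N. fact (lk r j))"
  proof -
    have "(\<Prod>j<N. fact (lk (r + unit_mono i) j) :: 'b)
        = (\<Prod>j<N. (if j = i then of_nat (Suc (lk r i)) else 1) * fact (lk r j))"
      by (intro prod.cong refl) (auto simp: lookup_add)
    then show ?thesis using i by (simp add: prod.distrib)
  qed
  ultimately show ?thesis
    using r i by (simp add: tay_def taylor_def del: of_nat_Suc)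
qed

lemma tay_step':
  assumes "frame W x D" "i < N" "r \<in> monomials N" "reg W f" "P \<in> W"
  shows "tay W x f P (r + unit_mono i) = tay W x (D i f) P r / of_nat (Suc (lk r i))"
  using tay_step[OF assms] by (simp add: field_simps del: of_nat_Suc)

lemma tay_restrict_open:
  assumes F: "frame W x D" and V: "openin T V" "V \<subseteq> W" and f: "reg W f" and P: "P \<in> V"
  shows "tay V x f P r = tay W x f P r"
proof (cases "r \<in> monomials N")
  case True
  then show ?thesis using f
  proof (induction arbitrary: f rule: monomials_induct)
    case zero
    then show ?case using P V by (auto simp: tay_zero)
  next
    case (step r i)
    then show ?case
      using tay_step'[OF F step(2,1,4)] tay_step'[OF frame_subset[OF F V] step(2,1) reg_subset[OF step(4) V] P]
        derives_reg[OF frame_derives[OF F step(2)] step(4)] V P by auto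
  qed
qed (simp add: tay_outside)

lemma tay_reg:
  assumes F: "frame W x D" and f: "reg W f"
  shows "reg W (\<lambda>P. tay W x f P r)"
proof (cases "r \<in> monomials N")
  case True
  then show ?thesis using f
  proof (induction arbitrary: f rule: monomials_induct)
    case zero
    then show ?case by (subst reg_cong[of W _ f]) (auto simp: tay_zero)
  next
    case (step r i)
    have "reg W (\<lambda>P. tay W x (D i f) P r / of_nat (Suc (lk r i)))"
      using step(3)[OF derives_reg[OF frame_derives[OF F step(2)] step(4)]] frame_open[OF F]
      by (intro reg_divide reg_const) (auto simp del: of_nat_Suc)
    then show ?case
      by (subst reg_cong) (auto simp: tay_step'[OF F step(2,1,4)] simp del: of_nat_Suc)
  qed
qed (simp add: tay_outside reg_const frame_open[OF F])

lemma tay_add: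
  assumes F: "frame W x D" and f: "reg W f" and g: "reg W g" and P: "P \<in> W"
  shows "tay W x (\<lambda>Q. f Q + g Q) P r = tay W x f P r + tay W x g P r"
proof (cases "r \<in> monomials N")
  case True
  then show ?thesis using f g
  proof (induction arbitrary: f g rule: monomials_induct)
    case zero
    then show ?case using P by (simp add: tay_zero)
  next
    case (step r i)
    have "tay W x (D i (\<lambda>Q. f Q + g Q)) P r = tay W x (\<lambda>Q. D i f Q + D i g Q) P r"
      by (rule tay_cong) (rule derives_add[OF frame_derives[OF F step(2)] step(4,5)])
    then show ?case
      using tay_step'[OF F step(2,1,4) P] tay_step'[OF F step(2,1,5) P] tay_step'[OF F step(2,1) reg_add[OF step(4,5)] P]
        step(3)[OF derives_reg[OF frame_derives[OF F step(2)] step(4)] derives_reg[OF frame_derives[OF F step(2)] step(5)]]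
      by (simp add: add_divide_distrib del: of_nat_Suc)
  qed
qed (simp add: tay_outside)

lemma ps_mult_outside:
  assumes "\<And>a. a \<notin> monomials N \<Longrightarrow> f a = 0" "\<And>a. a \<notin> monomials N \<Longrightarrow> g a = 0" "r \<notin> monomials N"
  shows "ps_mult f g r = 0"
  unfolding ps_mult_def
proof (intro sum.neutral ballI, clarify)
  fix a b assume "r = a + b"
  then have "a \<notin> monomials N \<or> b \<notin> monomials N" using assms(3) monomials_add_iff by blast
  then show "f a * g b = 0" using assms(1,2) by auto
qed

text \<open>Both sides satisfy the same recursion in \<open>r\<close>, by the Leibniz rules for \<open>D i\<close> and for power series.\<close>

lemma tay_mult:
  assumes F: "frame W x D" and f: "reg W f" and g: "reg W g" and P: "P \<in> W"
  shows "tay W x (\<lambda>Q. f Q * g Q) P r = ps_mult (tay W x f P) (tay W x g P) r"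
proof (cases "r \<in> monomials N")
  case True
  then show ?thesis using f g
  proof (induction arbitrary: f g rule: monomials_induct)
    case zero
    then show ?case using P by (simp add: tay_zero ps_mult_zero_exponent)
  next
    case (step r i)
    note D = frame_derives[OF F step(2)]
    note Df = derives_reg[OF D step(4)] and Dg = derives_reg[OF D step(5)]
    have cng: "ps_mult u v r = ps_mult u' v' r"
      if "\<And>a. a \<in> monomials N \<Longrightarrow> u a = u' a" "\<And>a. a \<in> monomials N \<Longrightarrow> v a = v' a" for u v u' v' :: "mono \<Rightarrow> 'b"
      unfolding ps_mult_def
    proof (rule sum.cong[OF refl])
      fix ab assume "ab \<in> {(a, b). a + b = r}"
      then obtain a b where ab: "ab = (a, b)" "a + b = r" by blast
      then have "a \<in> monomials N" "b \<in> monomials N" using step(1) monomials_add_iff[of a b N] by auto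
      then show "(case ab of (a, b) \<Rightarrow> u a * v b) = (case ab of (a, b) \<Rightarrow> u' a * v' b)"
        using that ab by simp
    qed
    have "of_nat (Suc (lk r i)) * tay W x (\<lambda>Q. f Q * g Q) P (r + unit_mono i)
        = tay W x (D i (\<lambda>Q. f Q * g Q)) P r"
      by (rule tay_step[OF F step(2,1) reg_mult[OF step(4,5)] P])
    also have "\<dots> = tay W x (\<lambda>Q. f Q * D i g Q + g Q * D i f Q) P r"
      by (rule tay_cong) (rule derives_mult[OF D step(4,5)])
    also have "\<dots> = tay W x (\<lambda>Q. f Q * D i g Q) P r + tay W x (\<lambda>Q. D i f Q * g Q) P r"
      using tay_add[OF F reg_mult[OF step(4) Dg] reg_mult[OF step(5) Df] P] by (simp add: mult.commute)
    also have "\<dots> = ps_mult (tay W x f P) (tay W x (D i g) P) r + ps_mult (tay W x (D i f) P) (tay W x g P) r"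
      using step(3)[OF step(4) Dg] step(3)[OF Df step(5)] by simp
    also have "ps_mult (tay W x f P) (tay W x (D i g) P) r
        = ps_mult (tay W x f P) (\<lambda>b. of_nat (Suc (lk b i)) * tay W x g P (b + unit_mono i)) r"
      by (rule cng) (simp_all only: tay_step[OF F step(2) _ step(5) P])
    also have "ps_mult (tay W x (D i f) P) (tay W x g P) r
        = ps_mult (\<lambda>a. of_nat (Suc (lk a i)) * tay W x f P (a + unit_mono i)) (tay W x g P) r"
      by (rule cng) (simp_all only: tay_step[OF F step(2) _ step(4) P])
    finally have "of_nat (Suc (lk r i)) * tay W x (\<lambda>Q. f Q * g Q) P (r + unit_mono i)
        = of_nat (Suc (lk r i)) * ps_mult (tay W x f P) (tay W x g P) (r + unit_mono i)"
      by (simp only: ps_mult_derivative add.commute)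
    then show ?case by (simp del: of_nat_Suc)
  qed
next
  case False
  then show ?thesis using ps_mult_outside[of "tay W x f P" "tay W x g P" r] by (simp add: tay_outside)
qed

lemma tay_const:
  assumes F: "frame W x D" and P: "P \<in> W"
  shows "tay W x (\<lambda>_. c) P r = c * ps_one r"
proof (cases "r \<in> monomials N")
  case True
  then show ?thesis
  proof (induction arbitrary: c rule: monomials_induct)
    case zero
    then show ?case using P by (simp add: tay_zero ps_one_def)
  next
    case (step r i)
    have "tay W x (D i (\<lambda>_. c)) P r = tay W x (\<lambda>_. 0) P r"
      by (rule tay_cong) (rule derives_const[OF frame_derives[OF F step(2)]])
    moreover have "r + unit_mono i \<noteq> 0"
      using mdeg_add[of r "unit_mono i"] by auto
    ultimately show ?case
      using tay_step'[OF F step(2,1) reg_const[OF frame_open[OF F]] P, of c] step(3)[of 0] by (simp add: ps_one_def)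
  qed
next
  case False
  then have "r \<noteq> 0" by auto
  then show ?thesis using False by (simp add: tay_outside ps_one_def)
qed

lemma ps_mult_const: "ps_mult (\<lambda>a. c * ps_one a) g r = c * g r"
proof -
  have "ps_mult (\<lambda>a. c * ps_one a) g r = (\<Sum>(a, b)\<in>{(0, r)}. c * ps_one a * g b)"
    unfolding ps_mult_def using finite_mono_pairs[of r]
    by (intro sum.mono_neutral_right) (auto simp: ps_one_def split: if_splits)
  then show ?thesis by (simp add: ps_one_def)
qed

lemma tay_scale:
  assumes F: "frame W x D" and f: "reg W f" and P: "P \<in> W"
  shows "tay W x (\<lambda>Q. c * f Q) P r = c * tay W x f P r"
proof -
  have "tay W x (\<lambda>_. c) P = (\<lambda>a. c * ps_one a)" using tay_const[OF F P] by auto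
  then show ?thesis
    using tay_mult[OF F reg_const[OF frame_open[OF F]] f P, of c] by (simp add: ps_mult_const)
qed

lemma tay_sum:
  assumes F: "frame W x D" and f: "\<And>j. j \<in> J \<Longrightarrow> reg W (f j)" and P: "P \<in> W"
  shows "tay W x (\<lambda>Q. \<Sum>j\<in>J. f j Q) P r = (\<Sum>j\<in>J. tay W x (f j) P r)"
  using f
proof (induction J rule: infinite_finite_induct)
  case (insert j J)
  then show ?case
    using tay_add[OF F _ reg_sum[OF frame_open[OF F]] P, of "f j" J f] by simp
qed (use tay_const[OF F P, of 0] in auto)

lemma tay_diff:
  assumes F: "frame W x D" and f: "reg W f" and g: "reg W g" and P: "P \<in> W"
  shows "tay W x (\<lambda>Q. f Q - g Q) P r = tay W x f P r - tay W x g P r"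
  using tay_add[OF F f reg_uminus[OF g] P] tay_scale[OF F g P, of "-1"] by simp

lemma reg_shifted_monomial:
  assumes F: "frame W x D" and m: "m \<in> monomials N"
  shows "reg W (\<lambda>Q. mono_eval m (\<lambda>i. x i Q - a i))"
proof -
  have W: "openin T W" by (rule frame_open[OF F])
  have "Poly_Mapping.single m 1 \<in> polys N" using m by (auto simp: polys_def)
  then have "reg W (\<lambda>Q. peval (Poly_Mapping.single m 1) (\<lambda>i. x i Q - a i))"
    by (rule reg_peval[OF W]) (auto intro!: reg_diff reg_const W frame_reg[OF F])
  then show ?thesis by simp
qed

text \<open>Linear combinations of these functions realize any finite set of prescribed Taylor coefficients at \<open>P\<close>.\<close>

lemma tay_shifted_monomial:
  assumes F: "frame W x D" and m: "m \<in> monomials N" and P: "P \<in> W"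
  shows "tay W x (\<lambda>Q. mono_eval m (\<lambda>i. x i Q - x i P)) P r = (if r = m then 1 else 0)"
proof (cases "r \<in> monomials N")
  case True
  then show ?thesis using m
  proof (induction arbitrary: m rule: monomials_induct)
    case zero
    have "mono_eval m (\<lambda>i. 0 :: 'b) = (if m = 0 then 1 else 0)"
      using mono_eval_zero_point[of m] by (auto simp: mono_eval_def)
    then show ?case using P by (simp add: tay_zero)
  next
    case (step r i)
    have W: "openin T W" by (rule frame_open[OF F])
    let ?b = "\<lambda>j Q. x j Q - x j P"
    let ?X = "\<lambda>m Q. mono_eval m (\<lambda>j. ?b j Q)"
    have rb: "reg W (?b j)" if "j < N" for j
      using that by (intro reg_diff reg_const W frame_reg[OF F])
    have Db: "D i (?b j) Q = (if j = i then 1 else 0)" if "j < N" "Q \<in> W" for j Q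
      using derives_diff[OF frame_derives[OF F step(2)] frame_reg[OF F that(1)] reg_const[OF W] that(2)]
        derives_const[OF frame_derives[OF F step(2)] that(2)] frame_dual[OF F step(2) that] by simp
    have s: "Poly_Mapping.single m 1 \<in> polys N" using step(4) by (auto simp: polys_def)
    have DX: "D i (?X m) Q = of_nat (lk m i) * ?X (m - unit_mono i) Q" if Q: "Q \<in> W" for Q
    proof -
      have "D i (\<lambda>Q. peval (Poly_Mapping.single m 1) (\<lambda>j. ?b j Q)) Q
          = dir_deriv N (Poly_Mapping.single m 1) (\<lambda>j. ?b j Q) (\<lambda>j. D i (?b j) Q)"
        by (rule derives_peval[OF frame_derives[OF F step(2)] s rb Q])
      also have "\<dots> = (\<Sum>j<N. if j = i then peval (ppartial j (Poly_Mapping.single m 1)) (\<lambda>j. ?b j Q) else 0)"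
        unfolding dir_deriv_def by (intro sum.cong refl) (simp add: Db Q)
      finally show ?thesis using step(2) by (simp add: ppartial_single)
    qed
    have rX: "reg W (?X m)" if "m \<in> monomials N" for m
      by (rule reg_shifted_monomial[OF F that])
    have tX: "tay W x (D i (?X m)) P r = of_nat (lk m i) * (if r = m - unit_mono i then 1 else 0)"
    proof (cases "lk m i = 0")
      case True
      then have "tay W x (D i (?X m)) P r = tay W x (\<lambda>_. 0) P r"
        by (intro tay_cong) (simp add: DX)
      then show ?thesis using True tay_const[OF F P, of 0] by simp
    next
      case False
      have m': "m - unit_mono i \<in> monomials N"
        using step(4) mono_remove_unit[OF False] monomials_add_iff by metis
      have "tay W x (D i (?X m)) P r = tay W x (\<lambda>Q. of_nat (lk m i) * ?X (m - unit_mono i) Q) P r"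
        by (intro tay_cong) (simp add: DX)
      then show ?thesis using tay_scale[OF F rX[OF m'] P] step(3)[OF m'] by simp
    qed
    show ?case
    proof (cases "lk m i = 0")
      case True
      then have "r + unit_mono i \<noteq> m" by (auto simp: lookup_add)
      then show ?thesis using tay_step'[OF F step(2,1) rX[OF step(4)] P] tX True by simp
    next
      case False
      then have "(r = m - unit_mono i) = (r + unit_mono i = m)"
        using mono_remove_unit[OF False] by (metis add_diff_cancel_right')
      moreover have "r + unit_mono i = m \<Longrightarrow> lk m i = Suc (lk r i)"
        by (auto simp: lookup_add)
      ultimately show ?thesis using tay_step'[OF F step(2,1) rX[OF step(4)] P] tX
        by (auto simp del: of_nat_Suc)
    qed
  qed
qed (use m in \<open>auto simp: tay_outside\<close>)

subsection \<open>Order of vanishing\<close>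

definition vanishes :: "'a set \<Rightarrow> (nat \<Rightarrow> 'a \<Rightarrow> 'b) \<Rightarrow> nat \<Rightarrow> 'a \<Rightarrow> ('a \<Rightarrow> 'b) \<Rightarrow> bool" where
  "vanishes W x k P f \<longleftrightarrow> (\<forall>r\<in>monomials N. mdeg r \<le> k \<longrightarrow> tay W x f P r = 0)"

lemma vanishes_mult:
  assumes F: "frame W x D" and f: "reg W f" and g: "reg W g" and P: "P \<in> W" and v: "vanishes W x k P g"
  shows "vanishes W x k P (\<lambda>Q. f Q * g Q)"
  unfolding vanishes_def
proof (intro ballI impI)
  fix r assume r: "r \<in> monomials N" "mdeg r \<le> k"
  have "tay W x g P b = 0" if "a + b = r" for a b
    using that r v mdeg_add[of a b] monomials_add_iff[of a b N] by (auto simp: vanishes_def)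
  then show "tay W x (\<lambda>Q. f Q * g Q) P r = 0"
    unfolding tay_mult[OF F f g P] ps_mult_def by (intro sum.neutral) auto
qed

lemma vanishes_Suc:
  assumes F: "frame W x D" and f: "reg W f" and P: "P \<in> W"
  shows "vanishes W x (Suc k) P f \<longleftrightarrow> f P = 0 \<and> (\<forall>i<N. vanishes W x k P (D i f))"
proof (intro iffI conjI allI impI)
  assume v: "vanishes W x (Suc k) P f"
  show "f P = 0" using v P tay_zero[OF P, of x f] by (auto simp: vanishes_def dest: bspec[of _ _ 0])
  fix i assume i: "i < N"
  show "vanishes W x k P (D i f)"
    unfolding vanishes_def
  proof (intro ballI impI)
    fix r assume r: "r \<in> monomials N" "mdeg r \<le> k"
    then have "tay W x f P (r + unit_mono i) = 0" using v i by (auto simp: vanishes_def mdeg_add)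
    then show "tay W x (D i f) P r = 0" using tay_step[OF F i r(1) f P] by simp
  qed
next
  assume v: "f P = 0 \<and> (\<forall>i<N. vanishes W x k P (D i f))"
  show "vanishes W x (Suc k) P f"
    unfolding vanishes_def
  proof (intro ballI impI)
    fix r assume r: "r \<in> monomials N" "mdeg r \<le> Suc k"
    show "tay W x f P r = 0"
    proof (cases "r = 0")
      case True
      then show ?thesis using v P by (simp add: tay_zero)
    next
      case False
      with r(1) obtain i r' where r': "i < N" "r' \<in> monomials N" "r = r' + unit_mono i"
        by (rule mono_nonzero_split)
      then have "tay W x (D i f) P r' = 0" using v r(2) by (auto simp: vanishes_def mdeg_add)
      then show ?thesis using tay_step'[OF F r'(1,2) f P] r'(3) by simp
    qed
  qed
qed

text \<open>A function vanishes to order \<open>k + 1\<close> iff its value and the order \<open>k\<close> parts of its derivatives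
  vanish, and the derivatives in one chart are combinations of those in any other.\<close>

lemma vanishes_chart_independent:
  assumes F: "frame W x D" and G: "frame W y E" and f: "reg W f" and P: "P \<in> W" and v: "vanishes W x k P f"
  shows "vanishes W y k P f"
  using f v
proof (induction k arbitrary: f)
  case 0
  then have "f P = 0" using tay_zero[OF P, of x f] by (auto simp: vanishes_def)
  then show ?case using P by (auto simp: vanishes_def mdeg_eq_0_iff tay_zero)
next
  case (Suc k)
  have W: "openin T W" by (rule frame_open[OF F])
  have 1: "f P = 0" "\<And>i. i < N \<Longrightarrow> vanishes W x k P (D i f)"
    using Suc.prems vanishes_Suc[OF F Suc.prems(1) P] by auto
  have rD: "reg W (D i f)" if "i < N" for i
    by (rule derives_reg[OF frame_derives[OF F that] Suc.prems(1)])
  have "vanishes W y k P (E j f)" if j: "j < N" for j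
    unfolding vanishes_def
  proof (intro ballI impI)
    fix r assume r: "r \<in> monomials N" "mdeg r \<le> k"
    have rE: "reg W (E j (x i))" if "i < N" for i
      by (rule derives_reg[OF frame_derives[OF G j] frame_reg[OF F that]])
    have "tay W y (E j f) P r = tay W y (\<lambda>Q. \<Sum>i<N. E j (x i) Q * D i f Q) P r"
      by (rule tay_cong) (rule frame_expand[OF F frame_derives[OF G j] Suc.prems(1)])
    also have "\<dots> = (\<Sum>i<N. tay W y (\<lambda>Q. E j (x i) Q * D i f Q) P r)"
      by (rule tay_sum[OF G _ P]) (use rD rE reg_mult in auto)
    also have "\<dots> = 0"
    proof (intro sum.neutral ballI)
      fix i assume "i \<in> {..<N}"
      then have i: "i < N" by simp
      have "vanishes W y k P (\<lambda>Q. E j (x i) Q * D i f Q)"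
        by (rule vanishes_mult[OF G rE[OF i] rD[OF i] P Suc.IH[OF rD[OF i] 1(2)[OF i]]])
      then show "tay W y (\<lambda>Q. E j (x i) Q * D i f Q) P r = 0" using r by (simp add: vanishes_def)
    qed
    finally show "tay W y (E j f) P r = 0" .
  qed
  then show ?case using vanishes_Suc[OF G Suc.prems(1) P] 1(1) by blast
qed

end

section \<open>The transition formula and the cocycle condition\<close>

lemma mdeg_pos_iff [simp]: "0 < mdeg m \<longleftrightarrow> m \<noteq> 0"
  using mdeg_eq_0_iff[of m] by auto

context variety
begin

lemma ps_power_tay:
  assumes F: "frame W y D" and x: "\<And>i. i < N \<Longrightarrow> reg W (x i)" and k: "k \<in> monomials N" and P: "P \<in> W"
  shows "ps_power N (\<lambda>i. tay W y (x i) P) k = tay W y (\<lambda>Q. mono_eval k (\<lambda>i. x i Q)) P"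
proof -
  have W: "openin T W" by (rule frame_open[OF F])
  have pw: "(ps_mult (tay W y f P) ^^ e) (tay W y g P) = tay W y (\<lambda>Q. f Q ^ e * g Q) P"
    if f: "reg W f" and g: "reg W g" for f g e
  proof (induction e)
    case (Suc e)
    have "tay W y (\<lambda>Q. f Q ^ Suc e * g Q) P = tay W y (\<lambda>Q. f Q * (f Q ^ e * g Q)) P"
      by (simp add: mult.assoc)
    also have "\<dots> = ps_mult (tay W y f P) (tay W y (\<lambda>Q. f Q ^ e * g Q) P)"
      using tay_mult[OF F f reg_mult[OF reg_power[OF f] g] P] by auto
    finally show ?case using Suc by simp
  qed simp
  have "fold (\<lambda>i. ps_mult (tay W y (x i) P) ^^ lk k i) [0..<n] ps_one
      = tay W y (\<lambda>Q. \<Prod>i<n. x i Q ^ lk k i) P" if "n \<le> N" for n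
    using that
  proof (induction n)
    case 0
    then show ?case using tay_const[OF F P, of 1] by auto
  next
    case (Suc n)
    have "reg W (\<lambda>Q. \<Prod>i<n. x i Q ^ lk k i)"
      using Suc.prems by (intro reg_prod[OF W] reg_power x) auto
    then show ?case
      using Suc pw[of "x n" "\<lambda>Q. \<Prod>i<n. x i Q ^ lk k i" "lk k n"] x[of n] by (simp add: mult.commute)
  qed
  moreover have "mono_eval k (\<lambda>i. x i Q) = (\<Prod>i<N. x i Q ^ lk k i)" for Q
    using k by (intro mono_eval_superset) (auto simp: monomials_def)
  ultimately show ?thesis by (simp add: ps_power_def)
qed

lemma reg_mono_eval:
  assumes W: "openin T W" and x: "\<And>i. i < N \<Longrightarrow> reg W (x i)" and k: "k \<in> monomials N"
  shows "reg W (\<lambda>Q. mono_eval k (\<lambda>i. x i Q))"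
proof -
  have "Poly_Mapping.single k 1 \<in> polys N" using k by (auto simp: polys_def)
  then have "reg W (\<lambda>Q. peval (Poly_Mapping.single k 1) (\<lambda>i. x i Q))"
    by (rule reg_peval[OF W _ x])
  then show ?thesis by simp
qed

lemma below_mono_in_monomials:
  assumes "m \<in> monomials N" "k \<in> {k. \<forall>i. lk k i \<le> lk m i}"
  shows "k \<in> monomials N" "m - k \<in> monomials N"
proof -
  have "k + (m - k) = m"
    using assms(2) by (intro poly_mapping_eqI) (auto simp: lookup_add lookup_minus)
  then show "k \<in> monomials N" "m - k \<in> monomials N"
    using assms(1) monomials_add_iff[of k "m - k" N] by simp_all
qed

lemma transition_field_expand:
  assumes F: "frame W x Dx" and G: "frame W y Dy" and P: "P \<in> W" and m: "m \<in> monomials N"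
    and p: "p < N" and q: "q < N"
  shows "transition_field R N W x y m p P q r = (\<Sum>k\<in>{k. \<forall>i. lk k i \<le> lk m i}.
          (-1) ^ (mdeg m - mdeg k) * (\<Prod>i<N. of_nat (lk m i choose lk k i)) *
          mono_eval (m - k) (\<lambda>i. x i P) *
          (tay W y (\<lambda>Q. mono_eval k (\<lambda>i. x i Q) * Dx p (y q) Q) P r
            - mono_eval k (\<lambda>i. x i P) * Dx p (y q) P * ps_one r))"
proof -
  have "W \<noteq> {}" using P by blast
  have W: "openin T W" by (rule frame_open[OF F])
  have ry: "reg W (y q)" and rx: "\<And>i. i < N \<Longrightarrow> reg W (x i)" using frame_reg F G q by blast+
  have rD: "reg W (Dx p (y q))" by (rule derives_reg[OF frame_derives[OF F p] ry])
  have cp: "chart_partial R N W x p (restrict (y q) W) = restrict (Dx p (y q)) W"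
  proof -
    have "restrict (Dx p (restrict (y q) W)) W = restrict (Dx p (y q)) W"
      by (intro restrict_ext derives_cong[OF frame_derives[OF F p] ry, symmetric]) auto
    then show ?thesis
      using ry by (simp add: chart_partial_frame[OF F \<open>W \<noteq> {}\<close> p] reg_def)
  qed
  have "ps_mult (ps_power N (\<lambda>i. tay W y (x i) P) k) (tay W y (Dx p (y q)) P) r
      = tay W y (\<lambda>Q. mono_eval k (\<lambda>i. x i Q) * Dx p (y q) Q) P r" if "k \<in> monomials N" for k
  proof -
    have "ps_power N (\<lambda>i. tay W y (x i) P) k = tay W y (\<lambda>Q. mono_eval k (\<lambda>i. x i Q)) P"
      by (rule ps_power_tay[OF G rx that P])
    then show ?thesis
      using tay_mult[OF G reg_mono_eval[OF W, of x, OF rx that] rD P, where r = r] by simp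
  qed
  then show ?thesis
    unfolding transition_field_def Let_def cp tay_def[symmetric]
    using P below_mono_in_monomials(1)[OF m] by (intro sum.cong refl) simp
qed

text \<open>By the binomial formula, the products with \<open>G(y + Y)\<^sup>k\<close> add up to the expansion of \<open>(x - x(P))\<^sup>m \<partial>y\<^sub>q/\<partial>x\<^sub>p\<close>, and
  the subtracted terms to \<open>(x(P) - x(P))\<^sup>m \<partial>y\<^sub>q/\<partial>x\<^sub>p\<close>, which is \<open>0\<close> as \<open>m \<noteq> 0\<close>.\<close>

theorem transition_field_eq_taylor:
  assumes F: "frame W x Dx" and G: "frame W y Dy" and P: "P \<in> W" and m: "m \<in> monomials N" "m \<noteq> 0"
    and p: "p < N" and q: "q < N"
  shows "transition_field R N W x y m p P q r
    = tay W y (\<lambda>Q. mono_eval m (\<lambda>i. x i Q - x i P) * Dx p (y q) Q) P r"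
proof -
  let ?K = "{k. \<forall>i. lk k i \<le> lk m i}" and ?H = "Dx p (y q)"
  let ?c = "\<lambda>k. (-1) ^ (mdeg m - mdeg k) * (\<Prod>i<N. of_nat (lk m i choose lk k i)) * mono_eval (m - k) (\<lambda>i. x i P)"
  have W: "openin T W" by (rule frame_open[OF F])
  have rx: "\<And>i. i < N \<Longrightarrow> reg W (x i)" using frame_reg F by blast
  have rH: "reg W ?H" by (rule derives_reg[OF frame_derives[OF F p] frame_reg[OF G q]])
  have rk: "reg W (\<lambda>Q. mono_eval k (\<lambda>i. x i Q) * ?H Q)" if "k \<in> ?K" for k
    using reg_mult[OF reg_mono_eval[OF W rx below_mono_in_monomials(1)[OF m(1) that]] rH] .
  have "(\<Sum>k\<in>?K. ?c k * (mono_eval k (\<lambda>i. x i P) * ?H P * ps_one r))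
      = (\<Sum>k\<in>?K. ?c k * mono_eval k (\<lambda>i. x i P)) * (?H P * ps_one r)"
    by (simp add: sum_distrib_right mult.assoc)
  also have "\<dots> = 0"
    using multi_binomial[OF m(1), of "\<lambda>i. x i P" "\<lambda>i. x i P"] mono_eval_zero_point[OF m(2), where ?'a = 'b] by simp
  finally have "transition_field R N W x y m p P q r
      = (\<Sum>k\<in>?K. ?c k * tay W y (\<lambda>Q. mono_eval k (\<lambda>i. x i Q) * ?H Q) P r)"
    unfolding transition_field_expand[OF F G P m(1) p q] by (simp add: right_diff_distrib sum_subtractf)
  also have "\<dots> = (\<Sum>k\<in>?K. tay W y (\<lambda>Q. ?c k * (mono_eval k (\<lambda>i. x i Q) * ?H Q)) P r)"
    by (intro sum.cong refl tay_scale[OF G rk P, symmetric])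
  also have "\<dots> = tay W y (\<lambda>Q. \<Sum>k\<in>?K. ?c k * (mono_eval k (\<lambda>i. x i Q) * ?H Q)) P r"
    by (intro tay_sum[OF G _ P, symmetric] reg_mult[OF reg_const[OF W]] rk)
  also have "\<dots> = tay W y (\<lambda>Q. mono_eval m (\<lambda>i. x i Q - x i P) * ?H Q) P r"
  proof (rule tay_cong)
    fix Q
    have "(\<Sum>k\<in>?K. ?c k * (mono_eval k (\<lambda>i. x i Q) * ?H Q)) = (\<Sum>k\<in>?K. ?c k * mono_eval k (\<lambda>i. x i Q)) * ?H Q"
      by (simp add: sum_distrib_right mult.assoc)
    then show "(\<Sum>k\<in>?K. ?c k * (mono_eval k (\<lambda>i. x i Q) * ?H Q)) = mono_eval m (\<lambda>i. x i Q - x i P) * ?H Q"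
      using multi_binomial[OF m(1), of "\<lambda>i. x i P" "\<lambda>i. x i Q"] by simp
  qed
  finally show ?thesis .
qed

lemma reg_transition_field:
  assumes F: "frame W x Dx" and G: "frame W y Dy" and m: "m \<in> monomials N" and p: "p < N" and q: "q < N"
  shows "reg W (\<lambda>P. transition_field R N W x y m p P q r)"
proof -
  have W: "openin T W" by (rule frame_open[OF F])
  have rx: "\<And>i. i < N \<Longrightarrow> reg W (x i)" using frame_reg F by blast
  have rH: "reg W (Dx p (y q))" by (rule derives_reg[OF frame_derives[OF F p] frame_reg[OF G q]])
  have "reg W (\<lambda>P. \<Sum>k\<in>{k. \<forall>i. lk k i \<le> lk m i}.
          (-1) ^ (mdeg m - mdeg k) * (\<Prod>i<N. of_nat (lk m i choose lk k i)) *
          mono_eval (m - k) (\<lambda>i. x i P) *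
          (tay W y (\<lambda>Q. mono_eval k (\<lambda>i. x i Q) * Dx p (y q) Q) P r
            - mono_eval k (\<lambda>i. x i P) * Dx p (y q) P * ps_one r))"
    by (intro reg_sum[OF W] reg_mult[of _ "\<lambda>P. _ P * _ P"] reg_mult reg_const[OF W] reg_diff
        tay_reg[OF G] reg_mono_eval[OF W rx] rH below_mono_in_monomials[OF m])
  then show ?thesis
    by (subst reg_cong) (rule transition_field_expand[OF F G _ m p q])
qed

lemma vanishes_shifted_monomial:
  assumes F: "frame W x D" and m: "m \<in> monomials N" "k < mdeg m" and P: "P \<in> W"
  shows "vanishes W x k P (\<lambda>Q. mono_eval m (\<lambda>i. x i Q - x i P))"
  using m(2) by (auto simp: vanishes_def tay_shifted_monomial[OF F m(1) P])

lemma transition_field_order: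
  assumes F: "frame W x Dx" and G: "frame W y Dy" and P: "P \<in> W" and m: "m \<in> monomials N"
    and r: "mdeg r < mdeg m" and p: "p < N" and q: "q < N"
  shows "transition_field R N W x y m p P q r = 0"
proof (cases "r \<in> monomials N")
  case True
  have m0: "m \<noteq> 0" using r by auto
  have rX: "reg W (\<lambda>Q. mono_eval m (\<lambda>i. x i Q - x i P))" by (rule reg_shifted_monomial[OF F m])
  have rH: "reg W (Dx p (y q))" by (rule derives_reg[OF frame_derives[OF F p] frame_reg[OF G q]])
  have "vanishes W y (mdeg r) P (\<lambda>Q. Dx p (y q) Q * mono_eval m (\<lambda>i. x i Q - x i P))"
    by (rule vanishes_mult[OF G rH rX P vanishes_chart_independent[OF F G rX P vanishes_shifted_monomial[OF F m r P]]])
  then show ?thesis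
    using True by (simp add: transition_field_eq_taylor[OF F G P m m0 p q] vanishes_def mult.commute)
next
  case False
  have "m \<noteq> 0" using r by auto
  then show ?thesis using False by (simp add: transition_field_eq_taylor[OF F G P m _ p q] tay_outside)
qed

text \<open>The transition function applied to \<open>\<Sum>\<^sub>p \<Sum>\<^sub>m v\<^sub>p\<^sub>m X\<^sup>m \<partial>/\<partial>X\<^sub>p\<close>; the terms with \<open>|m| > |r|\<close>, which do not
  contribute to the coefficient of \<open>Y\<^sup>r\<close>, are left out to make the sum finite.\<close>

definition transfer :: "'a set \<Rightarrow> (nat \<Rightarrow> 'a \<Rightarrow> 'b) \<Rightarrow> (nat \<Rightarrow> 'a \<Rightarrow> 'b) \<Rightarrow> 'a \<Rightarrow> (nat \<Rightarrow> mono \<Rightarrow> 'b) \<Rightarrow> nat \<Rightarrow> mono \<Rightarrow> 'b" where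
  "transfer W x y P v q r = (if q < N then \<Sum>p<N. \<Sum>m\<in>{m \<in> monomials N. 0 < mdeg m \<and> mdeg m \<le> mdeg r}.
     v p m * transition_field R N W x y m p P q r else 0)"

lemma finite_positive_monomials: "finite {m \<in> monomials N. 0 < mdeg m \<and> mdeg m \<le> k}"
  using finite_monomials_mdeg[of N k] by (rule finite_subset[rotated]) auto

text \<open>The coefficients \<open>v\<close> at \<open>P\<close> represent the vector field \<open>\<Sum>\<^sub>p g\<^sub>p \<partial>/\<partial>x\<^sub>p\<close> up to order \<open>k\<close> if
  they are the Taylor coefficients of the \<open>g\<^sub>p\<close>.  In the chart \<open>y\<close> this field has the coefficient
  functions \<open>\<Sum>\<^sub>p g\<^sub>p \<partial>y\<^sub>q/\<partial>x\<^sub>p\<close>, and the transition function computes their Taylor coefficients: the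
  difference between \<open>g\<^sub>p\<close> and its Taylor polynomial vanishes to order \<open>k\<close>, in the chart \<open>y\<close> too.\<close>

lemma transfer_represents:
  assumes F: "frame W x Dx" and G: "frame W y Dy" and P: "P \<in> W" and q: "q < N"
    and g: "\<And>p. p < N \<Longrightarrow> reg W (g p)" "\<And>p. p < N \<Longrightarrow> g p P = 0"
    and v: "\<And>p m. p < N \<Longrightarrow> m \<in> monomials N \<Longrightarrow> m \<noteq> 0 \<Longrightarrow> mdeg m \<le> k \<Longrightarrow> tay W x (g p) P m = v p m"
    and r: "r \<in> monomials N" "mdeg r \<le> k"
  shows "transfer W x y P v q r = tay W y (\<lambda>Q. \<Sum>p<N. g p Q * Dx p (y q) Q) P r"
proof -
  let ?M = "{m \<in> monomials N. 0 < mdeg m \<and> mdeg m \<le> mdeg r}"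
  let ?X = "\<lambda>m Q. mono_eval m (\<lambda>i. x i Q - x i P)"
  have W: "openin T W" by (rule frame_open[OF F])
  have rX: "reg W (?X m)" if "m \<in> ?M" for m using that by (intro reg_shifted_monomial[OF F]) simp
  have rH: "reg W (Dx p (y q))" if "p < N" for p
    by (rule derives_reg[OF frame_derives[OF F that] frame_reg[OF G q]])
  have "tay W y (\<lambda>Q. g p Q * Dx p (y q) Q) P r = (\<Sum>m\<in>?M. v p m * transition_field R N W x y m p P q r)"
    if p: "p < N" for p
  proof -
    let ?S = "\<lambda>Q. \<Sum>m\<in>?M. v p m * ?X m Q"
    have rS: "reg W ?S" by (intro reg_sum[OF W] reg_mult[OF reg_const[OF W]] rX)
    have "vanishes W x (mdeg r) P (\<lambda>Q. g p Q - ?S Q)"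
      unfolding vanishes_def
    proof (intro ballI impI)
      fix l assume l: "l \<in> monomials N" "mdeg l \<le> mdeg r"
      have "tay W x ?S P l = (\<Sum>m\<in>?M. tay W x (\<lambda>Q. v p m * ?X m Q) P l)"
        by (rule tay_sum[OF F _ P]) (intro reg_mult[OF reg_const[OF W]] rX)
      also have "\<dots> = (\<Sum>m\<in>?M. v p m * (if l = m then 1 else 0))"
        by (intro sum.cong refl) (simp add: tay_scale[OF F rX P] tay_shifted_monomial[OF F _ P])
      also have "\<dots> = (if l \<in> ?M then v p l else 0)"
        using finite_positive_monomials[of "mdeg r"] by (simp add: if_distrib cong: if_cong)
      also have "\<dots> = tay W x (g p) P l"
      proof (cases "l = 0")
        case True
        then show ?thesis using g(2)[OF p] by (simp add: tay_zero P)
      next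
        case False
        then have "0 < mdeg l" using mdeg_eq_0_iff by auto
        then show ?thesis using l v[OF p l(1) False] r(2) by simp
      qed
      finally show "tay W x (\<lambda>Q. g p Q - ?S Q) P l = 0"
        using tay_diff[OF F g(1)[OF p] rS P] by simp
    qed
    then have "vanishes W y (mdeg r) P (\<lambda>Q. g p Q - ?S Q)"
      by (rule vanishes_chart_independent[OF F G reg_diff[OF g(1)[OF p] rS] P])
    from vanishes_mult[OF G rH[OF p] reg_diff[OF g(1)[OF p] rS] P this]
    have "tay W y (\<lambda>Q. Dx p (y q) Q * (g p Q - ?S Q)) P r = 0"
      using r by (simp add: vanishes_def)
    moreover have "tay W y (\<lambda>Q. Dx p (y q) Q * (g p Q - ?S Q)) P r
        = tay W y (\<lambda>Q. g p Q * Dx p (y q) Q - ?S Q * Dx p (y q) Q) P r"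
      by (rule tay_cong) (simp add: algebra_simps)
    ultimately have "tay W y (\<lambda>Q. g p Q * Dx p (y q) Q) P r = tay W y (\<lambda>Q. ?S Q * Dx p (y q) Q) P r"
      using tay_diff[OF G reg_mult[OF g(1)[OF p] rH[OF p]] reg_mult[OF rS rH[OF p]] P, of r] by simp
    also have "\<dots> = tay W y (\<lambda>Q. \<Sum>m\<in>?M. v p m * (?X m Q * Dx p (y q) Q)) P r"
      by (rule tay_cong) (simp add: sum_distrib_right mult.assoc)
    also have "\<dots> = (\<Sum>m\<in>?M. tay W y (\<lambda>Q. v p m * (?X m Q * Dx p (y q) Q)) P r)"
      by (rule tay_sum[OF G _ P]) (intro reg_mult[OF reg_const[OF W]] reg_mult[OF rX rH[OF p]])
    also have "\<dots> = (\<Sum>m\<in>?M. v p m * transition_field R N W x y m p P q r)"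
    proof (intro sum.cong refl)
      fix m assume m: "m \<in> ?M"
      then have "m \<in> monomials N" "m \<noteq> 0" by auto
      then show "tay W y (\<lambda>Q. v p m * (?X m Q * Dx p (y q) Q)) P r = v p m * transition_field R N W x y m p P q r"
        using tay_scale[OF G reg_mult[OF rX[OF m] rH[OF p]] P, of "v p m" r]
          transition_field_eq_taylor[OF F G P _ _ p q, of m r] by simp
    qed
    finally show ?thesis .
  qed
  moreover have "tay W y (\<lambda>Q. \<Sum>p<N. g p Q * Dx p (y q) Q) P r = (\<Sum>p<N. tay W y (\<lambda>Q. g p Q * Dx p (y q) Q) P r)"
    by (rule tay_sum[OF G _ P]) (simp add: reg_mult g(1) rH)
  ultimately show ?thesis
    using q by (simp add: transfer_def)
qed

lemma transfer_restrict_open: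
  assumes F: "frame W x Dx" and G: "frame W y Dy" and V: "openin T V" "V \<subseteq> W" and P: "P \<in> V"
  shows "transfer V x y P v q r = transfer W x y P v q r"
proof (cases "q < N")
  case True
  have "transition_field R N V x y m p P q r = transition_field R N W x y m p P q r"
    if m: "m \<in> monomials N" "m \<noteq> 0" and p: "p < N" for m p
  proof -
    have "reg W (\<lambda>Q. mono_eval m (\<lambda>i. x i Q - x i P) * Dx p (y q) Q)"
      by (rule reg_mult[OF reg_shifted_monomial[OF F m(1)] derives_reg[OF frame_derives[OF F p] frame_reg[OF G True]]])
    from tay_restrict_open[OF G V this P] show ?thesis
      using transition_field_eq_taylor[OF F G _ m p True, of P r] P V(2)
        transition_field_eq_taylor[OF frame_subset[OF F V] frame_subset[OF G V] P m p True, of r] by auto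
  qed
  then have "(\<Sum>m\<in>{m \<in> monomials N. 0 < mdeg m \<and> mdeg m \<le> mdeg r}. v p m * transition_field R N V x y m p P q r)
      = (\<Sum>m\<in>{m \<in> monomials N. 0 < mdeg m \<and> mdeg m \<le> mdeg r}. v p m * transition_field R N W x y m p P q r)"
    if "p < N" for p
    using that by (intro sum.cong refl arg_cong2[of _ _ _ _ "(*)"]) simp
  then show ?thesis
    using True by (simp add: transfer_def)
qed (simp add: transfer_def)

text \<open>Realize \<open>v\<close> up to order \<open>|r|\<close> by polynomials in \<open>x - x(P)\<close>, and compute the third set of
  coefficients of the same vector field directly and through the second.\<close>

theorem transfer_cocycle:
  assumes F: "frame W x Dx" and G: "frame W y Dy" and H: "frame W z Dz" and P: "P \<in> W"
    and r: "r \<in> monomials N"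
  shows "transfer W y z P (transfer W x y P v) s r = transfer W x z P v s r"
proof (cases "s < N")
  case s: True
  let ?M = "{m \<in> monomials N. 0 < mdeg m \<and> mdeg m \<le> mdeg r}"
  have W: "openin T W" by (rule frame_open[OF F])
  define g where "g = (\<lambda>p Q. \<Sum>m\<in>?M. v p m * mono_eval m (\<lambda>i. x i Q - x i P))"
  define h where "h = (\<lambda>q Q. \<Sum>p<N. g p Q * Dx p (y q) Q)"
  have rX: "reg W (\<lambda>Q. mono_eval m (\<lambda>i. x i Q - x i P))" if "m \<in> ?M" for m
    using that by (intro reg_shifted_monomial[OF F]) simp
  have rg: "reg W (g p)" for p
    unfolding g_def by (intro reg_sum[OF W] reg_mult[OF reg_const[OF W]] rX)
  have g0: "g p P = 0" for p
    unfolding g_def using mono_eval_zero_point[where ?'a = 'b] by (intro sum.neutral) auto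
  have tg: "tay W x (g p) P m = v p m" if m: "m \<in> monomials N" "m \<noteq> 0" "mdeg m \<le> mdeg r" for p m
  proof -
    have "tay W x (g p) P m = (\<Sum>l\<in>?M. tay W x (\<lambda>Q. v p l * mono_eval l (\<lambda>i. x i Q - x i P)) P m)"
      unfolding g_def by (rule tay_sum[OF F _ P]) (intro reg_mult[OF reg_const[OF W]] rX)
    also have "\<dots> = (\<Sum>l\<in>?M. v p l * (if m = l then 1 else 0))"
      by (intro sum.cong refl) (simp add: tay_scale[OF F rX P] tay_shifted_monomial[OF F _ P])
    also have "\<dots> = (if m \<in> ?M then v p m else 0)"
      using finite_positive_monomials[of "mdeg r"] by (simp add: if_distrib cong: if_cong)
    finally show ?thesis using m mdeg_eq_0_iff[of m] by auto
  qed
  have rD: "reg W (Dx p (y q))" if "p < N" "q < N" for p q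
    by (rule derives_reg[OF frame_derives[OF F that(1)] frame_reg[OF G that(2)]])
  have rh: "reg W (h q)" if "q < N" for q
    unfolding h_def by (intro reg_sum[OF W] reg_mult rg rD that) simp
  have h0: "h q P = 0" for q by (simp add: h_def g0)
  have th: "tay W y (h q) P m = transfer W x y P v q m" if "q < N" "m \<in> monomials N" "mdeg m \<le> mdeg r" for q m
    unfolding h_def by (rule transfer_represents[OF F G P that(1) rg g0 tg that(2,3), symmetric])
  have "transfer W y z P (transfer W x y P v) s r = tay W z (\<lambda>Q. \<Sum>q<N. h q Q * Dy q (z s) Q) P r"
    by (rule transfer_represents[OF G H P s rh h0 th r order_refl])
  also have "\<dots> = tay W z (\<lambda>Q. \<Sum>p<N. g p Q * Dx p (z s) Q) P r"
  proof (rule tay_cong)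
    fix Q assume Q: "Q \<in> W"
    have "(\<Sum>q<N. h q Q * Dy q (z s) Q) = (\<Sum>p<N. g p Q * (\<Sum>q<N. Dx p (y q) Q * Dy q (z s) Q))"
      unfolding h_def sum_distrib_left sum_distrib_right by (subst sum.swap) (simp add: mult.assoc)
    also have "\<dots> = (\<Sum>p<N. g p Q * Dx p (z s) Q)"
      by (intro sum.cong refl) (simp add: frame_expand[OF G frame_derives[OF F] frame_reg[OF H s] Q, symmetric])
    finally show "(\<Sum>q<N. h q Q * Dy q (z s) Q) = (\<Sum>p<N. g p Q * Dx p (z s) Q)" .
  qed
  also have "\<dots> = transfer W x z P v s r"
    by (rule transfer_represents[OF F H P s rg g0 tg r order_refl, symmetric])
  finally show ?thesis .
qed (simp add: transfer_def)

lemma transfer_same_chart: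
  assumes F: "frame W x D" and P: "P \<in> W" and q: "q < N" and r: "r \<in> monomials N" "r \<noteq> 0"
  shows "transfer W x x P v q r = v q r"
proof -
  have "transition_field R N W x x m p P q r = (if p = q \<and> r = m then 1 else 0)"
    if m: "m \<in> monomials N" "m \<noteq> 0" and p: "p < N" for m p
  proof -
    have "transition_field R N W x x m p P q r
        = tay W x (\<lambda>Q. (if p = q then 1 else 0) * mono_eval m (\<lambda>i. x i Q - x i P)) P r"
      unfolding transition_field_eq_taylor[OF F F P m p q]
      by (rule tay_cong) (simp add: frame_dual[OF F p q])
    then show ?thesis
      using tay_scale[OF F reg_shifted_monomial[OF F m(1)] P] tay_shifted_monomial[OF F m(1) P] by simp
  qed
  then have "transfer W x x P v q r
      = (\<Sum>p<N. \<Sum>m\<in>{m \<in> monomials N. 0 < mdeg m \<and> mdeg m \<le> mdeg r}. if m = r then (if p = q then v p m else 0) else 0)"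
    using q unfolding transfer_def by (simp, intro sum.cong refl) auto
  also have "\<dots> = (\<Sum>p<N. if p = q then v p r else 0)"
    using finite_positive_monomials[of "mdeg r"] r mdeg_eq_0_iff[of r] by simp
  finally show ?thesis using q by simp
qed

end

section \<open>The quotients of the Lie algebra of vector fields\<close>

lemma lookup_scale: "lk (Poly_Mapping.map ((*) (c::'k::field)) p) r = c * lk p r"
  by (simp add: Poly_Mapping.map.rep_eq when_def)

lemma scale_zero [simp]: "Poly_Mapping.map ((*) (c::'k::field)) 0 = 0"
  by (intro poly_mapping_eqI) (simp add: lookup_scale)

lemma L_plus_carrier:
  "w \<in> carrier (L_plus N) \<longleftrightarrow> (\<forall>q<N. w q \<in> polys N \<and> lk (w q) 0 = 0) \<and> (\<forall>q\<ge>N. w q = 0)"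
  by (simp add: L_plus_def)

lemma L_plus_add: "v \<oplus>\<^bsub>L_plus N\<^esub> w = (\<lambda>q. v q + w q)"
  by (simp add: L_plus_def)

lemma L_plus_smult: "c \<odot>\<^bsub>L_plus N\<^esub> w = (\<lambda>q. Poly_Mapping.map ((*) c) (w q))"
  by (simp add: L_plus_def)

lemma L_plus_lincomb_closed:
  assumes "v \<in> carrier (L_plus N)" "w \<in> carrier (L_plus N)"
  shows "(\<lambda>q. v q + w q) \<in> carrier (L_plus N)" "(\<lambda>q. Poly_Mapping.map ((*) c) (w q)) \<in> carrier (L_plus N)"
    "(\<lambda>q. v q - w q) \<in> carrier (L_plus N)" "(\<lambda>_. 0) \<in> carrier (L_plus N)"
  using assms
  by (auto simp: L_plus_carrier polys_add polys_diff lookup_add lookup_minus lookup_scale)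
    (auto simp: polys_iff lookup_scale)

text \<open>A class modulo \<open>L_ge N k\<close> consists of the vector fields with given coefficients up to order \<open>k\<close>.\<close>

definition jet_class :: "nat \<Rightarrow> nat \<Rightarrow> (nat \<Rightarrow> 'k::field mpoly) \<Rightarrow> (nat \<Rightarrow> 'k mpoly) set" where
  "jet_class N k w = {w' \<in> carrier (L_plus N). \<forall>q r. mdeg r \<le> k \<longrightarrow> lk (w' q) r = lk (w q) r}"

lemma L_ge_iff: "w \<in> L_ge N k \<longleftrightarrow> w \<in> carrier (L_plus N) \<and> (\<forall>q r. mdeg r \<le> k \<longrightarrow> lk (w q) r = 0)"
proof -
  have "(\<forall>r\<in>Poly_Mapping.keys (w q). k + 1 \<le> mdeg r) \<longleftrightarrow> (\<forall>r. mdeg r \<le> k \<longrightarrow> lk (w q) r = 0)" for q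
    unfolding Ball_def in_keys_iff by (metis Suc_eq_plus1 not_less_eq_eq)
  then show ?thesis by (simp add: L_ge_def)
qed

lemma coset_eq_jet_class:
  assumes w: "w \<in> carrier (L_plus N)"
  shows "L_ge N k +>\<^bsub>L_plus N\<^esub> w = jet_class N k w"
proof -
  have "L_ge N k +>\<^bsub>L_plus N\<^esub> w = {(\<lambda>q. h q + w q) | h. h \<in> L_ge N k}"
    by (auto simp: a_r_coset_def r_coset_def L_plus_add)
  also have "\<dots> = jet_class N k w"
  proof (intro subset_antisym subsetI)
    fix w' assume "w' \<in> {(\<lambda>q. h q + w q) | h. h \<in> L_ge N k}"
    then obtain h where h: "h \<in> L_ge N k" and w': "w' = (\<lambda>q. h q + w q)" by blast
    have "w' \<in> carrier (L_plus N)"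
      unfolding w' using h w by (intro L_plus_lincomb_closed(1)) (simp add: L_ge_iff)
    then show "w' \<in> jet_class N k w"
      using h unfolding w' by (simp add: jet_class_def L_ge_iff lookup_add)
  next
    fix w' assume w': "w' \<in> jet_class N k w"
    then have "(\<lambda>q. w' q - w q) \<in> L_ge N k"
      using L_plus_lincomb_closed(3)[of w' N w] w by (simp add: jet_class_def L_ge_iff lookup_minus)
    then show "w' \<in> {(\<lambda>q. h q + w q) | h. h \<in> L_ge N k}"
      by (intro CollectI exI[of _ "\<lambda>q. w' q - w q"]) simp
  qed
  finally show ?thesis .
qed

lemma jet_class_self: "w \<in> carrier (L_plus N) \<Longrightarrow> w \<in> jet_class N k w"
  by (simp add: jet_class_def)

lemma jet_class_eqI: "(\<And>q r. mdeg r \<le> k \<Longrightarrow> lk (v q) r = lk (w q) r) \<Longrightarrow> jet_class N k v = jet_class N k w"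
  by (auto simp: jet_class_def)

lemma jet_class_eqD:
  assumes "jet_class N k v = jet_class N k w" "v \<in> carrier (L_plus N)" "mdeg r \<le> k"
  shows "lk (v q) r = lk (w q) r"
  using jet_class_self[OF assms(2), of k] assms(1,3) by (auto simp: jet_class_def)

lemma L_quot_carrier: "C \<in> carrier (L_quot N k) \<longleftrightarrow> (\<exists>w\<in>carrier (L_plus N). C = jet_class N k w)"
proof -
  have "C \<in> carrier (L_quot N k) \<longleftrightarrow> (\<exists>w\<in>carrier (L_plus N). C = L_ge N k +>\<^bsub>L_plus N\<^esub> w)"
    by (auto simp: L_quot_def quotient_module_def A_RCOSETS_def RCOSETS_def a_r_coset_def)
  then show ?thesis
    by (simp add: coset_eq_jet_class cong: bex_cong)
qed

lemma L_quot_zero: "\<zero>\<^bsub>L_quot N k\<^esub> = jet_class N k (\<lambda>_. 0)"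
  by (auto simp: L_quot_def quotient_module_def jet_class_def L_ge_iff)

lemma L_quot_add:
  assumes v: "v \<in> carrier (L_plus N)" and w: "w \<in> carrier (L_plus N)"
  shows "jet_class N k v \<oplus>\<^bsub>L_quot N k\<^esub> jet_class N k w = jet_class N k (\<lambda>q. v q + w q)"
proof -
  have "jet_class N k v \<oplus>\<^bsub>L_quot N k\<^esub> jet_class N k w
      = {(\<lambda>q. a q + b q) | a b. a \<in> jet_class N k v \<and> b \<in> jet_class N k w}"
    by (auto simp: L_quot_def quotient_module_def set_add_def set_mult_def L_plus_add)
  also have "\<dots> = jet_class N k (\<lambda>q. v q + w q)"
  proof (intro subset_antisym subsetI)
    fix u assume "u \<in> {(\<lambda>q. a q + b q) | a b. a \<in> jet_class N k v \<and> b \<in> jet_class N k w}"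
    then obtain a b where ab: "u = (\<lambda>q. a q + b q)" "a \<in> jet_class N k v" "b \<in> jet_class N k w" by blast
    then show "u \<in> jet_class N k (\<lambda>q. v q + w q)"
      using L_plus_lincomb_closed(1)[of a N b] by (auto simp: jet_class_def lookup_add)
  next
    fix u assume u: "u \<in> jet_class N k (\<lambda>q. v q + w q)"
    then have "(\<lambda>q. u q - w q) \<in> jet_class N k v"
      using L_plus_lincomb_closed(3)[of u N w] w by (auto simp: jet_class_def lookup_add lookup_minus)
    then show "u \<in> {(\<lambda>q. a q + b q) | a b. a \<in> jet_class N k v \<and> b \<in> jet_class N k w}"
      using jet_class_self[OF w] by (intro CollectI exI[of _ "\<lambda>q. u q - w q"] exI[of _ w]) simp
  qed
  finally show ?thesis .
qed

lemma L_quot_smult: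
  assumes w: "w \<in> carrier (L_plus N)"
  shows "c \<odot>\<^bsub>L_quot N k\<^esub> jet_class N k w = jet_class N k (\<lambda>q. Poly_Mapping.map ((*) c) (w q))"
proof -
  have eq: "L_ge N k +>\<^bsub>L_plus N\<^esub> (c \<odot>\<^bsub>L_plus N\<^esub> w') = jet_class N k (\<lambda>q. Poly_Mapping.map ((*) c) (w q))"
    if "w' \<in> jet_class N k w" for w'
  proof -
    have w': "w' \<in> carrier (L_plus N)" using that by (simp add: jet_class_def)
    show ?thesis
      unfolding L_plus_smult coset_eq_jet_class[OF L_plus_lincomb_closed(2)[OF w' w']]
      using that by (intro jet_class_eqI) (simp add: jet_class_def lookup_scale)
  qed
  have "c \<odot>\<^bsub>L_quot N k\<^esub> jet_class N k w = (\<Union>w'\<in>jet_class N k w. L_ge N k +>\<^bsub>L_plus N\<^esub> (c \<odot>\<^bsub>L_plus N\<^esub> w'))"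
    by (simp add: L_quot_def quotient_module_def)
  also have "\<dots> = (\<Union>w'\<in>jet_class N k w. jet_class N k (\<lambda>q. Poly_Mapping.map ((*) c) (w q)))"
    using eq by (intro SUP_cong refl)
  finally show ?thesis using jet_class_self[OF w, of k] by auto
qed

lemma module_L_quot: "module ring_of_type_algebra (L_quot N k :: ('k::field, _) module)"
proof (rule moduleI)
  show "cring (ring_of_type_algebra :: 'k ring)" by (rule cring_from_type_algebra)
  have cl: "jet_class N k w \<in> carrier (L_quot N k)" if "w \<in> carrier (L_plus N)" for w :: "nat \<Rightarrow> 'k mpoly"
    using that by (auto simp: L_quot_carrier)
  note closed = L_plus_lincomb_closed
  show "abelian_group (L_quot N k :: ('k, _) module)"
  proof (rule abelian_groupI)
    fix x y z :: "(nat \<Rightarrow> 'k mpoly) set"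
    assume "x \<in> carrier (L_quot N k)" "y \<in> carrier (L_quot N k)" "z \<in> carrier (L_quot N k)"
    then obtain u v w where u: "u \<in> carrier (L_plus N)" "x = jet_class N k u"
        and v: "v \<in> carrier (L_plus N)" "y = jet_class N k v" and w: "w \<in> carrier (L_plus N)" "z = jet_class N k w"
      by (auto simp: L_quot_carrier)
    show "x \<oplus>\<^bsub>L_quot N k\<^esub> y \<in> carrier (L_quot N k)"
      using u v by (simp add: L_quot_add cl closed)
    show "x \<oplus>\<^bsub>L_quot N k\<^esub> y \<oplus>\<^bsub>L_quot N k\<^esub> z = x \<oplus>\<^bsub>L_quot N k\<^esub> (y \<oplus>\<^bsub>L_quot N k\<^esub> z)"
      using u v w by (simp add: L_quot_add closed add.assoc)
    show "x \<oplus>\<^bsub>L_quot N k\<^esub> y = y \<oplus>\<^bsub>L_quot N k\<^esub> x"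
      using u v by (simp add: L_quot_add add.commute)
    show "\<zero>\<^bsub>L_quot N k\<^esub> \<oplus>\<^bsub>L_quot N k\<^esub> x = x"
      by (simp add: u(2) L_quot_zero L_quot_add[OF closed(4)[OF u(1) u(1)] u(1)])
    have "(\<lambda>q. 0 - u q) \<in> carrier (L_plus N)" using closed(3)[OF closed(4)[OF u(1) u(1)] u(1)] .
    then show "\<exists>y\<in>carrier (L_quot N k). y \<oplus>\<^bsub>L_quot N k\<^esub> x = \<zero>\<^bsub>L_quot N k\<^esub>"
      using u by (intro bexI[of _ "jet_class N k (\<lambda>q. 0 - u q)"]) (simp_all add: L_quot_add L_quot_zero cl del: diff_0)
  next
    show "\<zero>\<^bsub>L_quot N k\<^esub> \<in> carrier (L_quot N k :: ('k, _) module)"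
      unfolding L_quot_zero by (rule cl) (simp add: L_plus_carrier)
  qed
  fix a b :: 'k and x y :: "(nat \<Rightarrow> 'k mpoly) set"
  assume "x \<in> carrier (L_quot N k)" "y \<in> carrier (L_quot N k)"
  then obtain u v where u: "u \<in> carrier (L_plus N)" "x = jet_class N k u"
      and v: "v \<in> carrier (L_plus N)" "y = jet_class N k v"
    by (auto simp: L_quot_carrier)
  note su = closed(2)[OF u(1) u(1)] and sv = closed(2)[OF v(1) v(1)]
  show "a \<odot>\<^bsub>L_quot N k\<^esub> x \<in> carrier (L_quot N k)"
    using u su by (simp add: L_quot_smult cl)
  show "(a \<oplus>\<^bsub>ring_of_type_algebra\<^esub> b) \<odot>\<^bsub>L_quot N k\<^esub> x = a \<odot>\<^bsub>L_quot N k\<^esub> x \<oplus>\<^bsub>L_quot N k\<^esub> b \<odot>\<^bsub>L_quot N k\<^esub> x"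
    using u su by (auto simp: L_quot_smult L_quot_add ring_of_type_algebra_def lookup_scale lookup_add algebra_simps
        intro!: jet_class_eqI)
  show "a \<odot>\<^bsub>L_quot N k\<^esub> (x \<oplus>\<^bsub>L_quot N k\<^esub> y) = a \<odot>\<^bsub>L_quot N k\<^esub> x \<oplus>\<^bsub>L_quot N k\<^esub> a \<odot>\<^bsub>L_quot N k\<^esub> y"
    using u v su sv by (auto simp: L_quot_smult L_quot_add closed lookup_scale lookup_add algebra_simps
        intro!: jet_class_eqI)
  show "(a \<otimes>\<^bsub>ring_of_type_algebra\<^esub> b) \<odot>\<^bsub>L_quot N k\<^esub> x = a \<odot>\<^bsub>L_quot N k\<^esub> (b \<odot>\<^bsub>L_quot N k\<^esub> x)"
    using u su by (auto simp: L_quot_smult ring_of_type_algebra_def lookup_scale intro!: jet_class_eqI)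
  show "\<one>\<^bsub>ring_of_type_algebra\<^esub> \<odot>\<^bsub>L_quot N k\<^esub> x = x"
    using u by (auto simp: L_quot_smult ring_of_type_algebra_def lookup_scale intro!: jet_class_eqI)
qed

lemma L_proj_jet_class:
  assumes w: "w \<in> carrier (L_plus N)"
  shows "L_proj N k (jet_class N (Suc k) w) = jet_class N k w"
proof -
  have "L_ge N k +>\<^bsub>L_plus N\<^esub> w' = jet_class N k w" if "w' \<in> jet_class N (Suc k) w" for w'
  proof -
    have "L_ge N k +>\<^bsub>L_plus N\<^esub> w' = jet_class N k w'"
      using that by (intro coset_eq_jet_class) (simp add: jet_class_def)
    also have "\<dots> = jet_class N k w" using that by (intro jet_class_eqI) (simp add: jet_class_def)
    finally show ?thesis .
  qed
  then show ?thesis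
    using jet_class_self[OF w, of "Suc k"] unfolding L_proj_def by auto
qed

lemma linear_L_proj:
  "linear_map_on ring_of_type_algebra (L_quot N (Suc k) :: ('k::field, _) module) (L_quot N k) (L_proj N k)"
  unfolding linear_map_on_def
proof (intro conjI ballI funcsetI)
  fix x :: "(nat \<Rightarrow> 'k mpoly) set" assume "x \<in> carrier (L_quot N (Suc k))"
  then obtain u where u: "u \<in> carrier (L_plus N)" "x = jet_class N (Suc k) u" by (auto simp: L_quot_carrier)
  show "L_proj N k x \<in> carrier (L_quot N k)"
    using u by (auto simp: L_proj_jet_class L_quot_carrier)
  show "L_proj N k (a \<odot>\<^bsub>L_quot N (Suc k)\<^esub> x) = a \<odot>\<^bsub>L_quot N k\<^esub> L_proj N k x" for a
    using u L_plus_lincomb_closed(2)[OF u(1) u(1)] by (simp add: L_quot_smult L_proj_jet_class)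
  fix y :: "(nat \<Rightarrow> 'k mpoly) set" assume "y \<in> carrier (L_quot N (Suc k))"
  then obtain v where v: "v \<in> carrier (L_plus N)" "y = jet_class N (Suc k) v" by (auto simp: L_quot_carrier)
  show "L_proj N k (x \<oplus>\<^bsub>L_quot N (Suc k)\<^esub> y) = L_proj N k x \<oplus>\<^bsub>L_quot N k\<^esub> L_proj N k y"
    using u v by (simp add: L_quot_add L_proj_jet_class L_plus_lincomb_closed)
qed

lemma lookup_truncated_field:
  "lk (truncated_field N k c q) r = (if q < N \<and> r \<in> monomials N \<and> mdeg r \<le> k then c q r else 0)"
proof (cases "q < N")
  case True
  have "lk (truncated_field N k c q) r
      = (\<Sum>r'\<in>{r \<in> monomials N. mdeg r \<le> k}. if r' = r then c q r' else 0)"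
    using True by (simp add: truncated_field_def lookup_sum lookup_single when_def)
  then show ?thesis using True finite_monomials_mdeg[of N k] by simp
qed (simp add: truncated_field_def)

lemma truncated_field_in_L_plus:
  assumes "\<And>q. q < N \<Longrightarrow> c q 0 = 0"
  shows "truncated_field N k c \<in> carrier (L_plus N)"
proof -
  have "truncated_field N k c q = 0" if "q \<ge> N" for q using that by (simp add: truncated_field_def)
  then show ?thesis
    using assms by (simp add: L_plus_carrier polys_iff lookup_truncated_field)
qed

definition jet :: "nat \<Rightarrow> nat \<Rightarrow> (nat \<Rightarrow> mono \<Rightarrow> 'k::field) \<Rightarrow> (nat \<Rightarrow> 'k mpoly) set" where
  "jet N k c = jet_class N k (truncated_field N k c)"

lemma formal_field_eq_jet:
  assumes "\<And>P q. P \<in> W \<Longrightarrow> q < N \<Longrightarrow> c P q 0 = 0"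
  shows "formal_field N W c k = (\<lambda>P\<in>W. jet N k (c P))"
  unfolding formal_field_def jet_def
  using coset_eq_jet_class[OF truncated_field_in_L_plus] assms by (intro restrict_ext) blast

lemma jet_eq_iff:
  assumes "\<And>q. q < N \<Longrightarrow> c q 0 = 0"
  shows "jet N k c = jet N k d \<longleftrightarrow> (\<forall>q<N. \<forall>r\<in>monomials N. mdeg r \<le> k \<longrightarrow> c q r = d q r)"
proof
  assume "jet N k c = jet N k d"
  then have "mdeg r \<le> k \<Longrightarrow> lk (truncated_field N k c q) r = lk (truncated_field N k d q) r" for q r
    using jet_class_eqD truncated_field_in_L_plus[of N c k] assms unfolding jet_def by blast
  then show "\<forall>q<N. \<forall>r\<in>monomials N. mdeg r \<le> k \<longrightarrow> c q r = d q r"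
    unfolding lookup_truncated_field by (metis (full_types))
next
  assume "\<forall>q<N. \<forall>r\<in>monomials N. mdeg r \<le> k \<longrightarrow> c q r = d q r"
  then show "jet N k c = jet N k d"
    unfolding jet_def by (intro jet_class_eqI) (simp add: lookup_truncated_field)
qed

lemma jet_add:
  assumes "\<And>q. q < N \<Longrightarrow> c q 0 = 0" "\<And>q. q < N \<Longrightarrow> d q 0 = 0"
  shows "jet N k c \<oplus>\<^bsub>L_quot N k\<^esub> jet N k d = jet N k (\<lambda>q r. c q r + d q r)"
proof -
  have "jet N k c \<oplus>\<^bsub>L_quot N k\<^esub> jet N k d = jet_class N k (\<lambda>q. truncated_field N k c q + truncated_field N k d q)"
    unfolding jet_def using assms by (intro L_quot_add truncated_field_in_L_plus)
  then show ?thesis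
    by (simp add: jet_def) (rule jet_class_eqI, simp add: lookup_add lookup_truncated_field)
qed

lemma jet_smult:
  assumes "\<And>q. q < N \<Longrightarrow> c q 0 = 0"
  shows "a \<odot>\<^bsub>L_quot N k\<^esub> jet N k c = jet N k (\<lambda>q r. a * c q r)"
proof -
  have "a \<odot>\<^bsub>L_quot N k\<^esub> jet N k c = jet_class N k (\<lambda>q. Poly_Mapping.map ((*) a) (truncated_field N k c q))"
    unfolding jet_def using assms by (intro L_quot_smult truncated_field_in_L_plus)
  then show ?thesis
    by (simp add: jet_def) (rule jet_class_eqI, simp add: lookup_scale lookup_truncated_field)
qed

lemma jet_zero: "jet N k (\<lambda>_ _. 0) = \<zero>\<^bsub>L_quot N k\<^esub>"
  unfolding jet_def L_quot_zero by (intro jet_class_eqI) (simp add: lookup_truncated_field)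

lemma jet_in_L_quot: "(\<And>q. q < N \<Longrightarrow> c q 0 = 0) \<Longrightarrow> jet N k c \<in> carrier (L_quot N k)"
  using truncated_field_in_L_plus[of N c k] by (auto simp: jet_def L_quot_carrier)

lemma jet_L_proj:
  assumes "\<And>q. q < N \<Longrightarrow> c q 0 = 0"
  shows "L_proj N k (jet N (Suc k) c) = jet N k c"
proof -
  have "truncated_field N (Suc k) c \<in> carrier (L_plus N)"
    by (intro truncated_field_in_L_plus assms)
  then have "L_proj N k (jet N (Suc k) c) = jet_class N k (truncated_field N (Suc k) c)"
    by (simp add: jet_def L_proj_jet_class)
  then show ?thesis
    unfolding jet_def by simp (intro jet_class_eqI, simp add: lookup_truncated_field)
qed

lemma L_quot_is_jet:
  assumes "C \<in> carrier (L_quot N k)"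
  obtains c where "\<And>q. c q 0 = 0" "C = jet N k c"
proof -
  obtain w where w: "w \<in> carrier (L_plus N)" "C = jet_class N k w" using assms by (auto simp: L_quot_carrier)
  have "lk (w q) r = 0" if "\<not> (q < N \<and> r \<in> monomials N)" for q r
    using w(1) that by (cases "q < N") (auto simp: L_plus_carrier polys_iff not_less)
  then have C: "C = jet N k (\<lambda>q. lk (w q))"
    unfolding jet_def w(2) by (intro jet_class_eqI) (simp add: lookup_truncated_field)
  have "lk (w q) 0 = 0" for q
    using w(1) by (cases "q < N") (auto simp: L_plus_carrier not_less)
  then show ?thesis using C by (rule that)
qed

lemma finsum_jet:
  assumes "\<And>j q. j < J \<Longrightarrow> c j q 0 = 0"
  shows "(\<Oplus>\<^bsub>L_quot N k\<^esub>j\<in>{..<J::nat}. a j \<odot>\<^bsub>L_quot N k\<^esub> jet N k (c j)) = jet N k (\<lambda>q r. \<Sum>j<J. a j * c j q r)"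
proof -
  interpret module "ring_of_type_algebra" "L_quot N k :: ('a, _) module" by (rule module_L_quot)
  show ?thesis
    using assms
  proof (induction J)
    case 0
    show ?case by (simp add: jet_zero)
  next
    case (Suc J)
    have cl: "a j \<odot>\<^bsub>L_quot N k\<^esub> jet N k (c j) \<in> carrier (L_quot N k)" if "j < Suc J" for j
      using Suc.prems[OF that] by (simp add: jet_smult jet_in_L_quot)
    have "(\<Oplus>\<^bsub>L_quot N k\<^esub>j\<in>{..<Suc J}. a j \<odot>\<^bsub>L_quot N k\<^esub> jet N k (c j))
        = a J \<odot>\<^bsub>L_quot N k\<^esub> jet N k (c J) \<oplus>\<^bsub>L_quot N k\<^esub> (\<Oplus>\<^bsub>L_quot N k\<^esub>j\<in>{..<J}. a j \<odot>\<^bsub>L_quot N k\<^esub> jet N k (c j))"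
      unfolding lessThan_Suc using cl by (intro finsum_insert) auto
    also have "\<dots> = jet N k (\<lambda>q r. a J * c J q r) \<oplus>\<^bsub>L_quot N k\<^esub> jet N k (\<lambda>q r. \<Sum>j<J. a j * c j q r)"
      using Suc by (simp add: jet_smult)
    also have "\<dots> = jet N k (\<lambda>q r. a J * c J q r + (\<Sum>j<J. a j * c j q r))"
      using Suc.prems by (intro jet_add) auto
    finally show ?case by (simp add: add.commute)
  qed
qed

context variety
begin

text \<open>A section of the tensor product is thus a family of jets with regular coefficients.  Only finitely many
  coefficients matter, so the jets of the monomial fields can be used as the vectors \<open>v\<close>.\<close>

lemma tensor_carrier_iff:
  assumes W: "openin T W"
  shows "\<sigma> \<in> carrier (tensor_module R W (L_quot N k)) \<longleftrightarrow>
    (\<exists>c. (\<forall>q r. reg W (\<lambda>P. c P q r)) \<and> (\<forall>P q. c P q 0 = 0) \<and> \<sigma> = (\<lambda>P\<in>W. jet N k (c P)))"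
proof
  assume "\<sigma> \<in> carrier (tensor_module R W (L_quot N k))"
  then obtain J f v where \<sigma>: "\<sigma> \<in> extensional W" and fv: "\<forall>j<(J::nat). f j \<in> A W \<and> v j \<in> carrier (L_quot N k)"
      and eq: "\<forall>P\<in>W. \<sigma> P = (\<Oplus>\<^bsub>L_quot N k\<^esub>j\<in>{..<J}. f j P \<odot>\<^bsub>L_quot N k\<^esub> v j)"
    unfolding tensor_module_def fun_ring_def by auto
  have "\<forall>j. \<exists>c. j < J \<longrightarrow> (\<forall>q. c q 0 = 0) \<and> v j = jet N k c"
    using fv L_quot_is_jet by metis
  then obtain d where d: "\<And>j q. j < J \<Longrightarrow> d j q 0 = 0" "\<And>j. j < J \<Longrightarrow> v j = jet N k (d j)"
    by metis
  have rf: "reg W (f j)" if "j < J" for j using fv that reg_of_functions[OF W] by blast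
  let ?c = "\<lambda>P q r. \<Sum>j<J. f j P * d j q r"
  have "\<sigma> P = jet N k (?c P)" if "P \<in> W" for P
  proof -
    interpret module "ring_of_type_algebra" "L_quot N k :: ('b, _) module" by (rule module_L_quot)
    have "\<sigma> P = (\<Oplus>\<^bsub>L_quot N k\<^esub>j\<in>{..<J}. f j P \<odot>\<^bsub>L_quot N k\<^esub> v j)"
      using eq that by blast
    also have "\<dots> = (\<Oplus>\<^bsub>L_quot N k\<^esub>j\<in>{..<J}. f j P \<odot>\<^bsub>L_quot N k\<^esub> jet N k (d j))"
      using d by (intro finsum_cong') (auto simp: jet_smult jet_in_L_quot)
    finally show ?thesis using finsum_jet[of J d N k] d(1) by simp
  qed
  then have "\<sigma> = (\<lambda>P\<in>W. jet N k (?c P))" using \<sigma> by (auto simp: extensional_def restrict_def fun_eq_iff)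
  moreover have "reg W (\<lambda>P. ?c P q r)" for q r
    using rf by (intro reg_sum[OF W] reg_mult reg_const[OF W]) simp
  moreover have "?c P q 0 = 0" for P q
    using d(1) by simp
  ultimately show "\<exists>c. (\<forall>q r. reg W (\<lambda>P. c P q r)) \<and> (\<forall>P q. c P q 0 = 0) \<and> \<sigma> = (\<lambda>P\<in>W. jet N k (c P))"
    by (intro exI[of _ ?c] conjI allI)
next
  assume "\<exists>c. (\<forall>q r. reg W (\<lambda>P. c P q r)) \<and> (\<forall>P q. c P q 0 = 0) \<and> \<sigma> = (\<lambda>P\<in>W. jet N k (c P))"
  then obtain c where c: "\<And>q r. reg W (\<lambda>P. c P q r)" "\<And>P q. c P q 0 = 0" "\<sigma> = (\<lambda>P\<in>W. jet N k (c P))"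
    by blast
  let ?I = "{..<N} \<times> {m \<in> monomials N. 0 < mdeg m \<and> mdeg m \<le> k}"
  have "finite ?I" using finite_positive_monomials by blast
  then obtain e where e: "bij_betw e {0..<card ?I} ?I" using ex_bij_betw_nat_finite by blast
  let ?f = "\<lambda>j. restrict (\<lambda>P. c P (fst (e j)) (snd (e j))) W"
  let ?d = "\<lambda>j q r. if (q, r) = e j then 1 else 0 :: 'b"
  have eI: "e j \<in> ?I" if "j < card ?I" for j by (rule bij_betw_apply[OF e]) (use that in simp)
  have "\<sigma> P = (\<Oplus>\<^bsub>L_quot N k\<^esub>j\<in>{..<card ?I}. ?f j P \<odot>\<^bsub>L_quot N k\<^esub> jet N k (?d j))" if P: "P \<in> W" for P
  proof -
    have "(\<Sum>j<card ?I. ?f j P * ?d j q r) = c P q r" if q: "q < N" "r \<in> monomials N" "mdeg r \<le> k" for q r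
    proof -
      have "(\<Sum>j<card ?I. ?f j P * ?d j q r)
          = (\<Sum>j<card ?I. (\<lambda>i. c P (fst i) (snd i) * (if (q, r) = i then 1 else 0)) (e j))"
        using P by simp
      also have "\<dots> = (\<Sum>i\<in>?I. c P (fst i) (snd i) * (if (q, r) = i then 1 else 0))"
        by (rule sum.reindex_bij_betw[OF e[unfolded atLeast0LessThan]])
      also have "\<dots> = (\<Sum>i\<in>?I. if i = (q, r) then c P q r else 0)"
        by (intro sum.cong refl) auto
      also have "\<dots> = (if (q, r) \<in> ?I then c P q r else 0)"
        using \<open>finite ?I\<close> by simp
      finally show ?thesis using q c(2) by auto
    qed
    then have "jet N k (c P) = jet N k (\<lambda>q r. \<Sum>j<card ?I. ?f j P * ?d j q r)"
      using c(2) by (subst jet_eq_iff) auto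
    moreover have "?d j q 0 = 0" if "j < card ?I" for j q
      using eI[OF that] by auto
    ultimately show ?thesis
      using finsum_jet[of "card ?I" ?d N k "\<lambda>j. ?f j P"] P c(3) by simp
  qed
  moreover have "?f j \<in> A W" for j using c(1) by (simp add: reg_def)
  moreover have "jet N k (?d j) \<in> carrier (L_quot N k)" if "j < card ?I" for j
    using eI[OF that] by (intro jet_in_L_quot) auto
  moreover have "\<sigma> \<in> extensional W" using c(3) by simp
  ultimately show "\<sigma> \<in> carrier (tensor_module R W (L_quot N k))"
    unfolding tensor_module_def fun_ring_def partial_object.simps mem_Collect_eq
    by (intro conjI exI[of _ "card ?I"] exI[of _ ?f] exI[of _ "\<lambda>j. jet N k (?d j)"]) blast+
qed

end

section \<open>The bundle\<close>

type_synonym ('p, 'c) family = "'p set \<times> (nat \<Rightarrow> 'p \<Rightarrow> 'c) \<Rightarrow> 'p \<Rightarrow> nat \<Rightarrow> mono \<Rightarrow> 'c"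

context variety
begin

definition charts :: "('a set \<times> (nat \<Rightarrow> 'a \<Rightarrow> 'b)) set" where
  "charts = {(U, x). etale_chart T R N U x}"

lemma charts_iff: "i \<in> charts \<longleftrightarrow> etale_chart T R N (fst i) (snd i)"
  by (simp add: charts_def case_prod_beta)

lemma chart_open: "i \<in> charts \<Longrightarrow> openin T (fst i)"
  unfolding charts_iff using frame_of_etale_chart frame_open by blast

lemma chart_frame: "i \<in> charts \<Longrightarrow> \<exists>D. frame (fst i) (snd i) D"
  unfolding charts_iff using frame_of_etale_chart by blast

text \<open>From the coefficients at \<open>P\<close> in the chart \<open>i\<close> to those in the chart \<open>j\<close>.\<close>

definition change :: "'a set \<times> (nat \<Rightarrow> 'a \<Rightarrow> 'b) \<Rightarrow> 'a set \<times> (nat \<Rightarrow> 'a \<Rightarrow> 'b) \<Rightarrow> 'a \<Rightarrow>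
    (nat \<Rightarrow> mono \<Rightarrow> 'b) \<Rightarrow> nat \<Rightarrow> mono \<Rightarrow> 'b" where
  "change i j P v q r = (if r \<in> monomials N then transfer (fst i \<inter> fst j) (snd i) (snd j) P v q r else 0)"

lemma change_zero_exponent: "change i j P v q 0 = 0"
proof -
  have "{m \<in> monomials N. 0 < mdeg m \<and> mdeg m \<le> mdeg 0} = {}" by (auto simp: mdeg_eq_0_iff)
  then show ?thesis by (simp only: change_def transfer_def sum.empty sum.neutral_const if_cancel)
qed

lemma change_outside: "\<not> (q < N \<and> r \<in> monomials N) \<Longrightarrow> change i j P v q r = 0"
  by (auto simp: change_def transfer_def)

lemma change_cong:
  assumes "\<And>p m. p < N \<Longrightarrow> m \<in> monomials N \<Longrightarrow> m \<noteq> 0 \<Longrightarrow> mdeg m \<le> mdeg r \<Longrightarrow> v p m = w p m"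
  shows "change i j P v q r = change i j P w q r"
  unfolding change_def transfer_def using assms by (auto intro!: sum.cong)

lemma change_add: "change i j P (\<lambda>p m. v p m + w p m) q r = change i j P v q r + change i j P w q r"
  by (simp add: change_def transfer_def distrib_right sum.distrib)

lemma change_scale: "change i j P (\<lambda>p m. a * v p m) q r = a * change i j P v q r"
  by (simp add: change_def transfer_def sum_distrib_left mult.assoc)

lemma change_cocycle:
  assumes "i \<in> charts" "j \<in> charts" "l \<in> charts" "P \<in> fst i" "P \<in> fst j" "P \<in> fst l"
  shows "change j l P (change i j P v) s r = change i l P v s r"
proof (cases "r \<in> monomials N")
  case r: True
  let ?W = "fst i \<inter> fst j \<inter> fst l"
  have W: "openin T ?W" using assms chart_open by blast
  obtain Di Dj Dl where F: "frame (fst i) (snd i) Di" "frame (fst j) (snd j) Dj" "frame (fst l) (snd l) Dl"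
    using assms chart_frame by metis
  have P: "P \<in> ?W" using assms by blast
  have FW: "frame ?W (snd i) Di" "frame ?W (snd j) Dj" "frame ?W (snd l) Dl"
    by (rule frame_subset[OF F(1) W] frame_subset[OF F(2) W] frame_subset[OF F(3) W], blast)+
  have loc: "transfer (fst a \<inter> fst b) (snd a) (snd b) P v q r = transfer ?W (snd a) (snd b) P v q r"
    if "frame (fst a) (snd a) Da" "frame (fst b) (snd b) Db" "?W \<subseteq> fst a \<inter> fst b" for a b Da Db v q r
  proof -
    have o: "openin T (fst a \<inter> fst b)" using that frame_open by blast
    show ?thesis
      by (rule transfer_restrict_open[OF frame_subset[OF that(1) o] frame_subset[OF that(2) o] W that(3) P, symmetric]) auto
  qed
  have l: "transfer (fst i \<inter> fst j) (snd i) (snd j) P v q r = transfer ?W (snd i) (snd j) P v q r"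
    "transfer (fst j \<inter> fst l) (snd j) (snd l) P v q r = transfer ?W (snd j) (snd l) P v q r"
    "transfer (fst i \<inter> fst l) (snd i) (snd l) P v q r = transfer ?W (snd i) (snd l) P v q r" for v q r
    by (rule loc[OF F(1,2)] loc[OF F(2,3)] loc[OF F(1,3)], blast)+
  have "change j l P (change i j P v) s r = change j l P (transfer ?W (snd i) (snd j) P v) s r"
    by (rule change_cong) (simp add: change_def l)
  also have "\<dots> = transfer ?W (snd j) (snd l) P (transfer ?W (snd i) (snd j) P v) s r"
    using r by (simp add: change_def l)
  also have "\<dots> = transfer ?W (snd i) (snd l) P v s r"
    by (rule transfer_cocycle[OF FW P r])
  also have "\<dots> = change i l P v s r"
    using r by (simp add: change_def l)
  finally show ?thesis .
qed (simp add: change_outside)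

lemma change_same:
  assumes "i \<in> charts" "P \<in> fst i" "q < N" "r \<in> monomials N" "r \<noteq> 0"
  shows "change i i P v q r = v q r"
proof -
  obtain D where "frame (fst i) (snd i) D" using chart_frame[OF assms(1)] by blast
  then show ?thesis
    using transfer_same_chart[OF _ assms(2,3,4,5)] assms(4) by (simp add: change_def)
qed

lemma reg_change:
  assumes i: "i \<in> charts" and j: "j \<in> charts" and W: "openin T W" "W \<subseteq> fst i \<inter> fst j"
    and v: "\<And>p m. p < N \<Longrightarrow> m \<in> monomials N \<Longrightarrow> m \<noteq> 0 \<Longrightarrow> reg W (\<lambda>P. v P p m)"
  shows "reg W (\<lambda>P. change i j P (v P) q r)"
proof (cases "q < N \<and> r \<in> monomials N")
  case True
  let ?W = "fst i \<inter> fst j"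
  obtain Di Dj where F: "frame (fst i) (snd i) Di" "frame (fst j) (snd j) Dj"
    using i j chart_frame by metis
  have o: "openin T ?W" using F frame_open by blast
  have tr: "reg W (\<lambda>P. transition_field R N ?W (snd i) (snd j) m p P q r)" if "p < N" "m \<in> monomials N" for p m
    using reg_subset[OF reg_transition_field[OF frame_subset[OF F(1) o] frame_subset[OF F(2) o] that(2,1)] W] True by simp
  have "reg W (\<lambda>P. \<Sum>p<N. \<Sum>m\<in>{m \<in> monomials N. 0 < mdeg m \<and> mdeg m \<le> mdeg r}.
     v P p m * transition_field R N ?W (snd i) (snd j) m p P q r)"
    using v tr by (intro reg_sum[OF W(1)] reg_mult) auto
  then show ?thesis using True by (simp add: change_def transfer_def)
qed (simp add: change_outside reg_const W)

subsection \<open>Sections\<close>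

text \<open>A section is given by its coefficients in all charts; they are \<open>0\<close> wherever they have no meaning.\<close>

definition bundle_sections :: "'a set \<Rightarrow> ('a, 'b) family set" where
  "bundle_sections W = {s.
     (\<forall>i P q r. \<not> (i \<in> charts \<and> P \<in> W \<inter> fst i \<and> q < N \<and> r \<in> monomials N \<and> r \<noteq> 0) \<longrightarrow> s i P q r = 0) \<and>
     (\<forall>i\<in>charts. \<forall>q r. reg (W \<inter> fst i) (\<lambda>P. s i P q r)) \<and>
     (\<forall>i\<in>charts. \<forall>j\<in>charts. \<forall>P\<in>W \<inter> fst i \<inter> fst j. \<forall>q r. s j P q r = change i j P (s i P) q r)}"

definition jet_bundle :: "('a, 'b, ('a, 'b) family) mod_presheaf" where
  "jet_bundle = \<lparr>sections = (\<lambda>W. \<lparr>carrier = bundle_sections W, monoid.mult = undefined, one = undefined,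
       ring.zero = (\<lambda>_ _ _ _. 0), add = (\<lambda>s t i P q r. s i P q r + t i P q r),
       module.smult = (\<lambda>a s i P q r. a P * s i P q r)\<rparr>),
     res = (\<lambda>U V s i P q r. if P \<in> V then s i P q r else 0)\<rparr>"

definition bundle_filtration :: "nat \<Rightarrow> 'a set \<Rightarrow> ('a, 'b) family set" where
  "bundle_filtration m W = {s \<in> bundle_sections W. \<forall>i P q r. mdeg r \<le> m \<longrightarrow> s i P q r = 0}"

lemma bundle_simps [simp]:
  "carrier (sections jet_bundle W) = bundle_sections W"
  "\<zero>\<^bsub>sections jet_bundle W\<^esub> = (\<lambda>_ _ _ _. 0)"
  "s \<oplus>\<^bsub>sections jet_bundle W\<^esub> t = (\<lambda>i P q r. s i P q r + t i P q r)"
  "a \<odot>\<^bsub>sections jet_bundle W\<^esub> s = (\<lambda>i P q r. a P * s i P q r)"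
  "res jet_bundle U V s = (\<lambda>i P q r. if P \<in> V then s i P q r else 0)"
  by (simp_all add: jet_bundle_def)

lemma bundle_sections_0:
  "s \<in> bundle_sections W \<Longrightarrow> \<not> (i \<in> charts \<and> P \<in> W \<inter> fst i \<and> q < N \<and> r \<in> monomials N \<and> r \<noteq> 0) \<Longrightarrow> s i P q r = 0"
  unfolding bundle_sections_def mem_Collect_eq by (elim conjE allE) (erule impE)

lemma bundle_sections_reg: "s \<in> bundle_sections W \<Longrightarrow> i \<in> charts \<Longrightarrow> reg (W \<inter> fst i) (\<lambda>P. s i P q r)"
  unfolding bundle_sections_def mem_Collect_eq by blast

lemma bundle_sections_change:
  "s \<in> bundle_sections W \<Longrightarrow> i \<in> charts \<Longrightarrow> j \<in> charts \<Longrightarrow> P \<in> W \<Longrightarrow> P \<in> fst i \<Longrightarrow> P \<in> fst j \<Longrightarrow>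
     s j P q r = change i j P (s i P) q r"
  unfolding bundle_sections_def mem_Collect_eq by blast

lemma bundle_sectionsI:
  assumes "\<And>i P q r. \<not> (i \<in> charts \<and> P \<in> W \<inter> fst i \<and> q < N \<and> r \<in> monomials N \<and> r \<noteq> 0) \<Longrightarrow> s i P q r = 0"
    and "\<And>i q r. i \<in> charts \<Longrightarrow> reg (W \<inter> fst i) (\<lambda>P. s i P q r)"
    and "\<And>i j P q r. i \<in> charts \<Longrightarrow> j \<in> charts \<Longrightarrow> P \<in> W \<Longrightarrow> P \<in> fst i \<Longrightarrow> P \<in> fst j \<Longrightarrow> s j P q r = change i j P (s i P) q r"
  shows "s \<in> bundle_sections W"
  unfolding bundle_sections_def mem_Collect_eq
proof (intro conjI allI impI ballI)
  show "s i P q r = 0" if "\<not> (i \<in> charts \<and> P \<in> W \<inter> fst i \<and> q < N \<and> r \<in> monomials N \<and> r \<noteq> 0)" for i P q r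
    using that by (rule assms(1))
  show "reg (W \<inter> fst i) (\<lambda>P. s i P q r)" if "i \<in> charts" for i q r
    using that by (rule assms(2))
  show "s j P q r = change i j P (s i P) q r" if "i \<in> charts" "j \<in> charts" "P \<in> W \<inter> fst i \<inter> fst j" for i j P q r
    using that by (intro assms(3)) auto
qed

lemma bundle_sections_add:
  assumes s: "s \<in> bundle_sections W" and t: "t \<in> bundle_sections W"
  shows "(\<lambda>i P q r. s i P q r + t i P q r) \<in> bundle_sections W"
proof (rule bundle_sectionsI)
  show "s i P q r + t i P q r = 0" if "\<not> (i \<in> charts \<and> P \<in> W \<inter> fst i \<and> q < N \<and> r \<in> monomials N \<and> r \<noteq> 0)" for i P q r
    using bundle_sections_0[OF s that] bundle_sections_0[OF t that] by simp
  show "reg (W \<inter> fst i) (\<lambda>P. s i P q r + t i P q r)" if "i \<in> charts" for i q r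
    by (rule reg_add[OF bundle_sections_reg[OF s that] bundle_sections_reg[OF t that]])
  show "s j P q r + t j P q r = change i j P (\<lambda>q r. s i P q r + t i P q r) q r"
    if "i \<in> charts" "j \<in> charts" "P \<in> W" "P \<in> fst i" "P \<in> fst j" for i j P q r
    unfolding change_add using bundle_sections_change[OF s that] bundle_sections_change[OF t that] by simp
qed

lemma bundle_sections_smult:
  assumes W: "openin T W" and s: "s \<in> bundle_sections W" and a: "reg W a"
  shows "(\<lambda>i P q r. a P * s i P q r) \<in> bundle_sections W"
proof (rule bundle_sectionsI)
  show "a P * s i P q r = 0" if "\<not> (i \<in> charts \<and> P \<in> W \<inter> fst i \<and> q < N \<and> r \<in> monomials N \<and> r \<noteq> 0)" for i P q r
    using bundle_sections_0[OF s that] by simp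
  show "reg (W \<inter> fst i) (\<lambda>P. a P * s i P q r)" if "i \<in> charts" for i q r
    using reg_mult[OF reg_subset[OF a] bundle_sections_reg[OF s that]] openin_Int[OF W chart_open[OF that]] by simp
  show "a P * s j P q r = change i j P (\<lambda>q r. a P * s i P q r) q r"
    if "i \<in> charts" "j \<in> charts" "P \<in> W" "P \<in> fst i" "P \<in> fst j" for i j P q r
    unfolding change_scale using bundle_sections_change[OF s that] by simp
qed

lemma change_of_zero: "change i j P (\<lambda>_ _. 0) q r = 0"
  using change_scale[of i j P 0 "\<lambda>_ _. 0" q r] by simp

lemma zero_in_bundle_sections: "openin T W \<Longrightarrow> (\<lambda>_ _ _ _. 0) \<in> bundle_sections W"
  by (rule bundle_sectionsI) (auto simp: change_of_zero intro!: reg_const openin_Int chart_open)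

lemma bundle_sections_res:
  assumes s: "s \<in> bundle_sections U" and V: "openin T V" "V \<subseteq> U"
  shows "(\<lambda>i P q r. if P \<in> V then s i P q r else 0) \<in> bundle_sections V"
proof (rule bundle_sectionsI)
  show "(if P \<in> V then s i P q r else 0) = 0"
    if "\<not> (i \<in> charts \<and> P \<in> V \<inter> fst i \<and> q < N \<and> r \<in> monomials N \<and> r \<noteq> 0)" for i P q r
    using bundle_sections_0[OF s, of i P q r] that V by auto
  show "reg (V \<inter> fst i) (\<lambda>P. if P \<in> V then s i P q r else 0)" if "i \<in> charts" for i q r
    using reg_subset[OF bundle_sections_reg[OF s that, of q r] openin_Int[OF V(1) chart_open[OF that]]] V(2)
    by (subst reg_cong[of _ _ "\<lambda>P. s i P q r"]) auto
  show "(if P \<in> V then s j P q r else 0) = change i j P (\<lambda>q r. if P \<in> V then s i P q r else 0) q r"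
    if "i \<in> charts" "j \<in> charts" "P \<in> V" "P \<in> fst i" "P \<in> fst j" for i j P q r
    using bundle_sections_change[OF s that(1,2) _ that(4,5)] that V by auto
qed

lemma reg_carrier: "openin T W \<Longrightarrow> a \<in> carrier (R W) \<Longrightarrow> reg W a"
  by (simp add: fun_ring_def reg_of_functions)

lemma R_ops:
  "\<one>\<^bsub>R W\<^esub> = (\<lambda>P\<in>W. 1)" "a \<oplus>\<^bsub>R W\<^esub> b = (\<lambda>P\<in>W. a P + b P)" "a \<otimes>\<^bsub>R W\<^esub> b = (\<lambda>P\<in>W. a P * b P)"
  by (simp_all add: fun_ring_def)

lemma module_bundle:
  assumes W: "openin T W"
  shows "module (R W) (sections jet_bundle W)"
proof (rule moduleI)
  show "cring (R W)" by (rule cring_functions[OF W])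
  show "abelian_group (sections jet_bundle W)"
  proof (rule abelian_groupI)
    fix x assume x: "x \<in> carrier (sections jet_bundle W)"
    have "reg W (\<lambda>_. -1)" by (rule reg_const[OF W])
    then have "(\<lambda>i P q r. -1 * x i P q r) \<in> bundle_sections W"
      using x by (intro bundle_sections_smult[OF W]) simp_all
    then show "\<exists>y\<in>carrier (sections jet_bundle W). y \<oplus>\<^bsub>sections jet_bundle W\<^esub> x = \<zero>\<^bsub>sections jet_bundle W\<^esub>"
      by (intro bexI[of _ "\<lambda>i P q r. -1 * x i P q r"]) auto
  qed (auto simp: bundle_sections_add zero_in_bundle_sections[OF W] add_ac)
  have out: "s i P q r = 0" if "s \<in> bundle_sections W" "P \<notin> W" for s i P q r
    by (rule bundle_sections_0[OF that(1)]) (use that(2) in simp)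
  fix x assume "x \<in> carrier (sections jet_bundle W)"
  then have x: "x \<in> bundle_sections W" by simp
  show "\<one>\<^bsub>R W\<^esub> \<odot>\<^bsub>sections jet_bundle W\<^esub> x = x"
    using out[OF x] by (auto simp: R_ops fun_eq_iff restrict_def)
  fix a assume a: "a \<in> carrier (R W)"
  show "a \<odot>\<^bsub>sections jet_bundle W\<^esub> x \<in> carrier (sections jet_bundle W)"
    using bundle_sections_smult[OF W x reg_carrier[OF W a]] by simp
  show "(a \<oplus>\<^bsub>R W\<^esub> b) \<odot>\<^bsub>sections jet_bundle W\<^esub> x = a \<odot>\<^bsub>sections jet_bundle W\<^esub> x \<oplus>\<^bsub>sections jet_bundle W\<^esub> b \<odot>\<^bsub>sections jet_bundle W\<^esub> x"
    "(a \<otimes>\<^bsub>R W\<^esub> b) \<odot>\<^bsub>sections jet_bundle W\<^esub> x = a \<odot>\<^bsub>sections jet_bundle W\<^esub> (b \<odot>\<^bsub>sections jet_bundle W\<^esub> x)"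
    if "b \<in> carrier (R W)" for b
    using out[OF x] by (auto simp: R_ops fun_eq_iff restrict_def distrib_right mult.assoc)
  show "a \<odot>\<^bsub>sections jet_bundle W\<^esub> (x \<oplus>\<^bsub>sections jet_bundle W\<^esub> y) = a \<odot>\<^bsub>sections jet_bundle W\<^esub> x \<oplus>\<^bsub>sections jet_bundle W\<^esub> a \<odot>\<^bsub>sections jet_bundle W\<^esub> y"
    if "y \<in> carrier (sections jet_bundle W)" for y
    by (simp add: distrib_left)
qed

lemma presheaf_bundle: "presheaf_of_modules T R jet_bundle"
  unfolding presheaf_of_modules_def
proof (intro conjI allI impI ballI funcsetI)
  fix U s assume "openin T U" "s \<in> carrier (sections jet_bundle U)"
  then show "res jet_bundle U U s = s"
    using bundle_sections_0[of s U] by (auto simp: fun_eq_iff)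
qed (auto simp: module_bundle bundle_sections_res fun_eq_iff)

text \<open>Sections are functions of the point subject to local conditions, so they are glued pointwise.\<close>

theorem sheaf_bundle: "sheaf_of_modules T R jet_bundle"
  unfolding sheaf_of_modules_def
proof (intro conjI allI impI presheaf_bundle)
  fix \<U> s
  assume "(\<forall>U\<in>\<U>. openin T U \<and> s U \<in> carrier (sections jet_bundle U)) \<and>
    (\<forall>U\<in>\<U>. \<forall>V\<in>\<U>. res jet_bundle U (U \<inter> V) (s U) = res jet_bundle V (U \<inter> V) (s V))"
  then have o: "\<And>U. U \<in> \<U> \<Longrightarrow> openin T U" and s: "\<And>U. U \<in> \<U> \<Longrightarrow> s U \<in> bundle_sections U"
    and eq: "\<And>U V. U \<in> \<U> \<Longrightarrow> V \<in> \<U> \<Longrightarrow> res jet_bundle U (U \<inter> V) (s U) = res jet_bundle V (U \<inter> V) (s V)"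
    by auto
  have agree: "s U i P q r = s V i P q r" if "U \<in> \<U>" "V \<in> \<U>" "P \<in> U" "P \<in> V" for U V i P q r
    using fun_cong[OF fun_cong[OF fun_cong[OF fun_cong[OF eq[OF that(1,2)]]]], of i P q r] that by simp
  define t where "t = (\<lambda>i P q r. if P \<in> \<Union>\<U> then s (SOME U. U \<in> \<U> \<and> P \<in> U) i P q r else 0)"
  have t: "t i P q r = s U i P q r" if "U \<in> \<U>" "P \<in> U" for U i P q r
  proof -
    have "\<exists>U. U \<in> \<U> \<and> P \<in> U" using that by blast
    from someI_ex[OF this] show ?thesis
      unfolding t_def using that agree[of "SOME U. U \<in> \<U> \<and> P \<in> U" U P] by auto
  qed
  have "t \<in> bundle_sections (\<Union>\<U>)"
  proof (rule bundle_sectionsI)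
    show "t i P q r = 0" if "\<not> (i \<in> charts \<and> P \<in> \<Union>\<U> \<inter> fst i \<and> q < N \<and> r \<in> monomials N \<and> r \<noteq> 0)" for i P q r
    proof (cases "P \<in> \<Union>\<U>")
      case True
      then obtain U where U: "U \<in> \<U>" "P \<in> U" by blast
      have "s U i P q r = 0" by (rule bundle_sections_0[OF s[OF U(1)]]) (use that U in blast)
      then show ?thesis using t[OF U] by simp
    qed (simp add: t_def)
    show "reg (\<Union>\<U> \<inter> fst i) (\<lambda>P. t i P q r)" if i: "i \<in> charts" for i q r
    proof (rule reg_local)
      show "openin T (\<Union>\<U> \<inter> fst i)" using o chart_open[OF i] by blast
      fix P assume "P \<in> \<Union>\<U> \<inter> fst i"
      then obtain U where U: "U \<in> \<U>" "P \<in> U" "P \<in> fst i" by blast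
      have "reg (U \<inter> fst i) (\<lambda>P. t i P q r)"
        using bundle_sections_reg[OF s[OF U(1)] i, of q r] t[OF U(1)] by (subst reg_cong[of _ _ "\<lambda>P. s U i P q r"]) auto
      then show "\<exists>V. P \<in> V \<and> V \<subseteq> \<Union>\<U> \<inter> fst i \<and> reg V (\<lambda>P. t i P q r)"
        using U by (intro exI[of _ "U \<inter> fst i"]) auto
    qed
    show "t j P q r = change i j P (t i P) q r"
      if ij: "i \<in> charts" "j \<in> charts" and P: "P \<in> \<Union>\<U>" "P \<in> fst i" "P \<in> fst j" for i j P q r
    proof -
      obtain U where U: "U \<in> \<U>" "P \<in> U" using P by blast
      have "t i P = s U i P" using t[OF U] by (auto simp: fun_eq_iff)
      then show ?thesis using bundle_sections_change[OF s[OF U(1)] ij U(2) P(2,3)] t[OF U] by simp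
    qed
  qed
  then have 1: "t \<in> carrier (sections jet_bundle (\<Union>\<U>))" by simp
  have 2: "res jet_bundle (\<Union>\<U>) U t = s U" if U: "U \<in> \<U>" for U
    using t[OF U] bundle_sections_0[OF s[OF U]] by (auto simp: fun_eq_iff)
  have 3: "t' = t" if t': "t' \<in> carrier (sections jet_bundle (\<Union>\<U>))" "\<forall>U\<in>\<U>. res jet_bundle (\<Union>\<U>) U t' = s U" for t'
  proof (intro ext)
    fix i P q r
    show "t' i P q r = t i P q r"
    proof (cases "P \<in> \<Union>\<U>")
      case True
      then obtain U where U: "U \<in> \<U>" "P \<in> U" by blast
      have "res jet_bundle (\<Union>\<U>) U t' i P q r = s U i P q r" using t'(2) U by simp
      then show ?thesis using U t[OF U] by simp
    next
      case False
      have "t' i P q r = 0" by (rule bundle_sections_0[of t' "\<Union>\<U>"]) (use t' False in auto)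
      then show ?thesis using False by (simp add: t_def)
    qed
  qed
  show "\<exists>!t. t \<in> carrier (sections jet_bundle (\<Union>\<U>)) \<and> (\<forall>U\<in>\<U>. res jet_bundle (\<Union>\<U>) U t = s U)"
  proof (rule ex1I)
    show "t \<in> carrier (sections jet_bundle (\<Union>\<U>)) \<and> (\<forall>U\<in>\<U>. res jet_bundle (\<Union>\<U>) U t = s U)"
      using 1 2 by blast
  qed (elim conjE, rule 3)
qed

lemma subsheaf_filtration: "subsheaf T R jet_bundle (bundle_filtration m)"
  unfolding subsheaf_def
proof (intro conjI allI impI ballI)
  fix U assume U: "openin T U"
  interpret M: module "R U" "sections jet_bundle U" by (rule module_bundle[OF U])
  show "submodule (bundle_filtration m U) (R U) (sections jet_bundle U)"
  proof (rule M.submoduleI)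
    fix s assume s: "s \<in> bundle_filtration m U"
    have neg: "(\<lambda>i P q r. -1 * s i P q r) \<in> bundle_sections U"
      using s bundle_sections_smult[OF U _ reg_const[OF U, of "-1"], of s] by (simp add: bundle_filtration_def)
    have "\<ominus>\<^bsub>sections jet_bundle U\<^esub> s = (\<lambda>i P q r. -1 * s i P q r)"
      by (rule M.minus_equality) (use neg s in \<open>auto simp: bundle_filtration_def\<close>)
    then show "\<ominus>\<^bsub>sections jet_bundle U\<^esub> s \<in> bundle_filtration m U"
      using neg s by (simp add: bundle_filtration_def)
    show "a \<odot>\<^bsub>sections jet_bundle U\<^esub> s \<in> bundle_filtration m U" if "a \<in> carrier (R U)" for a
      using s bundle_sections_smult[OF U _ reg_carrier[OF U that], of s] by (simp add: bundle_filtration_def)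
  qed (auto simp: bundle_filtration_def zero_in_bundle_sections[OF U] bundle_sections_add)
next
  fix U V assume "openin T U \<and> openin T V \<and> V \<subseteq> U"
  then show "res jet_bundle U V ` bundle_filtration m U \<subseteq> bundle_filtration m V"
    using bundle_sections_res[of _ U V] by (auto simp: bundle_filtration_def)
next
  fix \<U> s assume s: "s \<in> carrier (sections jet_bundle (\<Union>\<U>))"
    and sU: "\<forall>U\<in>\<U>. openin T U \<and> res jet_bundle (\<Union>\<U>) U s \<in> bundle_filtration m U"
  have "s i P q r = 0" if "mdeg r \<le> m" for i P q r
  proof (cases "P \<in> \<Union>\<U>")
    case True
    then obtain U where U: "U \<in> \<U>" "P \<in> U" by blast
    have "\<forall>i P q r. mdeg r \<le> m \<longrightarrow> res jet_bundle (\<Union>\<U>) U s i P q r = 0"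
      using bspec[OF sU U(1)] unfolding bundle_filtration_def by blast
    then have "res jet_bundle (\<Union>\<U>) U s i P q r = 0" using that by blast
    then show ?thesis using U by simp
  next
    case False
    then show ?thesis using bundle_sections_0[of s "\<Union>\<U>" i P q r] s by auto
  qed
  then show "s \<in> bundle_filtration m (\<Union>\<U>)" using s by (simp add: bundle_filtration_def)
qed

lemma filtration_properties:
  assumes W: "openin T W"
  shows "bundle_filtration 0 W = carrier (sections jet_bundle W)"
    "bundle_filtration (Suc m) W \<subseteq> bundle_filtration m W"
    "(\<Inter>m. bundle_filtration m W) = {\<zero>\<^bsub>sections jet_bundle W\<^esub>}"
proof -
  show "bundle_filtration 0 W = carrier (sections jet_bundle W)"
    using bundle_sections_0 by (fastforce simp: bundle_filtration_def mdeg_eq_0_iff)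
  show "bundle_filtration (Suc m) W \<subseteq> bundle_filtration m W"
    by (auto simp: bundle_filtration_def)
  show "(\<Inter>m. bundle_filtration m W) = {\<zero>\<^bsub>sections jet_bundle W\<^esub>}"
  proof (intro subset_antisym subsetI)
    fix s assume "s \<in> (\<Inter>m. bundle_filtration m W)"
    then have "s \<in> bundle_filtration (mdeg r) W" for r by blast
    then have "s i P q r = 0" for i P q r
      unfolding bundle_filtration_def by blast
    then show "s \<in> {\<zero>\<^bsub>sections jet_bundle W\<^esub>}" by (auto simp: fun_eq_iff)
  qed (auto simp: bundle_filtration_def zero_in_bundle_sections[OF W])
qed

end

context variety
begin

subsection \<open>The quotient sheaves\<close>

abbreviation jet_quotient :: "nat \<Rightarrow> ('a, 'b, ('a, 'b) family set) mod_presheaf" where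
  "jet_quotient m \<equiv> quotient_presheaf jet_bundle (bundle_filtration m)"

abbreviation jet_sheaf :: "nat \<Rightarrow> ('a, 'b, 'a \<Rightarrow> ('a set \<times> ('a, 'b) family set) set) mod_presheaf" where
  "jet_sheaf m \<equiv> quotient_sheaf T jet_bundle (bundle_filtration m)"

definition agree :: "nat \<Rightarrow> 'a set \<Rightarrow> ('a, 'b) family \<Rightarrow> ('a, 'b) family \<Rightarrow> bool" where
  "agree m W s t \<longleftrightarrow> (\<forall>i. \<forall>P\<in>W. \<forall>q r. mdeg r \<le> m \<longrightarrow> s i P q r = t i P q r)"

definition section_class :: "nat \<Rightarrow> 'a set \<Rightarrow> ('a, 'b) family \<Rightarrow> ('a, 'b) family set" where
  "section_class m W s = {t \<in> bundle_sections W. agree m W s t}"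

definition restrict_family :: "'a set \<Rightarrow> ('a, 'b) family \<Rightarrow> ('a, 'b) family" where
  "restrict_family V s = (\<lambda>i P q r. if P \<in> V then s i P q r else 0)"

lemma agreeD: "agree m W s t \<Longrightarrow> P \<in> W \<Longrightarrow> mdeg r \<le> m \<Longrightarrow> s i P q r = t i P q r"
  unfolding agree_def by blast

lemma agree_sym: "agree m W s t \<Longrightarrow> agree m W t s"
  by (simp add: agree_def)

lemma agree_trans: "agree m W s t \<Longrightarrow> agree m W t u \<Longrightarrow> agree m W s u"
  by (simp add: agree_def)

lemma agree_subset: "agree m W s t \<Longrightarrow> V \<subseteq> W \<Longrightarrow> agree m V s t"
  by (auto simp: agree_def)

lemma agree_refl [simp]: "agree m W s s"
  by (simp add: agree_def)

lemma section_class_self: "s \<in> bundle_sections W \<Longrightarrow> s \<in> section_class m W s"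
  by (simp add: section_class_def)

lemma section_class_eq_iff:
  assumes "s \<in> bundle_sections W" "t \<in> bundle_sections W"
  shows "section_class m W s = section_class m W t \<longleftrightarrow> agree m W s t"
proof
  assume "section_class m W s = section_class m W t"
  then have "t \<in> section_class m W s" using section_class_self[OF assms(2)] by blast
  then show "agree m W s t" by (simp add: section_class_def)
next
  assume "agree m W s t"
  then show "section_class m W s = section_class m W t"
    unfolding section_class_def using agree_trans agree_sym by blast
qed

lemma restrict_family_section:
  "s \<in> bundle_sections U \<Longrightarrow> openin T V \<Longrightarrow> V \<subseteq> U \<Longrightarrow> restrict_family V s \<in> bundle_sections V"
  unfolding restrict_family_def by (rule bundle_sections_res)

lemma res_jet_bundle: "res jet_bundle U V s = restrict_family V s"
  by (simp add: restrict_family_def)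

lemma filtration_iff:
  "s \<in> bundle_filtration m W \<longleftrightarrow> s \<in> bundle_sections W \<and> (\<forall>i P q r. mdeg r \<le> m \<longrightarrow> s i P q r = 0)"
  by (simp add: bundle_filtration_def)

lemma coset_eq_section_class:
  assumes W: "openin T W" and s: "s \<in> bundle_sections W"
  shows "bundle_filtration m W +>\<^bsub>sections jet_bundle W\<^esub> s = section_class m W s"
proof -
  have "bundle_filtration m W +>\<^bsub>sections jet_bundle W\<^esub> s = {(\<lambda>i P q r. h i P q r + s i P q r) | h. h \<in> bundle_filtration m W}"
    unfolding a_r_coset_def' by auto
  also have "\<dots> = section_class m W s"
  proof (intro subset_antisym subsetI)
    fix t assume "t \<in> {(\<lambda>i P q r. h i P q r + s i P q r) | h. h \<in> bundle_filtration m W}"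
    then obtain h where h: "h \<in> bundle_filtration m W" and t: "t = (\<lambda>i P q r. h i P q r + s i P q r)" by blast
    have "t \<in> bundle_sections W"
      unfolding t using h s by (intro bundle_sections_add) (auto simp: filtration_iff)
    moreover have "h i P q r = 0" if "mdeg r \<le> m" for i P q r
      using h that unfolding filtration_iff by blast
    ultimately show "t \<in> section_class m W s" by (simp add: section_class_def agree_def t)
  next
    fix t assume t: "t \<in> section_class m W s"
    then have tW: "t \<in> bundle_sections W" by (simp add: section_class_def)
    have "(\<lambda>i P q r. t i P q r + (-1) * s i P q r) \<in> bundle_sections W"
      by (rule bundle_sections_add[OF tW bundle_sections_smult[OF W s reg_const[OF W]]])
    then have d: "(\<lambda>i P q r. t i P q r - s i P q r) \<in> bundle_sections W" by simp
    have "t i P q r - s i P q r = 0" if "mdeg r \<le> m" for i P q r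
    proof (cases "P \<in> W")
      case True
      have ag: "agree m W s t" using t by (simp add: section_class_def)
      show ?thesis using agreeD[OF ag True that, of i q] by simp
    next
      case False
      then have "t i P q r = 0" "s i P q r = 0"
        using bundle_sections_0[OF tW, of i P q r] bundle_sections_0[OF s, of i P q r] by auto
      then show ?thesis by simp
    qed
    then have "(\<lambda>i P q r. t i P q r - s i P q r) \<in> bundle_filtration m W"
      using d unfolding filtration_iff by blast
    then show "t \<in> {(\<lambda>i P q r. h i P q r + s i P q r) | h. h \<in> bundle_filtration m W}"
      by (intro CollectI exI[of _ "\<lambda>i P q r. t i P q r - s i P q r"]) simp
  qed
  finally show ?thesis .
qed

lemma jet_quotient_carrier:
  assumes W: "openin T W"
  shows "C \<in> carrier (sections (jet_quotient m) W) \<longleftrightarrow> (\<exists>s\<in>bundle_sections W. C = section_class m W s)"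
proof -
  have "C \<in> carrier (sections (jet_quotient m) W) \<longleftrightarrow>
      (\<exists>s\<in>bundle_sections W. C = bundle_filtration m W +>\<^bsub>sections jet_bundle W\<^esub> s)"
    by (auto simp: quotient_presheaf_def quotient_module_def A_RCOSETS_def')
  then show ?thesis
    by (simp add: coset_eq_section_class[OF W] cong: bex_cong)
qed

lemma UN_constant_value:
  assumes "X \<noteq> {}" "\<And>x. x \<in> X \<Longrightarrow> f x = c"
  shows "(\<Union>x\<in>X. f x) = c"
  using assms by auto

lemma jet_quotient_res:
  assumes "openin T V" "V \<subseteq> U" "s \<in> bundle_sections U"
  shows "res (jet_quotient m) U V (section_class m U s) = section_class m V (restrict_family V s)"
proof -
  have "bundle_filtration m V +>\<^bsub>sections jet_bundle V\<^esub> restrict_family V t = section_class m V (restrict_family V s)"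
    if t: "t \<in> section_class m U s" for t
  proof -
    have tU: "t \<in> bundle_sections U" "agree m U s t" using t by (auto simp: section_class_def)
    have "agree m V (restrict_family V t) (restrict_family V s)"
      using tU(2) assms(2) by (auto simp: agree_def restrict_family_def)
    then show ?thesis
      unfolding coset_eq_section_class[OF assms(1) restrict_family_section[OF tU(1) assms(1,2)]]
      using section_class_eq_iff[OF restrict_family_section[OF tU(1) assms(1,2)] restrict_family_section[OF assms(3,1,2)]]
      by blast
  qed
  moreover have "res (jet_quotient m) U V (section_class m U s)
      = (\<Union>t\<in>section_class m U s. bundle_filtration m V +>\<^bsub>sections jet_bundle V\<^esub> restrict_family V t)"
    by (simp add: quotient_presheaf_def res_jet_bundle del: bundle_simps(5))
  ultimately show ?thesis
    using section_class_self[OF assms(3), of m] by (simp only:) (rule UN_constant_value, blast+)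
qed

lemma jet_quotient_add:
  assumes W: "openin T W" and s: "s \<in> bundle_sections W" and t: "t \<in> bundle_sections W"
  shows "section_class m W s \<oplus>\<^bsub>sections (jet_quotient m) W\<^esub> section_class m W t
    = section_class m W (\<lambda>i P q r. s i P q r + t i P q r)"
proof -
  have "section_class m W s \<oplus>\<^bsub>sections (jet_quotient m) W\<^esub> section_class m W t
      = {(\<lambda>i P q r. a i P q r + b i P q r) | a b. a \<in> section_class m W s \<and> b \<in> section_class m W t}"
    by (auto simp: quotient_presheaf_def quotient_module_def set_add_def')
  also have "\<dots> = section_class m W (\<lambda>i P q r. s i P q r + t i P q r)"
  proof (intro subset_antisym subsetI)
    fix u assume "u \<in> {(\<lambda>i P q r. a i P q r + b i P q r) | a b. a \<in> section_class m W s \<and> b \<in> section_class m W t}"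
    then obtain a b where "u = (\<lambda>i P q r. a i P q r + b i P q r)" "a \<in> section_class m W s" "b \<in> section_class m W t" by blast
    then show "u \<in> section_class m W (\<lambda>i P q r. s i P q r + t i P q r)"
      by (auto simp: section_class_def agree_def intro: bundle_sections_add)
  next
    fix u assume u: "u \<in> section_class m W (\<lambda>i P q r. s i P q r + t i P q r)"
    then have uW: "u \<in> bundle_sections W" by (simp add: section_class_def)
    have "(\<lambda>i P q r. u i P q r + (-1) * t i P q r) \<in> bundle_sections W"
      by (rule bundle_sections_add[OF uW bundle_sections_smult[OF W t reg_const[OF W]]])
    then have "(\<lambda>i P q r. u i P q r - t i P q r) \<in> section_class m W s"
      using u by (simp add: section_class_def agree_def eq_diff_eq)
    then show "u \<in> {(\<lambda>i P q r. a i P q r + b i P q r) | a b. a \<in> section_class m W s \<and> b \<in> section_class m W t}"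
      using section_class_self[OF t, of m]
      by (intro CollectI exI[of _ "\<lambda>i P q r. u i P q r - t i P q r"] exI[of _ t]) simp
  qed
  finally show ?thesis .
qed

lemma jet_quotient_smult:
  assumes W: "openin T W" and s: "s \<in> bundle_sections W" and a: "reg W a"
  shows "a \<odot>\<^bsub>sections (jet_quotient m) W\<^esub> section_class m W s = section_class m W (\<lambda>i P q r. a P * s i P q r)"
proof -
  have "bundle_filtration m W +>\<^bsub>sections jet_bundle W\<^esub> (a \<odot>\<^bsub>sections jet_bundle W\<^esub> t)
      = section_class m W (\<lambda>i P q r. a P * s i P q r)" if t: "t \<in> section_class m W s" for t
  proof -
    have tW: "t \<in> bundle_sections W" and ag: "agree m W s t" using t by (auto simp: section_class_def)
    show ?thesis
      unfolding bundle_simps coset_eq_section_class[OF W bundle_sections_smult[OF W tW a]]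
        section_class_eq_iff[OF bundle_sections_smult[OF W tW a] bundle_sections_smult[OF W s a]]
      using ag by (simp add: agree_def)
  qed
  moreover have "a \<odot>\<^bsub>sections (jet_quotient m) W\<^esub> section_class m W s
      = (\<Union>t\<in>section_class m W s. bundle_filtration m W +>\<^bsub>sections jet_bundle W\<^esub> (a \<odot>\<^bsub>sections jet_bundle W\<^esub> t))"
    by (simp add: quotient_presheaf_def quotient_module_def del: bundle_simps)
  ultimately show ?thesis
    using section_class_self[OF s, of m] by (simp only:) (rule UN_constant_value, blast+)
qed

subsection \<open>Germs\<close>

definition jet_germ :: "nat \<Rightarrow> 'a \<Rightarrow> 'a set \<Rightarrow> ('a, 'b) family \<Rightarrow> ('a set \<times> ('a, 'b) family set) set" where
  "jet_germ m P V s = germ T (jet_quotient m) P (V, section_class m V s)"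

lemma mem_jet_germ:
  assumes V: "openin T V" "s \<in> bundle_sections V"
  shows "(V', C) \<in> jet_germ m P V s \<longleftrightarrow> openin T V' \<and> P \<in> V' \<and>
    (\<exists>s'\<in>bundle_sections V'. C = section_class m V' s' \<and>
      (\<exists>W. openin T W \<and> P \<in> W \<and> W \<subseteq> V \<inter> V' \<and> agree m W s s'))"
proof -
  have eq: "res (jet_quotient m) V W (section_class m V s) = res (jet_quotient m) V' W (section_class m V' s')
      \<longleftrightarrow> agree m W s s'"
    if V': "openin T V'" "s' \<in> bundle_sections V'" and W: "openin T W" "W \<subseteq> V \<inter> V'" for s' W
  proof -
    have sub: "W \<subseteq> V" "W \<subseteq> V'" using W by auto
    show ?thesis
      unfolding jet_quotient_res[OF W(1) sub(1) V(2)] jet_quotient_res[OF W(1) sub(2) V'(2)]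
        section_class_eq_iff[OF restrict_family_section[OF V(2) W(1) sub(1)] restrict_family_section[OF V'(2) W(1) sub(2)]]
      by (auto simp: agree_def restrict_family_def)
  qed
  show ?thesis
  proof
    assume "(V', C) \<in> jet_germ m P V s"
    then obtain W where o: "openin T V'" "P \<in> V'" "C \<in> carrier (sections (jet_quotient m) V')"
        and W: "openin T W" "P \<in> W" "W \<subseteq> V \<inter> V'"
        and r: "res (jet_quotient m) V W (section_class m V s) = res (jet_quotient m) V' W C"
      by (auto simp: jet_germ_def germ_def)
    obtain s' where s': "s' \<in> bundle_sections V'" "C = section_class m V' s'"
      using o(3) jet_quotient_carrier[OF o(1)] by blast
    then have "agree m W s s'" using r eq[OF o(1) s'(1) W(1,3)] by simp
    then show "openin T V' \<and> P \<in> V' \<and> (\<exists>s'\<in>bundle_sections V'. C = section_class m V' s' \<and>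
      (\<exists>W. openin T W \<and> P \<in> W \<and> W \<subseteq> V \<inter> V' \<and> agree m W s s'))"
      using o W s' by blast
  next
    assume "openin T V' \<and> P \<in> V' \<and> (\<exists>s'\<in>bundle_sections V'. C = section_class m V' s' \<and>
      (\<exists>W. openin T W \<and> P \<in> W \<and> W \<subseteq> V \<inter> V' \<and> agree m W s s'))"
    then obtain s' W where o: "openin T V'" "P \<in> V'" and s': "s' \<in> bundle_sections V'" "C = section_class m V' s'"
        and W: "openin T W" "P \<in> W" "W \<subseteq> V \<inter> V'" "agree m W s s'" by blast
    have "res (jet_quotient m) V W (section_class m V s) = res (jet_quotient m) V' W C"
      using eq[OF o(1) s'(1) W(1,3)] W(4) s'(2) by simp
    moreover have "C \<in> carrier (sections (jet_quotient m) V')"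
      using jet_quotient_carrier[OF o(1)] s' by blast
    ultimately show "(V', C) \<in> jet_germ m P V s"
      using o W(1-3) by (auto simp: jet_germ_def germ_def)
  qed
qed

lemma jet_germ_self: "openin T V \<Longrightarrow> P \<in> V \<Longrightarrow> s \<in> bundle_sections V \<Longrightarrow> (V, section_class m V s) \<in> jet_germ m P V s"
  unfolding mem_jet_germ by (intro conjI bexI[of _ s] exI[of _ V]) simp_all

lemma jet_germ_eqI:
  assumes V: "openin T V" "s \<in> bundle_sections V" and V': "openin T V'" "s' \<in> bundle_sections V'"
    and W: "openin T W" "P \<in> W" "W \<subseteq> V \<inter> V'" "agree m W s s'"
  shows "jet_germ m P V s = jet_germ m P V' s'"
proof -
  have "jet_germ m P V s \<subseteq> jet_germ m P V' s'"
    if V: "openin T V" "s \<in> bundle_sections V" and V': "openin T V'" "s' \<in> bundle_sections V'"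
      and W: "W \<subseteq> V \<inter> V'" "agree m W s s'" for V s V' s'
  proof (rule subrelI)
    fix V2 C assume "(V2, C) \<in> jet_germ m P V s"
    then obtain s2 W2 where *: "openin T V2" "P \<in> V2" "s2 \<in> bundle_sections V2" "C = section_class m V2 s2"
        "openin T W2" "P \<in> W2" "W2 \<subseteq> V \<inter> V2" "agree m W2 s s2"
      unfolding mem_jet_germ[OF V] by blast
    have "agree m (W \<inter> W2) s' s2"
      by (rule agree_trans[OF agree_sym[OF agree_subset[OF W(2)]] agree_subset[OF *(8)]]) auto
    then show "(V2, C) \<in> jet_germ m P V' s'"
      unfolding mem_jet_germ[OF V'] using * W(1) assms(5,6)
      by (intro conjI bexI[of _ s2] exI[of _ "W \<inter> W2"]) auto
  qed
  from this[OF V V' W(3,4)] this[OF V' V _ agree_sym[OF W(4)]] W(3) show ?thesis by blast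
qed

lemma jet_germ_eqD:
  assumes V: "openin T V" "P \<in> V" "s \<in> bundle_sections V" and V': "openin T V'" "s' \<in> bundle_sections V'"
    and eq: "jet_germ m P V s = jet_germ m P V' s'"
  shows "\<exists>W. openin T W \<and> P \<in> W \<and> W \<subseteq> V \<inter> V' \<and> agree m W s s'"
proof -
  have "(V, section_class m V s) \<in> jet_germ m P V' s'" using jet_germ_self[OF V] eq by blast
  then obtain s1 W where 1: "s1 \<in> bundle_sections V" "section_class m V s = section_class m V s1"
      "openin T W" "P \<in> W" "W \<subseteq> V' \<inter> V" "agree m W s' s1"
    unfolding mem_jet_germ[OF V'] by blast
  have "agree m W s1 s"
    using agree_subset[OF agree_sym, of m V s s1 W] 1(2,5) section_class_eq_iff[OF V(3) 1(1)] by simp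
  then have "agree m W s s'"
    using agree_sym[OF agree_trans[OF 1(6)]] by blast
  moreover have "W \<subseteq> V \<inter> V'" using 1(5) by blast
  ultimately show ?thesis using 1(3,4) by blast
qed

lemma jet_sheaf_carrier:
  "\<sigma> \<in> carrier (sections (jet_sheaf m) W) \<longleftrightarrow> \<sigma> \<in> extensional W \<and>
    (\<forall>P\<in>W. \<exists>V s. openin T V \<and> P \<in> V \<and> V \<subseteq> W \<and> s \<in> bundle_sections V \<and> (\<forall>Q\<in>V. \<sigma> Q = jet_germ m Q V s))"
proof -
  have "(\<exists>V C. openin T V \<and> P \<in> V \<and> V \<subseteq> W \<and> C \<in> carrier (sections (jet_quotient m) V) \<and>
        (\<forall>Q\<in>V. \<sigma> Q = germ T (jet_quotient m) Q (V, C)))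
      \<longleftrightarrow> (\<exists>V s. openin T V \<and> P \<in> V \<and> V \<subseteq> W \<and> s \<in> bundle_sections V \<and> (\<forall>Q\<in>V. \<sigma> Q = jet_germ m Q V s))" for P
  proof (intro iffI; elim exE conjE)
    fix V C assume V: "openin T V" "P \<in> V" "V \<subseteq> W" and C: "C \<in> carrier (sections (jet_quotient m) V)"
      and eq: "\<forall>Q\<in>V. \<sigma> Q = germ T (jet_quotient m) Q (V, C)"
    obtain s where "s \<in> bundle_sections V" "C = section_class m V s"
      using C unfolding jet_quotient_carrier[OF V(1)] by blast
    then show "\<exists>V s. openin T V \<and> P \<in> V \<and> V \<subseteq> W \<and> s \<in> bundle_sections V \<and> (\<forall>Q\<in>V. \<sigma> Q = jet_germ m Q V s)"
      using V eq by (intro exI[of _ V] exI[of _ s]) (simp add: jet_germ_def)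
  next
    fix V s assume V: "openin T V" "P \<in> V" "V \<subseteq> W" and s: "s \<in> bundle_sections V"
      and eq: "\<forall>Q\<in>V. \<sigma> Q = jet_germ m Q V s"
    have "section_class m V s \<in> carrier (sections (jet_quotient m) V)"
      unfolding jet_quotient_carrier[OF V(1)] using s by blast
    then show "\<exists>V C. openin T V \<and> P \<in> V \<and> V \<subseteq> W \<and> C \<in> carrier (sections (jet_quotient m) V) \<and>
        (\<forall>Q\<in>V. \<sigma> Q = germ T (jet_quotient m) Q (V, C))"
      using V eq by (intro exI[of _ V] exI[of _ "section_class m V s"]) (simp add: jet_germ_def)
  qed
  then show ?thesis
    by (simp add: quotient_sheaf_def sheafify_def)
qed

lemma jet_sheaf_local:
  assumes "\<sigma> \<in> carrier (sections (jet_sheaf m) W)" "P \<in> W"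
  obtains V s where "openin T V" "P \<in> V" "V \<subseteq> W" "s \<in> bundle_sections V" "\<And>Q. Q \<in> V \<Longrightarrow> \<sigma> Q = jet_germ m Q V s"
proof -
  have "\<exists>V s. openin T V \<and> P \<in> V \<and> V \<subseteq> W \<and> s \<in> bundle_sections V \<and> (\<forall>Q\<in>V. \<sigma> Q = jet_germ m Q V s)"
    using assms unfolding jet_sheaf_carrier by blast
  then show ?thesis using that by blast
qed

lemma jet_sheaf_add_at:
  assumes P: "P \<in> W" and V: "openin T V" "P \<in> V" "s \<in> bundle_sections V" "\<sigma> P = jet_germ m P V s"
    and V': "openin T V'" "P \<in> V'" "t \<in> bundle_sections V'" "\<tau> P = jet_germ m P V' t"
  shows "(\<sigma> \<oplus>\<^bsub>sections (jet_sheaf m) W\<^esub> \<tau>) P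
    = jet_germ m P (V \<inter> V') (\<lambda>i P q r. restrict_family (V \<inter> V') s i P q r + restrict_family (V \<inter> V') t i P q r)"
    (is "_ = ?G")
proof -
  have VV: "openin T (V \<inter> V')" "P \<in> V \<inter> V'" using V V' by auto
  let ?u = "\<lambda>V s t i P q r. restrict_family V s i P q r + restrict_family V t i P q r"
  have u: "?u (V \<inter> V') s t \<in> bundle_sections (V \<inter> V')"
    if "openin T (V \<inter> V')" "s \<in> bundle_sections V" "t \<in> bundle_sections V'" for V V' s t
    by (rule bundle_sections_add[OF restrict_family_section[OF that(2,1)] restrict_family_section[OF that(3,1)]]) auto
  have one: "germ T (jet_quotient m) P (V1 \<inter> V2,
        res (jet_quotient m) V1 (V1 \<inter> V2) C1 \<oplus>\<^bsub>sections (jet_quotient m) (V1 \<inter> V2)\<^esub> res (jet_quotient m) V2 (V1 \<inter> V2) C2) = ?G"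
    if C1: "(V1, C1) \<in> jet_germ m P V s" and C2: "(V2, C2) \<in> jet_germ m P V' t" for V1 C1 V2 C2
  proof -
    obtain s1 W1 where 1: "openin T V1" "P \<in> V1" "s1 \<in> bundle_sections V1" "C1 = section_class m V1 s1"
        "openin T W1" "P \<in> W1" "W1 \<subseteq> V \<inter> V1" "agree m W1 s s1"
      using C1 unfolding mem_jet_germ[OF V(1,3)] by blast
    obtain t2 W2 where 2: "openin T V2" "P \<in> V2" "t2 \<in> bundle_sections V2" "C2 = section_class m V2 t2"
        "openin T W2" "P \<in> W2" "W2 \<subseteq> V' \<inter> V2" "agree m W2 t t2"
      using C2 unfolding mem_jet_germ[OF V'(1,3)] by blast
    have o: "openin T (V1 \<inter> V2)" using 1 2 by blast
    have "res (jet_quotient m) V1 (V1 \<inter> V2) C1 \<oplus>\<^bsub>sections (jet_quotient m) (V1 \<inter> V2)\<^esub> res (jet_quotient m) V2 (V1 \<inter> V2) C2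
        = section_class m (V1 \<inter> V2) (?u (V1 \<inter> V2) s1 t2)"
      unfolding 1(4) 2(4) jet_quotient_res[OF o Int_lower1 1(3)] jet_quotient_res[OF o Int_lower2 2(3)]
      by (rule jet_quotient_add[OF o restrict_family_section[OF 1(3) o Int_lower1] restrict_family_section[OF 2(3) o Int_lower2]])
    moreover have "jet_germ m P (V1 \<inter> V2) (?u (V1 \<inter> V2) s1 t2) = ?G"
    proof (rule jet_germ_eqI[OF o u[OF o 1(3) 2(3)] VV(1) u[OF VV(1) V(3) V'(3)]])
      show "openin T (W1 \<inter> W2)" "P \<in> W1 \<inter> W2" using 1 2 by auto
      show "W1 \<inter> W2 \<subseteq> V1 \<inter> V2 \<inter> (V \<inter> V')" using 1(7) 2(7) by blast
      show "agree m (W1 \<inter> W2) (?u (V1 \<inter> V2) s1 t2) (?u (V \<inter> V') s t)"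
        unfolding agree_def
      proof (intro allI ballI impI)
        fix i Q q r assume Q: "Q \<in> W1 \<inter> W2" "mdeg r \<le> m"
        then have "Q \<in> V1 \<inter> V2" "Q \<in> V \<inter> V'" using 1(7) 2(7) by auto
        then show "?u (V1 \<inter> V2) s1 t2 i Q q r = ?u (V \<inter> V') s t i Q q r"
          using agreeD[OF 1(8)] agreeD[OF 2(8)] Q by (simp add: restrict_family_def)
      qed
    qed
    ultimately show ?thesis by (simp add: jet_germ_def)
  qed
  have "(\<sigma> \<oplus>\<^bsub>sections (jet_sheaf m) W\<^esub> \<tau>) P = (\<Union>x\<in>jet_germ m P V s. \<Union>y\<in>jet_germ m P V' t.
      germ T (jet_quotient m) P (fst x \<inter> fst y, res (jet_quotient m) (fst x) (fst x \<inter> fst y) (snd x)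
        \<oplus>\<^bsub>sections (jet_quotient m) (fst x \<inter> fst y)\<^esub> res (jet_quotient m) (fst y) (fst x \<inter> fst y) (snd y)))"
    using P V(4) V'(4) by (simp add: quotient_sheaf_def sheafify_def case_prod_beta)
  also have "\<dots> = ?G"
    using jet_germ_self[OF V(1-3), of m] jet_germ_self[OF V'(1-3), of m] one
    by (intro UN_constant_value) (auto simp: ex_in_conv[symmetric])
  finally show ?thesis .
qed

lemma jet_sheaf_smult_at:
  assumes W: "openin T W" and a: "reg W a" and P: "P \<in> W"
    and V: "openin T V" "P \<in> V" "s \<in> bundle_sections V" "\<sigma> P = jet_germ m P V s"
  shows "(a \<odot>\<^bsub>sections (jet_sheaf m) W\<^esub> \<sigma>) P
    = jet_germ m P (V \<inter> W) (\<lambda>i P q r. restrict a (V \<inter> W) P * restrict_family (V \<inter> W) s i P q r)"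
    (is "_ = ?G")
proof -
  have VW: "openin T (V \<inter> W)" "P \<in> V \<inter> W" using V W P by auto
  let ?u = "\<lambda>V s i P q r. restrict a V P * restrict_family V s i P q r"
  have ra: "reg V (restrict a V)" if "openin T V" "V \<subseteq> W" for V
    using reg_subset[OF a that] reg_cong[of V "restrict a V" a] by simp
  have u: "?u (V \<inter> W) s \<in> bundle_sections (V \<inter> W)" if "openin T (V \<inter> W)" "s \<in> bundle_sections V" for V s
    by (rule bundle_sections_smult[OF that(1) restrict_family_section[OF that(2,1)] ra[OF that(1)]]) auto
  have one: "germ T (jet_quotient m) P (V1 \<inter> W, restrict a (V1 \<inter> W) \<odot>\<^bsub>sections (jet_quotient m) (V1 \<inter> W)\<^esub>
        res (jet_quotient m) V1 (V1 \<inter> W) C1) = ?G"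
    if C1: "(V1, C1) \<in> jet_germ m P V s" for V1 C1
  proof -
    obtain s1 W1 where 1: "openin T V1" "P \<in> V1" "s1 \<in> bundle_sections V1" "C1 = section_class m V1 s1"
        "openin T W1" "P \<in> W1" "W1 \<subseteq> V \<inter> V1" "agree m W1 s s1"
      using C1 unfolding mem_jet_germ[OF V(1,3)] by blast
    have o: "openin T (V1 \<inter> W)" using 1 W by blast
    have "restrict a (V1 \<inter> W) \<odot>\<^bsub>sections (jet_quotient m) (V1 \<inter> W)\<^esub> res (jet_quotient m) V1 (V1 \<inter> W) C1
        = section_class m (V1 \<inter> W) (?u (V1 \<inter> W) s1)"
      unfolding 1(4) jet_quotient_res[OF o Int_lower1 1(3)]
      by (rule jet_quotient_smult[OF o restrict_family_section[OF 1(3) o Int_lower1] ra[OF o Int_lower2]])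
    moreover have "jet_germ m P (V1 \<inter> W) (?u (V1 \<inter> W) s1) = ?G"
    proof (rule jet_germ_eqI[OF o u[OF o 1(3)] VW(1) u[OF VW(1) V(3)]])
      show "openin T (W1 \<inter> W)" "P \<in> W1 \<inter> W" using 1 W P by auto
      show "W1 \<inter> W \<subseteq> V1 \<inter> W \<inter> (V \<inter> W)" using 1(7) by blast
      show "agree m (W1 \<inter> W) (?u (V1 \<inter> W) s1) (?u (V \<inter> W) s)"
        unfolding agree_def
      proof (intro allI ballI impI)
        fix i Q q r assume Q: "Q \<in> W1 \<inter> W" "mdeg r \<le> m"
        then have "Q \<in> V1 \<inter> W" "Q \<in> V \<inter> W" using 1(7) by auto
        then show "?u (V1 \<inter> W) s1 i Q q r = ?u (V \<inter> W) s i Q q r"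
          using agreeD[OF 1(8)] Q by (simp add: restrict_family_def)
      qed
    qed
    ultimately show ?thesis by (simp add: jet_germ_def)
  qed
  have "(a \<odot>\<^bsub>sections (jet_sheaf m) W\<^esub> \<sigma>) P = (\<Union>x\<in>jet_germ m P V s. germ T (jet_quotient m) P (fst x \<inter> W,
      restrict a (fst x \<inter> W) \<odot>\<^bsub>sections (jet_quotient m) (fst x \<inter> W)\<^esub> res (jet_quotient m) (fst x) (fst x \<inter> W) (snd x)))"
    using P V(4) by (simp add: quotient_sheaf_def sheafify_def case_prod_beta)
  also have "\<dots> = ?G"
    using jet_germ_self[OF V(1-3), of m] one by (intro UN_constant_value) auto
  finally show ?thesis .
qed

lemma quotient_projection_at:
  assumes P: "P \<in> W" and V: "openin T V" "P \<in> V" "s \<in> bundle_sections V" "\<sigma> P = jet_germ (Suc m) P V s"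
  shows "quotient_projection T jet_bundle (bundle_filtration m) W \<sigma> P = jet_germ m P V s"
proof -
  have one: "germ T (jet_quotient m) P (V1, \<Union>t\<in>C1. bundle_filtration m V1 +>\<^bsub>sections jet_bundle V1\<^esub> t) = jet_germ m P V s"
    if C1: "(V1, C1) \<in> jet_germ (Suc m) P V s" for V1 C1
  proof -
    obtain s1 W1 where 1: "openin T V1" "P \<in> V1" "s1 \<in> bundle_sections V1" "C1 = section_class (Suc m) V1 s1"
        "openin T W1" "P \<in> W1" "W1 \<subseteq> V \<inter> V1" "agree (Suc m) W1 s s1"
      using C1 unfolding mem_jet_germ[OF V(1,3)] by blast
    have "(\<Union>t\<in>C1. bundle_filtration m V1 +>\<^bsub>sections jet_bundle V1\<^esub> t) = section_class m V1 s1"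
    proof (rule UN_constant_value)
      show "C1 \<noteq> {}" using section_class_self[OF 1(3)] 1(4) by blast
      fix t assume "t \<in> C1"
      then have t: "t \<in> bundle_sections V1" "agree (Suc m) V1 s1 t" using 1(4) by (auto simp: section_class_def)
      have "agree m V1 t s1" using t(2) by (auto simp: agree_def)
      then show "bundle_filtration m V1 +>\<^bsub>sections jet_bundle V1\<^esub> t = section_class m V1 s1"
        unfolding coset_eq_section_class[OF 1(1) t(1)] section_class_eq_iff[OF t(1) 1(3)] .
    qed
    moreover have "jet_germ m P V1 s1 = jet_germ m P V s"
      by (rule jet_germ_eqI[OF 1(1,3) V(1,3) 1(5,6)]) (use 1(7,8) in \<open>auto simp: agree_def\<close>)
    ultimately show ?thesis by (simp add: jet_germ_def)
  qed
  have "quotient_projection T jet_bundle (bundle_filtration m) W \<sigma> P = (\<Union>x\<in>jet_germ (Suc m) P V s.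
      germ T (jet_quotient m) P (fst x, \<Union>t\<in>snd x. bundle_filtration m (fst x) +>\<^bsub>sections jet_bundle (fst x)\<^esub> t))"
    using P V(4) by (simp add: quotient_projection_def case_prod_beta)
  also have "\<dots> = jet_germ m P V s"
    using jet_germ_self[OF V(1-3), of "Suc m"] one by (intro UN_constant_value) auto
  finally show ?thesis .
qed

subsection \<open>Trivializations\<close>

text \<open>In the chart \<open>i\<close> a section of the quotient has at each point the jet of any representative.\<close>

definition trivialization :: "nat \<Rightarrow> 'a set \<times> (nat \<Rightarrow> 'a \<Rightarrow> 'b) \<Rightarrow> 'a set \<Rightarrow>
    ('a \<Rightarrow> ('a set \<times> ('a, 'b) family set) set) \<Rightarrow> 'a \<Rightarrow> (nat \<Rightarrow> 'b mpoly) set" where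
  "trivialization m i W \<sigma> = (\<lambda>P\<in>W. THE B. \<exists>V C s. (V, C) \<in> \<sigma> P \<and> s \<in> C \<and> B = jet N m (s i P))"

lemma jet_cong: "(\<And>q r. mdeg r \<le> m \<Longrightarrow> c q r = d q r) \<Longrightarrow> jet n m c = jet n m d"
  unfolding jet_def by (rule jet_class_eqI) (simp add: lookup_truncated_field)

lemma trivialization_at:
  assumes P: "P \<in> W" and V: "openin T V" "P \<in> V" "s \<in> bundle_sections V" "\<sigma> P = jet_germ m P V s"
  shows "trivialization m i W \<sigma> P = jet N m (s i P)"
proof -
  have "(THE B. \<exists>V C s. (V, C) \<in> \<sigma> P \<and> s \<in> C \<and> B = jet N m (s i P)) = jet N m (s i P)"
  proof (rule the_equality)
    show "\<exists>V C s'. (V, C) \<in> \<sigma> P \<and> s' \<in> C \<and> jet N m (s i P) = jet N m (s' i P)"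
      using jet_germ_self[OF V(1-3), of m] section_class_self[OF V(3), of m] V(4) by blast
    fix B assume "\<exists>V C s. (V, C) \<in> \<sigma> P \<and> s \<in> C \<and> B = jet N m (s i P)"
    then obtain V1 C1 t where t: "(V1, C1) \<in> jet_germ m P V s" "t \<in> C1" "B = jet N m (t i P)"
      using V(4) by auto
    obtain s1 W1 where 1: "P \<in> V1" "C1 = section_class m V1 s1" "P \<in> W1" "agree m W1 s s1"
      using t(1) unfolding mem_jet_germ[OF V(1,3)] by blast
    have ag: "agree m V1 s1 t" using t(2) 1(2) by (simp add: section_class_def)
    show "B = jet N m (s i P)"
      unfolding t(3) by (rule jet_cong) (simp add: agreeD[OF 1(4,3)] agreeD[OF ag 1(1), symmetric])
  qed
  then show ?thesis using P by (simp add: trivialization_def)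
qed

lemma section_zero_exponent: "s \<in> bundle_sections V \<Longrightarrow> s i P q 0 = 0"
  by (rule bundle_sections_0) simp_all

text \<open>Representatives of \<open>\<sigma>\<close> exist only locally, but their coefficients up to order \<open>m\<close> agree on overlaps and so are
  regular functions on all of \<open>W\<close>.\<close>

lemma trivialization_in_tensor:
  assumes i: "i \<in> charts" and W: "openin T W" "W \<subseteq> fst i" and \<sigma>: "\<sigma> \<in> carrier (sections (jet_sheaf m) W)"
  shows "trivialization m i W \<sigma> \<in> carrier (tensor_module R W (L_quot N m))"
proof -
  have "\<forall>P\<in>W. \<exists>Vs. openin T (fst Vs) \<and> P \<in> fst Vs \<and> fst Vs \<subseteq> W \<and> snd Vs \<in> bundle_sections (fst Vs) \<and>
      (\<forall>Q\<in>fst Vs. \<sigma> Q = jet_germ m Q (fst Vs) (snd Vs))"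
  proof
    fix P assume P: "P \<in> W"
    obtain V s where "openin T V" "P \<in> V" "V \<subseteq> W" "s \<in> bundle_sections V" "\<And>Q. Q \<in> V \<Longrightarrow> \<sigma> Q = jet_germ m Q V s"
      using jet_sheaf_local[OF \<sigma> P] by blast
    then show "\<exists>Vs. openin T (fst Vs) \<and> P \<in> fst Vs \<and> fst Vs \<subseteq> W \<and> snd Vs \<in> bundle_sections (fst Vs) \<and>
      (\<forall>Q\<in>fst Vs. \<sigma> Q = jet_germ m Q (fst Vs) (snd Vs))"
      by (intro exI[of _ "(V, s)"]) simp
  qed
  from bchoice[OF this] obtain F where F0: "\<forall>P\<in>W. openin T (fst (F P)) \<and> P \<in> fst (F P) \<and> fst (F P) \<subseteq> W \<and>
      snd (F P) \<in> bundle_sections (fst (F P)) \<and> (\<forall>Q\<in>fst (F P). \<sigma> Q = jet_germ m Q (fst (F P)) (snd (F P)))"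
    by (elim exE) (rule that)
  note F = bspec[OF F0]
  define c where "c = (\<lambda>P q r. if P \<in> W \<and> mdeg r \<le> m then snd (F P) i P q r else 0)"
  have near: "c Q q r = snd (F P) i Q q r" if P: "P \<in> W" and Q: "Q \<in> fst (F P)" and r: "mdeg r \<le> m" for P Q q r
  proof -
    have QW: "Q \<in> W" using F[OF P] Q by blast
    have eq: "jet_germ m Q (fst (F Q)) (snd (F Q)) = jet_germ m Q (fst (F P)) (snd (F P))"
      using F[OF P] F[OF QW] Q by metis
    have o: "openin T (fst (F Q))" "Q \<in> fst (F Q)" "snd (F Q) \<in> bundle_sections (fst (F Q))"
        "openin T (fst (F P))" "snd (F P) \<in> bundle_sections (fst (F P))"
      using F[OF P] F[OF QW] by simp_all
    obtain W' where W': "Q \<in> W'" "agree m W' (snd (F Q)) (snd (F P))"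
      using jet_germ_eqD[OF o eq] by (elim exE conjE) (rule that)
    then show ?thesis using QW r agreeD[OF W'(2,1) r, of i q] by (simp add: c_def)
  qed
  have "reg W (\<lambda>P. c P q r)" for q r
  proof (cases "mdeg r \<le> m")
    case True
    show ?thesis
    proof (rule reg_local[OF W(1)])
      fix P assume P: "P \<in> W"
      have "fst (F P) \<inter> fst i = fst (F P)" using F[OF P] W(2) by blast
      then have "reg (fst (F P)) (\<lambda>Q. snd (F P) i Q q r)"
        using bundle_sections_reg[of "snd (F P)" "fst (F P)" i q r] F[OF P] i by simp
      then have "reg (fst (F P)) (\<lambda>Q. c Q q r)"
        using near[OF P _ True] by (subst reg_cong[of _ _ "\<lambda>Q. snd (F P) i Q q r"]) auto
      then show "\<exists>V. P \<in> V \<and> V \<subseteq> W \<and> reg V (\<lambda>Q. c Q q r)" using F[OF P] by blast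
    qed
  qed (simp add: c_def reg_const[OF W(1)])
  moreover have "c P q 0 = 0" for P q
  proof (cases "P \<in> W")
    case True
    have "snd (F P) \<in> bundle_sections (fst (F P))" using F[OF True] by blast
    then show ?thesis unfolding c_def using section_zero_exponent by simp
  qed (simp add: c_def)
  moreover have "trivialization m i W \<sigma> = (\<lambda>P\<in>W. jet N m (c P))"
  proof
    fix P
    show "trivialization m i W \<sigma> P = (\<lambda>P\<in>W. jet N m (c P)) P"
    proof (cases "P \<in> W")
      case True
      have "trivialization m i W \<sigma> P = jet N m (snd (F P) i P)"
        using F[OF True] by (intro trivialization_at[OF True, of "fst (F P)"]) auto
      also have "\<dots> = jet N m (c P)"
        by (rule jet_cong) (simp add: c_def True)
      finally show ?thesis using True by simp
    qed (simp add: trivialization_def)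
  qed
  ultimately show ?thesis
    unfolding tensor_carrier_iff[OF W(1)] by blast
qed

lemma linear_trivialization:
  assumes i: "i \<in> charts" and W: "openin T W" "W \<subseteq> fst i"
  shows "linear_map_on (R W) (sections (jet_sheaf m) W) (tensor_module R W (L_quot N m)) (trivialization m i W)"
  unfolding linear_map_on_def
proof (intro conjI ballI funcsetI)
  fix \<sigma> assume \<sigma>: "\<sigma> \<in> carrier (sections (jet_sheaf m) W)"
  then show "trivialization m i W \<sigma> \<in> carrier (tensor_module R W (L_quot N m))"
    by (rule trivialization_in_tensor[OF i W])
  {
    fix \<tau> assume \<tau>: "\<tau> \<in> carrier (sections (jet_sheaf m) W)"
    show "trivialization m i W (\<sigma> \<oplus>\<^bsub>sections (jet_sheaf m) W\<^esub> \<tau>)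
        = trivialization m i W \<sigma> \<oplus>\<^bsub>tensor_module R W (L_quot N m)\<^esub> trivialization m i W \<tau>"
    proof
      fix P
      show "trivialization m i W (\<sigma> \<oplus>\<^bsub>sections (jet_sheaf m) W\<^esub> \<tau>) P
        = (trivialization m i W \<sigma> \<oplus>\<^bsub>tensor_module R W (L_quot N m)\<^esub> trivialization m i W \<tau>) P"
      proof (cases "P \<in> W")
        case True
        obtain V s where V: "openin T V" "P \<in> V" "V \<subseteq> W" "s \<in> bundle_sections V" "\<And>Q. Q \<in> V \<Longrightarrow> \<sigma> Q = jet_germ m Q V s"
          using jet_sheaf_local[OF \<sigma> True] by blast
        obtain V' t where V': "openin T V'" "P \<in> V'" "V' \<subseteq> W" "t \<in> bundle_sections V'" "\<And>Q. Q \<in> V' \<Longrightarrow> \<tau> Q = jet_germ m Q V' t"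
          using jet_sheaf_local[OF \<tau> True] by blast
        have o: "openin T (V \<inter> V')" "P \<in> V \<inter> V'" using V V' by auto
        have u: "(\<lambda>i P q r. restrict_family (V \<inter> V') s i P q r + restrict_family (V \<inter> V') t i P q r) \<in> bundle_sections (V \<inter> V')"
          by (rule bundle_sections_add[OF restrict_family_section[OF V(4) o(1)] restrict_family_section[OF V'(4) o(1)]]) auto
        have "trivialization m i W (\<sigma> \<oplus>\<^bsub>sections (jet_sheaf m) W\<^esub> \<tau>) P = jet N m (\<lambda>q r. s i P q r + t i P q r)"
          using trivialization_at[where \<sigma> = "\<sigma> \<oplus>\<^bsub>sections (jet_sheaf m) W\<^esub> \<tau>", OF True o u
              jet_sheaf_add_at[where \<sigma> = \<sigma> and \<tau> = \<tau>, OF True V(1,2,4) V(5)[OF V(2)] V'(1,2,4) V'(5)[OF V'(2)]], of i]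
            V(2) V'(2) by (simp add: restrict_family_def)
        then show ?thesis
          using True trivialization_at[where \<sigma> = \<sigma>, OF True V(1,2,4) V(5)[OF V(2)], of i] trivialization_at[where \<sigma> = \<tau>, OF True V'(1,2,4) V'(5)[OF V'(2)], of i]
            jet_add[of N "s i P" "t i P" m] section_zero_exponent[OF V(4)] section_zero_exponent[OF V'(4)]
          by (simp add: tensor_module_def)
      qed (simp add: trivialization_def tensor_module_def)
    qed
  }
  fix a assume "a \<in> carrier (R W)"
  then have a: "reg W a" by (rule reg_carrier[OF W(1)])
  show "trivialization m i W (a \<odot>\<^bsub>sections (jet_sheaf m) W\<^esub> \<sigma>) = a \<odot>\<^bsub>tensor_module R W (L_quot N m)\<^esub> trivialization m i W \<sigma>"
  proof
    fix P
    show "trivialization m i W (a \<odot>\<^bsub>sections (jet_sheaf m) W\<^esub> \<sigma>) P = (a \<odot>\<^bsub>tensor_module R W (L_quot N m)\<^esub> trivialization m i W \<sigma>) P"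
    proof (cases "P \<in> W")
      case True
      obtain V s where V: "openin T V" "P \<in> V" "V \<subseteq> W" "s \<in> bundle_sections V" "\<And>Q. Q \<in> V \<Longrightarrow> \<sigma> Q = jet_germ m Q V s"
        using jet_sheaf_local[OF \<sigma> True] by blast
      have o: "openin T (V \<inter> W)" "P \<in> V \<inter> W" using V W True by auto
      have "reg (V \<inter> W) (restrict a (V \<inter> W))"
        using reg_subset[OF a o(1)] reg_cong[of "V \<inter> W" "restrict a (V \<inter> W)" a] by simp
      then have u: "(\<lambda>i P q r. restrict a (V \<inter> W) P * restrict_family (V \<inter> W) s i P q r) \<in> bundle_sections (V \<inter> W)"
        by (rule bundle_sections_smult[OF o(1) restrict_family_section[OF V(4) o(1)], rotated]) auto
      have "trivialization m i W (a \<odot>\<^bsub>sections (jet_sheaf m) W\<^esub> \<sigma>) P = jet N m (\<lambda>q r. a P * s i P q r)"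
        using trivialization_at[where \<sigma> = "a \<odot>\<^bsub>sections (jet_sheaf m) W\<^esub> \<sigma>", OF True o u
            jet_sheaf_smult_at[where \<sigma> = \<sigma>, OF W(1) a True V(1,2,4) V(5)[OF V(2)]], of i]
          V(2) True by (simp add: restrict_family_def)
      then show ?thesis
        using True trivialization_at[where \<sigma> = \<sigma>, OF True V(1,2,4) V(5)[OF V(2)], of i] jet_smult[where N = N and c = "s i P" and a = "a P" and k = m]
          section_zero_exponent[OF V(4)] by (simp add: tensor_module_def)
    qed (simp add: trivialization_def tensor_module_def)
  qed
qed

text \<open>Coefficients in one chart determine a section: the others are computed by the transition
  functions, and the cocycle condition says that they fit together.\<close>

definition extend_section :: "'a set \<times> (nat \<Rightarrow> 'a \<Rightarrow> 'b) \<Rightarrow> 'a set \<Rightarrow> ('a \<Rightarrow> nat \<Rightarrow> mono \<Rightarrow> 'b) \<Rightarrow> ('a, 'b) family" where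
  "extend_section i W c = (\<lambda>j P q r. if j \<in> charts \<and> P \<in> W \<inter> fst j then change i j P (c P) q r else 0)"

lemma extend_section_in:
  assumes i: "i \<in> charts" and W: "openin T W" "W \<subseteq> fst i" and c: "\<And>q r. reg W (\<lambda>P. c P q r)"
  shows "extend_section i W c \<in> bundle_sections W"
proof (rule bundle_sectionsI)
  show "extend_section i W c j P q r = 0" if "\<not> (j \<in> charts \<and> P \<in> W \<inter> fst j \<and> q < N \<and> r \<in> monomials N \<and> r \<noteq> 0)" for j P q r
  proof (cases "j \<in> charts \<and> P \<in> W \<inter> fst j")
    case True
    then have "r = 0 \<or> \<not> (q < N \<and> r \<in> monomials N)" using that by blast
    then have "change i j P (c P) q r = 0"
      using change_outside change_zero_exponent by blast
    then show ?thesis by (simp add: extend_section_def)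
  next
    case False
    then show ?thesis unfolding extend_section_def by (rule if_not_P)
  qed
  show "reg (W \<inter> fst j) (\<lambda>P. extend_section i W c j P q r)" if j: "j \<in> charts" for j q r
  proof -
    have o: "openin T (W \<inter> fst j)" using W(1) chart_open[OF j] by blast
    have "reg (W \<inter> fst j) (\<lambda>P. change i j P (c P) q r)"
      by (rule reg_change[OF i j o]) (use W(2) reg_subset[OF c o] in auto)
    then show ?thesis
      using j by (subst reg_cong[of _ _ "\<lambda>P. change i j P (c P) q r"]) (auto simp: extend_section_def)
  qed
  show "extend_section i W c l P q r = change j l P (extend_section i W c j P) q r"
    if "j \<in> charts" "l \<in> charts" "P \<in> W" "P \<in> fst j" "P \<in> fst l" for j l P q r
    using change_cocycle[OF i that(1,2) _ that(4,5)] that W(2) by (auto simp: extend_section_def)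
qed

lemma extend_section_same:
  assumes "i \<in> charts" "W \<subseteq> fst i" "P \<in> W" "q < N" "r \<in> monomials N" "r \<noteq> 0"
  shows "extend_section i W c i P q r = c P q r"
  using change_same[OF assms(1) _ assms(4-6)] assms by (auto simp: extend_section_def)

lemma global_section_in_jet_sheaf:
  assumes "openin T W" "s \<in> bundle_sections W"
  shows "(\<lambda>P\<in>W. jet_germ m P W s) \<in> carrier (sections (jet_sheaf m) W)"
  unfolding jet_sheaf_carrier using assms by auto

lemma trivialization_global_section:
  assumes "openin T W" "s \<in> bundle_sections W"
  shows "trivialization m i W (\<lambda>P\<in>W. jet_germ m P W s) = (\<lambda>P\<in>W. jet N m (s i P))"
proof
  fix P
  show "trivialization m i W (\<lambda>P\<in>W. jet_germ m P W s) P = (\<lambda>P\<in>W. jet N m (s i P)) P"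
    using trivialization_at[of P W W s "\<lambda>P\<in>W. jet_germ m P W s" m i] assms
    by (cases "P \<in> W") (simp_all add: trivialization_def)
qed

text \<open>Equal jets at all points of \<open>W\<close> in the chart \<open>i\<close> give equal coefficients up to order \<open>m\<close> in all charts, by the
  transition functions, hence equal germs.\<close>

lemma trivialization_inj:
  assumes i: "i \<in> charts" and W: "openin T W" "W \<subseteq> fst i"
  shows "inj_on (trivialization m i W) (carrier (sections (jet_sheaf m) W))"
proof (rule inj_onI)
  fix \<sigma> \<tau> assume \<sigma>: "\<sigma> \<in> carrier (sections (jet_sheaf m) W)" and \<tau>: "\<tau> \<in> carrier (sections (jet_sheaf m) W)"
    and eq: "trivialization m i W \<sigma> = trivialization m i W \<tau>"
  have "\<sigma> P = \<tau> P" if P: "P \<in> W" for P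
  proof -
    obtain V s where V: "openin T V" "P \<in> V" "V \<subseteq> W" "s \<in> bundle_sections V" "\<And>Q. Q \<in> V \<Longrightarrow> \<sigma> Q = jet_germ m Q V s"
      using jet_sheaf_local[OF \<sigma> P] by blast
    obtain V' t where V': "openin T V'" "P \<in> V'" "V' \<subseteq> W" "t \<in> bundle_sections V'" "\<And>Q. Q \<in> V' \<Longrightarrow> \<tau> Q = jet_germ m Q V' t"
      using jet_sheaf_local[OF \<tau> P] by blast
    have i_eq: "s i Q p l = t i Q p l" if Q: "Q \<in> V \<inter> V'" and p: "p < N" "l \<in> monomials N" "mdeg l \<le> m" for Q p l
    proof -
      have QW: "Q \<in> W" "Q \<in> V" "Q \<in> V'" using Q V(3) by auto
      have "jet N m (s i Q) = jet N m (t i Q)"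
        using fun_cong[OF eq, of Q] trivialization_at[where \<sigma> = \<sigma>, OF QW(1) V(1) QW(2) V(4) V(5)[OF QW(2)], of i]
          trivialization_at[where \<sigma> = \<tau>, OF QW(1) V'(1) QW(3) V'(4) V'(5)[OF QW(3)], of i] by simp
      then show ?thesis
        using jet_eq_iff[of N "s i Q" m "t i Q"] section_zero_exponent[OF V(4)] p by simp
    qed
    have "agree m (V \<inter> V') s t"
      unfolding agree_def
    proof (intro allI ballI impI)
      fix j Q q r assume Q: "Q \<in> V \<inter> V'" and r: "mdeg r \<le> m"
      show "s j Q q r = t j Q q r"
      proof (cases "j \<in> charts \<and> Q \<in> fst j")
        case True
        have "Q \<in> fst i" using Q V(3) W(2) by blast
        then have "s j Q q r = change i j Q (s i Q) q r" "t j Q q r = change i j Q (t i Q) q r"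
          using bundle_sections_change[OF V(4) i] bundle_sections_change[OF V'(4) i] True Q by auto
        moreover have "change i j Q (s i Q) q r = change i j Q (t i Q) q r"
          using i_eq[OF Q] r by (intro change_cong) auto
        ultimately show ?thesis by simp
      next
        case False
        then have "s j Q q r = 0" "t j Q q r = 0"
          using bundle_sections_0[OF V(4), of j Q q r] bundle_sections_0[OF V'(4), of j Q q r] by auto
        then show ?thesis by simp
      qed
    qed
    then have "jet_germ m P V s = jet_germ m P V' t"
      using V V' by (intro jet_germ_eqI[of V s V' t "V \<inter> V'"]) auto
    then show ?thesis using V(5)[OF V(2)] V'(5)[OF V'(2)] by simp
  qed
  moreover have "\<sigma> \<in> extensional W" "\<tau> \<in> extensional W"
    using \<sigma> \<tau> unfolding jet_sheaf_carrier by auto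
  ultimately show "\<sigma> = \<tau>" by (intro extensionalityI)
qed

lemma trivialization_bij:
  assumes i: "i \<in> charts" and W: "openin T W" "W \<subseteq> fst i"
  shows "bij_betw (trivialization m i W) (carrier (sections (jet_sheaf m) W)) (carrier (tensor_module R W (L_quot N m)))"
  unfolding bij_betw_def
proof (intro conjI trivialization_inj[OF assms] subset_antisym)
  show "trivialization m i W ` carrier (sections (jet_sheaf m) W) \<subseteq> carrier (tensor_module R W (L_quot N m))"
    using trivialization_in_tensor[OF assms] by blast
  show "carrier (tensor_module R W (L_quot N m)) \<subseteq> trivialization m i W ` carrier (sections (jet_sheaf m) W)"
  proof
    fix \<rho> assume "\<rho> \<in> carrier (tensor_module R W (L_quot N m))"
    then obtain c where c: "\<And>q r. reg W (\<lambda>P. c P q r)" "\<And>P q. c P q 0 = 0" "\<rho> = (\<lambda>P\<in>W. jet N m (c P))"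
      unfolding tensor_carrier_iff[OF W(1)] by blast
    have s: "extend_section i W c \<in> bundle_sections W" by (rule extend_section_in[OF assms c(1)])
    have "jet N m (extend_section i W c i P) = jet N m (c P)" if P: "P \<in> W" for P
    proof (subst jet_eq_iff)
      show "\<forall>q<N. \<forall>r\<in>monomials N. mdeg r \<le> m \<longrightarrow> extend_section i W c i P q r = c P q r"
      proof (intro allI ballI impI)
        fix q r assume "q < N" "r \<in> monomials N"
        then show "extend_section i W c i P q r = c P q r"
          using extend_section_same[OF i W(2) P, of q r c] c(2)[of P q] section_zero_exponent[OF s, of i P q]
          by (cases "r = 0") simp_all
      qed
    qed (simp add: section_zero_exponent[OF s])
    then have "trivialization m i W (\<lambda>P\<in>W. jet_germ m P W (extend_section i W c)) = \<rho>"
      unfolding trivialization_global_section[OF W(1) s] c(3) by (intro restrict_ext)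
    then show "\<rho> \<in> trivialization m i W ` carrier (sections (jet_sheaf m) W)"
      using imageI[OF global_section_in_jet_sheaf[OF W(1) s, of m], of "trivialization m i W"] by simp
  qed
qed

theorem topological_vector_bundle_jet_bundle:
  assumes cover: "\<And>P. P \<in> topspace T \<Longrightarrow> \<exists>i\<in>charts. P \<in> fst i"
  shows "topological_vector_bundle T R jet_bundle bundle_filtration charts fst
    (\<lambda>k _. L_quot N k) (\<lambda>k _. L_proj N k) trivialization"
  unfolding topological_vector_bundle_def
proof (intro conjI allI impI ballI)
  show "sheaf_of_modules T R jet_bundle" by (rule sheaf_bundle)
  show "subsheaf T R jet_bundle (bundle_filtration m)" for m by (rule subsheaf_filtration)
  show "bundle_filtration 0 W = carrier (sections jet_bundle W)" "bundle_filtration (Suc m) W \<subseteq> bundle_filtration m W"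
    "(\<Inter>m. bundle_filtration m W) = {\<zero>\<^bsub>sections jet_bundle W\<^esub>}" if "openin T W" for W m
    using that by (rule filtration_properties)+
  show "affine_open T R (fst i)" if "i \<in> charts" for i
    using that by (auto simp: charts_iff etale_chart_def)
  show "(\<Union>i\<in>charts. fst i) = topspace T"
    using cover openin_subset[OF chart_open] by blast
  show "module ring_of_type_algebra (L_quot N m :: ('b, _) module)" for m by (rule module_L_quot)
  show "linear_map_on ring_of_type_algebra (L_quot N (Suc m) :: ('b, _) module) (L_quot N m) (L_proj N m)" for m
    by (rule linear_L_proj)
next
  fix m i W assume i: "i \<in> charts" and "openin T W \<and> W \<subseteq> fst i"
  then have W: "openin T W" "W \<subseteq> fst i" by auto
  show "linear_map_on (R W) (sections (jet_sheaf m) W) (tensor_module R W (L_quot N m)) (trivialization m i W)"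
    by (rule linear_trivialization[OF i W])
  show "bij_betw (trivialization m i W) (carrier (sections (jet_sheaf m) W)) (carrier (tensor_module R W (L_quot N m)))"
    by (rule trivialization_bij[OF i W])
  show "trivialization m i W' (res (jet_sheaf m) W W' \<sigma>) = restrict (trivialization m i W \<sigma>) W'"
    if "openin T W' \<and> W' \<subseteq> W" for W' \<sigma>
    using that by (auto simp: trivialization_def quotient_sheaf_def sheafify_def restrict_def fun_eq_iff subset_iff)
  show "trivialization m i W (quotient_projection T jet_bundle (bundle_filtration m) W \<sigma>)
      = (\<lambda>P\<in>W. L_proj N m (trivialization (Suc m) i W \<sigma> P))"
    if \<sigma>: "\<sigma> \<in> carrier (sections (jet_sheaf (Suc m)) W)" for \<sigma>
  proof
    fix P
    show "trivialization m i W (quotient_projection T jet_bundle (bundle_filtration m) W \<sigma>) P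
      = (\<lambda>P\<in>W. L_proj N m (trivialization (Suc m) i W \<sigma> P)) P"
    proof (cases "P \<in> W")
      case True
      obtain V s where V: "openin T V" "P \<in> V" "V \<subseteq> W" "s \<in> bundle_sections V" "\<And>Q. Q \<in> V \<Longrightarrow> \<sigma> Q = jet_germ (Suc m) Q V s"
        using jet_sheaf_local[OF \<sigma> True] by blast
      show ?thesis
        using True trivialization_at[where \<sigma> = "quotient_projection T jet_bundle (bundle_filtration m) W \<sigma>", OF True V(1,2,4)
              quotient_projection_at[where \<sigma> = \<sigma>, OF True V(1,2,4) V(5)[OF V(2)]], of i]
          trivialization_at[where \<sigma> = \<sigma>, OF True V(1,2,4) V(5)[OF V(2)], of i] jet_L_proj[of N "s i P" m] section_zero_exponent[OF V(4)]
        by simp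
    qed (simp add: trivialization_def)
  qed
qed

lemma change_monomial_field:
  assumes i: "i \<in> charts" and j: "j \<in> charts" and P: "P \<in> fst i \<inter> fst j"
    and m: "m \<in> monomials N" "m \<noteq> 0" and p: "p < N" and q: "q < N" and r: "r \<in> monomials N"
  shows "change i j P (monomial_field m p P') q r = transition_field R N (fst i \<inter> fst j) (snd i) (snd j) m p P q r"
proof -
  let ?W = "fst i \<inter> fst j" and ?M = "{l \<in> monomials N. 0 < mdeg l \<and> mdeg l \<le> mdeg r}"
  let ?t = "\<lambda>l p. transition_field R N ?W (snd i) (snd j) l p P q r"
  obtain Di Dj where F: "frame (fst i) (snd i) Di" "frame (fst j) (snd j) Dj"
    using i j chart_frame by metis
  have o: "openin T ?W" using F frame_open by blast
  have FW: "frame ?W (snd i) Di" "frame ?W (snd j) Dj"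
    using frame_subset[OF F(1) o] frame_subset[OF F(2) o] by auto
  have "change i j P (monomial_field m p P') q r = (\<Sum>p'<N. \<Sum>l\<in>?M. if l = m then (if p' = p then ?t l p' else 0) else 0)"
    using q r unfolding change_def transfer_def by (simp, intro sum.cong refl) (auto simp: monomial_field_def)
  also have "\<dots> = (\<Sum>p'<N. if p' = p then (if m \<in> ?M then ?t m p' else 0) else 0)"
    using finite_positive_monomials[of "mdeg r"] by (intro sum.cong refl) simp
  also have "\<dots> = (if m \<in> ?M then ?t m p else 0)" using p by simp
  also have "\<dots> = ?t m p"
    using transition_field_order[OF FW P m(1) _ p q, of r] m by (auto simp: not_le)
  finally show ?thesis .
qed

text \<open>The constant coefficients of \<open>X\<^sup>m \<partial>/\<partial>X\<^sub>p\<close> in the first chart belong to a section, which by definition of the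
  bundle has the coefficients \<open>transition_field\<close> in the second.\<close>

theorem transition_jet_bundle:
  assumes i: "i \<in> charts" and j: "j \<in> charts" and m: "m \<in> monomials N - {0}" and p: "p < N"
  shows "transition T jet_bundle bundle_filtration trivialization i j (fst i \<inter> fst j)
      (formal_field N (fst i \<inter> fst j) (monomial_field m p))
    = formal_field N (fst i \<inter> fst j) (transition_field R N (fst i \<inter> fst j) (snd i) (snd j) m p)"
proof
  fix k
  let ?W = "fst i \<inter> fst j"
  have m': "m \<in> monomials N" "m \<noteq> 0" using m by auto
  have W: "openin T ?W" using chart_open i j by blast
  have Wi: "?W \<subseteq> fst i" by blast
  define s where "s = extend_section i ?W (monomial_field m p)"
  define \<tau> where "\<tau> = (\<lambda>P\<in>?W. jet_germ k P ?W s)"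
  have "reg ?W (\<lambda>P. monomial_field m p P q r)" for q r
    unfolding monomial_field_def by (rule reg_const[OF W])
  then have s: "s \<in> bundle_sections ?W"
    unfolding s_def by (rule extend_section_in[OF i W Wi])
  have \<tau>: "\<tau> \<in> carrier (sections (jet_sheaf k) ?W)"
    unfolding \<tau>_def by (rule global_section_in_jet_sheaf[OF W s])
  have "trivialization k i ?W \<tau> = (\<lambda>P\<in>?W. jet N k (s i P))"
    unfolding \<tau>_def by (rule trivialization_global_section[OF W s])
  also have "\<dots> = (\<lambda>P\<in>?W. jet N k (monomial_field m p P))"
  proof (rule restrict_ext)
    fix P assume P: "P \<in> ?W"
    show "jet N k (s i P) = jet N k (monomial_field m p P)"
    proof (subst jet_eq_iff)
      show "\<forall>q<N. \<forall>r\<in>monomials N. mdeg r \<le> k \<longrightarrow> s i P q r = monomial_field m p P q r"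
      proof (intro allI impI ballI)
        fix q r assume "q < N" "r \<in> monomials N"
        then show "s i P q r = monomial_field m p P q r"
          using extend_section_same[OF i Wi P, of q r "monomial_field m p"] section_zero_exponent[OF s, of i P q] m'(2)
          by (cases "r = 0") (auto simp: s_def monomial_field_def)
      qed
    qed (simp add: section_zero_exponent[OF s])
  qed
  also have "\<dots> = formal_field N ?W (monomial_field m p) k"
    by (rule formal_field_eq_jet[symmetric]) (use m'(2) in \<open>auto simp: monomial_field_def\<close>)
  finally have "inv_into (carrier (sections (jet_sheaf k) ?W)) (trivialization k i ?W) (formal_field N ?W (monomial_field m p) k) = \<tau>"
    using inv_into_f_f[OF trivialization_inj[OF i W Wi] \<tau>] by simp
  then have "transition T jet_bundle bundle_filtration trivialization i j ?W (formal_field N ?W (monomial_field m p)) k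
      = trivialization k j ?W \<tau>"
    by (simp add: transition_def)
  also have "\<dots> = (\<lambda>P\<in>?W. jet N k (s j P))"
    unfolding \<tau>_def by (rule trivialization_global_section[OF W s])
  also have "\<dots> = (\<lambda>P\<in>?W. jet N k (transition_field R N ?W (snd i) (snd j) m p P))"
  proof (rule restrict_ext)
    fix P assume P: "P \<in> ?W"
    show "jet N k (s j P) = jet N k (transition_field R N ?W (snd i) (snd j) m p P)"
    proof (subst jet_eq_iff)
      show "\<forall>q<N. \<forall>r\<in>monomials N. mdeg r \<le> k \<longrightarrow> s j P q r = transition_field R N ?W (snd i) (snd j) m p P q r"
      proof (intro allI ballI impI)
        fix q r assume "q < N" "r \<in> monomials N"
        then show "s j P q r = transition_field R N ?W (snd i) (snd j) m p P q r"
          using change_monomial_field[OF i j P m' p, of q r P] P j by (simp add: s_def extend_section_def)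
      qed
    qed (simp add: section_zero_exponent[OF s])
  qed
  also have "\<dots> = formal_field N ?W (transition_field R N ?W (snd i) (snd j) m p) k"
  proof (rule formal_field_eq_jet[symmetric])
    fix P q assume P: "P \<in> ?W" and q: "q < N"
    show "transition_field R N ?W (snd i) (snd j) m p P q 0 = 0"
      using change_monomial_field[OF i j P m' p q monomials_zero, of P] change_zero_exponent by simp
  qed
  finally show "transition T jet_bundle bundle_filtration trivialization i j ?W (formal_field N ?W (monomial_field m p)) k
      = formal_field N ?W (transition_field R N ?W (snd i) (snd j) m p) k" .
qed

end

section \<open>Quasi-projective varieties\<close>

lemma proj_point_scalings:
  assumes "Q \<in> proj_space n" "v \<in> Q"
  shows "Q = {\<lambda>j. c * v j | c. c \<noteq> 0}" "v \<noteq> (\<lambda>_. 0)" "\<And>j. j > n \<Longrightarrow> v j = 0"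
proof -
  obtain u where u: "u \<noteq> (\<lambda>_. 0)" "\<forall>j>n. u j = 0" "Q = {\<lambda>j. c * u j | c. c \<noteq> 0}"
    using assms(1) by (auto simp: proj_space_def)
  then obtain c where c: "c \<noteq> 0" "v = (\<lambda>j. c * u j)" using assms(2) by auto
  show "v \<noteq> (\<lambda>_. 0)" "\<And>j. j > n \<Longrightarrow> v j = 0"
    using c u by (auto simp: fun_eq_iff)
  show "Q = {\<lambda>j. c * v j | c. c \<noteq> 0}"
  proof (intro subset_antisym subsetI)
    fix x assume "x \<in> Q"
    then obtain b where "b \<noteq> 0" "x = (\<lambda>j. b * u j)" using u(3) by auto
    then have "x = (\<lambda>j. (b / c) * v j)" "b / c \<noteq> 0" using c by (auto simp: fun_eq_iff)
    then show "x \<in> {\<lambda>j. c * v j | c. c \<noteq> 0}" by blast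
  next
    fix x assume "x \<in> {\<lambda>j. c * v j | c. c \<noteq> 0}"
    then obtain b where "b \<noteq> 0" "x = (\<lambda>j. b * v j)" by auto
    then have "x = (\<lambda>j. (b * c) * u j)" "b * c \<noteq> 0" using c by (auto simp: fun_eq_iff)
    then show "x \<in> Q" unfolding u(3) by blast
  qed
qed

lemma proj_point_of_vector:
  assumes "v \<noteq> (\<lambda>_. 0)" "\<forall>j>n. v j = 0"
  shows "{\<lambda>j. c * v j | c. c \<noteq> 0} \<in> proj_space n" "v \<in> {\<lambda>j. c * v j | c. c \<noteq> (0::'k::field)}"
proof -
  show "{\<lambda>j. c * v j | c. c \<noteq> 0} \<in> proj_space n" using assms by (auto simp: proj_space_def)
  have "v = (\<lambda>j. 1 * v j)" by simp
  then show "v \<in> {\<lambda>j. c * v j | c. c \<noteq> 0}" using one_neq_zero by blast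
qed

lemma proj_point_nonempty: "Q \<in> proj_space n \<Longrightarrow> \<exists>v. v \<in> (Q :: 'k::field ppoint)"
  using proj_point_of_vector(2) by (auto simp: proj_space_def)

lemma homogeneous_in_polys: "homogeneous n d f \<Longrightarrow> f \<in> polys (Suc n)"
  by (simp add: homogeneous_def)

lemma homogeneous_const: "homogeneous n 0 (pconst c)"
  by (auto simp: homogeneous_def pconst_def polys_def split: if_splits)

lemma homogeneous_var: "i \<le> n \<Longrightarrow> homogeneous n 1 (pvar i)"
  by (auto simp: homogeneous_def pvar_def polys_def)

lemma homogeneous_add:
  assumes "homogeneous n d f" "homogeneous n d g"
  shows "homogeneous n d (f + g)"
  using assms keys_add[of f g] by (auto simp: homogeneous_def polys_add)

lemma homogeneous_power:
  assumes "homogeneous n d f"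
  shows "homogeneous n (k * d) (f ^ k)"
  by (induction k) (use homogeneous_one homogeneous_mult[OF assms] in auto)

lemma open_nonzero_locus:
  assumes "X \<subseteq> proj_space n" "homogeneous n d F"
  shows "openin (zariski n X) {Q \<in> X. \<forall>v\<in>Q. peval F v \<noteq> 0}"
proof -
  have "openin (proj_zariski n) (proj_space n - proj_zeros n {F})"
    unfolding openin_proj_zariski by (intro exI[of _ "{F}"]) (use assms(2) in auto)
  moreover have "{Q \<in> X. \<forall>v\<in>Q. peval F v \<noteq> 0} = (proj_space n - proj_zeros n {F}) \<inter> X"
  proof -
    have "(\<forall>v\<in>Q. peval F v \<noteq> 0) \<longleftrightarrow> \<not> (\<forall>v\<in>Q. peval F v = 0)" if Q: "Q \<in> proj_space n" for Q
      using peval_zero_on_ppoint[OF assms(2) Q] proj_point_nonempty[OF Q] by blast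
    then show ?thesis using assms(1) proj_point_nonempty[of "{}" n] by (auto simp: proj_zeros_def)
  qed
  ultimately show ?thesis by (auto simp: openin_subtopology)
qed

text \<open>Fractions \<open>g/h\<close> of forms of the same degree are closed under sums and products, the inverse of \<open>g/h\<close> is \<open>h/g\<close>,
  and \<open>g/h\<close> vanishes where \<open>g\<close> does.\<close>

lemma function_space_regular_functions:
  fixes X :: "'k::field_char_0 ppoint set"
  assumes X: "X \<subseteq> proj_space n" and irr: "irreducible_space (zariski n X)"
  shows "function_space (zariski n X) (regular_functions n X)"
proof
  let ?T = "zariski n X" and ?A = "regular_functions n X"
  have top: "topspace ?T = X"
  proof -
    have "homogeneous n 0 1" by (rule homogeneous_one)
    then have "openin ?T {Q \<in> X. \<forall>v\<in>Q. peval 1 v \<noteq> (0::'k)}" by (rule open_nonzero_locus[OF X])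
    then have "X \<subseteq> topspace ?T" using openin_subset by fastforce
    then show ?thesis by auto
  qed
  have local_fraction: "\<exists>V g h d. openin ?T V \<and> P \<in> V \<and> V \<subseteq> U \<and> homogeneous n d g \<and> homogeneous n d h \<and>
     (\<forall>Q\<in>V. \<forall>v\<in>Q. peval h v \<noteq> 0 \<and> f Q = peval g v / peval h v)" if "f \<in> ?A U" "P \<in> U" for f U P
    using that by (simp add: regular_functions_def)
  have regularI: "restrict f U \<in> ?A U"
    if loc: "\<And>P. P \<in> U \<Longrightarrow> \<exists>V g h d. openin ?T V \<and> P \<in> V \<and> V \<subseteq> U \<and> homogeneous n d g \<and> homogeneous n d h \<and>
     (\<forall>Q\<in>V. \<forall>v\<in>Q. peval h v \<noteq> 0 \<and> f Q = peval g v / peval h v)" for f U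
    unfolding regular_functions_def mem_Collect_eq
  proof (intro conjI ballI)
    fix P assume P: "P \<in> U"
    obtain V g h d where "openin ?T V" "P \<in> V" "V \<subseteq> U" "homogeneous n d g" "homogeneous n d h"
     "\<forall>Q\<in>V. \<forall>v\<in>Q. peval h v \<noteq> 0 \<and> f Q = peval g v / peval h v"
      using loc[OF P] by (elim exE conjE) (rule that)
    then show "\<exists>V g h d. openin ?T V \<and> P \<in> V \<and> V \<subseteq> U \<and> homogeneous n d g \<and> homogeneous n d h \<and>
     (\<forall>Q\<in>V. \<forall>v\<in>Q. peval h v \<noteq> 0 \<and> restrict f U Q = peval g v / peval h v)"
      by (intro exI[of _ V] exI[of _ g] exI[of _ h] exI[of _ d]) auto
  qed simp
  fix U assume U: "openin ?T U"
  show "f \<in> extensional U" if "f \<in> ?A U" for f using that by (simp add: regular_functions_def)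
  show "restrict (\<lambda>_. c) U \<in> ?A U" for c
    by (rule regularI) (use U homogeneous_const homogeneous_one in
      \<open>intro exI[of _ U] exI[of _ "pconst c"] exI[of _ 1] exI[of _ 0], auto\<close>)
  {
    fix f g assume f: "f \<in> ?A U" and g: "g \<in> ?A U"
    have two: "\<exists>V a b d a' b' d'. openin ?T V \<and> P \<in> V \<and> V \<subseteq> U \<and> homogeneous n d a \<and> homogeneous n d b \<and>
        homogeneous n d' a' \<and> homogeneous n d' b' \<and> (\<forall>Q\<in>V. \<forall>v\<in>Q. peval b v \<noteq> 0 \<and> f Q = peval a v / peval b v \<and>
        peval b' v \<noteq> 0 \<and> g Q = peval a' v / peval b' v)" if P: "P \<in> U" for P
    proof -
      obtain V a b d where 1: "openin ?T V" "P \<in> V" "V \<subseteq> U" "homogeneous n d a" "homogeneous n d b"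
          "\<forall>Q\<in>V. \<forall>v\<in>Q. peval b v \<noteq> 0 \<and> f Q = peval a v / peval b v"
        using local_fraction[OF f P] by (elim exE conjE) (rule that)
      obtain V' a' b' d' where 2: "openin ?T V'" "P \<in> V'" "V' \<subseteq> U" "homogeneous n d' a'" "homogeneous n d' b'"
          "\<forall>Q\<in>V'. \<forall>v\<in>Q. peval b' v \<noteq> 0 \<and> g Q = peval a' v / peval b' v"
        using local_fraction[OF g P] by (elim exE conjE) (rule that)
      show ?thesis
        by (rule exI[of _ "V \<inter> V'"], rule exI[of _ a], rule exI[of _ b], rule exI[of _ d], rule exI[of _ a'],
            rule exI[of _ b'], rule exI[of _ d']) (use 1 2 in auto)
    qed
    show "restrict (\<lambda>P. f P + g P) U \<in> ?A U"
    proof (rule regularI)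
      fix P assume P: "P \<in> U"
      obtain V a b d a' b' d' where *: "openin ?T V" "P \<in> V" "V \<subseteq> U" "homogeneous n d a" "homogeneous n d b"
        "homogeneous n d' a'" "homogeneous n d' b'" "\<forall>Q\<in>V. \<forall>v\<in>Q. peval b v \<noteq> 0 \<and> f Q = peval a v / peval b v \<and>
        peval b' v \<noteq> 0 \<and> g Q = peval a' v / peval b' v" using two[OF P] by (elim exE conjE) (rule that)
      have "homogeneous n (d + d') (a * b' + a' * b)" "homogeneous n (d + d') (b * b')"
        using homogeneous_mult[OF *(4,7)] homogeneous_mult[OF *(6,5)] homogeneous_mult[OF *(5,7)]
        by (simp_all add: homogeneous_add add.commute)
      then show "\<exists>V g' h d. openin ?T V \<and> P \<in> V \<and> V \<subseteq> U \<and> homogeneous n d g' \<and> homogeneous n d h \<and>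
        (\<forall>Q\<in>V. \<forall>v\<in>Q. peval h v \<noteq> 0 \<and> f Q + g Q = peval g' v / peval h v)"
        using *(1-3,8) by (intro exI[of _ V] exI[of _ "a * b' + a' * b"] exI[of _ "b * b'"] exI[of _ "d + d'"])
          (simp add: peval_add peval_mult add_frac_eq)
    qed
    show "restrict (\<lambda>P. f P * g P) U \<in> ?A U"
    proof (rule regularI)
      fix P assume P: "P \<in> U"
      obtain V a b d a' b' d' where *: "openin ?T V" "P \<in> V" "V \<subseteq> U" "homogeneous n d a" "homogeneous n d b"
        "homogeneous n d' a'" "homogeneous n d' b'" "\<forall>Q\<in>V. \<forall>v\<in>Q. peval b v \<noteq> 0 \<and> f Q = peval a v / peval b v \<and>
        peval b' v \<noteq> 0 \<and> g Q = peval a' v / peval b' v" using two[OF P] by (elim exE conjE) (rule that)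
      then show "\<exists>V g' h d. openin ?T V \<and> P \<in> V \<and> V \<subseteq> U \<and> homogeneous n d g' \<and> homogeneous n d h \<and>
        (\<forall>Q\<in>V. \<forall>v\<in>Q. peval h v \<noteq> 0 \<and> f Q * g Q = peval g' v / peval h v)"
        using homogeneous_mult[OF *(4,6)] homogeneous_mult[OF *(5,7)]
        by (intro exI[of _ V] exI[of _ "a * a'"] exI[of _ "b * b'"] exI[of _ "d + d'"]) (simp add: peval_mult)
    qed
  }
  fix f assume f: "f \<in> ?A U"
  show "restrict (\<lambda>P. inverse (f P)) U \<in> ?A U" if nz: "\<forall>P\<in>U. f P \<noteq> 0"
  proof (rule regularI)
    fix P assume PU: "P \<in> U"
    obtain V a b d where *: "openin ?T V" "P \<in> V" "V \<subseteq> U" "homogeneous n d a" "homogeneous n d b"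
          "\<forall>Q\<in>V. \<forall>v\<in>Q. peval b v \<noteq> 0 \<and> f Q = peval a v / peval b v"
      using local_fraction[OF f PU] by (elim exE conjE) (rule that)
    have "peval a v \<noteq> 0 \<and> inverse (f Q) = peval b v / peval a v" if Q: "Q \<in> V" "v \<in> Q" for Q v
    proof -
      have "f Q = peval a v / peval b v" using *(6) Q by blast
      moreover have "f Q \<noteq> 0" using nz *(3) Q(1) by blast
      ultimately show ?thesis by auto
    qed
    then show "\<exists>V g h d. openin ?T V \<and> P \<in> V \<and> V \<subseteq> U \<and> homogeneous n d g \<and> homogeneous n d h \<and>
        (\<forall>Q\<in>V. \<forall>v\<in>Q. peval h v \<noteq> 0 \<and> inverse (f Q) = peval g v / peval h v)"
      using *(1-5) by (intro exI[of _ V] exI[of _ b] exI[of _ a] exI[of _ d]) simp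
  qed
  show "restrict f V \<in> ?A V" if V: "openin ?T V" "V \<subseteq> U" for V
  proof (rule regularI)
    fix P assume P: "P \<in> V"
    then have PU: "P \<in> U" using V by blast
    obtain V' a b d where *: "openin ?T V'" "P \<in> V'" "V' \<subseteq> U" "homogeneous n d a" "homogeneous n d b"
          "\<forall>Q\<in>V'. \<forall>v\<in>Q. peval b v \<noteq> 0 \<and> f Q = peval a v / peval b v"
      using local_fraction[OF f PU] by (elim exE conjE) (rule that)
    then show "\<exists>V' g h d. openin ?T V' \<and> P \<in> V' \<and> V' \<subseteq> V \<and> homogeneous n d g \<and> homogeneous n d h \<and>
        (\<forall>Q\<in>V'. \<forall>v\<in>Q. peval h v \<noteq> 0 \<and> f Q = peval g v / peval h v)"
      using V(1) P by (intro exI[of _ "V' \<inter> V"] exI[of _ a] exI[of _ b] exI[of _ d]) auto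
  qed
  show "openin ?T {P \<in> U. f P \<noteq> 0}"
  proof (subst openin_subopen, intro ballI)
    fix P assume P: "P \<in> {P \<in> U. f P \<noteq> 0}"
    then have PU: "P \<in> U" by blast
    obtain V a b d where *: "openin ?T V" "P \<in> V" "V \<subseteq> U" "homogeneous n d a" "homogeneous n d b"
          "\<forall>Q\<in>V. \<forall>v\<in>Q. peval b v \<noteq> 0 \<and> f Q = peval a v / peval b v"
      using local_fraction[OF f PU] by (elim exE conjE) (rule that)
    let ?O = "V \<inter> {Q \<in> X. \<forall>v\<in>Q. peval a v \<noteq> 0}"
    have "openin ?T ?O" using *(1) open_nonzero_locus[OF X *(4)] by blast
    moreover have "P \<in> ?O" using * P openin_subset[OF U] top by auto
    moreover have "?O \<subseteq> {P \<in> U. f P \<noteq> 0}"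
    proof
      fix Q assume Q: "Q \<in> ?O"
      obtain v where "v \<in> Q" using proj_point_nonempty[of Q n] Q X by blast
      then show "Q \<in> {P \<in> U. f P \<noteq> 0}" using Q *(3,6) by auto
    qed
    ultimately show "\<exists>S. openin ?T S \<and> P \<in> S \<and> S \<subseteq> {P \<in> U. f P \<noteq> 0}" by blast
  qed
next
  fix U f
  assume U: "openin (zariski n X) U" and f: "f \<in> extensional U" and
    loc: "\<forall>P\<in>U. \<exists>V. openin (zariski n X) V \<and> P \<in> V \<and> V \<subseteq> U \<and> restrict f V \<in> regular_functions n X V"
  show "f \<in> regular_functions n X U"
    unfolding regular_functions_def mem_Collect_eq
  proof (intro conjI ballI f)
    fix P assume "P \<in> U"
    then obtain V where V: "P \<in> V" "V \<subseteq> U" "restrict f V \<in> regular_functions n X V"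
      using loc by blast
    have "\<exists>V' g h d. openin (zariski n X) V' \<and> P \<in> V' \<and> V' \<subseteq> V \<and> homogeneous n d g \<and> homogeneous n d h \<and>
     (\<forall>Q\<in>V'. \<forall>v\<in>Q. peval h v \<noteq> 0 \<and> restrict f V Q = peval g v / peval h v)"
      using V(1,3) by (simp add: regular_functions_def)
    then obtain V' g h d where *: "openin (zariski n X) V'" "P \<in> V'" "V' \<subseteq> V" "homogeneous n d g" "homogeneous n d h"
       "\<forall>Q\<in>V'. \<forall>v\<in>Q. peval h v \<noteq> 0 \<and> restrict f V Q = peval g v / peval h v"
      by (elim exE conjE) (rule that)
    then show "\<exists>V g h d. openin (zariski n X) V \<and> P \<in> V \<and> V \<subseteq> U \<and> homogeneous n d g \<and> homogeneous n d h \<and>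
     (\<forall>Q\<in>V. \<forall>v\<in>Q. peval h v \<noteq> 0 \<and> f Q = peval g v / peval h v)"
      using V(2) by (intro exI[of _ V'] exI[of _ g] exI[of _ h] exI[of _ d]) (auto simp: subset_iff)
  qed
next
  fix U V assume U: "openin (zariski n X) U" "U \<noteq> {}" and V: "openin (zariski n X) V" "V \<noteq> {}"
  let ?t = "topspace (zariski n X)"
  show "U \<inter> V \<noteq> {}"
  proof
    assume "U \<inter> V = {}"
    then have "?t = (?t - U) \<union> (?t - V)" using openin_subset U V by blast
    then have "?t - U = ?t \<or> ?t - V = ?t"
      using irr U V unfolding irreducible_space_def by (metis closedin_diff closedin_topspace)
    then show False using U V openin_subset by blast
  qed
qed

subsection \<open>Affine neighbourhoods\<close>

text \<open>The part of the set of zeros of \<open>S\<close> where \<open>G = F X\<^sub>i\<close> does not vanish embeds into affine space by the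
  functions \<open>X\<^sub>j/X\<^sub>i\<close> and \<open>X\<^sub>i\<^sup>e/G\<close>, where \<open>e\<close> is the degree of \<open>G\<close>.  Points are represented by their vectors with
  \<open>X\<^sub>i = 1\<close>.\<close>

locale principal_open =
  fixes n d i :: nat and F :: "'k::field_char_0 mpoly" and S :: "'k mpoly set" and X :: "'k ppoint set"
  assumes F: "homogeneous n d F" and i: "i \<le> n" and S: "\<And>g. g \<in> S \<Longrightarrow> \<exists>c. homogeneous n c g"
    and X: "X \<subseteq> proj_space n"
    and piece: "\<And>Q. Q \<in> proj_space n \<Longrightarrow> \<forall>v\<in>Q. peval F v \<noteq> 0 \<Longrightarrow> Q \<in> X \<longleftrightarrow> Q \<in> proj_zeros n S"
begin

definition "G = F * pvar i"

definition "V = {Q \<in> X. \<forall>v\<in>Q. peval G v \<noteq> 0}"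

definition normal :: "'k ppoint \<Rightarrow> nat \<Rightarrow> 'k" where
  "normal Q = (SOME v. v \<in> Q \<and> v i = 1)"

definition embed :: "'k ppoint \<Rightarrow> nat \<Rightarrow> 'k" where
  "embed Q = (\<lambda>j\<in>{..<Suc (Suc n)}. if j \<le> n then normal Q j else 1 / peval G (normal Q))"

definition Z :: "(nat \<Rightarrow> 'k) set" where
  "Z = affine_zeros (Suc (Suc n)) (insert (pvar i - 1) (insert (pvar (Suc n) * G - 1) S))"

lemma G: "homogeneous n (Suc d) G"
  unfolding G_def using homogeneous_mult[OF F homogeneous_var[OF i]] by simp

lemma peval_G: "peval G v = peval F v * v i"
  by (simp add: G_def peval_mult)

lemma V_proj: "Q \<in> V \<Longrightarrow> Q \<in> proj_space n"
  using X by (auto simp: V_def)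

lemma normal: assumes "Q \<in> V" shows "normal Q \<in> Q" "normal Q i = 1" "peval G (normal Q) \<noteq> 0"
proof -
  obtain v where v: "v \<in> Q" using proj_point_nonempty[OF V_proj[OF assms]] by blast
  then have "v i \<noteq> 0" using assms by (auto simp: V_def peval_G)
  then have "(\<lambda>j. inverse (v i) * v j) \<in> Q \<and> (\<lambda>j. inverse (v i) * v j) i = 1"
    using proj_point_scalings(1)[OF V_proj[OF assms] v] by auto
  then have n: "normal Q \<in> Q \<and> normal Q i = 1"
    unfolding normal_def
    by (rule someI[where P = "\<lambda>v. v \<in> Q \<and> v i = 1" and x = "\<lambda>j. inverse (v i) * v j"])
  then show "normal Q \<in> Q" "normal Q i = 1" by auto
  show "peval G (normal Q) \<noteq> 0" using n assms by (auto simp: V_def)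
qed

lemma peval_embed_homogeneous: "h \<in> polys (Suc n) \<Longrightarrow> peval h (embed Q) = peval h (normal Q)"
  by (rule peval_cong) (auto simp: embed_def)

lemma embed_inj: "inj_on embed V"
proof (rule inj_onI)
  fix Q Q' assume Q: "Q \<in> V" and Q': "Q' \<in> V" and eq: "embed Q = embed Q'"
  have "normal Q j = normal Q' j" for j
  proof (cases "j \<le> n")
    case True
    then show ?thesis using fun_cong[OF eq, of j] by (simp add: embed_def)
  next
    case False
    then show ?thesis using proj_point_scalings(3)[OF V_proj normal(1)] Q Q' by simp
  qed
  then have "normal Q = normal Q'" by auto
  then show "Q = Q'"
    using proj_point_scalings(1)[OF V_proj[OF Q] normal(1)[OF Q]] proj_point_scalings(1)[OF V_proj[OF Q'] normal(1)[OF Q']] by simp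
qed

lemma embed_image: "embed ` V = Z"
proof (intro subset_antisym subsetI)
  fix a assume "a \<in> embed ` V"
  then obtain Q where Q: "Q \<in> V" "a = embed Q" by blast
  have "peval g (embed Q) = 0" if g: "g \<in> S" for g
  proof -
    obtain c where c: "homogeneous n c g" using S[OF g] by blast
    have "Q \<in> proj_zeros n S"
      using Q(1) piece[OF V_proj[OF Q(1)]] by (auto simp: V_def peval_G)
    then have "peval g (normal Q) = 0" using g normal(1)[OF Q(1)] by (auto simp: proj_zeros_def)
    then show ?thesis using peval_embed_homogeneous[OF homogeneous_in_polys[OF c]] by simp
  qed
  moreover have "peval (pvar i - 1) (embed Q) = 0"
    using i normal(2)[OF Q(1)] by (simp add: peval_diff embed_def)
  moreover have "peval (pvar (Suc n) * G - 1) (embed Q) = 0"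
    using peval_embed_homogeneous[OF homogeneous_in_polys[OF G]] normal(3)[OF Q(1)]
    by (simp add: peval_diff peval_mult embed_def)
  moreover have "embed Q \<in> affine_space (Suc (Suc n))"
    by (simp add: embed_def affine_space_def)
  ultimately show "a \<in> Z" using Q(2) by (simp add: Z_def affine_zeros_def)
next
  fix a assume a: "a \<in> Z"
  then have as: "a \<in> affine_space (Suc (Suc n))" and ai: "a i = 1" and aG: "a (Suc n) * peval G a = 1"
      and ag: "\<And>g. g \<in> S \<Longrightarrow> peval g a = 0"
    by (auto simp: Z_def affine_zeros_def peval_diff peval_mult)
  define v where "v = (\<lambda>j. if j \<le> n then a j else 0)"
  have pv: "peval h v = peval h a" if "h \<in> polys (Suc n)" for h
    using that by (rule peval_cong) (simp add: v_def)
  have vi: "v i = 1" using i ai by (simp add: v_def)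
  then have v: "v \<noteq> (\<lambda>_. 0)" by auto
  have v0: "\<forall>j>n. v j = 0" by (simp add: v_def)
  define Q where "Q = {\<lambda>j. c * v j | c. c \<noteq> 0}"
  have Q: "Q \<in> proj_space n" "v \<in> Q" unfolding Q_def using proj_point_of_vector[OF v v0] by auto
  have Gv: "peval G v \<noteq> 0" using aG pv[OF homogeneous_in_polys[OF G]] by auto
  have GQ: "\<forall>w\<in>Q. peval G w \<noteq> 0" using peval_zero_on_ppoint[OF G Q] Gv by blast
  have "Q \<in> proj_zeros n S"
    unfolding proj_zeros_def
  proof (intro CollectI conjI Q(1) ballI)
    fix g w assume g: "g \<in> S" and w: "w \<in> Q"
    obtain c where c: "homogeneous n c g" using S[OF g] by blast
    show "peval g w = 0"
      using peval_zero_on_ppoint[OF c Q w] pv[OF homogeneous_in_polys[OF c]] ag[OF g] by simp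
  qed
  moreover have "\<forall>w\<in>Q. peval F w \<noteq> 0" using GQ by (auto simp: peval_G)
  ultimately have QV: "Q \<in> V" using piece[OF Q(1)] GQ by (auto simp: V_def)
  obtain c where "normal Q = (\<lambda>j. c * v j)" using normal(1)[OF QV] by (auto simp: Q_def)
  then have nv: "normal Q = v" using normal(2)[OF QV] vi by auto
  have "embed Q = a"
  proof
    fix j
    show "embed Q j = a j"
    proof (cases "j < Suc (Suc n)")
      case True
      then consider "j \<le> n" | "j = Suc n" by linarith
      then show ?thesis
      proof cases
        case 1
        then show ?thesis by (simp add: embed_def nv v_def)
      next
        case 2
        have "1 / peval G v = a (Suc n)"
          using aG Gv by (simp add: pv[OF homogeneous_in_polys[OF G]] eq_divide_eq divide_eq_eq)
        then show ?thesis by (simp add: 2 embed_def nv)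
      qed
    next
      case False
      then show ?thesis using as by (auto simp: embed_def affine_space_def PiE_def extensional_def)
    qed
  qed
  then show "a \<in> embed ` V" using QV by blast
qed

text \<open>Multiplying a polynomial in the affine coordinates by a high power of \<open>G\<close> clears the denominators;
  the degree can then be corrected by powers of \<open>X\<^sub>i\<close> and \<open>F\<close>.\<close>

lemma homogenize:
  assumes "h \<in> polys (Suc (Suc n))"
  shows "\<exists>M0. \<forall>M\<ge>M0. \<exists>H. homogeneous n (M * Suc d) H \<and>
    (\<forall>Q\<in>V. peval H (normal Q) = peval G (normal Q) ^ M * peval h (embed Q))"
  using assms
proof (induction rule: polys_induct)
  case (const c)
  have "homogeneous n (M * Suc d) (pconst c * G ^ M)" for M
    using homogeneous_mult[OF homogeneous_const homogeneous_power[OF G]] by simp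
  then show ?case
    by (intro exI[of _ 0] allI impI exI[of _ "pconst c * G ^ _"] conjI) (auto simp: peval_mult peval_power)
next
  case (var j)
  show ?case
  proof (intro exI[of _ "1 :: nat"] allI impI)
    fix M :: nat assume "1 \<le> M"
    then obtain M' where M: "M = Suc M'" by (cases M) auto
    show "\<exists>H. homogeneous n (M * Suc d) H \<and>
        (\<forall>Q\<in>V. peval H (normal Q) = peval G (normal Q) ^ M * peval (pvar j) (embed Q))"
    proof (cases "j \<le> n")
      case True
      have "homogeneous n (M * Suc d) (pvar j * F * G ^ M')"
        using homogeneous_mult[OF homogeneous_mult[OF homogeneous_var[OF True] F] homogeneous_power[OF G, of M']]
        by (simp add: M add_ac)
      moreover have "peval (pvar j * F * G ^ M') (normal Q) = peval G (normal Q) ^ M * peval (pvar j) (embed Q)"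
        if "Q \<in> V" for Q
        using True normal(2)[OF that] by (simp add: M peval_mult peval_power peval_G embed_def)
      ultimately show ?thesis by blast
    next
      case False
      then have j: "j = Suc n" using var by simp
      have "homogeneous n (M * Suc d) (pvar i ^ Suc d * G ^ M')"
        using homogeneous_mult[OF homogeneous_power[OF homogeneous_var[OF i], of "Suc d"] homogeneous_power[OF G, of M']]
        by (simp add: M add_ac)
      moreover have "peval (pvar i ^ Suc d * G ^ M') (normal Q) = peval G (normal Q) ^ M * peval (pvar j) (embed Q)"
        if "Q \<in> V" for Q
        using normal(2,3)[OF that] by (simp add: M j peval_mult peval_power embed_def)
      ultimately show ?thesis by blast
    qed
  qed
next
  case (add p q)
  then obtain M1 M2 where
    M: "\<forall>M\<ge>M1. \<exists>H. homogeneous n (M * Suc d) H \<and> (\<forall>Q\<in>V. peval H (normal Q) = peval G (normal Q) ^ M * peval p (embed Q))"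
    "\<forall>M\<ge>M2. \<exists>H. homogeneous n (M * Suc d) H \<and> (\<forall>Q\<in>V. peval H (normal Q) = peval G (normal Q) ^ M * peval q (embed Q))"
    by blast
  show ?case
  proof (intro exI[of _ "max M1 M2"] allI impI)
    fix M assume "max M1 M2 \<le> M"
    then obtain H H' where "homogeneous n (M * Suc d) H \<and> (\<forall>Q\<in>V. peval H (normal Q) = peval G (normal Q) ^ M * peval p (embed Q))"
        "homogeneous n (M * Suc d) H' \<and> (\<forall>Q\<in>V. peval H' (normal Q) = peval G (normal Q) ^ M * peval q (embed Q))"
      using M by (meson max.bounded_iff)
    then show "\<exists>H. homogeneous n (M * Suc d) H \<and> (\<forall>Q\<in>V. peval H (normal Q) = peval G (normal Q) ^ M * peval (p + q) (embed Q))"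
      by (intro exI[of _ "H + H'"]) (simp add: homogeneous_add peval_add distrib_left)
  qed
next
  case (mult p q)
  then obtain M1 M2 where
    M: "\<forall>M\<ge>M1. \<exists>H. homogeneous n (M * Suc d) H \<and> (\<forall>Q\<in>V. peval H (normal Q) = peval G (normal Q) ^ M * peval p (embed Q))"
    "\<forall>M\<ge>M2. \<exists>H. homogeneous n (M * Suc d) H \<and> (\<forall>Q\<in>V. peval H (normal Q) = peval G (normal Q) ^ M * peval q (embed Q))"
    by blast
  show ?case
  proof (intro exI[of _ "M1 + M2"] allI impI)
    fix M assume M12: "M1 + M2 \<le> M"
    then have "M2 \<le> M - M1" by simp
    then obtain H H' where H: "homogeneous n (M1 * Suc d) H" "\<forall>Q\<in>V. peval H (normal Q) = peval G (normal Q) ^ M1 * peval p (embed Q)"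
        "homogeneous n ((M - M1) * Suc d) H'" "\<forall>Q\<in>V. peval H' (normal Q) = peval G (normal Q) ^ (M - M1) * peval q (embed Q)"
      using M by (meson order_refl)
    have deg: "M1 * Suc d + (M - M1) * Suc d = M * Suc d"
      using M12 by (simp only: distrib_right[symmetric]) simp
    have pow: "x ^ M = x ^ M1 * x ^ (M - M1)" for x :: 'k
      using M12 by (simp add: power_add[symmetric])
    have "homogeneous n (M * Suc d) (H * H')" using homogeneous_mult[OF H(1,3)] unfolding deg .
    then show "\<exists>H. homogeneous n (M * Suc d) H \<and> (\<forall>Q\<in>V. peval H (normal Q) = peval G (normal Q) ^ M * peval (p * q) (embed Q))"
      using H(2,4) by (intro exI[of _ "H * H'"]) (simp add: peval_mult pow mult_ac)
  qed
qed

abbreviation "Y \<equiv> subtopology (affine_zariski (Suc (Suc n))) Z"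

lemma Z_closed: "closedin (affine_zariski (Suc (Suc n))) Z"
proof -
  let ?S = "insert (pvar i - 1) (insert (pvar (Suc n) * G - 1) S)"
  have top: "topspace (affine_zariski (Suc (Suc n))) = (affine_space (Suc (Suc n)) :: (nat \<Rightarrow> 'k) set)"
  proof (rule antisym)
    show "topspace (affine_zariski (Suc (Suc n))) \<subseteq> (affine_space (Suc (Suc n)) :: (nat \<Rightarrow> 'k) set)"
      using openin_topspace[of "affine_zariski (Suc (Suc n)) :: (nat \<Rightarrow> 'k) topology"] unfolding openin_affine_zariski by blast
    have "openin (affine_zariski (Suc (Suc n))) (affine_space (Suc (Suc n)) :: (nat \<Rightarrow> 'k) set)"
      unfolding openin_affine_zariski
      by (intro exI[of _ "{1}"]) (auto simp: one_in_polys affine_zeros_def)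
    then show "(affine_space (Suc (Suc n)) :: (nat \<Rightarrow> 'k) set) \<subseteq> topspace (affine_zariski (Suc (Suc n)))"
      by (rule openin_subset)
  qed
  have "?S \<subseteq> polys (Suc (Suc n))"
  proof -
    have "g \<in> polys (Suc (Suc n))" if "\<exists>c. homogeneous n c g" for g :: "'k mpoly"
      using that by (auto intro: polys_mono[OF homogeneous_in_polys])
    then have "S \<subseteq> polys (Suc (Suc n))" "G \<in> polys (Suc (Suc n))" using S G by blast+
    then show ?thesis using i by (auto simp: one_in_polys intro!: polys_diff pvar_in_polys polys_mult)
  qed
  then have "openin (affine_zariski (Suc (Suc n))) (affine_space (Suc (Suc n)) - Z)"
    unfolding openin_affine_zariski Z_def by blast
  then show ?thesis
    unfolding closedin_def top by (auto simp: Z_def affine_zeros_def)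
qed

lemma topspace_Y: "topspace Y = Z"
  using closedin_subset[OF Z_closed] by auto

lemma openin_Y: "openin Y O' \<longleftrightarrow> (\<exists>H\<subseteq>polys (Suc (Suc n)). O' = {a \<in> Z. \<exists>h\<in>H. peval h a \<noteq> 0})"
proof -
  have Zs: "Z \<subseteq> affine_space (Suc (Suc n))" by (auto simp: Z_def affine_zeros_def)
  have "(affine_space (Suc (Suc n)) - affine_zeros (Suc (Suc n)) H) \<inter> Z = {a \<in> Z. \<exists>h\<in>H. peval h a \<noteq> 0}" for H
    using Zs by (auto simp: affine_zeros_def)
  then show ?thesis
    unfolding openin_subtopology openin_affine_zariski by metis
qed

lemma open_V: "openin (zariski n X) V"
  unfolding V_def by (rule open_nonzero_locus[OF X G])

lemma open_preimage:
  assumes "openin Y O'"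
  shows "openin (zariski n X) {Q \<in> V. embed Q \<in> O'}"
proof -
  obtain H where H: "H \<subseteq> polys (Suc (Suc n))" "O' = {a \<in> Z. \<exists>h\<in>H. peval h a \<noteq> 0}"
    using assms unfolding openin_Y by blast
  have "openin (zariski n X) {Q \<in> V. peval h (embed Q) \<noteq> 0}" if h: "h \<in> H" for h
  proof -
    have "h \<in> polys (Suc (Suc n))" using h H(1) by blast
    from homogenize[OF this] obtain M K where K: "homogeneous n (M * Suc d) K"
        "\<forall>Q\<in>V. peval K (normal Q) = peval G (normal Q) ^ M * peval h (embed Q)" by blast
    have "{Q \<in> V. peval h (embed Q) \<noteq> 0} = V \<inter> {Q \<in> X. \<forall>v\<in>Q. peval K v \<noteq> 0}"
    proof -
      have "peval h (embed Q) \<noteq> 0 \<longleftrightarrow> (\<forall>v\<in>Q. peval K v \<noteq> 0)" if Q: "Q \<in> V" for Q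
      proof -
        have "peval h (embed Q) \<noteq> 0 \<longleftrightarrow> peval K (normal Q) \<noteq> 0" using K(2) Q normal(3)[OF Q] by simp
        then show ?thesis using peval_zero_on_ppoint[OF K(1) V_proj[OF Q] normal(1)[OF Q]] normal(1)[OF Q] by blast
      qed
      then show ?thesis by (auto simp: V_def)
    qed
    then show ?thesis using open_V open_nonzero_locus[OF X K(1)] by auto
  qed
  then have "openin (zariski n X) (\<Union>h\<in>H. {Q \<in> V. peval h (embed Q) \<noteq> 0})" by blast
  moreover have "{Q \<in> V. embed Q \<in> O'} = (\<Union>h\<in>H. {Q \<in> V. peval h (embed Q) \<noteq> 0})"
    using embed_image H(2) by auto
  ultimately show ?thesis by simp
qed

lemma open_image:
  assumes "openin (zariski n X) U" "U \<subseteq> V"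
  shows "openin Y (embed ` U)"
proof -
  obtain U' where U': "openin (proj_zariski n) U'" "U = U' \<inter> X"
    using assms(1) by (auto simp: openin_subtopology)
  obtain K where K: "\<And>f. f \<in> K \<Longrightarrow> \<exists>c. homogeneous n c f" "U' = proj_space n - proj_zeros n K"
    using U'(1) unfolding openin_proj_zariski by auto
  have mem: "embed Q \<in> {a \<in> Z. \<exists>h\<in>K. peval h a \<noteq> 0} \<longleftrightarrow> Q \<in> U" if Q: "Q \<in> V" for Q
  proof -
    have "peval h (embed Q) = 0 \<longleftrightarrow> (\<forall>v\<in>Q. peval h v = 0)" if h: "h \<in> K" for h
    proof -
      obtain c where c: "homogeneous n c h" using K(1)[OF h] by blast
      show ?thesis
        unfolding peval_embed_homogeneous[OF homogeneous_in_polys[OF c]]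
        using normal(1)[OF Q] peval_zero_on_ppoint[OF c V_proj[OF Q] normal(1)[OF Q]] by blast
    qed
    moreover have "Q \<in> X" using Q by (simp add: V_def)
    ultimately show ?thesis
      using Q embed_image V_proj[OF Q] by (auto simp: U'(2) K(2) proj_zeros_def)
  qed
  have "embed ` U = {a \<in> Z. \<exists>h\<in>K. peval h a \<noteq> 0}"
  proof (intro subset_antisym subsetI)
    fix a assume "a \<in> embed ` U"
    then obtain Q where "Q \<in> U" "a = embed Q" by blast
    then show "a \<in> {a \<in> Z. \<exists>h\<in>K. peval h a \<noteq> 0}" using mem[of Q] assms(2) by blast
  next
    fix a assume a: "a \<in> {a \<in> Z. \<exists>h\<in>K. peval h a \<noteq> 0}"
    then obtain Q where Q: "Q \<in> V" "a = embed Q" using embed_image by blast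
    then have "Q \<in> U" using mem[of Q] a by blast
    then show "a \<in> embed ` U" using Q(2) by blast
  qed
  moreover have "K \<subseteq> polys (Suc (Suc n))"
    using K(1) homogeneous_in_polys polys_mono by (metis Suc_n_not_le_n nat_le_linear subsetI)
  ultimately show ?thesis unfolding openin_Y by blast
qed

lemma embed_homeomorphic: "homeomorphic_map (subtopology (zariski n X) V) Y embed"
proof (rule bijective_open_imp_homeomorphic_map)
  have topV: "topspace (subtopology (zariski n X) V) = V"
    using openin_subset[OF open_V] by auto
  show "continuous_map (subtopology (zariski n X) V) Y embed"
    unfolding continuous_map_def topV topspace_Y
    using embed_image open_preimage open_V by (auto simp: openin_open_subtopology)
  show "open_map (subtopology (zariski n X) V) Y embed"
    unfolding open_map_def using open_image open_V by (auto simp: openin_open_subtopology)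
  show "embed ` topspace (subtopology (zariski n X) V) = topspace Y"
    unfolding topV topspace_Y by (rule embed_image)
  show "inj_on embed (topspace (subtopology (zariski n X) V))"
    unfolding topV by (rule embed_inj)
qed

lemma embed_functions:
  assumes O: "openin Y O'" and f: "f \<in> extensional O'"
  shows "f \<in> affine_regular_functions (Suc (Suc n)) Z O' \<longleftrightarrow>
    (\<lambda>P \<in> {P\<in>V. embed P \<in> O'}. f (embed P)) \<in> regular_functions n X {P\<in>V. embed P \<in> O'}"
    (is "_ \<longleftrightarrow> ?f \<in> regular_functions n X ?U")
proof
  assume reg: "f \<in> affine_regular_functions (Suc (Suc n)) Z O'"
  show "?f \<in> regular_functions n X ?U"
    unfolding regular_functions_def mem_Collect_eq
  proof (intro conjI ballI)
    fix P assume P: "P \<in> ?U"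
    then obtain O1 g h where O1: "openin Y O1" "embed P \<in> O1" "O1 \<subseteq> O'" "g \<in> polys (Suc (Suc n))" "h \<in> polys (Suc (Suc n))"
        and eq: "\<forall>b\<in>O1. peval h b \<noteq> 0 \<and> f b = peval g b / peval h b"
      using reg unfolding affine_regular_functions_def by blast
    obtain M1 M2 where
      "\<forall>M\<ge>M1. \<exists>H. homogeneous n (M * Suc d) H \<and> (\<forall>Q\<in>V. peval H (normal Q) = peval G (normal Q) ^ M * peval g (embed Q))"
      "\<forall>M\<ge>M2. \<exists>H. homogeneous n (M * Suc d) H \<and> (\<forall>Q\<in>V. peval H (normal Q) = peval G (normal Q) ^ M * peval h (embed Q))"
      using homogenize[OF O1(4)] homogenize[OF O1(5)] by blast
    then obtain M A B where A: "homogeneous n (M * Suc d) A" "\<forall>Q\<in>V. peval A (normal Q) = peval G (normal Q) ^ M * peval g (embed Q)"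
        and B: "homogeneous n (M * Suc d) B" "\<forall>Q\<in>V. peval B (normal Q) = peval G (normal Q) ^ M * peval h (embed Q)"
      by (meson max.cobounded1 max.cobounded2)
    let ?O = "{Q \<in> V. embed Q \<in> O1}"
    have "peval B v \<noteq> 0 \<and> ?f Q = peval A v / peval B v" if Q: "Q \<in> ?O" and v: "v \<in> Q" for Q v
    proof -
      have QV: "Q \<in> V" using Q by blast
      obtain c where c: "c \<noteq> 0" "v = (\<lambda>j. c * normal Q j)"
        using proj_point_scalings(1)[OF V_proj[OF QV] normal(1)[OF QV]] v by auto
      have e: "peval h (embed Q) \<noteq> 0" "f (embed Q) = peval g (embed Q) / peval h (embed Q)"
        using eq Q by auto
      show ?thesis
        unfolding c(2) peval_scale[OF A(1)] peval_scale[OF B(1)]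
        using A(2) B(2) QV e c(1) normal(3)[OF QV] Q O1(3) by auto
    qed
    then have fraction: "\<forall>Q\<in>?O. \<forall>v\<in>Q. peval B v \<noteq> 0 \<and> ?f Q = peval A v / peval B v" by blast
    show "\<exists>V1 g h d. openin (zariski n X) V1 \<and> P \<in> V1 \<and> V1 \<subseteq> ?U \<and> homogeneous n d g \<and> homogeneous n d h \<and>
       (\<forall>Q\<in>V1. \<forall>v\<in>Q. peval h v \<noteq> 0 \<and> ?f Q = peval g v / peval h v)"
      by (rule exI[of _ ?O], rule exI[of _ A], rule exI[of _ B], rule exI[of _ "M * Suc d"], intro conjI)
        (rule open_preimage[OF O1(1)], use P O1(2) in blast, use O1(3) in blast, rule A(1), rule B(1), rule fraction)
  qed simp
next
  assume reg: "?f \<in> regular_functions n X ?U"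
  show "f \<in> affine_regular_functions (Suc (Suc n)) Z O'"
    unfolding affine_regular_functions_def mem_Collect_eq
  proof (intro conjI ballI f)
    fix a assume a: "a \<in> O'"
    have "O' \<subseteq> Z" using openin_subset[OF O] topspace_Y by blast
    then obtain P where P: "P \<in> V" "a = embed P" using a embed_image by blast
    then have "P \<in> ?U" using a by blast
    then have "\<exists>V1 g h c. openin (zariski n X) V1 \<and> P \<in> V1 \<and> V1 \<subseteq> ?U \<and> homogeneous n c g \<and> homogeneous n c h \<and>
       (\<forall>Q\<in>V1. \<forall>v\<in>Q. peval h v \<noteq> 0 \<and> ?f Q = peval g v / peval h v)"
      using reg unfolding regular_functions_def by blast
    then obtain V1 g h c where V1: "openin (zariski n X) V1" "P \<in> V1" "V1 \<subseteq> ?U" "homogeneous n c g" "homogeneous n c h"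
       "\<forall>Q\<in>V1. \<forall>v\<in>Q. peval h v \<noteq> 0 \<and> ?f Q = peval g v / peval h v"
      by (elim exE conjE) (rule that)
    have "peval h (embed Q) \<noteq> 0 \<and> f (embed Q) = peval g (embed Q) / peval h (embed Q)" if Q: "Q \<in> V1" for Q
    proof -
      have QU: "Q \<in> ?U" using Q V1(3) by blast
      then have "Q \<in> V" by blast
      then have "peval h (normal Q) \<noteq> 0 \<and> ?f Q = peval g (normal Q) / peval h (normal Q)"
        using V1(6) Q normal(1) by blast
      then show ?thesis
        using QU peval_embed_homogeneous[OF homogeneous_in_polys[OF V1(4)]] peval_embed_homogeneous[OF homogeneous_in_polys[OF V1(5)]]
        by simp
    qed
    moreover have "openin Y (embed ` V1)" by (rule open_image[OF V1(1)]) (use V1(3) in blast)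
    moreover have "g \<in> polys (Suc (Suc n))" "h \<in> polys (Suc (Suc n))"
      using polys_mono[OF homogeneous_in_polys[OF V1(4)]] polys_mono[OF homogeneous_in_polys[OF V1(5)]] by auto
    ultimately show "\<exists>V g h. openin Y V \<and> a \<in> V \<and> V \<subseteq> O' \<and> g \<in> polys (Suc (Suc n)) \<and> h \<in> polys (Suc (Suc n)) \<and>
        (\<forall>b\<in>V. peval h b \<noteq> 0 \<and> f b = peval g b / peval h b)"
      using P(2) V1(2,3) by (intro exI[of _ "embed ` V1"] exI[of _ g] exI[of _ h]) auto
  qed
qed

lemma affine_open_V: "affine_open (zariski n X) (\<lambda>U. fun_ring U (regular_functions n X U)) V"
  unfolding affine_open_def fun_ring_def partial_object.simps
  using open_V Z_closed embed_homeomorphic embed_functions by blast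

end

text \<open>\<open>X = A \<inter> B\<close> with \<open>A\<close> open and \<open>B\<close> closed.  Take a form that is nonzero at \<open>P\<close> and vanishes outside \<open>A\<close>,
  another one for \<open>W\<close>, and a coordinate that is nonzero at \<open>P\<close>; where all three are nonzero, \<open>X\<close> is given by the
  equations of \<open>B\<close>.\<close>

lemma affine_open_neighbourhood:
  fixes X :: "'k::field_char_0 ppoint set"
  assumes qp: "quasi_projective n X" and W: "openin (zariski n X) W" and P: "P \<in> W"
  shows "\<exists>V. affine_open (zariski n X) (\<lambda>U. fun_ring U (regular_functions n X U)) V \<and> P \<in> V \<and> V \<subseteq> W"
proof -
  obtain A B where A: "openin (proj_zariski n) A" and B: "closedin (proj_zariski n) B" and XAB: "X = A \<inter> B"
    using qp by (auto simp: quasi_projective_def)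
  obtain SA where SA: "SA \<subseteq> {f. \<exists>d. homogeneous n d f}" "A = proj_space n - proj_zeros n SA"
    using A unfolding openin_proj_zariski by blast
  obtain W' where W': "openin (proj_zariski n) W'" "W = W' \<inter> X"
    using W by (auto simp: openin_subtopology)
  obtain SW where SW: "SW \<subseteq> {f. \<exists>d. homogeneous n d f}" "W' = proj_space n - proj_zeros n SW"
    using W'(1) unfolding openin_proj_zariski by blast
  have Btop: "B \<subseteq> topspace (proj_zariski n)" "openin (proj_zariski n) (topspace (proj_zariski n) - B)"
    using B by (auto simp: closedin_def)
  obtain S where S: "S \<subseteq> {f. \<exists>d. homogeneous n d f}" "topspace (proj_zariski n) - B = proj_space n - proj_zeros n S"
    using Btop(2) unfolding openin_proj_zariski by blast
  have top: "topspace (proj_zariski n) \<subseteq> (proj_space n :: 'k ppoint set)"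
    using openin_topspace[of "proj_zariski n :: 'k ppoint topology"] unfolding openin_proj_zariski by blast
  have PX: "P \<in> X" "P \<in> A" "P \<in> W'" using P W'(2) XAB by auto
  obtain f where f: "f \<in> SA" "\<not> (\<forall>v\<in>P. peval f v = 0)" using PX(2) SA(2) by (auto simp: proj_zeros_def)
  obtain g where g: "g \<in> SW" "\<not> (\<forall>v\<in>P. peval g v = 0)" using PX(3) SW(2) by (auto simp: proj_zeros_def)
  obtain c where c: "homogeneous n c f" using f(1) SA(1) by blast
  obtain e where e: "homogeneous n e g" using g(1) SW(1) by blast
  have PP: "P \<in> proj_space n" using PX SA(2) by blast
  obtain v where v: "v \<in> P" using proj_point_nonempty[OF PP] by blast
  have "\<exists>i\<le>n. v i \<noteq> 0"
    using proj_point_scalings(2,3)[OF PP v] by (metis ext not_le)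
  then obtain i where iv: "i \<le> n" "v i \<noteq> 0" by blast
  have X: "X \<subseteq> proj_space n" using XAB SA(2) by blast
  interpret principal_open n "c + e" i "f * g" S X
  proof
    show "homogeneous n (c + e) (f * g)" by (rule homogeneous_mult[OF c e])
    show "i \<le> n" "X \<subseteq> proj_space n" by (rule iv(1), rule X)
    show "\<exists>c. homogeneous n c g" if "g \<in> S" for g using that S(1) by blast
    fix Q :: "'k ppoint" assume Q: "Q \<in> proj_space n" and nz: "\<forall>v\<in>Q. peval (f * g) v \<noteq> 0"
    obtain u where u: "u \<in> Q" using proj_point_nonempty[OF Q] by blast
    then have "Q \<in> A" using nz Q f(1) by (auto simp: SA(2) proj_zeros_def peval_mult)
    moreover have "Q \<in> topspace (proj_zariski n)" using openin_subset[OF A] \<open>Q \<in> A\<close> by blast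
    moreover have "Q \<in> topspace (proj_zariski n) - B \<longleftrightarrow> Q \<in> proj_space n - proj_zeros n S" using S(2) by simp
    ultimately show "Q \<in> X \<longleftrightarrow> Q \<in> proj_zeros n S" using XAB Q by blast
  qed
  have "peval f v \<noteq> 0" "peval g v \<noteq> 0"
    using f(2) g(2) peval_zero_on_ppoint[OF c PP v] peval_zero_on_ppoint[OF e PP v] by blast+
  then have "peval G v \<noteq> 0" using iv(2) by (simp add: peval_G peval_mult)
  then have "P \<in> V"
    using PX(1) peval_zero_on_ppoint[OF G PP v] by (auto simp: V_def)
  moreover have "V \<subseteq> W"
  proof
    fix Q assume Q: "Q \<in> V"
    obtain u where u: "u \<in> Q" using proj_point_nonempty[OF V_proj[OF Q]] by blast
    then have "peval g u \<noteq> 0" using Q by (auto simp: V_def peval_G peval_mult)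
    then have "Q \<in> W'" using u g(1) V_proj[OF Q] by (auto simp: SW(2) proj_zeros_def)
    then show "Q \<in> W" using Q W'(2) by (simp add: V_def)
  qed
  ultimately show ?thesis using affine_open_V by blast
qed

theorem theorem29:
  fixes N n :: nat
    and X :: "'k::{alg_closed_field, field_char_0} ppoint set"
  defines "T \<equiv> zariski n X" and "R \<equiv> structure_sheaf n X"
  assumes "quasi_projective n X"
    and "irreducible_space T"
    and "has_dimension T R N"
    and "\<forall>P\<in>X. smooth_at T R N P"
  shows "\<exists>(F :: ('k ppoint, 'k, 'k ppoint set \<times> (nat \<Rightarrow> 'k ppoint \<Rightarrow> 'k) \<Rightarrow>
              'k ppoint \<Rightarrow> nat \<Rightarrow> mono \<Rightarrow> 'k) mod_presheaf) Fil \<phi>.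
     topological_vector_bundle T R F Fil
       {(U, x). etale_chart T R N U x} fst (\<lambda>k _. L_quot N k) (\<lambda>k _. L_proj N k) \<phi> \<and>
     (\<forall>U\<^sub>1 x U\<^sub>2 y. etale_chart T R N U\<^sub>1 x \<and> etale_chart T R N U\<^sub>2 y \<longrightarrow>
       (\<forall>m\<in>monomials N - {0}. \<forall>p<N.
          transition T F Fil \<phi> (U\<^sub>1, x) (U\<^sub>2, y) (U\<^sub>1 \<inter> U\<^sub>2) (formal_field N (U\<^sub>1 \<inter> U\<^sub>2) (monomial_field m p))
            = formal_field N (U\<^sub>1 \<inter> U\<^sub>2) (transition_field R N (U\<^sub>1 \<inter> U\<^sub>2) x y m p)))"
proof -
  have R: "R = (\<lambda>U. fun_ring U (regular_functions n X U))"
    by (auto simp: R_def structure_sheaf_def)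
  have X: "X \<subseteq> proj_space n"
    using assms(3) unfolding quasi_projective_def openin_proj_zariski by blast
  interpret function_space T "regular_functions n X"
    unfolding T_def by (rule function_space_regular_functions[OF X assms(4)[unfolded T_def]])
  interpret variety T "regular_functions n X" N
    by unfold_locales (use assms(5) in \<open>simp add: R\<close>)
  have "\<exists>j\<in>charts. P \<in> fst j" if P: "P \<in> topspace T" for P
  proof -
    have "P \<in> X" using P by (simp add: T_def)
    then have "smooth_at T (\<lambda>U. fun_ring U (regular_functions n X U)) N P"
      using assms(6) by (simp add: R)
    then obtain U x where "etale_chart T (\<lambda>U. fun_ring U (regular_functions n X U)) N U x" "P \<in> U"
      using etale_chart_near_smooth_point affine_open_neighbourhood[OF assms(3)] unfolding T_def by blast
    then show ?thesis by (intro bexI[of _ "(U, x)"]) (simp_all add: charts_iff)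
  qed
  then have "topological_vector_bundle T R jet_bundle bundle_filtration charts fst
      (\<lambda>k _. L_quot N k) (\<lambda>k _. L_proj N k) trivialization"
    unfolding R by (rule topological_vector_bundle_jet_bundle)
  moreover have "charts = {(U, x). etale_chart T R N U x}"
    unfolding charts_def R ..
  moreover have "transition T jet_bundle bundle_filtration trivialization (U1, x) (U2, y) (U1 \<inter> U2)
        (formal_field N (U1 \<inter> U2) (monomial_field m p))
      = formal_field N (U1 \<inter> U2) (transition_field R N (U1 \<inter> U2) x y m p)"
    if "etale_chart T R N U1 x" "etale_chart T R N U2 y" "m \<in> monomials N - {0}" "p < N" for U1 x U2 y m p
    using transition_jet_bundle[of "(U1, x)" "(U2, y)" m p] that unfolding R by (simp add: charts_iff)
  ultimately show ?thesis
    by (intro exI[of _ jet_bundle] exI[of _ bundle_filtration] exI[of _ trivialization]) auto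
qed

end
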